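(* Let $k$ be a field of characteristic zero and let $A$ be an associative (non-unitary) $k$-algebra with multiplication $\alpha$. Form $\mathrm{Def}_{\mathrm{rel}}$ with respect to the canonical free DG algebra resolution $\Omega\mathcal{B}A$ of $A$. Let $E:\mathrm{Def}_{\mathrm{rel}}(B)\to\mathrm{Def}_{\mathrm{ass}}(B)$ be the map induced by the natural quasi-isomorphism of DG Lie algebras $\mathrm{Der}(\Omega\mathcal{B}A)\to\mathrm{Coder}(\mathcal{B}A)$, and let $F:\mathrm{Def}_{\mathrm{ass}}(B)\to\mathrm{Def}_{\mathrm{flat}}(B)$ and $G:\mathrm{Def}_{\mathrm{rel}}(B)\to\mathrm{Def}_{\mathrm{flat}}(B)$ be the maps $[\beta]\mapsto[(A_B,\alpha+\beta)]$ and $[\delta]\mapsto[H^0((\Omega\mathcal{B}A)_B,d+\delta)]$. Then for any local commutative artinian $k$-algebra $(B,\mathfrak{m})$ with $B/\mathfrak{m}=k$, the triangle formed by $E$, $F$ and $G$ commutes, i.e. $F\circ E=G$, and all three maps $E$, $F$, $G$ are bijections.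
   Context: For a $k$-module (or graded module) $M$ put $M_B=M\otimes_k B$ and $M_{\mathfrak{m}}=M\otimes_k\mathfrak{m}\subseteq M_B$. $B$-linear extensions of $k$-linear structure maps are denoted by the same letter. **Deformation functor of a DG Lie algebra.** For a DG Lie algebra $L$ (differential $d_L$ of degree $+1$), let $\mathrm{MC}(B)=\{u\in L^1\otimes\mathfrak{m}: d_Lu+\frac12[u,u]=0\}$. Elements $u,v$ of $\mathrm{MC}(B)$ are (gauge-)equivalent if $d_L+u$ and $d_L+v$ lie in the same orbit of the group $\exp(L^0\otimes\mathfrak{m})$, acting by $\exp(f)\cdot w=\exp(\mathrm{ad}_f)(w)$ on $(L^1\otimes\mathfrak{m})\oplus k\,d_L$, where $[d_L,w]=d_Lw$ for $w\in L\otimes\mathfrak{m}$ and $[d_L,d_L]=0$. The deformation functor of $L$ is $B\mapsto\mathrm{MC}(B)/\sim$. It is a known result of Kontsevich that a quasi-isomorphism of DG Lie algebras induces an isomorphism of the corresponding deformation functors. **Associative deformations.** A deformation of the associative structure of $A$ with basis $B$ is a $B$-linear map $\beta:A_B\otimes_B A_B\to A_B$ with $\mathrm{Im}(\beta)\subseteq A_{\mathfrak{m}}$ such that $\alpha+\beta$ is an associative product on $A_B$. Two such, $\beta$ and $\beta'$, are equivalent if there is an isomorphism of $B$-algebras $\Phi:(A_B,\alpha+\beta)\to(A_B,\alpha+\beta')$ compatible with the canonical projections to $A$. $\mathrm{Def}_{\mathrm{ass}}(B)$ is the set of equivalence classes. Let $M={\downarrow}A$ be $A$ placed in degree $-1$,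 with shift maps ${\downarrow}:A\to M$ and ${\uparrow}:M\to A$. The bar construction $\mathcal{B}A$ is the tensor coalgebra $TM=\bigoplus_{n\ge1}M^{\otimes n}$ with the deconcatenation coproduct and the degree $+1$ codifferential $Q$ determined by $Q_2(m_1\otimes m_2)=-{\downarrow}\alpha({\uparrow}m_1,{\uparrow}m_2)$. The functor $\mathrm{Def}_{\mathrm{ass}}$ is the deformation functor of the DG Lie algebra $\mathrm{Coder}(\mathcal{B}A)$ of coderivations of $\mathcal{B}A$, with graded commutator bracket and differential $q\mapsto[Q,q]$ (the Hochschild cochain complex). **Canonical resolution.** $\Omega\mathcal{B}A$ (cobar construction of the bar construction of $A$) is the following non-unitary DG algebra. As a graded algebra it is the free non-unitary tensor algebra $T(V)=\bigoplus_{r\ge1}V^{\otimes r}$ on $V={\uparrow}\mathcal{B}A=\bigoplus_{n\ge1}V^{1-n}$, $V^{1-n}=A^{\otimes n}$; write $[a_1|\cdots|a_n]\in V^{1-n}$ for the generator corresponding to $a_1\otimes\cdots\otimes a_n$. Its differential $d$ is the degree $+1$ derivation determined by $$d[a_1|\cdots|a_n]=\sum_{j=1}^{n-1}(-1)^j[a_1|\cdots|a_j]\otimes[a_{j+1}|\cdots|a_n]+\sum_{j=1}^{n-1}(-1)^{j-1}[a_1|\cdots|a_{j-1}|\alpha(a_j,a_{j+1})|a_{j+2}|\cdots|a_n].$$ The algebra map $p:\Omega\mathcal{B}A\to A$, given in degree $0$ by $[a_1]\otimes\cdots\otimes[a_r]\mapsto a_1\cdots a_r$ and zero in negative degrees,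 is a quasi-isomorphism. **Deformations of the relations.** For $(R,s)=(\Omega\mathcal{B}A,d)$, a deformation of the relations of $A$ with basis $B$ is a degree $+1$ derivation $\delta$ of the graded $B$-algebra $R_B$ with $\mathrm{Im}\,\delta\subseteq R_{\mathfrak{m}}$ and $(s+\delta)^2=0$. Two such, $\delta_1$ and $\delta_2$, are equivalent if there is a $B$-linear isomorphism of DG algebras $\Phi:(R_B,s+\delta_1)\to(R_B,s+\delta_2)$ compatible with the canonical projections $R_B\to R$. $\mathrm{Def}_{\mathrm{rel}}(B)$ is the set of equivalence classes. The functor $\mathrm{Def}_{\mathrm{rel}}$ is the deformation functor of the DG Lie algebra $\mathrm{Der}(\Omega\mathcal{B}A)$ of $k$-linear derivations, with graded commutator bracket and differential $\delta\mapsto[s,\delta]$. **Flat deformations.** A flat deformation of $A$ with basis $B$ is an associative $B$-algebra $\tilde A$, flat over $B$, together with a fixed isomorphism $\tilde A\otimes_B k\to A$. Two such are equivalent if there is an isomorphism of $B$-algebras $\tilde A_1\to\tilde A_2$ compatible with the induced maps $\tilde A_i\to A$. $\mathrm{Def}_{\mathrm{flat}}(B)$ is the set of equivalence classes. **The maps.** $E$ is the map induced on deformation functors by the natural quasi-isomorphism, asserted (following Kontsevich) to respect the DG Lie structures, $$\mathrm{Der}(\Omega\mathcal{B}A)=\mathrm{Hom}({\uparrow}\mathcal{B}A,\Omega\mathcal{B}A)\to\mathrm{Hom}({\uparrow}\mathcal{B}A,A)\cong\mathrm{Hom}(\mathcal{B}A,{\downarrow}A)=\mathrm{Coder}(\mathcal{B}A),$$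 given by composition with $p$. (Its inverse is described by $E^{-1}([\beta])=[\delta(\beta)]$, where $\delta(\beta)$ is the difference of the differentials of $\Omega\mathcal{B}(A_B,\alpha+\beta)$ and $\Omega\mathcal{B}(A_B,\alpha)$ on the common underlying graded $B$-algebra $(\Omega\mathcal{B}A)_B$.) $F([\beta])$ is the class of the flat deformation $(A_B,\alpha+\beta)$ with the canonical identification $A_B\otimes_Bk=A$. $G([\delta])$ is the class of $H^0(R_B,s+\delta)$, which is a flat $B$-algebra, with the isomorphism $H^0(R_B,s+\delta)\otimes_B k\cong H^0(R,s)\cong A$.
   Formalization: Composition with p does not respect the Lie brackets on all of Der(ΩBA), so E is taken as composition with p on representatives δ(β) of a class, i.e. as the inverse of [β] ↦ [δ(β)]; flatness is tested on a set of modules that includes all ideals of B. *)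

theory Defs
  imports "HOL-Algebra.Free_Abelian_Groups" "HOL-Algebra.QuotRing" "HOL-Algebra.Module"
begin

section \<open>Modules, non-unitary algebras and tensor products\<close>

text \<open>
  Modules and algebras are records of type \<open>('r, 'm) module\<close>. For a non-unitary algebra the field
  \<open>one\<close> is unused, for a mere module also \<open>mult\<close>; no definition below reads an unused field.
\<close>

locale nonunital_algebra = module R A for R (structure) and A (structure) +
  assumes mult_closed:
      "\<lbrakk>x \<in> carrier A; y \<in> carrier A\<rbrakk> \<Longrightarrow> x \<otimes>\<^bsub>A\<^esub> y \<in> carrier A"
    and mult_assoc:
      "\<lbrakk>x \<in> carrier A; y \<in> carrier A; z \<in> carrier A\<rbrakk>
        \<Longrightarrow> (x \<otimes>\<^bsub>A\<^esub> y) \<otimes>\<^bsub>A\<^esub> z = x \<otimes>\<^bsub>A\<^esub> (y \<otimes>\<^bsub>A\<^esub> z)"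
    and mult_add_left:
      "\<lbrakk>x \<in> carrier A; y \<in> carrier A; z \<in> carrier A\<rbrakk>
        \<Longrightarrow> (x \<oplus>\<^bsub>A\<^esub> y) \<otimes>\<^bsub>A\<^esub> z = x \<otimes>\<^bsub>A\<^esub> z \<oplus>\<^bsub>A\<^esub> y \<otimes>\<^bsub>A\<^esub> z"
    and mult_add_right:
      "\<lbrakk>x \<in> carrier A; y \<in> carrier A; z \<in> carrier A\<rbrakk>
        \<Longrightarrow> x \<otimes>\<^bsub>A\<^esub> (y \<oplus>\<^bsub>A\<^esub> z) = x \<otimes>\<^bsub>A\<^esub> y \<oplus>\<^bsub>A\<^esub> x \<otimes>\<^bsub>A\<^esub> z"
    and mult_smult_left:
      "\<lbrakk>r \<in> carrier R; x \<in> carrier A; y \<in> carrier A\<rbrakk>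
        \<Longrightarrow> (r \<odot>\<^bsub>A\<^esub> x) \<otimes>\<^bsub>A\<^esub> y = r \<odot>\<^bsub>A\<^esub> (x \<otimes>\<^bsub>A\<^esub> y)"
    and mult_smult_right:
      "\<lbrakk>r \<in> carrier R; x \<in> carrier A; y \<in> carrier A\<rbrakk>
        \<Longrightarrow> x \<otimes>\<^bsub>A\<^esub> (r \<odot>\<^bsub>A\<^esub> y) = r \<odot>\<^bsub>A\<^esub> (x \<otimes>\<^bsub>A\<^esub> y)"

definition linear_maps ::
  "('r, 'z) ring_scheme \<Rightarrow> ('r, 'm) module \<Rightarrow> ('r, 'n) module \<Rightarrow> ('m \<Rightarrow> 'n) set" where
  "linear_maps R M N = {f \<in> carrier M \<rightarrow>\<^sub>E carrier N.
     (\<forall>x\<in>carrier M. \<forall>y\<in>carrier M. f (x \<oplus>\<^bsub>M\<^esub> y) = f x \<oplus>\<^bsub>N\<^esub> f y) \<and>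
     (\<forall>r\<in>carrier R. \<forall>x\<in>carrier M. f (r \<odot>\<^bsub>M\<^esub> x) = r \<odot>\<^bsub>N\<^esub> f x)}"

definition algebra_homs ::
  "('r, 'z) ring_scheme \<Rightarrow> ('r, 'm) module \<Rightarrow> ('r, 'n) module \<Rightarrow> ('m \<Rightarrow> 'n) set" where
  "algebra_homs R X Y = {f \<in> linear_maps R X Y.
     \<forall>x\<in>carrier X. \<forall>y\<in>carrier X. f (x \<otimes>\<^bsub>X\<^esub> y) = f x \<otimes>\<^bsub>Y\<^esub> f y}"

definition algebra_isos ::
  "('r, 'z) ring_scheme \<Rightarrow> ('r, 'm) module \<Rightarrow> ('r, 'n) module \<Rightarrow> ('m \<Rightarrow> 'n) set" where
  "algebra_isos R X Y = {f \<in> algebra_homs R X Y. bij_betw f (carrier X) (carrier Y)}"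

text \<open>
  \<open>M \<otimes>\<^sub>R N\<close> is the free abelian group on \<open>M \<times> N\<close> modulo the usual relations; its elements are cosets.
\<close>

definition tensor_relations ::
  "('r, 'z) ring_scheme \<Rightarrow> ('r, 'm) module \<Rightarrow> ('r, 'n) module \<Rightarrow> ('m \<times> 'n \<Rightarrow>\<^sub>0 int) set" where
  "tensor_relations R M N =
     {frag_of (x \<oplus>\<^bsub>M\<^esub> x', y) - frag_of (x, y) - frag_of (x', y) | x x' y.
        x \<in> carrier M \<and> x' \<in> carrier M \<and> y \<in> carrier N} \<union>
     {frag_of (x, y \<oplus>\<^bsub>N\<^esub> y') - frag_of (x, y) - frag_of (x, y') | x y y'.
        x \<in> carrier M \<and> y \<in> carrier N \<and> y' \<in> carrier N} \<union>
     {frag_of (r \<odot>\<^bsub>M\<^esub> x, y) - frag_of (x, r \<odot>\<^bsub>N\<^esub> y) | r x y.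
        r \<in> carrier R \<and> x \<in> carrier M \<and> y \<in> carrier N}"

definition tensor_kernel ::
  "('r, 'z) ring_scheme \<Rightarrow> ('r, 'm) module \<Rightarrow> ('r, 'n) module \<Rightarrow> ('m \<times> 'n \<Rightarrow>\<^sub>0 int) set" where
  "tensor_kernel R M N =
     generate (free_Abelian_group (carrier M \<times> carrier N)) (tensor_relations R M N)"

definition tensor_class ::
  "('r, 'z) ring_scheme \<Rightarrow> ('r, 'm) module \<Rightarrow> ('r, 'n) module
    \<Rightarrow> ('m \<times> 'n \<Rightarrow>\<^sub>0 int) \<Rightarrow> ('m \<times> 'n \<Rightarrow>\<^sub>0 int) set" where
  "tensor_class R M N c =
     tensor_kernel R M N #>\<^bsub>free_Abelian_group (carrier M \<times> carrier N)\<^esub> c"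

definition pure_tensor ::
  "('r, 'z) ring_scheme \<Rightarrow> ('r, 'm) module \<Rightarrow> ('r, 'n) module
    \<Rightarrow> 'm \<Rightarrow> 'n \<Rightarrow> ('m \<times> 'n \<Rightarrow>\<^sub>0 int) set" where
  "pure_tensor R M N x y = tensor_class R M N (frag_of (x, y))"

definition tensor ::
  "('r, 'z) ring_scheme \<Rightarrow> ('r, 'm) module \<Rightarrow> ('r, 'n) module
    \<Rightarrow> ('r, ('m \<times> 'n \<Rightarrow>\<^sub>0 int) set) module" where
  "tensor R M N =
     (let Q = free_Abelian_group (carrier M \<times> carrier N) Mod tensor_kernel R M N in
      \<lparr>carrier = carrier Q, mult = undefined, one = undefined,
       zero = one Q, add = mult Q,
       smult = \<lambda>r X. \<Union>c\<in>X. tensor_class R M N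
                 (frag_extend (\<lambda>(x, y). frag_of (r \<odot>\<^bsub>M\<^esub> x, y)) c)\<rparr>)"

text \<open>
  The additive map on \<open>M \<otimes>\<^sub>R N\<close> with prescribed values on pure tensors (meaningful whenever
  \<open>f\<close> is biadditive and \<open>R\<close>-balanced).
\<close>

definition tensor_lift ::
  "('r, 'z) ring_scheme \<Rightarrow> ('r, 'm) module \<Rightarrow> ('r, 'n) module \<Rightarrow> ('s, 'p) module
    \<Rightarrow> ('m \<Rightarrow> 'n \<Rightarrow> 'p) \<Rightarrow> ('m \<times> 'n \<Rightarrow>\<^sub>0 int) set \<Rightarrow> 'p" where
  "tensor_lift R M N P f =
     (THE h. h \<in> extensional (carrier (tensor R M N)) \<and>
             h \<in> hom (add_monoid (tensor R M N)) (add_monoid P) \<and>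
             (\<forall>x\<in>carrier M. \<forall>y\<in>carrier N. h (pure_tensor R M N x y) = f x y))"

text \<open>
  Extension of scalars \<open>M \<otimes>\<^sub>R S\<close> of an \<open>R\<close>-module or \<open>R\<close>-algebra \<open>M\<close> along an \<open>R\<close>-algebra \<open>S\<close>, as a module
  or algebra over \<open>S\<close>: \<open>s(x \<otimes> t) = x \<otimes> st\<close> and \<open>(x \<otimes> s)(y \<otimes> t) = xy \<otimes> st\<close>.
\<close>

definition base_change ::
  "('r, 'z) ring_scheme \<Rightarrow> ('r, 'm) module \<Rightarrow> ('r, 's) module
    \<Rightarrow> ('s, ('m \<times> 's \<Rightarrow>\<^sub>0 int) set) module" where
  "base_change R M S =
     \<lparr>carrier = carrier (tensor R M S),
      mult = \<lambda>X Y. \<Union>c\<in>X. \<Union>c'\<in>Y. tensor_class R M S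
        (frag_extend (\<lambda>(x, s). frag_extend (\<lambda>(y, t). frag_of (x \<otimes>\<^bsub>M\<^esub> y, s \<otimes>\<^bsub>S\<^esub> t)) c') c),
      one = undefined,
      zero = zero (tensor R M S), add = add (tensor R M S),
      smult = \<lambda>s X. \<Union>c\<in>X. tensor_class R M S
        (frag_extend (\<lambda>(x, t). frag_of (x, s \<otimes>\<^bsub>S\<^esub> t)) c)\<rparr>"

definition base_change_map ::
  "('r, 'z) ring_scheme \<Rightarrow> ('r, 'm) module \<Rightarrow> ('r, 'n) module \<Rightarrow> ('r, 's) module \<Rightarrow> ('m \<Rightarrow> 'n)
    \<Rightarrow> ('m \<times> 's \<Rightarrow>\<^sub>0 int) set \<Rightarrow> ('n \<times> 's \<Rightarrow>\<^sub>0 int) set" where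
  "base_change_map R M N S f =
     tensor_lift R M S (base_change R N S) (\<lambda>x s. pure_tensor R N S (f x) s)"

text \<open>
  Flatness: tensoring preserves injectivity of linear maps. The quantification is over modules carried
  by sets in the type \<open>nat \<Rightarrow> 'b\<close>, where \<open>'b\<close> is the type of elements of \<open>B\<close>. Up to isomorphism these
  include all finitely generated \<open>B\<close>-modules and all ideals of \<open>B\<close>, so this is flatness.
\<close>

definition flat_module :: "('b, 'z) ring_scheme \<Rightarrow> ('b, 'u) module \<Rightarrow> bool" where
  "flat_module B X \<longleftrightarrow>
     (\<forall>(N' :: ('b, nat \<Rightarrow> 'b) module) (N :: ('b, nat \<Rightarrow> 'b) module) f.
        module B N' \<and> module B N \<and> f \<in> linear_maps B N' N \<and> inj_on f (carrier N') \<longrightarrow>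
        inj_on (tensor_lift B N' X (tensor B N X) (\<lambda>n x. pure_tensor B N X (f n) x))
          (carrier (tensor B N' X)))"


section \<open>The base of a deformation\<close>

definition local_artinian_algebra :: "'k ring \<Rightarrow> ('k, 'b) module \<Rightarrow> 'b set \<Rightarrow> bool" where
  "local_artinian_algebra K B m \<longleftrightarrow>
     algebra K B \<and>
     maximalideal m B \<and> (\<forall>n. maximalideal n B \<longrightarrow> n = m) \<and>
     (\<forall>I :: nat \<Rightarrow> 'b set. (\<forall>i. ideal (I i) B \<and> I (Suc i) \<subseteq> I i) \<longrightarrow> (\<exists>i0. \<forall>i\<ge>i0. I i = I i0)) \<and>
     (\<lambda>c. m +>\<^bsub>B\<^esub> (c \<odot>\<^bsub>B\<^esub> \<one>\<^bsub>B\<^esub>)) \<in> ring_iso K (B Quot m)"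

definition residue_map :: "'k ring \<Rightarrow> ('k, 'b) module \<Rightarrow> 'b set \<Rightarrow> 'b \<Rightarrow> 'k" where
  "residue_map K B m b = (THE c. c \<in> carrier K \<and> b \<ominus>\<^bsub>B\<^esub> (c \<odot>\<^bsub>B\<^esub> \<one>\<^bsub>B\<^esub>) \<in> m)"

text \<open>The field \<open>k = B/m\<close> as a \<open>B\<close>-algebra.\<close>

definition residue_algebra :: "'k ring \<Rightarrow> ('k, 'b) module \<Rightarrow> 'b set \<Rightarrow> ('b, 'k) module" where
  "residue_algebra K B m =
     \<lparr>carrier = carrier K, mult = mult K, one = one K, zero = zero K, add = add K,
      smult = \<lambda>b c. residue_map K B m b \<otimes>\<^bsub>K\<^esub> c\<rparr>"

text \<open>The submodule \<open>M\<^sub>m = M \<otimes> m\<close> of \<open>M\<^sub>B\<close>, and the canonical projection of \<open>M\<^sub>B\<close> onto \<open>M\<close>.\<close>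

definition m_part ::
  "'k ring \<Rightarrow> ('k, 'x) module \<Rightarrow> ('k, 'b) module \<Rightarrow> 'b set \<Rightarrow> ('x \<times> 'b \<Rightarrow>\<^sub>0 int) set set" where
  "m_part K M B m =
     generate (add_monoid (base_change K M B))
       {pure_tensor K M B x b | x b. x \<in> carrier M \<and> b \<in> m}"

definition reduction ::
  "'k ring \<Rightarrow> ('k, 'x) module \<Rightarrow> ('k, 'b) module \<Rightarrow> 'b set \<Rightarrow> ('x \<times> 'b \<Rightarrow>\<^sub>0 int) set \<Rightarrow> 'x" where
  "reduction K M B m = tensor_lift K M B M (\<lambda>x b. residue_map K B m b \<odot>\<^bsub>M\<^esub> x)"


section \<open>The canonical resolution\<close>

text \<open>
  The non-unitary tensor algebra \<open>T(M) = \<Oplus>\<^sub>r\<^sub>\<ge>\<^sub>1 M\<^sup>\<otimes>\<^sup>r\<close>: the free abelian group on the nonempty words in \<open>M\<close>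
  modulo multilinearity, with concatenation as product. The relations do not change the length of a
  word, so the quotient is the direct sum of the tensor powers. A scalar acts on the first letter.
\<close>

definition nonempty_words :: "'m set \<Rightarrow> 'm list set" where
  "nonempty_words S = {xs. xs \<noteq> [] \<and> set xs \<subseteq> S}"

definition word_relations ::
  "('r, 'z) ring_scheme \<Rightarrow> ('r, 'm) module \<Rightarrow> ('m list \<Rightarrow>\<^sub>0 int) set" where
  "word_relations R M =
     {frag_of (xs @ (x \<oplus>\<^bsub>M\<^esub> y) # ys) - frag_of (xs @ x # ys) - frag_of (xs @ y # ys) | xs x y ys.
        set xs \<subseteq> carrier M \<and> x \<in> carrier M \<and> y \<in> carrier M \<and> set ys \<subseteq> carrier M} \<union>
     {frag_of (xs @ (r \<odot>\<^bsub>M\<^esub> x) # y # ys) - frag_of (xs @ x # (r \<odot>\<^bsub>M\<^esub> y) # ys) | xs r x y ys.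
        r \<in> carrier R \<and>
        set xs \<subseteq> carrier M \<and> x \<in> carrier M \<and> y \<in> carrier M \<and> set ys \<subseteq> carrier M}"

definition word_kernel ::
  "('r, 'z) ring_scheme \<Rightarrow> ('r, 'm) module \<Rightarrow> ('m list \<Rightarrow>\<^sub>0 int) set" where
  "word_kernel R M =
     generate (free_Abelian_group (nonempty_words (carrier M))) (word_relations R M)"

definition word_class ::
  "('r, 'z) ring_scheme \<Rightarrow> ('r, 'm) module \<Rightarrow> ('m list \<Rightarrow>\<^sub>0 int) \<Rightarrow> ('m list \<Rightarrow>\<^sub>0 int) set" where
  "word_class R M c = word_kernel R M #>\<^bsub>free_Abelian_group (nonempty_words (carrier M))\<^esub> c"

definition tensor_word ::
  "('r, 'z) ring_scheme \<Rightarrow> ('r, 'm) module \<Rightarrow> 'm list \<Rightarrow> ('m list \<Rightarrow>\<^sub>0 int) set" where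
  "tensor_word R M xs = word_class R M (frag_of xs)"

definition tensor_algebra ::
  "('r, 'z) ring_scheme \<Rightarrow> ('r, 'm) module \<Rightarrow> ('r, ('m list \<Rightarrow>\<^sub>0 int) set) module" where
  "tensor_algebra R M =
     (let Q = free_Abelian_group (nonempty_words (carrier M)) Mod word_kernel R M in
      \<lparr>carrier = carrier Q,
       mult = \<lambda>X Y. \<Union>c\<in>X. \<Union>c'\<in>Y. word_class R M
         (frag_extend (\<lambda>xs. frag_extend (\<lambda>ys. frag_of (xs @ ys)) c') c),
       one = undefined,
       zero = one Q, add = mult Q,
       smult = \<lambda>r X. \<Union>c\<in>X. word_class R M
         (frag_extend (\<lambda>xs. frag_of ((r \<odot>\<^bsub>M\<^esub> hd xs) # tl xs)) c)\<rparr>)"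

text \<open>
  The generating space \<open>V = \<Oplus>\<^sub>n\<^sub>\<ge>\<^sub>1 A\<^sup>\<otimes>\<^sup>n\<close> of \<open>\<Omega>\<B>A\<close> is the module underlying \<open>T(A)\<close>, with \<open>A\<^sup>\<otimes>\<^sup>n\<close> in degree
  \<open>1 - n\<close>, and \<open>\<Omega>\<B>A = T(V)\<close>. The list of lists \<open>[w\<^sub>1, \<dots>, w\<^sub>r]\<close> stands for \<open>[w\<^sub>1] \<otimes> \<dots> \<otimes> [w\<^sub>r]\<close>, where \<open>[w]\<close> is the
  generator \<open>[a\<^sub>1|\<dots>|a\<^sub>n]\<close> if \<open>w\<close> is the list \<open>[a\<^sub>1, \<dots>, a\<^sub>n]\<close>.
\<close>

type_synonym 'a bar = "('a list \<Rightarrow>\<^sub>0 int) set"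
type_synonym 'a omega = "('a bar list \<Rightarrow>\<^sub>0 int) set"
type_synonym ('x, 'b) bc = "('x \<times> 'b \<Rightarrow>\<^sub>0 int) set"

definition omega :: "'k ring \<Rightarrow> ('k, 'a) module \<Rightarrow> ('k, 'a omega) module" where
  "omega K A = tensor_algebra K (tensor_algebra K A)"

definition omega_word :: "'k ring \<Rightarrow> ('k, 'a) module \<Rightarrow> 'a list list \<Rightarrow> 'a omega" where
  "omega_word K A ws = tensor_word K (tensor_algebra K A) (map (tensor_word K A) ws)"

definition omega_degree :: "'k ring \<Rightarrow> ('k, 'a) module \<Rightarrow> int \<Rightarrow> 'a omega set" where
  "omega_degree K A i =
     generate (add_monoid (omega K A))
       {omega_word K A ws | ws. ws \<in> nonempty_words (nonempty_words (carrier A)) \<and>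
          (\<Sum>w\<leftarrow>ws. 1 - int (length w)) = i}"

definition signed :: "('x, 'z) ring_scheme \<Rightarrow> int \<Rightarrow> 'x \<Rightarrow> 'x" where
  "signed M i x = (if even i then x else \<ominus>\<^bsub>M\<^esub> x)"

text \<open>Derivations of degree \<open>+1\<close> of a graded algebra; \<open>gr i\<close> is the component of degree \<open>i\<close>.\<close>

definition odd_derivations ::
  "('r, 'z) ring_scheme \<Rightarrow> ('r, 'x) module \<Rightarrow> (int \<Rightarrow> 'x set) \<Rightarrow> ('x \<Rightarrow> 'x) set" where
  "odd_derivations R X gr = {d \<in> linear_maps R X X.
     (\<forall>i. d ` gr i \<subseteq> gr (i + 1)) \<and>
     (\<forall>i. \<forall>x\<in>gr i. \<forall>y\<in>carrier X. d (x \<otimes>\<^bsub>X\<^esub> y) = d x \<otimes>\<^bsub>X\<^esub> y \<oplus>\<^bsub>X\<^esub> signed X i (x \<otimes>\<^bsub>X\<^esub> d y))}"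

definition omega_diff :: "'k ring \<Rightarrow> ('k, 'a) module \<Rightarrow> 'a omega \<Rightarrow> 'a omega" where
  "omega_diff K A =
     (THE d. d \<in> odd_derivations K (omega K A) (omega_degree K A) \<and>
        (\<forall>w \<in> nonempty_words (carrier A).
           d (omega_word K A [w]) =
             (\<Oplus>\<^bsub>omega K A\<^esub>j\<in>{1..<length w}.
                signed (omega K A) (int j) (omega_word K A [take j w, drop j w])) \<oplus>\<^bsub>omega K A\<^esub>
             (\<Oplus>\<^bsub>omega K A\<^esub>j\<in>{1..<length w}.
                signed (omega K A) (int j - 1)
                  (omega_word K A [take (j - 1) w @ (w ! (j - 1) \<otimes>\<^bsub>A\<^esub> w ! j) # drop (j + 1) w]))))"

text \<open>The map \<open>p\<close> from \<open>\<Omega>\<B>A\<close> to \<open>A\<close>.\<close>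

definition omega_proj :: "'k ring \<Rightarrow> ('k, 'a) module \<Rightarrow> 'a omega \<Rightarrow> 'a" where
  "omega_proj K A =
     (THE p. p \<in> algebra_homs K (omega K A) A \<and>
        (\<forall>w \<in> nonempty_words (carrier A).
           p (omega_word K A [w]) = (if length w = 1 then hd w else \<zero>\<^bsub>A\<^esub>)))"

abbreviation omegaB ::
  "'k ring \<Rightarrow> ('k, 'a) module \<Rightarrow> ('k, 'b) module \<Rightarrow> ('b, ('a omega, 'b) bc) module" where
  "omegaB K A B \<equiv> base_change K (omega K A) B"

definition omegaB_degree ::
  "'k ring \<Rightarrow> ('k, 'a) module \<Rightarrow> ('k, 'b) module \<Rightarrow> int \<Rightarrow> ('a omega, 'b) bc set" where
  "omegaB_degree K A B i =
     generate (add_monoid (omegaB K A B))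
       {pure_tensor K (omega K A) B x b | x b. x \<in> omega_degree K A i \<and> b \<in> carrier B}"


section \<open>Associative deformations\<close>

abbreviation algB ::
  "'k ring \<Rightarrow> ('k, 'a) module \<Rightarrow> ('k, 'b) module \<Rightarrow> ('b, ('a, 'b) bc) module" where
  "algB K A B \<equiv> base_change K A B"

type_synonym ('a, 'b) cochain =
  "(('a, 'b) bc, ('a, 'b) bc) bc \<Rightarrow> ('a, 'b) bc"

definition deformed_algebra ::
  "'k ring \<Rightarrow> ('k, 'a) module \<Rightarrow> ('k, 'b) module \<Rightarrow> ('a, 'b) cochain
    \<Rightarrow> ('b, ('a, 'b) bc) module" where
  "deformed_algebra K A B \<beta> =
     (algB K A B)\<lparr>mult := \<lambda>x y. (x \<otimes>\<^bsub>algB K A B\<^esub> y) \<oplus>\<^bsub>algB K A B\<^esub>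
                     \<beta> (pure_tensor B (algB K A B) (algB K A B) x y)\<rparr>"

definition MC_ass ::
  "'k ring \<Rightarrow> ('k, 'a) module \<Rightarrow> ('k, 'b) module \<Rightarrow> 'b set \<Rightarrow> ('a, 'b) cochain set" where
  "MC_ass K A B m =
     {\<beta> \<in> linear_maps B (tensor B (algB K A B) (algB K A B)) (algB K A B).
        \<beta> ` carrier (tensor B (algB K A B) (algB K A B)) \<subseteq> m_part K A B m \<and>
        nonunital_algebra B (deformed_algebra K A B \<beta>)}"

definition equiv_ass ::
  "'k ring \<Rightarrow> ('k, 'a) module \<Rightarrow> ('k, 'b) module \<Rightarrow> 'b set
    \<Rightarrow> (('a, 'b) cochain \<times> ('a, 'b) cochain) set" where
  "equiv_ass K A B m =
     {(\<beta>, \<beta>'). \<beta> \<in> MC_ass K A B m \<and> \<beta>' \<in> MC_ass K A B m \<and>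
        (\<exists>\<Phi> \<in> algebra_isos B (deformed_algebra K A B \<beta>) (deformed_algebra K A B \<beta>').
           \<forall>x\<in>carrier (algB K A B). reduction K A B m (\<Phi> x) = reduction K A B m x)}"

definition Def_ass ::
  "'k ring \<Rightarrow> ('k, 'a) module \<Rightarrow> ('k, 'b) module \<Rightarrow> 'b set \<Rightarrow> ('a, 'b) cochain set set" where
  "Def_ass K A B m = MC_ass K A B m // equiv_ass K A B m"


section \<open>Deformations of the relations\<close>

type_synonym ('a, 'b) perturbation = "('a omega, 'b) bc \<Rightarrow> ('a omega, 'b) bc"

definition perturbed_diff ::
  "'k ring \<Rightarrow> ('k, 'a) module \<Rightarrow> ('k, 'b) module \<Rightarrow> ('a, 'b) perturbation
    \<Rightarrow> ('a omega, 'b) bc \<Rightarrow> ('a omega, 'b) bc" where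
  "perturbed_diff K A B \<delta> x =
     base_change_map K (omega K A) (omega K A) B (omega_diff K A) x \<oplus>\<^bsub>omegaB K A B\<^esub> \<delta> x"

definition MC_rel ::
  "'k ring \<Rightarrow> ('k, 'a) module \<Rightarrow> ('k, 'b) module \<Rightarrow> 'b set \<Rightarrow> ('a, 'b) perturbation set" where
  "MC_rel K A B m =
     {\<delta> \<in> odd_derivations B (omegaB K A B) (omegaB_degree K A B).
        \<delta> ` carrier (omegaB K A B) \<subseteq> m_part K (omega K A) B m \<and>
        (\<forall>x\<in>carrier (omegaB K A B).
           perturbed_diff K A B \<delta> (perturbed_diff K A B \<delta> x) = \<zero>\<^bsub>omegaB K A B\<^esub>)}"

definition equiv_rel ::
  "'k ring \<Rightarrow> ('k, 'a) module \<Rightarrow> ('k, 'b) module \<Rightarrow> 'b set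
    \<Rightarrow> (('a, 'b) perturbation \<times> ('a, 'b) perturbation) set" where
  "equiv_rel K A B m =
     {(\<delta>\<^sub>1, \<delta>\<^sub>2). \<delta>\<^sub>1 \<in> MC_rel K A B m \<and> \<delta>\<^sub>2 \<in> MC_rel K A B m \<and>
        (\<exists>\<Phi> \<in> algebra_isos B (omegaB K A B) (omegaB K A B).
           (\<forall>i. \<Phi> ` omegaB_degree K A B i = omegaB_degree K A B i) \<and>
           (\<forall>x\<in>carrier (omegaB K A B).
              \<Phi> (perturbed_diff K A B \<delta>\<^sub>1 x) = perturbed_diff K A B \<delta>\<^sub>2 (\<Phi> x)) \<and>
           (\<forall>x\<in>carrier (omegaB K A B).
              reduction K (omega K A) B m (\<Phi> x) = reduction K (omega K A) B m x))}"

definition Def_rel ::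
  "'k ring \<Rightarrow> ('k, 'a) module \<Rightarrow> ('k, 'b) module \<Rightarrow> 'b set \<Rightarrow> ('a, 'b) perturbation set set" where
  "Def_rel K A B m = MC_rel K A B m // equiv_rel K A B m"


section \<open>Flat deformations\<close>

text \<open>
  Flat deformations are pairs of a \<open>B\<close>-algebra carried by a subset of a type \<open>'u\<close> and an isomorphism of
  its reduction with \<open>A\<close>. The set \<open>Def_flat\<close> of classes is formed relative to such a universe \<open>'u\<close>, but
  being a flat deformation and being equivalent make sense across universes.
\<close>

type_synonym ('k, 'a, 'b, 'u) fdef = "('b, 'u) module \<times> (('u, 'k) bc \<Rightarrow> 'a)"

definition flat_deformation ::
  "'k ring \<Rightarrow> ('k, 'a) module \<Rightarrow> ('k, 'b) module \<Rightarrow> 'b set \<Rightarrow> ('k, 'a, 'b, 'u) fdef \<Rightarrow> bool" where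
  "flat_deformation K A B m = (\<lambda>(X, \<phi>).
     nonunital_algebra B X \<and> flat_module B X \<and>
     \<phi> \<in> algebra_isos K (base_change B X (residue_algebra K B m)) A)"

definition flat_equivalent ::
  "'k ring \<Rightarrow> ('k, 'a) module \<Rightarrow> ('k, 'b) module \<Rightarrow> 'b set
    \<Rightarrow> ('k, 'a, 'b, 'u) fdef \<Rightarrow> ('k, 'a, 'b, 'v) fdef \<Rightarrow> bool" where
  "flat_equivalent K A B m = (\<lambda>(X, \<phi>) (Y, \<psi>).
     flat_deformation K A B m (X, \<phi>) \<and> flat_deformation K A B m (Y, \<psi>) \<and>
     (\<exists>\<Psi> \<in> algebra_isos B X Y. \<forall>x\<in>carrier X.
        \<psi> (pure_tensor B Y (residue_algebra K B m) (\<Psi> x) \<one>\<^bsub>K\<^esub>) =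
        \<phi> (pure_tensor B X (residue_algebra K B m) x \<one>\<^bsub>K\<^esub>)))"

definition Def_flat ::
  "'u itself \<Rightarrow> 'k ring \<Rightarrow> ('k, 'a) module \<Rightarrow> ('k, 'b) module \<Rightarrow> 'b set
    \<Rightarrow> ('k, 'a, 'b, 'u) fdef set set" where
  "Def_flat U K A B m =
     {X. flat_deformation K A B m X} // {(X, Y). flat_equivalent K A B m X Y}"

text \<open>
  The class, inside the universe \<open>'u\<close>, of a flat deformation \<open>X\<close> living in a possibly different
  universe. It is empty unless \<open>X\<close> is a flat deformation that has a copy in \<open>'u\<close>.
\<close>

definition flat_class ::
  "'u itself \<Rightarrow> 'k ring \<Rightarrow> ('k, 'a) module \<Rightarrow> ('k, 'b) module \<Rightarrow> 'b set
    \<Rightarrow> ('k, 'a, 'b, 'v) fdef \<Rightarrow> ('k, 'a, 'b, 'u) fdef set" where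
  "flat_class U K A B m X = {Y. flat_equivalent K A B m X Y}"


section \<open>The maps E, F and G\<close>

text \<open>
  \<open>mult_slot xs ys\<close> is the \<open>B\<close>-linear map from \<open>A\<^sub>B\<close> to \<open>(\<Omega>\<B>A)\<^sub>B\<close> that puts its argument between \<open>xs\<close> and
  \<open>ys\<close> in a generator: \<open>a \<otimes> b\<close> goes to \<open>[xs|a|ys] \<otimes> b\<close>.
\<close>

definition mult_slot ::
  "'k ring \<Rightarrow> ('k, 'a) module \<Rightarrow> ('k, 'b) module \<Rightarrow> 'a list \<Rightarrow> 'a list
    \<Rightarrow> ('a, 'b) bc \<Rightarrow> ('a omega, 'b) bc" where
  "mult_slot K A B xs ys =
     tensor_lift K A B (omegaB K A B)
       (\<lambda>a b. pure_tensor K (omega K A) B (omega_word K A [xs @ a # ys]) b)"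

text \<open>
  The differential of the cobar-bar construction over \<open>B\<close> of a \<open>B\<close>-algebra \<open>P\<close> with underlying module
  \<open>A\<^sub>B\<close>, on the graded algebra \<open>(\<Omega>\<B>A)\<^sub>B\<close>. It is enough to prescribe it on the generators \<open>[w] \<otimes> 1\<close> with
  letters in \<open>A\<close>.
\<close>

definition cobar_bar_diff ::
  "'k ring \<Rightarrow> ('k, 'a) module \<Rightarrow> ('k, 'b) module \<Rightarrow> ('b, ('a, 'b) bc) module
    \<Rightarrow> ('a omega, 'b) bc \<Rightarrow> ('a omega, 'b) bc" where
  "cobar_bar_diff K A B P =
     (THE D. D \<in> odd_derivations B (omegaB K A B) (omegaB_degree K A B) \<and>
        (\<forall>w \<in> nonempty_words (carrier A).
           D (pure_tensor K (omega K A) B (omega_word K A [w]) \<one>\<^bsub>B\<^esub>) =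
             (\<Oplus>\<^bsub>omegaB K A B\<^esub>j\<in>{1..<length w}.
                signed (omegaB K A B) (int j)
                  (pure_tensor K (omega K A) B (omega_word K A [take j w, drop j w]) \<one>\<^bsub>B\<^esub>))
             \<oplus>\<^bsub>omegaB K A B\<^esub>
             (\<Oplus>\<^bsub>omegaB K A B\<^esub>j\<in>{1..<length w}.
                signed (omegaB K A B) (int j - 1)
                  (mult_slot K A B (take (j - 1) w) (drop (j + 1) w)
                    (pure_tensor K A B (w ! (j - 1)) \<one>\<^bsub>B\<^esub> \<otimes>\<^bsub>P\<^esub> pure_tensor K A B (w ! j) \<one>\<^bsub>B\<^esub>)))))"

definition cobar_perturbation ::
  "'k ring \<Rightarrow> ('k, 'a) module \<Rightarrow> ('k, 'b) module \<Rightarrow> ('a, 'b) cochain \<Rightarrow> ('a, 'b) perturbation" where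
  "cobar_perturbation K A B \<beta> =
     (\<lambda>x\<in>carrier (omegaB K A B).
        cobar_bar_diff K A B (deformed_algebra K A B \<beta>) x \<ominus>\<^bsub>omegaB K A B\<^esub>
        cobar_bar_diff K A B (algB K A B) x)"

text \<open>
  Composition with \<open>p\<close>. A cochain of degree 1 on the bar construction is a bilinear map on \<open>A\<close>, so only
  the values of \<open>\<delta>\<close> on the generators \<open>[a|a']\<close> matter.
\<close>

definition compose_p ::
  "'k ring \<Rightarrow> ('k, 'a) module \<Rightarrow> ('k, 'b) module \<Rightarrow> ('a, 'b) perturbation \<Rightarrow> ('a, 'b) cochain" where
  "compose_p K A B \<delta> =
     (THE \<beta>. \<beta> \<in> linear_maps B (tensor B (algB K A B) (algB K A B)) (algB K A B) \<and>
        (\<forall>a\<in>carrier A. \<forall>a'\<in>carrier A.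
           \<beta> (pure_tensor B (algB K A B) (algB K A B)
                (pure_tensor K A B a \<one>\<^bsub>B\<^esub>) (pure_tensor K A B a' \<one>\<^bsub>B\<^esub>)) =
           base_change_map K (omega K A) A B (omega_proj K A)
             (\<delta> (pure_tensor K (omega K A) B (omega_word K A [[a, a']]) \<one>\<^bsub>B\<^esub>))))"

text \<open>
  Composition with \<open>p\<close> is compatible with the brackets on the DG Lie subalgebra of \<open>Der(\<Omega>\<B>A)\<close> formed by
  the derivations that come from coderivations of \<open>\<B>A\<close>, but not on all of \<open>Der(\<Omega>\<B>A)\<close>: it need not send a
  Maurer-Cartan element outside the subalgebra to an associative deformation: for \<open>A = k \<times> k\<close> with
  idempotents \<open>e, e'\<close>, for \<open>B = k[t]/t\<^sup>3\<close>, and for the transform of \<open>d\<close> by \<open>exp(tf)\<close>, where \<open>f\<close> is the derivation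
  with \<open>f[e] = [e']\<close> that kills the other generators, the resulting product is not associative. The inclusion
  of the subalgebra is a quasi-isomorphism, so every class of \<open>Def_rel\<close> has representatives in it, and
  \<open>E\<close> composes these with \<open>p\<close>; the inverse of \<open>E\<close> is \<open>[\<beta>] \<mapsto> [\<delta>(\<beta>)]\<close>.
\<close>

definition map_E ::
  "'k ring \<Rightarrow> ('k, 'a) module \<Rightarrow> ('k, 'b) module \<Rightarrow> 'b set
    \<Rightarrow> ('a, 'b) perturbation set \<Rightarrow> ('a, 'b) cochain set" where
  "map_E K A B m c = compose_p K A B ` (c \<inter> cobar_perturbation K A B ` MC_ass K A B m)"

definition map_F ::
  "'u itself \<Rightarrow> 'k ring \<Rightarrow> ('k, 'a) module \<Rightarrow> ('k, 'b) module \<Rightarrow> 'b set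
    \<Rightarrow> ('a, 'b) cochain set \<Rightarrow> ('k, 'a, 'b, 'u) fdef set" where
  "map_F U K A B m c =
     (\<Union>\<beta>\<in>c. flat_class U K A B m
        (deformed_algebra K A B \<beta>,
         tensor_lift B (deformed_algebra K A B \<beta>) (residue_algebra K B m) A
           (\<lambda>x r. r \<odot>\<^bsub>A\<^esub> reduction K A B m x)))"

definition cohomology0 ::
  "'k ring \<Rightarrow> ('k, 'a) module \<Rightarrow> ('k, 'b) module \<Rightarrow> ('a, 'b) perturbation
    \<Rightarrow> ('b, ('a omega, 'b) bc set) module" where
  "cohomology0 K A B \<delta> =
     (let R = omegaB K A B;
          D = perturbed_diff K A B \<delta>;
          Z = {x \<in> omegaB_degree K A B 0. D x = \<zero>\<^bsub>R\<^esub>};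
          I = D ` omegaB_degree K A B (- 1) in
      \<lparr>carrier = (\<lambda>x. I +>\<^bsub>R\<^esub> x) ` Z,
       mult = \<lambda>X Y. \<Union>x\<in>X. \<Union>y\<in>Y. I +>\<^bsub>R\<^esub> (x \<otimes>\<^bsub>R\<^esub> y),
       one = undefined,
       zero = I, add = \<lambda>X Y. X <+>\<^bsub>R\<^esub> Y,
       smult = \<lambda>b X. \<Union>x\<in>X. I +>\<^bsub>R\<^esub> (b \<odot>\<^bsub>R\<^esub> x)\<rparr>)"

definition map_G ::
  "'u itself \<Rightarrow> 'k ring \<Rightarrow> ('k, 'a) module \<Rightarrow> ('k, 'b) module \<Rightarrow> 'b set
    \<Rightarrow> ('a, 'b) perturbation set \<Rightarrow> ('k, 'a, 'b, 'u) fdef set" where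
  "map_G U K A B m c =
     (\<Union>\<delta>\<in>c. flat_class U K A B m
        (cohomology0 K A B \<delta>,
         tensor_lift B (cohomology0 K A B \<delta>) (residue_algebra K B m) A
           (\<lambda>X r. r \<odot>\<^bsub>A\<^esub> omega_proj K A (reduction K (omega K A) B m (SOME x. x \<in> X)))))"

end

theory Submission imports Defs begin

syntax "_index" :: "logic => index" ("\<^sub>_" [1000] 1000)

text \<open>
 The resolution and its base change are spanned by nested words \<open>[a\<^sub>1|\<dots>] \<otimes> [b\<^sub>1|\<dots>] \<otimes> \<dots>\<close>. On these, the
 cobar-bar differential \<open>D\<close> of any associative product on \<open>A\<^sub>B\<close> has an explicit contraction onto \<open>A\<^sub>B\<close>:
 \<open>D H + H D = 1 - i p\<close>. For a deformation \<open>E = D + \<delta>\<close> of the relations the error \<open>\<delta> H + H \<delta>\<close> has image in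
 the \<open>m\<close>-part, so it is nilpotent, and a geometric series turns \<open>H\<close> into an operator \<open>Q\<close> with \<open>E Q z = z\<close> on
 cycles of negative degree and \<open>E Q z = z - i (q z)\<close> in degree 0. Hence \<open>H\<^sup>0(E)\<close> is a copy of \<open>A\<^sub>B\<close>, and its
 product \<open>q (i x \<cdot> i y)\<close> is an associative deformation \<open>\<beta>\<close>. Recursion over word length with \<open>Q\<close> gives an
 isomorphism from the cobar-bar construction of \<open>\<alpha> + \<beta>\<close> to \<open>E\<close>; with the functoriality of the construction
 this makes \<open>[\<delta>] \<mapsto> [\<beta>]\<close> bijective, and it identifies \<open>H\<^sup>0\<close> with the deformed algebra, which is the triangle.
 Finally, \<open>A\<^sub>B\<close> is flat because a linear retraction over the field \<open>k\<close> survives tensoring, and a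
 linear section \<open>A \<rightarrow> X\<close> of a flat deformation \<open>X\<close> extends to a map \<open>A\<^sub>B \<rightarrow> X\<close> that is onto since \<open>m\<close> is
 nilpotent and injective by flatness for the ideals \<open>m\<^sup>j\<close>; so every flat deformation comes from some \<open>\<beta>\<close>.
\<close>

text \<open>Two operations on nested words drive everything: multiplying on the left by a one-letter
  generator \<open>[a]\<close>, and putting a letter in front of the first generator. Every nested
  word arises from some \<open>[[a]]\<close> by these two, so the differential, the augmentation
  \<open>p\<close> and the homotopy \<open>H\<close> are defined by structural recursion, and their
  identities are checked one operation at a time. The same abstract setting is used for the
  resolution of \<open>A\<close> over \<open>K\<close> and for its base change over
  \<open>B\<close>, where each associative product on the module \<open>A_B\<close> has its own
  differential on one and the same graded algebra. Equivalences reduce to the identity, that is,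
  they are congruent to it modulo \<open>m\<close>. Such endomorphisms are automatically bijective,
  so only homomorphisms have to be constructed. Composition with \<open>p\<close> is meaningful only
  on special representatives, so \<open>E\<close> is studied through its inverse
  \<open>[\<beta>] \<mapsto> [\<Delta> \<beta>]\<close>: it is the preimage map on classes, and what
  has to be shown is that \<open>\<Delta>\<close> preserves and reflects equivalence and meets every
  class.\<close>

abbreviation elem (infix ":." 50) where "x :. M == x : carrier M"
abbreviation "gen M S == generate (add_monoid M) S"
lemmas words_def = nonempty_words_def

section \<open>Linear maps\<close>

context abelian_group begin

lemma minus_add_cancel: "a :. G ==> b :. G ==> (a \<ominus> b) \<oplus> b = a"
 by (simp add: a_minus_def a_assoc l_neg)

lemma diff_zero_iff: "a :. G ==> b :. G ==> a \<ominus> b = \<zero> \<longleftrightarrow> a = b"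
 using minus_add_cancel[of a b] by (auto simp: a_minus_def r_neg)

text \<open>AC rewriting can leave a summand and its negative apart. These rules cancel the pair
  across up to three summands, which makes \<open>ab_simps\<close> strong enough for the sign
  bookkeeping below.\<close>

lemma cancel_apart:
 "u :. G ==> w :. G ==> u \<oplus> (\<ominus> u \<oplus> w) = w"
 "u :. G ==> w :. G ==> \<ominus> u \<oplus> (u \<oplus> w) = w"
 "u :. G ==> v :. G ==> u \<oplus> (v \<oplus> \<ominus> u) = v"
 "u :. G ==> v :. G ==> w :. G ==> u \<oplus> (v \<oplus> (\<ominus> u \<oplus> w)) = v \<oplus> w"
 "u :. G ==> v :. G ==> x :. G ==> u \<oplus> (v \<oplus> (x \<oplus> \<ominus> u)) = v \<oplus> x"
 "u :. G ==> v :. G ==> x :. G ==> w :. G ==>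
  u \<oplus> (v \<oplus> (x \<oplus> (\<ominus> u \<oplus> w))) = v \<oplus> (x \<oplus> w)"
 "u :. G ==> v :. G ==> x :. G ==> y :. G ==>
  u \<oplus> (v \<oplus> (x \<oplus> (y \<oplus> \<ominus> u))) = v \<oplus> (x \<oplus> y)"
 "u :. G ==> v :. G ==> x :. G ==> y :. G ==> w :. G ==>
  u \<oplus> (v \<oplus> (x \<oplus> (y \<oplus> (\<ominus> u \<oplus> w)))) = v \<oplus> (x \<oplus> (y \<oplus> w))"
 using r_neg1[of u] r_neg2[of u] a_lcomm[of u v] a_lcomm[of u x] a_lcomm[of u y]
 by (simp_all add: r_neg)

lemmas ab_simps = a_minus_def minus_add minus_minus a_ac r_neg l_neg cancel_apart

end

text \<open>Source and target may have different scalars, as is needed for reductions from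
  \<open>B\<close>-modules to \<open>K\<close>-modules and for quotients that are mere
  groups.\<close>

definition additive :: "('a, 'x) ring_scheme => ('b, 'y) ring_scheme => ('a => 'b) => bool" where
 "additive M N f \<longleftrightarrow> f : carrier M \<rightarrow> carrier N \<and>
   (\<forall>x\<in>carrier M. \<forall>y\<in>carrier M. f (x \<oplus>\<^sub>M y) = f x \<oplus>\<^sub>N f y)"

lemma additive_iff_hom: "additive M N f \<longleftrightarrow> f : hom (add_monoid M) (add_monoid N)"
 by (auto simp: additive_def hom_def)

lemma additive_closed: "additive M N f ==> x :. M ==> f x :. N"
 by (auto simp: additive_def)

lemma additive_add:
 "additive M N f ==> x :. M ==> y :. M ==> f (x \<oplus>\<^sub>M y) = f x \<oplus>\<^sub>N f y"
 by (auto simp: additive_def)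

lemma additive_group_hom:
 assumes "abelian_group M" "abelian_group N" "additive M N f"
 shows "group_hom (add_monoid M) (add_monoid N) f"
 using assms by (auto simp: group_hom_def group_hom_axioms_def additive_iff_hom abelian_group_def
   abelian_group_axioms_def comm_group_def)

lemma additive_zero:
 assumes "abelian_group M" "abelian_group N" "additive M N f"
 shows "f \<zero>\<^sub>M = \<zero>\<^sub>N"
 using group_hom.hom_one[OF additive_group_hom[OF assms]] by simp

lemma additive_neg:
 assumes "abelian_group M" "abelian_group N" "additive M N f" "x :. M"
 shows "f (\<ominus>\<^sub>M x) = \<ominus>\<^sub>N f x"
 using group_hom.hom_inv[OF additive_group_hom[OF assms(1-3)]] assms(4) by (simp add: a_inv_def)

lemma additive_diff:
 assumes "abelian_group M" "abelian_group N" "additive M N f" "x :. M" "y :. M"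
 shows "f (x \<ominus>\<^sub>M y) = f x \<ominus>\<^sub>N f y"
 using assms by (simp add: a_minus_def additive_add additive_neg abelian_group.a_inv_closed)

text \<open>Linearity without the extensionality of \<open>linear_maps\<close>: such maps can be
  composed and added as plain functions, and \<open>restrict\<close> is applied only where a
  definition asks for it.\<close>

definition lin ::
 "('r, 'z) ring_scheme => ('r, 'm) module => ('r, 'n) module => ('m => 'n) => bool" where
 "lin R M N f \<longleftrightarrow> additive M N f \<and>
   (\<forall>r\<in>carrier R. \<forall>x\<in>carrier M. f (r \<odot>\<^sub>M x) = r \<odot>\<^sub>N f x)"

lemma maps_iff: "f : linear_maps R M N \<longleftrightarrow> lin R M N f \<and> f : extensional (carrier M)"
 by (auto simp: linear_maps_def lin_def additive_def PiE_def)

lemma linI: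
 assumes "!!x. x :. M ==> f x :. N"
  and "!!x y. x :. M ==> y :. M ==> f (x \<oplus>\<^sub>M y) = f x \<oplus>\<^sub>N f y"
  and "!!r x. r :. R ==> x :. M ==> f (r \<odot>\<^sub>M x) = r \<odot>\<^sub>N f x"
 shows "lin R M N f"
 using assms by (auto simp: lin_def additive_def)

lemma lin_additive: "lin R M N f ==> additive M N f"
 by (simp add: lin_def)

lemma lin_closed: "lin R M N f ==> x :. M ==> f x :. N"
 by (auto simp: lin_def intro: additive_closed)

lemma lin_add:
 "lin R M N f ==> x :. M ==> y :. M ==> f (x \<oplus>\<^sub>M y) = f x \<oplus>\<^sub>N f y"
 by (simp add: lin_def additive_add)

lemma lin_smult:
 "lin R M N f ==> r :. R ==> x :. M ==> f (r \<odot>\<^sub>M x) = r \<odot>\<^sub>N f x"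
 by (simp add: lin_def)

lemma mod_group: "module R M ==> abelian_group M"
 by (simp add: module_def)

lemma lin_zero: "module R M ==> module R N ==> lin R M N f ==> f \<zero>\<^sub>M = \<zero>\<^sub>N"
 by (simp add: lin_def additive_zero mod_group)

lemma lin_neg:
 "module R M ==> module R N ==> lin R M N f ==> x :. M ==> f (\<ominus>\<^sub>M x) = \<ominus>\<^sub>N f x"
 by (simp add: lin_def additive_neg mod_group)

lemma lin_diff:
 "module R M ==> module R N ==> lin R M N f ==> x :. M ==> y :. M ==>
  f (x \<ominus>\<^sub>M y) = f x \<ominus>\<^sub>N f y"
 by (simp add: lin_def additive_diff mod_group)

lemma lin_cong:
 assumes "module R M" "lin R M N f" "!!x. x :. M ==> f x = g x"
 shows "lin R M N g"
proof -
 interpret module R M by fact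
 show ?thesis using assms(2,3)
  by (intro linI) (auto simp: lin_add lin_smult lin_closed simp flip: assms(3))
qed

lemma lin_comp: "lin R M N f ==> lin R N P g ==> lin R M P (%x. g (f x))"
 by (auto intro!: linI simp: lin_closed lin_add lin_smult)

lemma lin_id: "lin R M M (%x. x)"
 by (auto intro!: linI)

lemma lin_const_zero: "module R N ==> lin R M N (%x. \<zero>\<^sub>N)"
proof -
 assume "module R N"
 then interpret module R N .
 show ?thesis by (auto intro!: linI)
qed

lemma lin_plus:
 assumes "module R N" "lin R M N f" "lin R M N g"
 shows "lin R M N (%x. f x \<oplus>\<^sub>N g x)"
proof -
 interpret module R N by fact
 note c = lin_closed[OF assms(2)] lin_closed[OF assms(3)]
 show ?thesis using assms(2,3)
  by (auto intro!: linI simp: lin_add lin_smult c smult_r_distr M.a_ac)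
qed

lemma lin_uminus:
 assumes "module R N" "lin R M N f"
 shows "lin R M N (%x. \<ominus>\<^sub>N f x)"
proof -
 interpret module R N by fact
 note c = lin_closed[OF assms(2)]
 show ?thesis using assms(2)
  by (auto intro!: linI simp: lin_add lin_smult c smult_r_minus M.minus_add)
qed

lemma lin_minus:
 "module R N ==> lin R M N f ==> lin R M N g ==> lin R M N (%x. f x \<ominus>\<^sub>N g x)"
 by (simp add: a_minus_def lin_plus lin_uminus)

lemma lin_scaled:
 assumes "module R N" "lin R M N f" "r :. R"
 shows "lin R M N (%x. r \<odot>\<^sub>N f x)"
proof -
 interpret module R N by fact
 note c = lin_closed[OF assms(2)]
 show ?thesis using assms(2,3)
  by (auto intro!: linI simp: lin_add lin_smult c smult_r_distr smult_assoc1[symmetric] R.m_comm)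
qed

lemma lin_restrict: "module R M ==> lin R M N f ==> restrict f (carrier M) : linear_maps R M N"
 by (auto simp: maps_iff intro: lin_cong)

lemma lin_finsum:
 assumes "module R M" "module R N" "lin R M N f" "finite I" "g : I \<rightarrow> carrier M"
 shows "f (finsum M g I) = finsum N (%i. f (g i)) I"
proof -
 interpret M: module R M by fact
 interpret N: module R N by fact
 show ?thesis using assms(4,5)
  by (induction rule: finite_induct)
    (auto simp: lin_zero[OF assms(1-3)] lin_add[OF assms(3)] lin_closed[OF assms(3)] Pi_iff)
qed

section \<open>Additive spans\<close>

lemma span_induct [consumes 3, case_names zero base neg add]:
 assumes "abelian_group M" "S \<subseteq> carrier M" "x : gen M S"
  and "P \<zero>\<^sub>M" "!!s. s : S ==> P s"
  and "!!x. x :. M ==> x : gen M S ==> P x ==> P (\<ominus>\<^sub>M x)"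
  and "!!x y. x :. M ==> y :. M ==> x : gen M S ==>
   y : gen M S ==> P x ==> P y ==> P (x \<oplus>\<^sub>M y)"
 shows "P x"
proof -
 interpret abelian_group M by fact
 have "x :. M \<and> x : gen M S \<and> P x" using assms(3)
 proof (induction rule: generate.induct)
  case one
  then show ?case using assms(4) generate.one[of "add_monoid M" S] by simp
 next
  case (incl h)
  then show ?case using assms(2,5) generate.incl[of h S "add_monoid M"] by auto
 next
  case (inv h)
  then show ?case
   using assms(2,5) assms(6)[of h] generate.incl[of h S "add_monoid M"]
    generate.inv[of h S "add_monoid M"] by (auto simp: a_inv_def[symmetric])
 next
  case (eng h1 h2)
  then show ?case using assms(7)[of h1 h2] generate.eng[of h1 "add_monoid M" S h2] by auto
 qed
 then show ?thesis by simp
qed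

lemma span_closed:
 assumes "abelian_group M" "S \<subseteq> carrier M"
 shows "gen M S \<subseteq> carrier M"
  and "\<zero>\<^sub>M : gen M S"
  and "!!x y. x : gen M S ==> y : gen M S ==>
   x \<oplus>\<^sub>M y : gen M S"
  and "!!x. x : gen M S ==> \<ominus>\<^sub>M x : gen M S"
  and "!!x y. x : gen M S ==> y : gen M S ==>
   x \<ominus>\<^sub>M y : gen M S"
proof -
 interpret abelian_group M by fact
 have g: "subgroup (gen M S) (add_monoid M)"
  using assms(2) by (intro add.generate_is_subgroup) simp
 show 1: "gen M S \<subseteq> carrier M" using subgroup.subset[OF g] by simp
 show "\<zero>\<^sub>M : gen M S" using subgroup.one_closed[OF g] by simp
 show 3: "x : gen M S ==> y : gen M S ==>
   x \<oplus>\<^sub>M y : gen M S" for x y using subgroup.m_closed[OF g] by simp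
 show 4: "x : gen M S ==> \<ominus>\<^sub>M x : gen M S" for x
  using subgroup.m_inv_closed[OF g] 1 by (simp add: a_inv_def)
 show "x : gen M S ==> y : gen M S ==>
   x \<ominus>\<^sub>M y : gen M S" for x y using 3 4 by (simp add: a_minus_def)
qed

lemma span_base: "s : S ==> s : gen M S"
 by (rule generate.incl)

lemma additive_span_ext:
 assumes "abelian_group M" "abelian_group N" "additive M N f" "additive M N g"
  and "S \<subseteq> carrier M" "!!s. s : S ==> f s = g s" "x : gen M S"
 shows "f x = g x"
 using assms(1,5,7)
 by (induction rule: span_induct)
   (use assms in \<open>auto simp: additive_zero additive_neg additive_add\<close>)

lemma additive_image_span:
 assumes "abelian_group M" "abelian_group N" "additive M N f"
  and "S \<subseteq> carrier M" "U \<subseteq> carrier N" "!!s. s : S ==> f s : gen N U"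
  and "x : gen M S"
 shows "f x : gen N U"
 using assms(1,4,7)
 by (induction rule: span_induct)
   (use assms span_closed[OF assms(2,5)] in \<open>auto simp: additive_zero additive_neg additive_add\<close>)

section \<open>Abelian groups given by generators and relations\<close>

text \<open>The common core of tensor products and tensor algebras: both are a free abelian group
  modulo relations, and only the additive part of the record \<open>T\<close> is fixed here.\<close>

locale presented_group =
 fixes S :: "'s set" and Rel :: "('s \<Rightarrow>\<^sub>0 int) set" and T :: "(('s \<Rightarrow>\<^sub>0 int) set, 'z) ring_scheme"
 assumes Rel_sub: "Rel \<subseteq> carrier (free_Abelian_group S)"
  and T_carrier: "carrier T = carrier (free_Abelian_group S Mod generate (free_Abelian_group S) Rel)"
  and T_zero: "\<zero>\<^sub>T = \<one>\<^bsub>free_Abelian_group S Mod generate (free_Abelian_group S) Rel\<^esub>"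
  and T_add: "add T = mult (free_Abelian_group S Mod generate (free_Abelian_group S) Rel)"
begin

abbreviation "F == free_Abelian_group S"
abbreviation "N == generate F Rel"
abbreviation "cls c == N #>\<^sub>F c"

lemma N_subgroup: "subgroup N F"
 by (rule group.generate_is_subgroup[OF group_free_Abelian_group Rel_sub])

lemma N_normal: "N \<lhd> F"
 using comm_group.normal_iff_subgroup[OF abelian_free_Abelian_group] N_subgroup by blast

lemma T_group: "abelian_group T"
proof -
 interpret Q: comm_group "F Mod N"
  using comm_group.abelian_FactGroup[OF abelian_free_Abelian_group N_subgroup] .
 show ?thesis
 proof (rule abelian_groupI)
  show "\<exists>y\<in>carrier T. y \<oplus>\<^sub>T x = \<zero>\<^sub>T" if "x :. T" for x
   using that Q.l_inv_ex by (simp add: T_carrier T_zero T_add)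
 qed (simp_all only: T_carrier T_zero T_add Q.m_closed Q.one_closed Q.m_assoc Q.l_one, simp_all only: Q.m_comm)
qed

lemma cls_in: "c :. F ==> cls c :. T"
 unfolding T_carrier FactGroup_def RCOSETS_def by auto

lemma T_cases: assumes "X :. T" obtains c where "c :. F" "X = cls c"
 using assms unfolding T_carrier FactGroup_def RCOSETS_def by auto

lemma cls_add: "c :. F ==> d :. F ==> cls (c + d) = cls c \<oplus>\<^sub>T cls d"
 unfolding T_add using normal.rcos_sum[OF N_normal, of c d] by (simp add: FactGroup_def)

lemma cls_zero: "cls 0 = \<zero>\<^sub>T"
 unfolding T_zero using group.coset_join2[OF group_free_Abelian_group _ N_subgroup, of 0]
  subgroup.one_closed[OF N_subgroup] by (simp add: FactGroup_def)

lemma cls_minus: assumes "c :. F" shows "cls (- c) = \<ominus>\<^sub>T cls c"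
proof -
 interpret abelian_group T by (rule T_group)
 have m: "- c :. F" using assms by simp
 have "cls (- c) \<oplus>\<^sub>T cls c = \<zero>\<^sub>T"
  using cls_add[OF m assms] cls_zero by simp
 then show ?thesis using cls_in[OF m] cls_in[OF assms] minus_equality by metis
qed

lemma cls_diff:
 "c :. F ==> d :. F ==> cls (c - d) = cls c \<ominus>\<^sub>T cls d"
 using cls_add[of c "- d"] cls_minus[of d] by (simp add: a_minus_def)

lemma cls_rel: "c : Rel ==> cls c = \<zero>\<^sub>T"
 using group.coset_join2[OF group_free_Abelian_group _ N_subgroup, of c] Rel_sub
  generate.incl[of c Rel F] by (auto simp: T_zero FactGroup_def)

lemma cls_self: "X :. T ==> c : X ==> c :. F \<and> cls c = X"
proof (erule T_cases)
 fix d assume "c : X" "d :. F" "X = cls d"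
 moreover have "c :. F"
  using calculation subgroup.elemrcos_carrier[OF N_subgroup group_free_Abelian_group] by metis
 ultimately show "c :. F \<and> cls c = X"
  using group.repr_independence[OF group_free_Abelian_group _ _ N_subgroup, of c d] by metis
qed

lemma T_nonempty: "X :. T ==> \<exists>c. c : X"
 using T_cases group.rcos_self[OF group_free_Abelian_group _ N_subgroup] by metis

lemma T_span: "carrier T = gen T ((%s. cls (frag_of s)) ` S)"
proof
 interpret abelian_group T by (rule T_group)
 have sub: "(%s. cls (frag_of s)) ` S \<subseteq> carrier T" using cls_in by auto
 note sp = span_closed[OF T_group sub]
 show "gen T ((%s. cls (frag_of s)) ` S) \<subseteq> carrier T" by (rule sp(1))
 show "carrier T \<subseteq> gen T ((%s. cls (frag_of s)) ` S)"
 proof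
  fix X assume "X :. T"
  then obtain c where c: "c :. F" and X: "X = cls c" by (rule T_cases)
  from c have "Poly_Mapping.keys c \<subseteq> S" by simp
  then have "c :. F \<and> cls c : gen T ((%s. cls (frag_of s)) ` S)"
  proof (induction c rule: frag_induction)
   case zero
   then show ?case using sp(2) cls_zero by simp
  next
   case (diff x y)
   then have xy: "x :. F" "y :. F" by simp_all
   then have "cls (x - y) = cls x \<ominus>\<^sub>T cls y" "x - y :. F"
    using cls_diff keys_diff[of x y] by auto
   then show ?case using diff sp(5) by auto
  next
   case (one x)
   then show ?case by (auto intro!: generate.incl)
  qed
  then show "X : gen T ((%s. cls (frag_of s)) ` S)" using X by simp
 qed
qed

text \<open>
 Operations on the quotient are given in the definitions as a union over all representatives, and
 no invariance under the relations has to be checked for them once an additive map on the quotient with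
 the same values on generators is available.
\<close>

lemma cls_extend:
 assumes c: "c :. F"
  and T': "presented_group S' Rel' T'" and \<rho>: "additive T T' \<rho>"
  and g: "!!s. s : S ==> g s :. (free_Abelian_group S')"
  and eq: "!!s. s : S ==>
   generate (free_Abelian_group S') Rel' #>\<^bsub>free_Abelian_group S'\<^esub> g s = \<rho> (cls (frag_of s))"
 shows "frag_extend g c :. (free_Abelian_group S') \<and>
  generate (free_Abelian_group S') Rel' #>\<^bsub>free_Abelian_group S'\<^esub> frag_extend g c = \<rho> (cls c)"
proof -
 interpret T': presented_group S' Rel' T' by fact
 note grp = T_group T'.T_group
 have "Poly_Mapping.keys c \<subseteq> S" using c by simp
 then have "c :. F \<and> frag_extend g c :. T'.F \<and> T'.cls (frag_extend g c) = \<rho> (cls c)"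
 proof (induction c rule: frag_induction)
  case zero
  then show ?case using T'.cls_zero cls_zero additive_zero[OF grp \<rho>] by simp
 next
  case (diff x y)
  then have xy: "x :. F" "y :. F" "x - y :. F"
   "frag_extend g x - frag_extend g y :. T'.F"
   using keys_diff[of x y] keys_diff[of "frag_extend g x" "frag_extend g y"] by auto
  then show ?case
   using diff additive_diff[OF grp \<rho>] cls_in by (simp add: T'.cls_diff cls_diff frag_extend_diff)
 next
  case (one x)
  then show ?case using g eq by auto
 qed
 then show ?thesis by simp
qed

lemma Union_cls_extend:
 assumes X: "X :. T"
  and T': "presented_group S' Rel' T'" and \<rho>: "additive T T' \<rho>"
  and g: "!!s. s : S ==> g s :. (free_Abelian_group S')"
  and eq: "!!s. s : S ==>
   generate (free_Abelian_group S') Rel' #>\<^bsub>free_Abelian_group S'\<^esub> g s = \<rho> (cls (frag_of s))"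
 shows "(\<Union>c\<in>X. generate (free_Abelian_group S') Rel' #>\<^bsub>free_Abelian_group S'\<^esub> frag_extend g c) = \<rho> X"
 using cls_extend[OF _ T' \<rho> g eq] cls_self[OF X] T_nonempty[OF X] by auto

text \<open>The relations are tested against every homomorphism that extends \<open>f\<close>,
  because the one supplied by freeness only exists inside the proof.\<close>

lemma universal:
 assumes P: "abelian_group P" and f: "f ` S \<subseteq> carrier P"
  and r: "!!h c. h : hom F (add_monoid P) ==> (!!s. s : S ==> h (frag_of s) = f s) ==> c : Rel ==>
   h c = \<zero>\<^sub>P"
 shows "\<exists>g. additive T P g \<and> (\<forall>s\<in>S. g (cls (frag_of s)) = f s)"
proof -
 interpret P: abelian_group P by fact
 obtain h where h: "h : hom F (add_monoid P)" "!!x. x : S ==> h (frag_of x) = f x"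
  using comm_group.free_Abelian_group_universal[OF P.a_comm_group, of f S] f by auto
 interpret group_hom F "add_monoid P" h
  using h by (simp add: group_hom_def group_hom_axioms_def P.add.is_group)
 have "N \<subseteq> kernel F (add_monoid P) h"
 proof (rule group.generate_subgroup_incl[OF group_free_Abelian_group])
  show "Rel \<subseteq> kernel F (add_monoid P) h" using r[OF h] Rel_sub by (fastforce simp: kernel_def)
 qed (rule subgroup_kernel)
 then obtain g where g: "g : hom (F Mod N) (add_monoid P)" "!!x. x :. F ==> g (cls x) = h x"
  using FactGroup_universal_kernel[OF N_normal] by metis
 have "additive T P g" using g(1) by (auto simp: additive_def hom_def T_carrier T_add)
 then show ?thesis using g(2) h(2) by force
qed

end

lemma hom_free_Abelian_group_diff:
 assumes "abelian_group P" "h : hom (free_Abelian_group S) (add_monoid P)"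
  and "c :. (free_Abelian_group S)" "d :. (free_Abelian_group S)"
 shows "h (c - d) = h c \<ominus>\<^sub>P h d"
proof -
 interpret P: abelian_group P by fact
 interpret group_hom "free_Abelian_group S" "add_monoid P" h
  using assms by (simp add: group_hom_def group_hom_axioms_def P.add.is_group)
 have "h (c + (- d)) = h c \<oplus>\<^sub>P h (- d)" "h (- d) = \<ominus>\<^sub>P h d"
  using hom_mult[of c "- d"] hom_inv[of d] assms(3,4) by (auto simp: a_inv_def)
 then show ?thesis by (simp add: a_minus_def)
qed

section \<open>Tensor products and extension of scalars\<close>

lemma additive_comp: "additive M N f ==> additive N P g ==> additive M P (%x. g (f x))"
 by (auto simp: additive_def Pi_iff)

lemma additiveI:
 assumes "!!x. x :. M ==> f x :. N"
  and "!!x y. x :. M ==> y :. M ==> f (x \<oplus>\<^sub>M y) = f x \<oplus>\<^sub>N f y"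
 shows "additive M N f"
 using assms by (auto simp: additive_def)

lemma additive_plus:
 assumes "abelian_group N" "additive M N f" "additive M N g"
 shows "additive M N (%x. f x \<oplus>\<^sub>N g x)"
proof -
 interpret abelian_group N by fact
 note c = additive_closed[OF assms(2)] additive_closed[OF assms(3)]
 show ?thesis using assms(2,3) by (auto intro!: additiveI simp: additive_add c a_ac)
qed

locale tensor_modules = M: module R M + N: module R N
 for R :: "('r, 'z) ring_scheme" (structure) and M :: "('r, 'm) module" and N :: "('r, 'n) module"
begin

text \<open>Only the additive structure of \<open>P\<close> enters, so the target may be a module
  over another ring or a bare quotient group.\<close>

definition balanced where
 "balanced P f \<longleftrightarrow> (\<forall>x\<in>carrier M. \<forall>y\<in>carrier N. f x y :. P) \<and>
  (\<forall>x\<in>carrier M. \<forall>x'\<in>carrier M. \<forall>y\<in>carrier N. f (x \<oplus>\<^sub>M x') y = f x y \<oplus>\<^sub>P f x' y) \<and>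
  (\<forall>x\<in>carrier M. \<forall>y\<in>carrier N. \<forall>y'\<in>carrier N. f x (y \<oplus>\<^sub>N y') = f x y \<oplus>\<^sub>P f x y') \<and>
  (\<forall>r\<in>carrier R. \<forall>x\<in>carrier M. \<forall>y\<in>carrier N. f (r \<odot>\<^sub>M x) y = f x (r \<odot>\<^sub>N y))"

lemma balancedI:
 assumes "!!x y. x :. M ==> y :. N ==> f x y :. P"
  "!!x x' y. x :. M ==> x' :. M ==> y :. N ==>
   f (x \<oplus>\<^sub>M x') y = f x y \<oplus>\<^sub>P f x' y"
  "!!x y y'. x :. M ==> y :. N ==> y' :. N ==>
   f x (y \<oplus>\<^sub>N y') = f x y \<oplus>\<^sub>P f x y'"
  "!!r x y. r :. R ==> x :. M ==> y :. N ==>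
   f (r \<odot>\<^sub>M x) y = f x (r \<odot>\<^sub>N y)"
 shows "balanced P f"
 unfolding balanced_def by (intro conjI ballI assms)

abbreviation "T == tensor R M N"
abbreviation "pure == pure_tensor R M N"

lemma relations_sub:
 "tensor_relations R M N \<subseteq> carrier (free_Abelian_group (carrier M \<times> carrier N))"
proof -
 let ?F = "carrier (free_Abelian_group (carrier M \<times> carrier N))"
 have d: "a : ?F ==> b : ?F ==> a - b : ?F" for a b
  using keys_diff[of a b] by auto
 have fr: "x :. M ==> y :. N ==> frag_of (x, y) : ?F" for x y by simp
 show ?thesis unfolding tensor_relations_def
  by (intro Un_least subsetI; elim CollectE exE conjE; simp only:; intro d fr;
    simp add: M.smult_closed N.smult_closed)
qed

lemma relations:
 "x :. M ==> x' :. M ==> y :. N ==>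
  frag_of (x \<oplus>\<^sub>M x', y) - frag_of (x, y) - frag_of (x', y) : tensor_relations R M N"
 "x :. M ==> y :. N ==> y' :. N ==>
  frag_of (x, y \<oplus>\<^sub>N y') - frag_of (x, y) - frag_of (x, y') : tensor_relations R M N"
 "r :. R ==> x :. M ==> y :. N ==>
  frag_of (r \<odot>\<^sub>M x, y) - frag_of (x, r \<odot>\<^sub>N y) : tensor_relations R M N"
 unfolding tensor_relations_def by blast+

sublocale TP: presented_group "carrier M \<times> carrier N" "tensor_relations R M N" T
 using relations_sub by unfold_locales (simp_all add: tensor_def Let_def tensor_kernel_def)

lemma class_eq: "tensor_class R M N c = TP.cls c"
 by (simp add: tensor_class_def tensor_kernel_def)

lemma pure_eq: "pure x y = TP.cls (frag_of (x, y))"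
 by (simp add: pure_tensor_def class_eq)

lemma pure_closed: "x :. M ==> y :. N ==> pure x y :. T"
 by (simp add: pure_eq TP.cls_in)

sublocale TG: abelian_group T by (rule TP.T_group)

lemma pure_balanced: "balanced T pure"
proof -
 have fr: "frag_of (x, y) :. TP.F" if "x :. M" "y :. N" for x y
  using that by simp
 have dc: "a - b :. TP.F" if "a :. TP.F" "b :. TP.F" for a b
  using that keys_diff[of a b] by auto
 have *: "TP.cls a = TP.cls b \<oplus>\<^sub>T TP.cls c"
  if "a - b - c : tensor_relations R M N" "a :. TP.F" "b :. TP.F" "c :. TP.F" for a b c
 proof -
  have *: "(TP.cls a \<ominus>\<^sub>T TP.cls b) \<ominus>\<^sub>T TP.cls c = \<zero>\<^sub>T"
   using TP.cls_rel[OF that(1)] that(2-4) TP.cls_diff dc by (metis (no_types, lifting))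
  note cl = that(2-4)[THEN TP.cls_in]
  from * have "TP.cls a \<ominus>\<^sub>T TP.cls b = TP.cls c"
   using cl TG.diff_zero_iff TG.minus_closed by simp
  then show ?thesis using TG.minus_add_cancel[OF cl(1,2)] TG.a_comm[OF cl(2,3)] by simp
 qed
 have **: "TP.cls a = TP.cls b"
  if "a - b : tensor_relations R M N" "a :. TP.F" "b :. TP.F" for a b
  using TP.cls_rel[OF that(1)] TP.cls_diff[OF that(2,3)] TP.cls_in that(2,3) TG.diff_zero_iff by simp
 show ?thesis
  unfolding pure_eq
  by (rule balancedI; (rule * | rule ** | rule TP.cls_in); (rule relations | rule fr);
    simp add: M.smult_closed N.smult_closed)
qed

lemma pure_add_left: "x :. M ==> x' :. M ==> y :. N ==>
  pure (x \<oplus>\<^sub>M x') y = pure x y \<oplus>\<^sub>T pure x' y"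
 and pure_add_right: "x :. M ==> y :. N ==> y' :. N ==>
  pure x (y \<oplus>\<^sub>N y') = pure x y \<oplus>\<^sub>T pure x y'"
 and pure_smult: "r :. R ==> x :. M ==> y :. N ==>
  pure (r \<odot>\<^sub>M x) y = pure x (r \<odot>\<^sub>N y)"
 using pure_balanced unfolding balanced_def by blast+

lemma tensor_span: "carrier T = gen T {pure x y | x y. x :. M \<and> y :. N}"
proof -
 have "(%s. TP.cls (frag_of s)) ` (carrier M \<times> carrier N) =
  {pure x y | x y. x :. M \<and> y :. N}" by (auto simp: pure_eq)
 then show ?thesis using TP.T_span by simp
qed

lemma tensor_ext:
 assumes "abelian_group P" "additive T P f" "additive T P g"
  and "!!x y. x :. M ==> y :. N ==> f (pure x y) = g (pure x y)"
  and "X :. T"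
 shows "f X = g X"
 by (rule additive_span_ext[OF TP.T_group assms(1-3), of "{pure x y | x y. x :. M \<and> y :. N}"])
   (use assms(4,5) tensor_span pure_closed in auto)

lemma tensor_induct [consumes 1, case_names zero pure neg add]:
 assumes "X :. T" "P \<zero>\<^sub>T" "!!x y. x :. M ==> y :. N ==> P (pure x y)"
  "!!X. X :. T ==> P X ==> P (\<ominus>\<^sub>T X)"
  "!!X Y. X :. T ==> Y :. T ==> P X ==> P Y ==> P (X \<oplus>\<^sub>T Y)"
 shows "P X"
proof -
 have s: "{pure x y | x y. x :. M \<and> y :. N} \<subseteq> carrier T" using pure_closed by auto
 have "X : gen T {pure x y | x y. x :. M \<and> y :. N}"
  using assms(1) tensor_span by simp
 then show ?thesis
  by (rule span_induct[OF TP.T_group s]) (use assms(2-5) in auto)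
qed

lemma tensor_universal:
 assumes P: "abelian_group P" and f: "balanced P f"
 shows "\<exists>h. additive T P h \<and> (\<forall>x\<in>carrier M. \<forall>y\<in>carrier N. h (pure x y) = f x y)"
proof -
 interpret P: abelian_group P by fact
 have fc: "!!x y. x :. M ==> y :. N ==> f x y :. P"
  using f by (auto simp: balanced_def)
 have "\<exists>g. additive T P g \<and> (\<forall>s\<in>carrier M \<times> carrier N. g (TP.cls (frag_of s)) = case_prod f s)"
 proof (rule TP.universal[OF P])
  show "case_prod f ` (carrier M \<times> carrier N) \<subseteq> carrier P" using fc by auto
 next
  fix h c
  assume h: "h : hom TP.F (add_monoid P)" and v: "!!s. s : carrier M \<times> carrier N ==> h (frag_of s) = case_prod f s"
   and c: "c : tensor_relations R M N"
  have v': "h (frag_of (x, y)) = f x y" if "x :. M" "y :. N" for x y using v that by auto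
  have d: "h (a - b) = h a \<ominus>\<^sub>P h b" if "a :. TP.F" "b :. TP.F" for a b
   by (rule hom_free_Abelian_group_diff[OF P h that])
  have dc: "a - b :. TP.F" if "a :. TP.F" "b :. TP.F" for a b
   using that keys_diff[of a b] by auto
  have fr: "frag_of (x, y) :. TP.F" if "x :. M" "y :. N" for x y
   using that by simp
  note [simp del] = carrier_free_Abelian_group_iff
  have e: "(u \<oplus>\<^sub>P v) \<ominus>\<^sub>P u \<ominus>\<^sub>P v = \<zero>\<^sub>P" if "u :. P" "v :. P" for u v
   using that by (simp add: P.ab_simps)
  show "h c = \<zero>\<^sub>P"
   using c unfolding tensor_relations_def
  proof (elim UnE CollectE exE conjE, goal_cases)
   case (1 x x' y)
   then show ?case using f fc by (simp add: d dc fr v' e balanced_def)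
  next
   case (2 x y y')
   then show ?case using f fc by (simp add: d dc fr v' e balanced_def)
  next
   case (3 r x y)
   then show ?case using f fc by (simp add: d dc fr v' P.diff_zero_iff balanced_def)
  qed
 qed
 then show ?thesis by (auto simp: pure_eq)
qed

text \<open>\<open>tensor_universal\<close> supplies a candidate, which is restricted to the carrier
  to meet the extensionality in the definite description; it is unique because pure tensors
  span.\<close>

lemma tensor_lift:
 assumes P: "abelian_group P" and f: "balanced P f"
 shows tensor_lift_additive: "additive T P (tensor_lift R M N P f)"
  and tensor_lift_extensional: "tensor_lift R M N P f : extensional (carrier T)"
  and tensor_lift_pure: "!!x y. x :. M ==> y :. N ==> tensor_lift R M N P f (pure x y) = f x y"
proof -
 obtain h where h: "additive T P h" "!!x y. x :. M ==> y :. N ==> h (pure x y) = f x y"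
  using tensor_universal[OF P f] by blast
 let ?Q = "%h. h : extensional (carrier T) \<and> h : hom (add_monoid T) (add_monoid P) \<and>
       (\<forall>x\<in>carrier M. \<forall>y\<in>carrier N. h (pure x y) = f x y)"
 have "additive T P (restrict h (carrier T))" using h(1) by (auto simp: additive_def)
 then have "?Q (restrict h (carrier T))" using h(2) pure_closed
  by (auto simp: additive_iff_hom)
 moreover have "g = restrict h (carrier T)" if "?Q g" for g
 proof (rule ext)
  fix X show "g X = restrict h (carrier T) X"
   using that tensor_ext[OF P, of g h X] h by (cases "X :. T")
    (auto simp: additive_iff_hom extensional_def)
 qed
 ultimately have "?Q (tensor_lift R M N P f)"
  unfolding tensor_lift_def by (rule theI)
 then show "additive T P (tensor_lift R M N P f)"
  "tensor_lift R M N P f : extensional (carrier T)"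
  "!!x y. x :. M ==> y :. N ==> tensor_lift R M N P f (pure x y) = f x y"
  by (auto simp: additive_iff_hom)
qed

lemma tensor_smult_additive:
 assumes r: "r :. R"
 shows "additive T T (smult T r)"
  and "!!x y. x :. M ==> y :. N ==> r \<odot>\<^sub>T pure x y = pure (r \<odot>\<^sub>M x) y"
proof -
 have "balanced T (%x y. pure (r \<odot>\<^sub>M x) y)"
  using r by (intro balancedI) (auto simp: pure_closed M.smult_r_distr pure_add_left pure_add_right
    pure_smult M.smult_assoc1[symmetric] N.smult_assoc1[symmetric] M.R.m_comm)
 from tensor_universal[OF TP.T_group this] obtain h where h: "additive T T h" "!!x y. x :. M ==> y :. N ==> h (pure x y) = pure (r \<odot>\<^sub>M x) y"
  by blast
 have eq: "r \<odot>\<^sub>T X = h X" if "X :. T" for X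
 proof -
  have "r \<odot>\<^sub>T X = (\<Union>c\<in>X. TP.cls (frag_extend (%(x, y). frag_of (r \<odot>\<^sub>M x, y)) c))"
   by (simp add: tensor_def Let_def class_eq)
  also have "\<dots> = h X"
   by (rule TP.Union_cls_extend[OF that TP.presented_group_axioms h(1)])
     (use r h(2) in \<open>auto simp: pure_eq\<close>)
  finally show ?thesis .
 qed
 show "additive T T (smult T r)"
  using h(1) by (auto simp: additive_def eq)
 show "r \<odot>\<^sub>T pure x y = pure (r \<odot>\<^sub>M x) y" if "x :. M" "y :. N" for x y
  using that h(2) eq pure_closed by simp
qed

lemma tensor_module: "module R T"
proof (rule moduleI)
 note sm = tensor_smult_additive
 note cl = additive_closed[OF sm(1)]
 show "cring R" by (rule M.R.is_cring)
 show "abelian_group T" by (rule TP.T_group)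
 fix a X assume a: "a :. R" and X: "X :. T"
 show "a \<odot>\<^sub>T X :. T" using cl a X by blast
 fix Y assume "Y :. T"
 then show "a \<odot>\<^sub>T (X \<oplus>\<^sub>T Y) = a \<odot>\<^sub>T X \<oplus>\<^sub>T a \<odot>\<^sub>T Y"
  using additive_add[OF sm(1)] a X by blast
next
 note sm = tensor_smult_additive
 fix a b X assume a: "a :. R" and b: "b :. R" and X: "X :. T"
 show "(a \<oplus> b) \<odot>\<^sub>T X = a \<odot>\<^sub>T X \<oplus>\<^sub>T b \<odot>\<^sub>T X"
  by (rule tensor_ext[OF TP.T_group sm(1) additive_plus[OF TP.T_group sm(1) sm(1)] _ X])
    (use a b in \<open>auto simp: sm(2) M.smult_l_distr pure_add_left\<close>)
 show "(a \<otimes> b) \<odot>\<^sub>T X = a \<odot>\<^sub>T (b \<odot>\<^sub>T X)"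
  by (rule tensor_ext[OF TP.T_group sm(1) additive_comp[OF sm(1) sm(1)] _ X])
    (use a b in \<open>auto simp: sm(2) M.smult_assoc1\<close>)
next
 note sm = tensor_smult_additive
 fix X assume X: "X :. T"
 have id: "additive T T (%x. x)" by (auto intro: additiveI)
 show "\<one> \<odot>\<^sub>T X = X"
  by (rule tensor_ext[OF TP.T_group sm(1) id _ X]) (auto simp: sm(2))
qed

lemma tensor_lift_lin:
 assumes P: "module R P" and f: "balanced P f"
  and h: "!!r x y. r :. R ==> x :. M ==> y :. N ==>
   f (r \<odot>\<^sub>M x) y = r \<odot>\<^sub>P f x y"
 shows "tensor_lift R M N P f : linear_maps R T P"
proof -
 interpret P: module R P by fact
 note Pg = P.abelian_group_axioms
 note tl = tensor_lift[OF Pg f]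
 have "tensor_lift R M N P f (r \<odot>\<^sub>T X) = r \<odot>\<^sub>P tensor_lift R M N P f X"
  if r: "r :. R" and X: "X :. T" for r X
  using tensor_ext[OF Pg additive_comp[OF tensor_smult_additive(1)[OF r] tl(1)] additive_comp[OF tl(1), of P "%x. r \<odot>\<^sub>P x"] _ X]
   r tl(3) h by (auto simp: tensor_smult_additive(2) intro!: additiveI P.smult_r_distr)
 then show ?thesis using tl(1,2) by (auto simp: maps_iff lin_def)
qed

end

locale scalar_extension = tensor_modules R M S + S: algebra R S
 for R :: "('r, 'z) ring_scheme" (structure) and M :: "('r, 'm) module" and S :: "('r, 's) module"
begin

abbreviation "BC == base_change R M S"

lemma bc_simps: "carrier BC = carrier T" "\<zero>\<^sub>BC = \<zero>\<^sub>T" "add BC = add T"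
 by (simp_all add: base_change_def)

lemma bc_group: "abelian_group BC"
proof (rule abelian_groupI)
 show "\<exists>y\<in>carrier BC. y \<oplus>\<^sub>BC x = \<zero>\<^sub>BC" if "x :. BC" for x
  using that TG.l_neg[of x] TG.a_inv_closed[of x] by (auto simp: bc_simps)
qed (simp_all add: bc_simps TG.a_ac)

lemma additive_bc: "additive BC P f \<longleftrightarrow> additive T P f" "additive P' BC g \<longleftrightarrow> additive P' T g"
 by (simp_all add: additive_def bc_simps)

lemma bc_pure_closed: "x :. M ==> s :. S ==> pure x s :. BC"
 by (simp add: bc_simps pure_closed)

lemma bc_pure_add:
 "x :. M ==> x' :. M ==> y :. S ==> pure (x \<oplus>\<^sub>M x') y = pure x y \<oplus>\<^sub>BC pure x' y"
 "x :. M ==> y :. S ==> y' :. S ==> pure x (y \<oplus>\<^sub>S y') = pure x y \<oplus>\<^sub>BC pure x y'"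
 by (simp_all add: bc_simps pure_add_left pure_add_right)

lemma bc_ext:
 assumes "abelian_group P" "additive BC P f" "additive BC P g"
  and "!!x y. x :. M ==> y :. S ==> f (pure x y) = g (pure x y)"
  and "X :. BC"
 shows "f X = g X"
 using tensor_ext[OF assms(1), of f g X] assms(2-) by (simp add: bc_simps additive_bc)

lemma bc_lift:
 assumes "abelian_group P" "balanced P f"
 shows "additive BC P (tensor_lift R M S P f)"
  "tensor_lift R M S P f : extensional (carrier BC)"
  "!!x y. x :. M ==> y :. S ==> tensor_lift R M S P f (pure x y) = f x y"
 using tensor_lift[OF assms] by (simp_all add: bc_simps additive_bc)

lemma S_smult2: "r :. R ==> s :. S ==> t :. S ==> s \<otimes>\<^sub>S (r \<odot>\<^sub>S t) = r \<odot>\<^sub>S (s \<otimes>\<^sub>S t)"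
 using S.smult_assoc2[of r t s] by (simp add: S.m_comm)

lemma bc_smult:
 assumes s: "s :. S"
 shows "additive BC BC (smult BC s)"
  and "!!x t. x :. M ==> t :. S ==> s \<odot>\<^sub>BC pure x t = pure x (s \<otimes>\<^sub>S t)"
proof -
 have "balanced T (%x y. pure x (s \<otimes>\<^sub>S y))"
  using s by (intro balancedI) (auto simp: pure_closed S.r_distr pure_add_left pure_add_right
    pure_smult S_smult2)
 from tensor_universal[OF TP.T_group this] obtain h where h: "additive T T h" "!!x y. x :. M ==> y :. S ==> h (pure x y) = pure x (s \<otimes>\<^sub>S y)"
  by blast
 have eq: "s \<odot>\<^sub>BC X = h X" if "X :. T" for X
 proof -
  have "s \<odot>\<^sub>BC X = (\<Union>c\<in>X. TP.cls (frag_extend (%(x, t). frag_of (x, s \<otimes>\<^sub>S t)) c))"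
   by (simp add: base_change_def class_eq)
  also have "\<dots> = h X"
   by (rule TP.Union_cls_extend[OF that TP.presented_group_axioms h(1)])
     (use s h(2) in \<open>auto simp: pure_eq\<close>)
  finally show ?thesis .
 qed
 show "additive BC BC (smult BC s)"
  using h(1) by (auto simp: additive_def eq bc_simps)
 show "s \<odot>\<^sub>BC pure x t = pure x (s \<otimes>\<^sub>S t)" if "x :. M" "t :. S" for x t
  using that h(2) eq pure_closed by simp
qed

lemma bc_module: "module S BC"
proof (rule moduleI)
 show "cring S" by (rule S.M_cring)
 show "abelian_group BC" by (rule bc_group)
next
 note sm = bc_smult
 fix a X assume a: "a :. S" and X: "X :. BC"
 show "a \<odot>\<^sub>BC X :. BC" by (rule additive_closed[OF sm(1)[OF a] X])
 fix Y assume "Y :. BC"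
 then show "a \<odot>\<^sub>BC (X \<oplus>\<^sub>BC Y) = a \<odot>\<^sub>BC X \<oplus>\<^sub>BC a \<odot>\<^sub>BC Y"
  using additive_add[OF sm(1)] a X by blast
next
 note sm = bc_smult
 fix a b X assume a: "a :. S" and b: "b :. S" and X: "X :. BC"
 show "(a \<oplus>\<^sub>S b) \<odot>\<^sub>BC X = a \<odot>\<^sub>BC X \<oplus>\<^sub>BC b \<odot>\<^sub>BC X"
  by (rule bc_ext[OF bc_group sm(1) additive_plus[OF bc_group sm(1) sm(1)] _ X])
    (use a b in \<open>auto simp: sm(2) S.l_distr bc_pure_add\<close>)
 show "(a \<otimes>\<^sub>S b) \<odot>\<^sub>BC X = a \<odot>\<^sub>BC (b \<odot>\<^sub>BC X)"
  by (rule bc_ext[OF bc_group sm(1) additive_comp[OF sm(1) sm(1)] _ X])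
    (use a b in \<open>auto simp: sm(2) S.m_assoc\<close>)
next
 note sm = bc_smult
 fix X assume X: "X :. BC"
 have id: "additive BC BC (%x. x)" by (auto intro: additiveI)
 show "\<one>\<^sub>S \<odot>\<^sub>BC X = X"
  by (rule bc_ext[OF bc_group sm(1) id _ X]) (auto simp: sm(2))
qed

lemma bc_lift_lin:
 assumes P: "module S P" and f: "balanced P f"
  and h: "!!s x t. s :. S ==> x :. M ==> t :. S ==>
   f x (s \<otimes>\<^sub>S t) = s \<odot>\<^sub>P f x t"
 shows "tensor_lift R M S P f : linear_maps S BC P"
proof -
 interpret P: module S P by fact
 note Pg = P.abelian_group_axioms
 note tl = bc_lift[OF Pg f]
 have "tensor_lift R M S P f (r \<odot>\<^sub>BC X) = r \<odot>\<^sub>P tensor_lift R M S P f X"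
  if r: "r :. S" and X: "X :. BC" for r X
  using bc_ext[OF Pg additive_comp[OF bc_smult(1)[OF r] tl(1)] additive_comp[OF tl(1), of P "%x. r \<odot>\<^sub>P x"] _ X]
   r tl(3) h by (auto simp: bc_smult(2) intro!: additiveI P.smult_r_distr)
 then show ?thesis using tl(1,2) by (auto simp: maps_iff lin_def)
qed

lemma pure_one: "x :. M ==> s :. S ==> pure x s = s \<odot>\<^sub>BC pure x \<one>\<^sub>S"
 by (simp add: bc_smult(2))

lemma bc_lin_ext:
 assumes P: "module S P" and f: "lin S BC P f" and g: "lin S BC P g"
  and eq: "!!x. x :. M ==> f (pure x \<one>\<^sub>S) = g (pure x \<one>\<^sub>S)"
  and "X :. BC"
 shows "f X = g X"
proof (rule bc_ext[OF mod_group[OF P] lin_additive[OF f] lin_additive[OF g] _ assms(5)])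
 fix x y assume x: "x :. M" and y: "y :. S"
 show "f (pure x y) = g (pure x y)"
  unfolding pure_one[OF x y] using y eq[OF x] bc_pure_closed[OF x S.one_closed]
  by (simp add: lin_smult[OF f] lin_smult[OF g])
qed

end

locale algebra_extension = nonunital_algebra R M + scalar_extension R M S
 for R :: "('r, 'z) ring_scheme" (structure) and M :: "('r, 'm) module" and S :: "('r, 's) module"
begin

lemma bc_mult:
 shows bc_mult_left: "Y :. BC ==> additive BC BC (%X. X \<otimes>\<^sub>BC Y)"
  and bc_mult_right: "X :. BC ==> additive BC BC (%Y. X \<otimes>\<^sub>BC Y)"
  and bc_mult_pure: "!!x s y t. x :. M ==> s :. S ==> y :. M ==> t :. S ==>
   pure x s \<otimes>\<^sub>BC pure y t = pure (x \<otimes>\<^sub>M y) (s \<otimes>\<^sub>S t)"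
proof -
 \<comment> \<open>Left multiplication by the pure tensor of \<open>x\<close> and \<open>s\<close>.
   Lifting it in the pair \<open>(x, s)\<close> for fixed \<open>Y\<close> gives
   \<open>\<mu> Y\<close>, which is right multiplication by \<open>Y\<close>.\<close>
 define l where "l x s = tensor_lift R M S T (%y t. pure (x \<otimes>\<^sub>M y) (s \<otimes>\<^sub>S t))" for x s
 have b: "balanced T (%y t. pure (x \<otimes>\<^sub>M y) (s \<otimes>\<^sub>S t))" if "x :. M" "s :. S" for x s
  using that by (intro balancedI) (auto simp: pure_closed mult_closed mult_add_right mult_smult_right S.r_distr
    pure_add_left pure_add_right pure_smult S_smult2)
 note l = tensor_lift[OF TP.T_group b, folded l_def]
 have lc: "l x s Y :. T" if "x :. M" "s :. S" "Y :. T" for x s Y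
  by (rule additive_closed[OF l(1)[OF that(1,2)] that(3)])
 have b2: "balanced T (%x s. l x s Y)" if Y: "Y :. T" for Y
 proof (rule balancedI)
  fix x s assume x: "x :. M" and s: "s :. S"
  show "l x s Y :. T" using lc x s Y by simp
  {
   fix x' assume x': "x' :. M"
   show "l (x \<oplus>\<^sub>M x') s Y = l x s Y \<oplus>\<^sub>T l x' s Y"
    by (rule tensor_ext[OF TP.T_group l(1) additive_plus[OF TP.T_group l(1) l(1)] _ Y])
      (use x x' s in \<open>auto simp: l(3) mult_add_left pure_add_left mult_closed\<close>)
  next
   fix s' assume s': "s' :. S"
   show "l x (s \<oplus>\<^sub>S s') Y = l x s Y \<oplus>\<^sub>T l x s' Y"
    by (rule tensor_ext[OF TP.T_group l(1) additive_plus[OF TP.T_group l(1) l(1)] _ Y])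
      (use x s' s in \<open>auto simp: l(3) S.l_distr pure_add_right mult_closed\<close>)
  next
   fix r assume r: "r :. R"
   show "l (r \<odot>\<^sub>M x) s Y = l x (r \<odot>\<^sub>S s) Y"
    by (rule tensor_ext[OF TP.T_group l(1) l(1) _ Y])
      (use x r s in \<open>auto simp: l(3) mult_smult_left S.smult_assoc2 mult_closed pure_smult\<close>)
  }
 qed
 define \<mu> where "\<mu> Y = tensor_lift R M S T (%x s. l x s Y)" for Y
 note m = tensor_lift[OF TP.T_group b2, folded \<mu>_def]
 have mr: "additive T T (%Y. \<mu> Y X)" if X: "X :. T" for X
 proof (rule additiveI)
  fix Y assume Y: "Y :. T"
  show "\<mu> Y X :. T" by (rule additive_closed[OF m(1)[OF Y] X])
  fix Z assume Z: "Z :. T"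
  show "\<mu> (Y \<oplus>\<^sub>T Z) X = \<mu> Y X \<oplus>\<^sub>T \<mu> Z X"
   by (rule tensor_ext[OF TP.T_group m(1) additive_plus[OF TP.T_group m(1) m(1)] _ X])
     (use Y Z in \<open>auto simp: m(3) additive_add[OF l(1)]\<close>)
 qed
 have eq: "X \<otimes>\<^sub>BC Y = \<mu> Y X" if X: "X :. T" and Y: "Y :. T" for X Y
 proof -
  let ?g = "%c' (x, s). frag_extend (%(y, t). frag_of (x \<otimes>\<^sub>M y, s \<otimes>\<^sub>S t)) c'"
  have 1: "?g c' z :. TP.F \<and> TP.cls (?g c' z) = \<mu> Y (TP.cls (frag_of z))"
   if z: "z : carrier M \<times> carrier S" and c': "c' : Y" for z c'
  proof -
   obtain x s where zz: "z = (x, s)" and x: "x :. M" and s: "s :. S"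
    using z by auto
   have "?g c' (x, s) :. TP.F \<and> TP.cls (?g c' (x, s)) = l x s (TP.cls c')"
    unfolding prod.case
    by (rule TP.cls_extend[OF _ TP.presented_group_axioms l(1)[OF x s]])
      (use TP.cls_self[OF Y c'] x s l(3)[OF x s] in \<open>auto simp: mult_closed pure_eq\<close>)
   moreover have "TP.cls c' = Y" using TP.cls_self[OF Y c'] by simp
   moreover have "\<mu> Y (TP.cls (frag_of z)) = l x s Y"
    using m(3)[OF Y x s] zz by (simp add: pure_eq)
   ultimately show ?thesis using zz by simp
  qed
  have 2: "(\<Union>c\<in>X. TP.cls (frag_extend (?g c') c)) = \<mu> Y X" if c': "c' : Y" for c'
   by (rule TP.Union_cls_extend[OF X TP.presented_group_axioms m(1)[OF Y]]) (use 1 c' in auto)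
  have "X \<otimes>\<^sub>BC Y = (\<Union>c\<in>X. \<Union>c'\<in>Y. TP.cls (frag_extend (?g c') c))"
   by (simp add: base_change_def class_eq)
  \<comment> \<open>Once the representative \<open>c'\<close> of \<open>Y\<close> is fixed, the
    union over \<open>X\<close> comes from a single additive map and collapses by
    \<open>2\<close>.\<close>
  also have "\<dots> = (\<Union>c'\<in>Y. \<Union>c\<in>X. TP.cls (frag_extend (?g c') c))" by blast
  also have "\<dots> = \<mu> Y X" using 2 TP.T_nonempty[OF Y] by auto
  finally show ?thesis .
 qed
 show "additive BC BC (%X. X \<otimes>\<^sub>BC Y)" if "Y :. BC"
  using m(1)[of Y] that by (auto simp: additive_def bc_simps eq)
 show "additive BC BC (%Y. X \<otimes>\<^sub>BC Y)" if "X :. BC"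
  using mr[of X] that by (auto simp: additive_def bc_simps eq)
 show "pure x s \<otimes>\<^sub>BC pure y t = pure (x \<otimes>\<^sub>M y) (s \<otimes>\<^sub>S t)"
  if "x :. M" "s :. S" "y :. M" "t :. S" for x s y t
  using that by (simp add: eq pure_closed m(3) l(3))
qed

text \<open>Both sides of each law are additive in every argument, so the arguments are reduced to
  pure tensors one after another.\<close>

lemma bc_algebra: "nonunital_algebra S BC"
proof -
 interpret BCm: module S BC by (rule bc_module)
 note cl = additive_closed[OF bc_mult_left]
 note sm = bc_smult
 show ?thesis
 proof (unfold_locales)
  fix X Y assume X: "X :. BC" and Y: "Y :. BC"
  show "X \<otimes>\<^sub>BC Y :. BC" by (rule cl[OF Y X])
  {
   fix Z assume Z: "Z :. BC"
   show "(X \<oplus>\<^sub>BC Y) \<otimes>\<^sub>BC Z = X \<otimes>\<^sub>BC Z \<oplus>\<^sub>BC Y \<otimes>\<^sub>BC Z"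
    by (rule additive_add[OF bc_mult_left[OF Z] X Y])
   show "X \<otimes>\<^sub>BC (Y \<oplus>\<^sub>BC Z) = X \<otimes>\<^sub>BC Y \<oplus>\<^sub>BC X \<otimes>\<^sub>BC Z"
    by (rule additive_add[OF bc_mult_right[OF X] Y Z])
   have 1: "(pure x s \<otimes>\<^sub>BC pure y t) \<otimes>\<^sub>BC Z = pure x s \<otimes>\<^sub>BC (pure y t \<otimes>\<^sub>BC Z)"
    if "x :. M" "s :. S" "y :. M" "t :. S" for x s y t
    by (rule bc_ext[OF bc_group bc_mult_right additive_comp[OF bc_mult_right bc_mult_right] _ Z])
      (use that in \<open>auto simp: bc_mult_pure mult_closed mult_assoc S.m_assoc bc_pure_closed cl\<close>)
   have 2: "(pure x s \<otimes>\<^sub>BC Y) \<otimes>\<^sub>BC Z = pure x s \<otimes>\<^sub>BC (Y \<otimes>\<^sub>BC Z)"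
    if "x :. M" "s :. S" for x s
    by (rule bc_ext[OF bc_group additive_comp[OF bc_mult_right bc_mult_left] additive_comp[OF bc_mult_left bc_mult_right] _ Y])
      (use that 1 Z in \<open>auto simp: bc_pure_closed\<close>)
   show "(X \<otimes>\<^sub>BC Y) \<otimes>\<^sub>BC Z = X \<otimes>\<^sub>BC (Y \<otimes>\<^sub>BC Z)"
    by (rule bc_ext[OF bc_group additive_comp[OF bc_mult_left bc_mult_left] bc_mult_left _ X])
      (use 2 Y Z cl in auto)
  next
   fix r assume r: "r :. S"
   have 1: "(r \<odot>\<^sub>BC pure x s) \<otimes>\<^sub>BC Y = r \<odot>\<^sub>BC (pure x s \<otimes>\<^sub>BC Y)"
    if "x :. M" "s :. S" for x s
    by (rule bc_ext[OF bc_group bc_mult_right additive_comp[OF bc_mult_right sm(1)] _ Y])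
      (use that r in \<open>auto simp: bc_mult_pure sm(2) mult_closed S.m_assoc bc_pure_closed\<close>)
   show "(r \<odot>\<^sub>BC X) \<otimes>\<^sub>BC Y = r \<odot>\<^sub>BC (X \<otimes>\<^sub>BC Y)"
    by (rule bc_ext[OF bc_group additive_comp[OF sm(1) bc_mult_left] additive_comp[OF bc_mult_left sm(1)] _ X])
      (use 1 r Y in auto)
   have 1: "pure x s \<otimes>\<^sub>BC (r \<odot>\<^sub>BC Y) = r \<odot>\<^sub>BC (pure x s \<otimes>\<^sub>BC Y)"
    if "x :. M" "s :. S" for x s
    by (rule bc_ext[OF bc_group additive_comp[OF sm(1) bc_mult_right] additive_comp[OF bc_mult_right sm(1)] _ Y])
      (use that r in \<open>auto simp: bc_mult_pure sm(2) mult_closed S.m_lcomm bc_pure_closed\<close>)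
   show "X \<otimes>\<^sub>BC (r \<odot>\<^sub>BC Y) = r \<odot>\<^sub>BC (X \<otimes>\<^sub>BC Y)"
    by (rule bc_ext[OF bc_group bc_mult_left additive_comp[OF bc_mult_left sm(1)] _ X])
      (use 1 r Y in auto)
  }
 qed
qed

end

section \<open>Tensor algebras\<close>

text \<open>Nothing is required of the empty word, which is not a word of the non-unitary tensor
  algebra.\<close>

definition multilin ::
 "('r, 'z) ring_scheme => ('r, 'm) module => ('r, 'n) module => ('m list => 'n) => bool" where
 "multilin R M P g \<longleftrightarrow> (\<forall>xs ys. set xs \<subseteq> carrier M --> set ys \<subseteq> carrier M -->
   lin R M P (%x. g (xs @ x # ys)))"

lemma multilinD:
 "multilin R M P g ==> set xs \<subseteq> carrier M ==> set ys \<subseteq> carrier M ==> lin R M P (%x. g (xs @ x # ys))"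
 by (simp add: multilin_def)

lemma multilin_closed: "multilin R M P g ==> w : nonempty_words (carrier M) ==> g w :. P"
 using lin_closed[OF multilinD[of R M P g "[]" "tl w"], of "hd w"]
 by (cases w) (auto simp: words_def)

locale tensor_alg = module R M for R :: "('r, 'z) ring_scheme" (structure) and M :: "('r, 'm) module"
begin

abbreviation "TA == tensor_algebra R M"
abbreviation "tw == tensor_word R M"
abbreviation "Wd == nonempty_words (carrier M)"

text \<open>The counterpart of the two kinds of word relations: scalars slide between neighbouring
  letters, so that the notion makes sense for a target that is only an abelian group.\<close>

definition word_balanced where
 "word_balanced P g \<longleftrightarrow> (\<forall>xs\<in>Wd. g xs :. P) \<and>
  (\<forall>xs x y ys. set xs \<subseteq> carrier M --> x :. M --> y :. M --> set ys \<subseteq> carrier M -->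
   g (xs @ (x \<oplus>\<^sub>M y) # ys) = g (xs @ x # ys) \<oplus>\<^sub>P g (xs @ y # ys)) \<and>
  (\<forall>xs r x y ys. r :. R --> set xs \<subseteq> carrier M --> x :. M --> y :. M -->
   set ys \<subseteq> carrier M --> g (xs @ (r \<odot>\<^sub>M x) # y # ys) = g (xs @ x # (r \<odot>\<^sub>M y) # ys))"

lemma multilin_balanced:
 assumes "multilin R M P g" shows "word_balanced P g"
 unfolding word_balanced_def
proof (intro conjI ballI allI impI)
 fix xs assume "xs : Wd"
 then show "g xs :. P" by (rule multilin_closed[OF assms])
next
 fix xs x y ys assume "set xs \<subseteq> carrier M" "x :. M" "y :. M" "set ys \<subseteq> carrier M"
 then show "g (xs @ (x \<oplus>\<^sub>M y) # ys) = g (xs @ x # ys) \<oplus>\<^sub>P g (xs @ y # ys)"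
  using lin_add[OF multilinD[OF assms]] by simp
next
 fix xs r x y ys assume *: "r :. R" "set xs \<subseteq> carrier M" "x :. M" "y :. M" "set ys \<subseteq> carrier M"
 have "g (xs @ (r \<odot>\<^sub>M x) # y # ys) = r \<odot>\<^sub>P g (xs @ x # y # ys)"
  using lin_smult[OF multilinD[OF assms, of xs "y # ys"]] * by simp
 moreover have "g ((xs @ [x]) @ (r \<odot>\<^sub>M y) # ys) = r \<odot>\<^sub>P g ((xs @ [x]) @ y # ys)"
  using lin_smult[OF multilinD[OF assms, of "xs @ [x]" ys]] * by simp
 ultimately show "g (xs @ (r \<odot>\<^sub>M x) # y # ys) = g (xs @ x # (r \<odot>\<^sub>M y) # ys)" by simp
qed

lemma word_relations_sub: "word_relations R M \<subseteq> carrier (free_Abelian_group Wd)"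
proof -
 let ?F = "carrier (free_Abelian_group Wd)"
 have d: "a : ?F ==> b : ?F ==> a - b : ?F" for a b
  using keys_diff[of a b] by auto
 have fr: "xs : Wd ==> frag_of xs : ?F" for xs by simp
 show ?thesis unfolding word_relations_def
  by (intro Un_least subsetI; elim CollectE exE conjE; simp only:; intro d fr;
    simp add: words_def)
qed

lemma word_relations:
 "set xs \<subseteq> carrier M ==> x :. M ==> y :. M ==> set ys \<subseteq> carrier M ==>
  frag_of (xs @ (x \<oplus>\<^sub>M y) # ys) - frag_of (xs @ x # ys) - frag_of (xs @ y # ys) : word_relations R M"
 "r :. R ==> set xs \<subseteq> carrier M ==> x :. M ==> y :. M ==> set ys \<subseteq> carrier M ==>
  frag_of (xs @ (r \<odot>\<^sub>M x) # y # ys) - frag_of (xs @ x # (r \<odot>\<^sub>M y) # ys) : word_relations R M"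
 unfolding word_relations_def by blast+

sublocale WP: presented_group Wd "word_relations R M" TA
 using word_relations_sub by unfold_locales (simp_all add: tensor_algebra_def Let_def word_kernel_def)

sublocale WG: abelian_group TA by (rule WP.T_group)

lemma class_eq: "word_class R M c = WP.cls c"
 by (simp add: word_class_def word_kernel_def)

lemma tw_eq: "tw xs = WP.cls (frag_of xs)"
 by (simp add: tensor_word_def class_eq)

lemma tw_closed: "xs : Wd ==> tw xs :. TA"
 by (simp add: tw_eq WP.cls_in)

lemma tw_balanced: "word_balanced TA tw"
proof -
 have fr: "xs : Wd ==> frag_of xs :. WP.F" for xs by simp
 have dc: "a - b :. WP.F" if "a :. WP.F" "b :. WP.F" for a b
  using that keys_diff[of a b] by auto
 have *: "WP.cls a = WP.cls b \<oplus>\<^sub>TA WP.cls c"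
  if "a - b - c : word_relations R M" "a :. WP.F" "b :. WP.F" "c :. WP.F" for a b c
 proof -
  have *: "(WP.cls a \<ominus>\<^sub>TA WP.cls b) \<ominus>\<^sub>TA WP.cls c = \<zero>\<^sub>TA"
   using WP.cls_rel[OF that(1)] that(2-4) WP.cls_diff dc by (metis (no_types, lifting))
  note cl = that(2-4)[THEN WP.cls_in]
  from * have "WP.cls a \<ominus>\<^sub>TA WP.cls b = WP.cls c"
   using cl WG.diff_zero_iff WG.minus_closed by simp
  then show ?thesis using WG.minus_add_cancel[OF cl(1,2)] WG.a_comm[OF cl(2,3)] by simp
 qed
 have **: "WP.cls a = WP.cls b"
  if "a - b : word_relations R M" "a :. WP.F" "b :. WP.F" for a b
  using WP.cls_rel[OF that(1)] WP.cls_diff[OF that(2,3)] WP.cls_in that(2,3) WG.diff_zero_iff by simp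
 show ?thesis
  unfolding tw_eq word_balanced_def
  by (intro conjI ballI allI impI; (rule * | rule ** | rule WP.cls_in); (rule word_relations | rule fr);
    simp add: words_def)
qed

lemma tw_add: "set xs \<subseteq> carrier M ==> x :. M ==> y :. M ==> set ys \<subseteq> carrier M ==>
   tw (xs @ (x \<oplus>\<^sub>M y) # ys) = tw (xs @ x # ys) \<oplus>\<^sub>TA tw (xs @ y # ys)"
 and tw_smult: "r :. R ==> set xs \<subseteq> carrier M ==> x :. M ==> y :. M ==>
   set ys \<subseteq> carrier M ==> tw (xs @ (r \<odot>\<^sub>M x) # y # ys) = tw (xs @ x # (r \<odot>\<^sub>M y) # ys)"
 using tw_balanced unfolding word_balanced_def by simp_all

lemma TA_span: "carrier TA = gen TA (tw ` Wd)"
 using WP.T_span by (simp add: tw_eq image_def)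

lemma TA_ext:
 assumes "abelian_group P" "additive TA P f" "additive TA P g"
  and "!!w. w : Wd ==> f (tw w) = g (tw w)" and "X :. TA"
 shows "f X = g X"
 by (rule additive_span_ext[OF WP.T_group assms(1-3), of "tw ` Wd"])
   (use assms(4,5) TA_span tw_closed in auto)

lemma TA_universal:
 assumes P: "abelian_group P" and f: "word_balanced P f"
 shows "\<exists>h. additive TA P h \<and> (\<forall>w\<in>Wd. h (tw w) = f w)"
proof -
 interpret P: abelian_group P by fact
 have fc: "!!w. w : Wd ==> f w :. P"
  using f by (auto simp: word_balanced_def)
 have "\<exists>g. additive TA P g \<and> (\<forall>s\<in>Wd. g (WP.cls (frag_of s)) = f s)"
 proof (rule WP.universal[OF P])
  show "f ` Wd \<subseteq> carrier P" using fc by auto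
 next
  fix h c
  assume h: "h : hom WP.F (add_monoid P)" and v: "!!s. s : Wd ==> h (frag_of s) = f s"
   and c: "c : word_relations R M"
  have d: "h (a - b) = h a \<ominus>\<^sub>P h b" if "a :. WP.F" "b :. WP.F" for a b
   by (rule hom_free_Abelian_group_diff[OF P h that])
  have dc: "a - b :. WP.F" if "a :. WP.F" "b :. WP.F" for a b
   using that keys_diff[of a b] by auto
  have fr: "w : Wd ==> frag_of w :. WP.F" for w by simp
  have W: "set xs \<subseteq> carrier M ==> x :. M ==> set ys \<subseteq> carrier M ==> xs @ x # ys : Wd" for xs x ys
   by (simp add: words_def)
  have W2: "set xs \<subseteq> carrier M ==> x :. M ==> y :. M ==> set ys \<subseteq> carrier M ==> xs @ x # y # ys : Wd" for xs x y ys
   by (simp add: words_def)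
  note [simp del] = carrier_free_Abelian_group_iff
  have e: "(u \<oplus>\<^sub>P v) \<ominus>\<^sub>P u \<ominus>\<^sub>P v = \<zero>\<^sub>P" if "u :. P" "v :. P" for u v
   using that by (simp add: P.ab_simps)
  show "h c = \<zero>\<^sub>P"
   using c unfolding word_relations_def
  proof (elim UnE CollectE exE conjE, goal_cases)
   case (1 xs x y ys)
   then show ?case using f fc by (simp add: d dc fr v e W word_balanced_def)
  next
   case (2 xs r x y ys)
   then show ?case using f fc by (simp add: d dc fr v P.diff_zero_iff W2 word_balanced_def)
  qed
 qed
 then show ?thesis by (simp add: tw_eq)
qed

lemma TA_smult:
 assumes r: "r :. R"
 shows "additive TA TA (smult TA r)"
  and "!!x ys. x :. M ==> set ys \<subseteq> carrier M ==> r \<odot>\<^sub>TA tw (x # ys) = tw ((r \<odot>\<^sub>M x) # ys)"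
proof -
 have "word_balanced TA (%w. tw ((r \<odot>\<^sub>M hd w) # tl w))"
  unfolding word_balanced_def
 proof (intro conjI ballI allI impI)
  fix xs assume "xs : Wd"
  then show "tw ((r \<odot>\<^sub>M hd xs) # tl xs) :. TA"
   using r by (cases xs) (auto intro!: tw_closed simp: words_def)
 next
  fix xs x y ys assume *: "set xs \<subseteq> carrier M" "x :. M" "y :. M" "set ys \<subseteq> carrier M"
  show "tw ((r \<odot>\<^sub>M hd (xs @ (x \<oplus>\<^sub>M y) # ys)) # tl (xs @ (x \<oplus>\<^sub>M y) # ys)) =
   tw ((r \<odot>\<^sub>M hd (xs @ x # ys)) # tl (xs @ x # ys)) \<oplus>\<^sub>TA tw ((r \<odot>\<^sub>M hd (xs @ y # ys)) # tl (xs @ y # ys))"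
   using * r tw_add[of "[]" "r \<odot>\<^sub>M x" "r \<odot>\<^sub>M y" ys] tw_add[of "(r \<odot>\<^sub>M hd xs) # tl xs" x y ys]
   by (cases xs) (auto simp: smult_r_distr)
 next
  fix xs s x y ys assume *: "s :. R" "set xs \<subseteq> carrier M" "x :. M" "y :. M" "set ys \<subseteq> carrier M"
  show "tw ((r \<odot>\<^sub>M hd (xs @ (s \<odot>\<^sub>M x) # y # ys)) # tl (xs @ (s \<odot>\<^sub>M x) # y # ys)) =
   tw ((r \<odot>\<^sub>M hd (xs @ x # (s \<odot>\<^sub>M y) # ys)) # tl (xs @ x # (s \<odot>\<^sub>M y) # ys))"
   using * r tw_smult[of s "[]" "r \<odot>\<^sub>M x" y ys] tw_smult[of s "(r \<odot>\<^sub>M hd xs) # tl xs" x y ys]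
   by (cases xs) (auto simp: smult_assoc1[symmetric] R.m_comm)
 qed
 from TA_universal[OF WP.T_group this] obtain h where h: "additive TA TA h"
  "!!w. w : Wd ==> h (tw w) = tw ((r \<odot>\<^sub>M hd w) # tl w)" by blast
 have hm: "(r \<odot>\<^sub>M hd w) # tl w : Wd" if "w : Wd" for w
  using that r by (cases w) (auto simp: words_def)
 have eq: "r \<odot>\<^sub>TA X = h X" if "X :. TA" for X
 proof -
  have "r \<odot>\<^sub>TA X = (\<Union>c\<in>X. WP.cls (frag_extend (%w. frag_of ((r \<odot>\<^sub>M hd w) # tl w)) c))"
   by (simp add: tensor_algebra_def Let_def class_eq)
  also have "\<dots> = h X"
   by (rule WP.Union_cls_extend[OF that WP.presented_group_axioms h(1)])
     (use r h(2) hm in \<open>auto simp: tw_eq\<close>)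
  finally show ?thesis .
 qed
 show "additive TA TA (smult TA r)"
  using h(1) by (auto simp: additive_def eq)
 show "r \<odot>\<^sub>TA tw (x # ys) = tw ((r \<odot>\<^sub>M x) # ys)" if "x :. M" "set ys \<subseteq> carrier M" for x ys
  using that h(2)[of "x # ys"] eq[of "tw (x # ys)"] tw_closed[of "x # ys"] by (simp add: words_def)
qed

lemma Wd_cases: assumes "w : Wd" obtains x ys where "w = x # ys" "x :. M" "set ys \<subseteq> carrier M"
 using assms by (cases w) (auto simp: words_def)

lemma TA_module: "module R TA"
proof (rule moduleI)
 note sm = TA_smult
 show "cring R" by (rule R.is_cring)
 show "abelian_group TA" by (rule WP.T_group)
 fix a X assume a: "a :. R" and X: "X :. TA"
 show "a \<odot>\<^sub>TA X :. TA" by (rule additive_closed[OF sm(1)[OF a] X])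
 fix Y assume "Y :. TA"
 then show "a \<odot>\<^sub>TA (X \<oplus>\<^sub>TA Y) = a \<odot>\<^sub>TA X \<oplus>\<^sub>TA a \<odot>\<^sub>TA Y"
  by (rule additive_add[OF sm(1)[OF a] X])
next
 note sm = TA_smult
 fix a b X assume a: "a :. R" and b: "b :. R" and X: "X :. TA"
 have ab: "a \<oplus> b :. R" "a \<otimes> b :. R" using a b by auto
 show "(a \<oplus> b) \<odot>\<^sub>TA X = a \<odot>\<^sub>TA X \<oplus>\<^sub>TA b \<odot>\<^sub>TA X"
 proof (rule TA_ext[OF WP.T_group sm(1)[OF ab(1)] additive_plus[OF WP.T_group sm(1)[OF a] sm(1)[OF b]] _ X])
  fix w assume "w : Wd"
  then show "(a \<oplus> b) \<odot>\<^sub>TA tw w = a \<odot>\<^sub>TA tw w \<oplus>\<^sub>TA b \<odot>\<^sub>TA tw w"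
   by (rule Wd_cases) (use a b tw_add[of "[]"] in \<open>simp add: sm(2) smult_l_distr\<close>)
 qed
 show "(a \<otimes> b) \<odot>\<^sub>TA X = a \<odot>\<^sub>TA (b \<odot>\<^sub>TA X)"
 proof (rule TA_ext[OF WP.T_group sm(1)[OF ab(2)] additive_comp[OF sm(1)[OF b] sm(1)[OF a]] _ X])
  fix w assume "w : Wd"
  then show "(a \<otimes> b) \<odot>\<^sub>TA tw w = a \<odot>\<^sub>TA (b \<odot>\<^sub>TA tw w)"
   by (rule Wd_cases) (use a b in \<open>simp add: sm(2) smult_assoc1\<close>)
 qed
next
 fix X assume X: "X :. TA"
 have id: "additive TA TA (%x. x)" by (auto intro: additiveI)
 show "\<one> \<odot>\<^sub>TA X = X"
 proof (rule TA_ext[OF WP.T_group TA_smult(1)[OF R.one_closed] id _ X])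
  fix w assume "w : Wd"
  then show "\<one> \<odot>\<^sub>TA tw w = tw w"
   by (rule Wd_cases) (simp add: TA_smult(2))
 qed
qed

text \<open>Scalars act on the first letter by definition; from any other slot they are moved left
  one letter at a time by \<open>tw_smult\<close>.\<close>

lemma tw_multilin: "multilin R M TA tw"
 unfolding multilin_def
proof (intro allI impI linI)
 fix xs ys x assume s: "set xs \<subseteq> carrier M" "set ys \<subseteq> carrier M" "x :. M"
 then show "tw (xs @ x # ys) :. TA" by (intro tw_closed) (simp add: words_def)
 show "tw (xs @ (x \<oplus>\<^sub>M y) # ys) = tw (xs @ x # ys) \<oplus>\<^sub>TA tw (xs @ y # ys)" if "y :. M" for y
  by (rule tw_add[OF s(1,3) that s(2)])
 fix r assume r: "r :. R"
 show "tw (xs @ (r \<odot>\<^sub>M x) # ys) = r \<odot>\<^sub>TA tw (xs @ x # ys)"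
  using s
 proof (induction xs arbitrary: x ys rule: rev_induct)
  case Nil
  then show ?case using r by (simp add: TA_smult(2))
 next
  case (snoc z zs)
  then have "tw (zs @ (r \<odot>\<^sub>M z) # x # ys) = r \<odot>\<^sub>TA tw (zs @ z # x # ys)"
   by (intro snoc.IH) auto
  then show ?case using snoc.prems tw_smult[OF r, of zs z x ys] by simp
 qed
qed

lemma TA_lift:
 assumes P: "module R P" and g: "multilin R M P g"
 shows "\<exists>h. lin R TA P h \<and> (\<forall>w\<in>Wd. h (tw w) = g w)"
proof -
 interpret P: module R P by fact
 from TA_universal[OF P.abelian_group_axioms multilin_balanced[OF g]]
 obtain h where h: "additive TA P h" "!!w. w : Wd ==> h (tw w) = g w" by blast
 have "h (r \<odot>\<^sub>TA X) = r \<odot>\<^sub>P h X" if r: "r :. R" and X: "X :. TA" for r X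
 proof (rule TA_ext[OF P.abelian_group_axioms additive_comp[OF TA_smult(1)[OF r] h(1)] _ _ X])
  show "additive TA P (%X. r \<odot>\<^sub>P h X)"
   using r additive_closed[OF h(1)] additive_add[OF h(1)] by (auto intro!: additiveI simp: P.smult_r_distr)
  fix w assume "w : Wd"
  then obtain x ys where w: "w = x # ys" "x :. M" "set ys \<subseteq> carrier M" by (rule Wd_cases)
  then show "h (r \<odot>\<^sub>TA tw w) = r \<odot>\<^sub>P h (tw w)"
   using lin_smult[OF multilinD[OF g, of "[]" ys] r] r by (simp add: TA_smult(2) h(2) words_def)
 qed
 then show ?thesis using h by (auto simp: lin_def)
qed

lemma lin_TA_ext:
 "module R P ==> lin R TA P f ==> lin R TA P g ==> (!!w. w : Wd ==> f (tw w) = g (tw w)) ==>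
  X :. TA ==> f X = g X"
 using TA_ext[of P f g X] mod_group lin_additive by blast

text \<open>Built like the product of a base change: left multiplication by a word \<open>u\<close>
  is lifted first, then the dependence on \<open>u\<close> for fixed \<open>Y\<close>, and the
  definition by unions is recognised as the result.\<close>

lemma TA_mult:
 "(\<forall>Y\<in>carrier TA. lin R TA TA (%X. X \<otimes>\<^sub>TA Y)) \<and>
  (\<forall>X\<in>carrier TA. lin R TA TA (%Y. X \<otimes>\<^sub>TA Y)) \<and>
  (\<forall>u\<in>Wd. \<forall>v\<in>Wd. tw u \<otimes>\<^sub>TA tw v = tw (u @ v))"
proof -
 have W: "u @ v : Wd" if "u : Wd" "v : Wd" for u v using that by (auto simp: words_def)
 have Wsub: "set u \<subseteq> carrier M" if "u : Wd" for u using that by (auto simp: words_def)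
 have l0: "\<exists>h. lin R TA TA h \<and> (\<forall>v\<in>Wd. h (tw v) = tw (u @ v))" if "u : Wd" for u
 proof (rule TA_lift[OF TA_module])
  show "multilin R M TA (%v. tw (u @ v))"
   unfolding multilin_def using multilinD[OF tw_multilin, of "u @ xs" for xs] Wsub[OF that] by simp
 qed
 define l where "l u = (SOME h. lin R TA TA h \<and> (\<forall>v\<in>Wd. h (tw v) = tw (u @ v)))" for u
 have l: "lin R TA TA (l u)" "!!v. v : Wd ==> l u (tw v) = tw (u @ v)" if "u : Wd" for u
  using someI_ex[OF l0[OF that], folded l_def] by simp_all
 have ml: "multilin R M TA (%u. l u Y)" if Y: "Y :. TA" for Y
  unfolding multilin_def
 proof (intro allI impI linI)
  fix xs ys x assume s: "set xs \<subseteq> carrier M" "set ys \<subseteq> carrier M" "x :. M"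
  have w: "xs @ z # ys : Wd" if "z :. M" for z using s that by (simp add: words_def)
  note lz = l(1)[OF w]
  show "l (xs @ x # ys) Y :. TA" by (rule lin_closed[OF lz[OF s(3)] Y])
  have tl: "lin R M TA (%x. tw (xs @ x # ys @ v))" if "v : Wd" for v
   using multilinD[OF tw_multilin, of xs "ys @ v"] s Wsub[OF that] by simp
  show "l (xs @ (x \<oplus>\<^sub>M y) # ys) Y = l (xs @ x # ys) Y \<oplus>\<^sub>TA l (xs @ y # ys) Y" if y: "y :. M" for y
   by (rule lin_TA_ext[OF TA_module lz lin_plus[OF TA_module lz lz] _ Y])
     (use s y lin_add[OF tl] in \<open>auto simp: l(2) w\<close>)
  show "l (xs @ (r \<odot>\<^sub>M x) # ys) Y = r \<odot>\<^sub>TA l (xs @ x # ys) Y" if r: "r :. R" for r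
   by (rule lin_TA_ext[OF TA_module lz lin_scaled[OF TA_module lz] _ Y])
     (use s r lin_smult[OF tl] in \<open>auto simp: l(2) w\<close>)
 qed
 have "\<forall>Y\<in>carrier TA. \<exists>h. lin R TA TA h \<and> (\<forall>u\<in>Wd. h (tw u) = l u Y)"
  using TA_lift[OF TA_module ml] by simp
 from bchoice[OF this] obtain \<mu> where
  "\<forall>Y\<in>carrier TA. lin R TA TA (\<mu> Y) \<and> (\<forall>u\<in>Wd. \<mu> Y (tw u) = l u Y)" by blast
 then have m: "lin R TA TA (\<mu> Y)" "!!u. u : Wd ==> \<mu> Y (tw u) = l u Y" if "Y :. TA" for Y
  using that by blast+
 have mr: "lin R TA TA (%Y. \<mu> Y X)" if X: "X :. TA" for X
 proof (rule linI)
  fix Y assume Y: "Y :. TA"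
  show "\<mu> Y X :. TA" by (rule lin_closed[OF m(1)[OF Y] X])
  show "\<mu> (Y \<oplus>\<^sub>TA Z) X = \<mu> Y X \<oplus>\<^sub>TA \<mu> Z X" if Z: "Z :. TA" for Z
   by (rule lin_TA_ext[OF TA_module m(1) lin_plus[OF TA_module m(1) m(1)] _ X])
     (use Y Z in \<open>auto simp: m(2) lin_add[OF l(1)]\<close>)
  show "\<mu> (r \<odot>\<^sub>TA Y) X = r \<odot>\<^sub>TA \<mu> Y X" if r: "r :. R" for r
   by (rule lin_TA_ext[OF TA_module m(1) lin_scaled[OF TA_module m(1)] _ X])
     (use Y r module.smult_closed[OF TA_module] in \<open>auto simp: m(2) lin_smult[OF l(1)]\<close>)
 qed
 have eq: "X \<otimes>\<^sub>TA Y = \<mu> Y X" if X: "X :. TA" and Y: "Y :. TA" for X Y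
 proof -
  let ?g = "%c' u. frag_extend (%v. frag_of (u @ v)) c'"
  have 1: "?g c' u :. WP.F \<and> WP.cls (?g c' u) = \<mu> Y (WP.cls (frag_of u))"
   if u: "u : Wd" and c': "c' : Y" for u c'
  proof -
   have "?g c' u :. WP.F \<and> WP.cls (?g c' u) = l u (WP.cls c')"
    by (rule WP.cls_extend[OF _ WP.presented_group_axioms lin_additive[OF l(1)[OF u]]])
      (use WP.cls_self[OF Y c'] u l(2)[OF u] W in \<open>auto simp: tw_eq\<close>)
   then show ?thesis using WP.cls_self[OF Y c'] m(2)[OF Y u] by (simp add: tw_eq)
  qed
  have 2: "(\<Union>c\<in>X. WP.cls (frag_extend (?g c') c)) = \<mu> Y X" if c': "c' : Y" for c'
   by (rule WP.Union_cls_extend[OF X WP.presented_group_axioms lin_additive[OF m(1)[OF Y]]]) (use 1 c' in auto)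
  have "X \<otimes>\<^sub>TA Y = (\<Union>c\<in>X. \<Union>c'\<in>Y. WP.cls (frag_extend (?g c') c))"
   by (simp add: tensor_algebra_def Let_def class_eq)
  also have "\<dots> = (\<Union>c'\<in>Y. \<Union>c\<in>X. WP.cls (frag_extend (?g c') c))" by blast
  also have "\<dots> = \<mu> Y X" using 2 WP.T_nonempty[OF Y] by auto
  finally show ?thesis .
 qed
 have A: "lin R TA TA (%X. X \<otimes>\<^sub>TA Y)" if "Y :. TA" for Y
  by (rule lin_cong[OF TA_module m(1)[OF that]], rule eq[OF _ that, symmetric])
 have B: "lin R TA TA (%Y. X \<otimes>\<^sub>TA Y)" if "X :. TA" for X
  by (rule lin_cong[OF TA_module mr[OF that]], rule eq[OF that, symmetric])
 have C: "tw u \<otimes>\<^sub>TA tw v = tw (u @ v)" if "u : Wd" "v : Wd" for u v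
  using that by (simp add: eq tw_closed m(2) l(2))
 from A B C show ?thesis by simp
qed

lemma TA_mult_left: "Y :. TA ==> lin R TA TA (%X. X \<otimes>\<^sub>TA Y)"
 and TA_mult_right: "X :. TA ==> lin R TA TA (%Y. X \<otimes>\<^sub>TA Y)"
 and TA_mult_tw: "u : Wd ==> v : Wd ==> tw u \<otimes>\<^sub>TA tw v = tw (u @ v)"
 using TA_mult by simp_all

lemma TA_algebra: "nonunital_algebra R TA"
proof -
 interpret TAm: module R TA by (rule TA_module)
 have W: "u @ v : Wd" if "u : Wd" "v : Wd" for u v using that by (auto simp: words_def)
 have cl: "X \<otimes>\<^sub>TA Y :. TA" if "X :. TA" "Y :. TA" for X Y
  by (rule lin_closed[OF TA_mult_left[OF that(2)] that(1)])
 note L = TA_mult_left and Rt = TA_mult_right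
 show ?thesis
 proof (unfold_locales)
  fix X Y assume X: "X :. TA" and Y: "Y :. TA"
  show "X \<otimes>\<^sub>TA Y :. TA" by (rule cl[OF X Y])
  {
   fix Z assume Z: "Z :. TA"
   show "(X \<oplus>\<^sub>TA Y) \<otimes>\<^sub>TA Z = X \<otimes>\<^sub>TA Z \<oplus>\<^sub>TA Y \<otimes>\<^sub>TA Z"
    by (rule lin_add[OF L[OF Z] X Y])
   show "X \<otimes>\<^sub>TA (Y \<oplus>\<^sub>TA Z) = X \<otimes>\<^sub>TA Y \<oplus>\<^sub>TA X \<otimes>\<^sub>TA Z"
    by (rule lin_add[OF Rt[OF X] Y Z])
   have 1: "(tw u \<otimes>\<^sub>TA tw v) \<otimes>\<^sub>TA Z = tw u \<otimes>\<^sub>TA (tw v \<otimes>\<^sub>TA Z)"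
    if "u : Wd" "v : Wd" for u v
    by (rule lin_TA_ext[OF TA_module Rt lin_comp[OF Rt Rt] _ Z])
      (use that in \<open>auto simp: TA_mult_tw W tw_closed\<close>)
   have 2: "(tw u \<otimes>\<^sub>TA Y) \<otimes>\<^sub>TA Z = tw u \<otimes>\<^sub>TA (Y \<otimes>\<^sub>TA Z)" if "u : Wd" for u
    by (rule lin_TA_ext[OF TA_module lin_comp[OF Rt L] lin_comp[OF L Rt] _ Y])
      (use that 1 Z in \<open>auto simp: tw_closed\<close>)
   show "(X \<otimes>\<^sub>TA Y) \<otimes>\<^sub>TA Z = X \<otimes>\<^sub>TA (Y \<otimes>\<^sub>TA Z)"
    by (rule lin_TA_ext[OF TA_module lin_comp[OF L L] L _ X])
      (use 2 Y Z cl in auto)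
  next
   fix r assume r: "r :. R"
   show "(r \<odot>\<^sub>TA X) \<otimes>\<^sub>TA Y = r \<odot>\<^sub>TA (X \<otimes>\<^sub>TA Y)"
    by (rule lin_smult[OF L[OF Y] r X])
   show "X \<otimes>\<^sub>TA (r \<odot>\<^sub>TA Y) = r \<odot>\<^sub>TA (X \<otimes>\<^sub>TA Y)"
    by (rule lin_smult[OF Rt[OF X] r Y])
  }
 qed
qed

end

section \<open>Multilinear functions of nested words\<close>

abbreviation NW :: "('r, 'm) module => 'm list list set" where
 "NW M == nonempty_words (nonempty_words (carrier M))"

text \<open>Linearity in every letter of every inner word. The outer slots of the iterated tensor
  algebra hold sums of words and not words, so extending such a function to a linear map takes two
  stages.\<close>

definition nmultilin ::
 "('r, 'z) ring_scheme => ('r, 'm) module => ('r, 'n) module => ('m list list => 'n) => bool" where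
 "nmultilin R M P g \<longleftrightarrow> (\<forall>us xs ys vs. set us \<subseteq> nonempty_words (carrier M) -->
   set vs \<subseteq> nonempty_words (carrier M) --> set xs \<subseteq> carrier M --> set ys \<subseteq> carrier M -->
   lin R M P (%x. g (us @ (xs @ x # ys) # vs)))"

lemma nmultilinD:
 "nmultilin R M P g ==> set us \<subseteq> nonempty_words (carrier M) ==>
  set vs \<subseteq> nonempty_words (carrier M) ==> set xs \<subseteq> carrier M ==> set ys \<subseteq> carrier M ==>
  lin R M P (%x. g (us @ (xs @ x # ys) # vs))"
 by (simp add: nmultilin_def)

lemma nmultilin_closed: "nmultilin R M P g ==> ws : NW M ==> g ws :. P"
 using lin_closed[OF nmultilinD[of R M P g "[]" "tl ws" "[]" "tl (hd ws)"], of "hd (hd ws)"]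
 by (cases ws; cases "hd ws") (auto simp: words_def)

text \<open>Extends a multilinear function of nested words, one outer letter at a time, to words in the tensor algebra.\<close>

context tensor_alg begin

definition lift1 where
 "lift1 P f = (SOME h. lin R TA P h \<and> (\<forall>w\<in>Wd. h (tw w) = f w))"

lemma lift1:
 assumes "module R P" "multilin R M P f"
 shows "lin R TA P (lift1 P f)" "!!w. w : Wd ==> lift1 P f (tw w) = f w"
 using someI_ex[OF TA_lift[OF assms], folded lift1_def] by simp_all

lemma lift1_add:
 assumes P: "module R P" and "multilin R M P f" "multilin R M P g" "multilin R M P h"
  and "!!w. w : Wd ==> h w = f w \<oplus>\<^sub>P g w" and X: "X :. TA"
 shows "lift1 P h X = lift1 P f X \<oplus>\<^sub>P lift1 P g X"
proof -
 note l = lift1[OF P]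
 show ?thesis
  by (rule lin_TA_ext[OF P l(1) lin_plus[OF P l(1) l(1)] _ X]) (use assms l(2) in auto)
qed

lemma lift1_smult:
 assumes P: "module R P" and "multilin R M P f" "multilin R M P h" "r :. R"
  and "!!w. w : Wd ==> h w = r \<odot>\<^sub>P f w" and X: "X :. TA"
 shows "lift1 P h X = r \<odot>\<^sub>P lift1 P f X"
proof -
 note l = lift1[OF P]
 show ?thesis
  by (rule lin_TA_ext[OF P l(1) lin_scaled[OF P l(1)] _ X]) (use assms l(2) in auto)
qed

primrec extend where
 "extend P [] g = g []"
| "extend P (t # ts) g = lift1 P (%w. extend P ts (%ws. g (w # ws))) t"

text \<open>A value in \<open>P\<close> is also demanded on the empty list, where the recursion of
  \<open>extend\<close> ends.\<close>

definition extendable where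
 "extendable P g \<longleftrightarrow> (\<forall>ws. set ws \<subseteq> Wd --> g ws :. P) \<and> nmultilin R M P g"

lemma extendable_Cons:
 assumes "extendable P g" "w : Wd" shows "extendable P (%ws. g (w # ws))"
 using assms nmultilinD[of R M P g "w # us" for us] by (auto simp: extendable_def nmultilin_def)

text \<open>The four claims need each other: \<open>lift1\<close> at the next outer letter requires
  multilinearity, which in turn comes from additivity and homogeneity of the remaining
  \<open>extend\<close> in the function \<open>g\<close>.\<close>

lemma extend_linear:
 assumes P: "module R P" and "set ts \<subseteq> carrier TA"
 shows "(\<forall>g. extendable P g --> extend P ts g :. P) \<and>
  (\<forall>f g h. extendable P f --> extendable P g --> extendable P h -->
   (\<forall>ws. set ws \<subseteq> Wd --> h ws = f ws \<oplus>\<^sub>P g ws) -->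
   extend P ts h = extend P ts f \<oplus>\<^sub>P extend P ts g) \<and>
  (\<forall>f h r. extendable P f --> extendable P h --> r :. R -->
   (\<forall>ws. set ws \<subseteq> Wd --> h ws = r \<odot>\<^sub>P f ws) -->
   extend P ts h = r \<odot>\<^sub>P extend P ts f) \<and>
  (\<forall>g. extendable P g --> multilin R M P (%w. extend P ts (%ws. g (w # ws))))"
 using assms(2)
proof (induction ts)
 case Nil
 have "multilin R M P (%w. g [w])" if "extendable P g" for g
  using that nmultilinD[of R M P g "[]" "[]"] by (auto simp: extendable_def multilin_def)
 then show ?case by (simp add: extendable_def)
next
 case (Cons t ts)
 then have t: "t :. TA" and ts: "set ts \<subseteq> carrier TA" by auto
 note IH = Cons.IH[OF ts]
 have cl: "extend P ts g :. P" if "extendable P g" for g using IH that by blast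
 have add: "extend P ts h = extend P ts f \<oplus>\<^sub>P extend P ts g"
  if "extendable P f" "extendable P g" "extendable P h" "!!ws. set ws \<subseteq> Wd ==> h ws = f ws \<oplus>\<^sub>P g ws"
  for f g h using IH that by simp
 have sm: "extend P ts h = r \<odot>\<^sub>P extend P ts f"
  if "extendable P f" "extendable P h" "r :. R" "!!ws. set ws \<subseteq> Wd ==> h ws = r \<odot>\<^sub>P f ws"
  for f h r using IH that by simp
 have ml: "multilin R M P (%w. extend P ts (%ws. g (w # ws)))" if "extendable P g" for g
  using IH that by blast
 have 1: "extend P (t # ts) g :. P" if "extendable P g" for g
  using lin_closed[OF lift1(1)[OF P ml[OF that]] t] by simp
 have 2: "extend P (t # ts) h = extend P (t # ts) f \<oplus>\<^sub>P extend P (t # ts) g"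
  if e: "extendable P f" "extendable P g" "extendable P h" and eq: "!!ws. set ws \<subseteq> Wd ==> h ws = f ws \<oplus>\<^sub>P g ws"
  for f g h
  unfolding extend.simps
  by (rule lift1_add[OF P ml[OF e(1)] ml[OF e(2)] ml[OF e(3)] _ t], rule add) (use e eq in \<open>auto intro: extendable_Cons\<close>)
 have 3: "extend P (t # ts) h = r \<odot>\<^sub>P extend P (t # ts) f"
  if e: "extendable P f" "extendable P h" "r :. R" and eq: "!!ws. set ws \<subseteq> Wd ==> h ws = r \<odot>\<^sub>P f ws"
  for f h r
  unfolding extend.simps
  by (rule lift1_smult[OF P ml[OF e(1)] ml[OF e(2)] e(3) _ t], rule sm) (use e eq in \<open>auto intro: extendable_Cons\<close>)
 have 4: "multilin R M P (%w. extend P (t # ts) (%ws. g (w # ws)))" if e: "extendable P g" for g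
  unfolding multilin_def
 proof (intro allI impI linI)
  fix xs ys x assume s: "set xs \<subseteq> carrier M" "set ys \<subseteq> carrier M" "x :. M"
  have w: "xs @ z # ys : Wd" if "z :. M" for z using s that by (simp add: words_def)
  note ew = extendable_Cons[OF e w]
  have nl: "lin R M P (%x. g ((xs @ x # ys) # ws))" if "set ws \<subseteq> Wd" for ws
   using nmultilinD[of R M P g "[]" ws xs ys] e that s by (simp add: extendable_def)
  show "extend P (t # ts) (%ws. g ((xs @ x # ys) # ws)) :. P" by (rule 1[OF ew[OF s(3)]])
  show "extend P (t # ts) (%ws. g ((xs @ (x \<oplus>\<^sub>M y) # ys) # ws)) =
   extend P (t # ts) (%ws. g ((xs @ x # ys) # ws)) \<oplus>\<^sub>P extend P (t # ts) (%ws. g ((xs @ y # ys) # ws))"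
   if y: "y :. M" for y
   by (rule 2[OF ew ew ew]) (use s y lin_add[OF nl] in auto)
  show "extend P (t # ts) (%ws. g ((xs @ (r \<odot>\<^sub>M x) # ys) # ws)) =
   r \<odot>\<^sub>P extend P (t # ts) (%ws. g ((xs @ x # ys) # ws))" if r: "r :. R" for r
   by (rule 3[OF ew ew r]) (use s r lin_smult[OF nl] in auto)
 qed
 from 1 2 3 4 show ?case by blast
qed

lemma extend_multilin:
 "module R P ==> set ts \<subseteq> carrier TA ==> extendable P g ==>
  multilin R M P (%w. extend P ts (%ws. g (w # ws)))"
 using extend_linear[of P ts] by blast

lemma extend_slot:
 assumes P: "module R P" and vs: "set vs \<subseteq> carrier TA"
 shows "set us \<subseteq> carrier TA ==> extendable P g ==> lin R TA P (%t. extend P (us @ t # vs) g)"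
proof (induction us arbitrary: g)
 case Nil
 then show ?case using lift1(1)[OF P extend_multilin[OF P vs]] by simp
next
 case (Cons u us)
 then have u: "u :. TA" and us: "set us \<subseteq> carrier TA" by auto
 have s: "set (us @ t # vs) \<subseteq> carrier TA" if "t :. TA" for t using us vs that by auto
 note ml = extend_multilin[OF P s Cons.prems(2)]
 note IH = Cons.IH[OF us extendable_Cons[OF Cons.prems(2)]]
 show ?case unfolding append_Cons extend.simps
 proof (rule linI)
  fix t assume t: "t :. TA"
  show "lift1 P (%w. extend P (us @ t # vs) (%ws. g (w # ws))) u :. P"
   by (rule lin_closed[OF lift1(1)[OF P ml[OF t]] u])
  show "lift1 P (%w. extend P (us @ (t \<oplus>\<^sub>TA t') # vs) (%ws. g (w # ws))) u =
   lift1 P (%w. extend P (us @ t # vs) (%ws. g (w # ws))) u \<oplus>\<^sub>P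
   lift1 P (%w. extend P (us @ t' # vs) (%ws. g (w # ws))) u" if t': "t' :. TA" for t'
   by (rule lift1_add[OF P ml ml ml _ u]) (use t t' lin_add[OF IH] in auto)
  show "lift1 P (%w. extend P (us @ (r \<odot>\<^sub>TA t) # vs) (%ws. g (w # ws))) u =
   r \<odot>\<^sub>P lift1 P (%w. extend P (us @ t # vs) (%ws. g (w # ws))) u" if r: "r :. R" for r
   by (rule lift1_smult[OF P ml ml r _ u])
     (use t r lin_smult[OF IH] module.smult_closed[OF TA_module] in auto)
 qed
qed

lemma extend_words:
 assumes P: "module R P"
 shows "set ws \<subseteq> Wd ==> extendable P g ==> extend P (map tw ws) g = g ws"
proof (induction ws arbitrary: g)
 case Nil
 then show ?case by simp
next
 case (Cons w ws)
 have s: "set (map tw ws) \<subseteq> carrier TA" using Cons.prems(1) tw_closed by auto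
 show ?case using lift1(2)[OF P extend_multilin[OF P s Cons.prems(2)], of w]
   Cons.IH[OF _ extendable_Cons[OF Cons.prems(2)], of w] Cons.prems(1) by simp
qed

end

locale nested_tensor_alg = tensor_alg R M + TT: tensor_alg R "tensor_algebra R M"
 for R :: "('r, 'z) ring_scheme" (structure) and M :: "('r, 'm) module"
begin

lemma nested_word_closed: "ws : NW M ==> map tw ws : TT.Wd"
 using tw_closed by (auto simp: words_def)

lemma nested_lift:
 assumes P: "module R P" and g: "nmultilin R M P g"
 shows "\<exists>h. lin R TT.TA P h \<and> (\<forall>ws\<in>NW M. h (TT.tw (map tw ws)) = g ws)"
proof -
 interpret P: module R P by fact
 \<comment> \<open>The zero at the empty list is a filler that makes \<open>g'\<close> extendable;
   nested words are never empty.\<close>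
 define g' where "g' ws = (if ws = [] then \<zero>\<^sub>P else g ws)" for ws
 have e: "extendable P g'"
  using g nmultilin_closed[OF g]
  by (auto simp: extendable_def g'_def nmultilin_def words_def)
 have "multilin R TA P (%ts. extend P ts g')"
  unfolding multilin_def using extend_slot[OF P _ _ e] by blast
 then obtain h where h: "lin R TT.TA P h" "\<forall>w\<in>TT.Wd. h (TT.tw w) = extend P w g'"
  using TT.TA_lift[OF P] by blast
 have "h (TT.tw (map tw ws)) = g ws" if "ws : NW M" for ws
  using h(2) nested_word_closed[OF that] extend_words[OF P _ e, of ws] that
  by (auto simp: words_def g'_def)
 with h(1) show ?thesis by blast
qed

lemma nested_word_multilin: "nmultilin R M TT.TA (%ws. TT.tw (map tw ws))"
 unfolding nmultilin_def
proof (intro allI impI)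
 fix us xs ys vs assume s: "set us \<subseteq> Wd" "set vs \<subseteq> Wd" "set xs \<subseteq> carrier M" "set ys \<subseteq> carrier M"
 have 1: "lin R M TA (%x. tw (xs @ x # ys))" by (rule multilinD[OF tw_multilin s(3,4)])
 have 2: "lin R TA TT.TA (%t. TT.tw (map tw us @ t # map tw vs))"
  using s(1,2) tw_closed by (intro multilinD[OF TT.tw_multilin]) auto
 show "lin R M TT.TA (%x. TT.tw (map tw (us @ (xs @ x # ys) # vs)))"
  using lin_comp[OF 1 2] by simp
qed

lemma nested_word_span: "carrier TT.TA = gen TT.TA ((%ws. TT.tw (map tw ws)) ` NW M)"
proof -
 let ?S = "(%ws. TT.tw (map tw ws)) ` NW M"
 have sub: "?S \<subseteq> carrier TT.TA" using TT.tw_closed nested_word_closed by auto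
 note sp = span_closed[OF TT.WP.T_group sub]
 have Wsub: "tw ` Wd \<subseteq> carrier TA" using tw_closed by auto
 \<comment> \<open>\<open>us\<close> collects the outer letters already reduced to words; each
   further outer letter \<open>t\<close> is expanded in the span of words.\<close>
 have step: "TT.tw (map tw us @ ts) : gen TT.TA ?S"
  if "set us \<subseteq> Wd" "set ts \<subseteq> carrier TA" "us \<noteq> [] \<or> ts \<noteq> []" for us ts
  using that
 proof (induction ts arbitrary: us)
  case Nil
  then show ?case by (auto intro!: span_base simp: words_def)
 next
  case (Cons t ts)
  have l: "lin R TA TT.TA (%t. TT.tw (map tw us @ t # ts))"
   using Cons.prems tw_closed by (intro multilinD[OF TT.tw_multilin]) auto
  have t: "t : gen TA (tw ` Wd)" using Cons.prems TA_span by simp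
  show ?case
  proof (rule additive_image_span[OF WP.T_group TT.WP.T_group lin_additive[OF l] Wsub sub _ t])
   fix s assume "s : tw ` Wd"
   then obtain w where "w : Wd" "s = tw w" by auto
   then show "TT.tw (map tw us @ s # ts) : gen TT.TA ?S"
    using Cons.IH[of "us @ [w]"] Cons.prems by simp
  qed
 qed
 have "TT.tw ` TT.Wd \<subseteq> gen TT.TA ?S"
  using step[of "[]"] by (auto simp: words_def)
 then have "gen TT.TA (TT.tw ` TT.Wd) \<subseteq> gen TT.TA ?S"
  by (intro group.generate_subgroup_incl[OF TT.WG.add.is_group] TT.WG.add.generate_is_subgroup) (use sub in auto)
 then show ?thesis using TT.TA_span sp(1) by auto
qed

end

section \<open>Algebras generated by nested words\<close>

text \<open>\<open>X\<close> abstracts the resolution of the algebra \<open>M\<close>, and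
  \<open>W\<close> the nested words spanning it. Lifting is assumed for the targets \<open>X\<close>
  and \<open>M\<close>, as a locale cannot quantify over the types of targets. The conditions on
  \<open>W\<close> refer to \<open>M\<close> as a module, so a single \<open>X\<close> can serve
  many products.\<close>

locale word_algebra = M: nonunital_algebra S M + X: nonunital_algebra S X
 for S :: "('s, 'z) ring_scheme" (structure) and M :: "('s, 'm) module" and X :: "('s, 'x) module" +
 fixes W :: "'m list list => 'x"
 assumes W_multilin: "nmultilin S M X W"
  and W_append: "us : NW M ==> vs : NW M ==> W (us @ vs) = W us \<otimes>\<^sub>X W vs"
  and W_span: "carrier X = gen X (W ` NW M)"
  and lift_X: "nmultilin S M X g ==> \<exists>h. lin S X X h \<and> (\<forall>ws\<in>NW M. h (W ws) = g ws)"
  and lift_M: "nmultilin S M M g' ==> \<exists>h. lin S X M h \<and> (\<forall>ws\<in>NW M. h (W ws) = g' ws)"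

text \<open>The three shapes are the constructors of a nested word: a single letter, a new
  one-letter generator in front of a word, and a new letter in front of the first generator. All
  recursions on the resolution follow them.\<close>

lemma nested_cases:
 assumes "ws : nonempty_words (nonempty_words C)"
 obtains a where "ws = [[a]]" "a : C"
 | a vs where "ws = [a] # vs" "a : C" "vs : nonempty_words (nonempty_words C)"
 | a w vs where "ws = (a # w) # vs" "a : C" "w # vs : nonempty_words (nonempty_words C)"
proof -
 obtain w vs where 1: "ws = w # vs" using assms by (cases ws) (auto simp: words_def)
 obtain a w' where 2: "w = a # w'" using assms 1 by (cases w) (auto simp: words_def)
 show thesis
  using assms that unfolding 1 2 by (cases "w' = []"; cases "vs = []") (auto simp: words_def)
qed

lemma nested_induct [consumes 1, case_names one tensor bar]:
 assumes "ws : nonempty_words (nonempty_words C)"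
  and "!!a. a : C ==> Q [[a]]"
  and "!!a ws. a : C ==> ws : nonempty_words (nonempty_words C) ==> Q ws ==> Q ([a] # ws)"
  and "!!a w ws. a : C ==> w # ws : nonempty_words (nonempty_words C) ==> Q (w # ws) ==> Q ((a # w) # ws)"
 shows "Q ws"
 using assms(1)
proof (induction "length (concat ws)" arbitrary: ws rule: less_induct)
 case less
 from less.prems show ?case
  by (cases rule: nested_cases) (use less assms(2-) in auto)
qed

text \<open>Primitive recursion along these constructors: \<open>F\<close> and \<open>G\<close> see
  the element \<open>W\<close> of the remaining word besides the recursive value. The total number
  of letters decreases.\<close>

function word_rec where
 "word_rec W f F G ([a] # ws) = (if ws = [] then f a else F a (W ws) (word_rec W f F G ws))"
| "word_rec W f F G ((a # b # w) # ws) = G a (W ((b # w) # ws)) (word_rec W f F G ((b # w) # ws))"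
| "word_rec W f F G [] = undefined"
| "word_rec W f F G ([] # ws) = undefined"
 by pat_completeness auto
termination by (relation "measure (%(W, f, F, G, ws). length (concat ws))") auto

lemma nmultilin_tensor:
 assumes "nmultilin R M P g" "a :. M" shows "nmultilin R M P (%ws. g ([a] # ws))"
 using nmultilinD[OF assms(1), of "[a] # us" for us] assms(2)
 by (auto simp: nmultilin_def words_def)

lemma nmultilin_bar:
 assumes g: "nmultilin R M P g" and a: "a :. M"
 shows "nmultilin R M P (%ws. g ((a # hd ws) # tl ws))"
 unfolding nmultilin_def
proof (intro allI impI)
 fix us xs ys vs assume s: "set us \<subseteq> nonempty_words (carrier M)" "set vs \<subseteq> nonempty_words (carrier M)"
  "set xs \<subseteq> carrier M" "set ys \<subseteq> carrier M"
 show "lin R M P (%x. g ((a # hd (us @ (xs @ x # ys) # vs)) # tl (us @ (xs @ x # ys) # vs)))"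
  using nmultilinD[OF g, of "[]" vs "a # xs" ys] a s
   nmultilinD[OF g, of "(a # hd us) # tl us" vs xs ys]
  by (cases us) (auto simp: words_def)
qed

lemma word_rec_bar: "w \<noteq> [] ==>
 word_rec W f F G ((a # w) # ws) = G a (W (w # ws)) (word_rec W f F G (w # ws))"
 by (cases w) auto

text \<open>Linear in \<open>a\<close> and in the pair \<open>(y, z)\<close> jointly, not in
  \<open>y\<close> and \<open>z\<close> separately: the clauses of the recursions are sums of a term
  in \<open>y\<close> and a term in \<open>z\<close>.\<close>

definition joint_linear where
 "joint_linear S M X P F \<longleftrightarrow> (\<forall>a\<in>carrier M. \<forall>y\<in>carrier X. \<forall>z\<in>carrier P. F a y z :. P) \<and>
  (\<forall>y\<in>carrier X. \<forall>z\<in>carrier P. lin S M P (%a. F a y z)) \<and>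
  (\<forall>a\<in>carrier M. \<forall>y\<in>carrier X. \<forall>y'\<in>carrier X. \<forall>z\<in>carrier P. \<forall>z'\<in>carrier P.
   F a (y \<oplus>\<^sub>X y') (z \<oplus>\<^sub>P z') = F a y z \<oplus>\<^sub>P F a y' z') \<and>
  (\<forall>a\<in>carrier M. \<forall>r\<in>carrier S. \<forall>y\<in>carrier X. \<forall>z\<in>carrier P.
   F a (r \<odot>\<^sub>X y) (r \<odot>\<^sub>P z) = r \<odot>\<^sub>P F a y z)"

lemma joint_lin:
 assumes "joint_linear S M X P F" "a :. M" "lin S N X y" "lin S N P z"
 shows "lin S N P (%x. F a (y x) (z x))"
proof (rule linI)
 note c = lin_closed[OF assms(3)] lin_closed[OF assms(4)]
 fix x assume x: "x :. N"
 show "F a (y x) (z x) :. P" using assms(1,2) c[OF x] unfolding joint_linear_def by simp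
 show "F a (y (x \<oplus>\<^sub>N x')) (z (x \<oplus>\<^sub>N x')) = F a (y x) (z x) \<oplus>\<^sub>P F a (y x') (z x')"
  if x': "x' :. N" for x'
  using assms(1,2) c[OF x] c[OF x'] lin_add[OF assms(3) x x'] lin_add[OF assms(4) x x'] unfolding joint_linear_def by simp
 show "F a (y (r \<odot>\<^sub>N x)) (z (r \<odot>\<^sub>N x)) = r \<odot>\<^sub>P F a (y x) (z x)" if r: "r :. S" for r
  using assms(1,2) c[OF x] r lin_smult[OF assms(3) r x] lin_smult[OF assms(4) r x] unfolding joint_linear_def by simp
qed

text \<open>If the varying letter is the first one, this is linearity of \<open>F\<close> or
  \<open>G\<close> in \<open>a\<close>; if it lies deeper, both the remaining word and the recursive
  value depend linearly on it, which is the situation of \<open>joint_lin\<close>.\<close>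

lemma word_rec_multilin:
 fixes M :: "('s, 'm) module" and X :: "('s, 'x) module" and P :: "('s, 'p) module"
 assumes W: "nmultilin S M X W"
  and f: "lin S M P f" and F: "joint_linear S M X P F" and G: "joint_linear S M X P G"
 shows "nmultilin S M P (word_rec W f F G)"
proof -
 note W_multilin = W
 have W_closed: "W ws :. X" if "ws : NW M" for ws by (rule nmultilin_closed[OF W that])
 let ?g = "word_rec W f F G"
 let ?Wd = "nonempty_words (carrier M)"
 have Fc: "F a y z :. P" if "a :. M" "y :. X" "z :. P" for a y z
  using F that unfolding joint_linear_def by simp
 have Gc: "G a y z :. P" if "a :. M" "y :. X" "z :. P" for a y z
  using G that unfolding joint_linear_def by simp
 have Fl: "lin S M P (%a. F a y z)" if "y :. X" "z :. P" for y z
  using F that unfolding joint_linear_def by simp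
 have Gl: "lin S M P (%a. G a y z)" if "y :. X" "z :. P" for y z
  using G that unfolding joint_linear_def by simp
 have ne: "w \<noteq> []" if "w # ws : NW M" for w ws using that by (auto simp: words_def)
 have ne': "ws \<noteq> []" if "ws : NW M" for ws using that by (auto simp: words_def)
 have cl: "?g ws :. P" if "ws : NW M" for ws
  using that
 proof (induction rule: nested_induct)
  case (one a)
  then show ?case using lin_closed[OF f] by simp
 next
  case (tensor a ws)
  then show ?case using Fc W_closed ne' by simp
 next
  case (bar a w ws)
  then show ?case using Gc W_closed ne by (simp add: word_rec_bar)
 qed
 have Wl: "lin S M X (%x. W (us @ (xs @ x # ys) # vs))"
  if "set us \<subseteq> ?Wd" "set vs \<subseteq> ?Wd" "set xs \<subseteq> carrier M" "set ys \<subseteq> carrier M" for us xs ys vs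
  by (rule nmultilinD[OF W_multilin that])
 have 1: "lin S M P (%x. ?g ((xs @ x # ys) # vs))"
  if "set vs \<subseteq> ?Wd" "set xs \<subseteq> carrier M" "set ys \<subseteq> carrier M" for xs ys vs
  using that
 proof (induction xs)
  case Nil
  then show ?case
  proof (cases ys)
   case yn: Nil
   show ?thesis
   proof (cases "vs = []")
    case True
    then show ?thesis using f yn by simp
   next
    case False
    then have "vs : NW M" using Nil by (simp add: words_def)
    then show ?thesis using Fl[OF W_closed cl] False yn by simp
   qed
  next
   case (Cons b zs)
   then have "ys # vs : NW M" using Nil by (simp add: words_def)
   then show ?thesis using Gl[OF W_closed cl] Cons by simp
  qed
 next
  case (Cons a xs)
  then have IH: "lin S M P (%x. ?g ((xs @ x # ys) # vs))" and a: "a :. M"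
   and W1: "lin S M X (%x. W ((xs @ x # ys) # vs))"
   using Wl[of "[]" vs xs ys] by auto
  show ?case using joint_lin[OF G a W1 IH] by (simp add: word_rec_bar)
 qed
 have 2: "lin S M P (%x. ?g (us @ (xs @ x # ys) # vs))"
  if "set us \<subseteq> ?Wd" and vs: "set vs \<subseteq> ?Wd" "set xs \<subseteq> carrier M" "set ys \<subseteq> carrier M" for us xs ys vs
  using that(1)
 proof (induction us)
  case Nil
  then show ?case using 1[OF vs] by simp
 next
  case (Cons u us)
  then have us: "set us \<subseteq> ?Wd" and IH: "lin S M P (%x. ?g (us @ (xs @ x # ys) # vs))" by auto
  have "u \<noteq> []" "set u \<subseteq> carrier M" using Cons.prems by (auto simp: words_def)
  then show ?case
  proof (induction u rule: list_nonempty_induct)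
   case (single a)
   then show ?case using joint_lin[OF F _ Wl[OF us vs] IH, of a] by simp
  next
   case (cons a u)
   then have IH2: "lin S M P (%x. ?g ((u # us) @ (xs @ x # ys) # vs))" and a: "a :. M"
    and us2: "set (u # us) \<subseteq> ?Wd" using us by (auto simp: words_def)
   show ?case using joint_lin[OF G a Wl[OF us2 vs] IH2] \<open>u \<noteq> []\<close> by (simp add: word_rec_bar)
  qed
 qed
 show ?thesis unfolding nmultilin_def using 2 by blast
qed

context word_algebra begin

lemma W_closed: "ws : NW M ==> W ws :. X"
 by (rule nmultilin_closed[OF W_multilin])

lemma X_lin_ext:
 assumes "module S P" "lin S X P f" "lin S X P g" "!!ws. ws : NW M ==> f (W ws) = g (W ws)" "y :. X"
 shows "f y = g y"
 by (rule additive_span_ext[OF X.M.abelian_group_axioms mod_group[OF assms(1)]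
   lin_additive[OF assms(2)] lin_additive[OF assms(3)], of "W ` NW M"])
   (use assms(4,5) W_span W_closed in auto)

definition "i a = W [[a]]"

text \<open>Puts \<open>a\<close> in front of the first generator: \<open>[a1|...]\<close> becomes
  \<open>[a|a1|...]\<close>. It lowers the degree by one and commutes with right multiplication
  (\<open>v_mult\<close>); from the elements \<open>i a\<close>, left multiplication by them and the
  operators \<open>v a\<close> produce all of \<open>X\<close> by linear combination.\<close>

definition "v a = (SOME h. lin S X X h \<and> (\<forall>ws\<in>NW M. h (W ws) = W ((a # hd ws) # tl ws)))"

lemma v_spec:
 assumes a: "a :. M"
 shows v_lin: "lin S X X (v a)" and v_W: "w # ws : NW M ==> v a (W (w # ws)) = W ((a # w) # ws)"
proof -
 note nmultilin_bar[OF W_multilin a]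
 from someI_ex[OF lift_X[OF this], folded v_def]
 show "lin S X X (v a)" "w # ws : NW M ==> v a (W (w # ws)) = W ((a # w) # ws)" by force+
qed

lemma i_lin: "lin S M X i"
 using nmultilinD[OF W_multilin, of "[]" "[]" "[]" "[]"] by (simp add: i_def[abs_def])

lemma i_closed: "a :. M ==> i a :. X"
 by (rule lin_closed[OF i_lin])

lemma v_closed: "a :. M ==> y :. X ==> v a y :. X"
 by (rule lin_closed[OF v_lin])

lemma W_tensor: "a :. M ==> ws : NW M ==> W ([a] # ws) = i a \<otimes>\<^sub>X W ws"
 using W_append[of "[[a]]" ws] by (simp add: i_def words_def)

lemma W_bar: "a :. M ==> w # ws : NW M ==> W ((a # w) # ws) = v a (W (w # ws))"
 by (simp add: v_W)

lemma v_lin1: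
 assumes y: "y :. X" shows "lin S M X (%a. v a y)"
proof (rule linI)
 fix a assume a: "a :. M"
 show "v a y :. X" by (rule v_closed[OF a y])
 have ll: "lin S M X (%a. v a (W ws))" if nw: "ws : NW M" for ws
 proof -
  obtain w us where ws: "ws = w # us" using nw by (cases ws) (auto simp: words_def)
  have "lin S M X (%a. W ((a # w) # us))"
   using nmultilinD[OF W_multilin, of "[]" us "[]" w] that ws by (auto simp: words_def)
  then show ?thesis by (rule lin_cong[OF M.module_axioms]) (use nw ws in \<open>simp add: W_bar\<close>)
 qed
 show "v (a \<oplus>\<^sub>M b) y = v a y \<oplus>\<^sub>X v b y" if b: "b :. M" for b
  by (rule X_lin_ext[OF X.module_axioms v_lin lin_plus[OF X.module_axioms v_lin v_lin] _ y])
    (use a b lin_add[OF ll] in auto)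
 show "v (r \<odot>\<^sub>M a) y = r \<odot>\<^sub>X v a y" if r: "r :. S" for r
  by (rule X_lin_ext[OF X.module_axioms v_lin lin_scaled[OF X.module_axioms v_lin] _ y])
    (use a r lin_smult[OF ll] in auto)
qed

lemma X_mult_lin:
 "y :. X ==> lin S X X (%z. z \<otimes>\<^sub>X y)" "y :. X ==> lin S X X (%z. y \<otimes>\<^sub>X z)"
 by (auto intro!: linI simp: X.mult_closed X.mult_add_left X.mult_add_right X.mult_smult_left X.mult_smult_right)

lemma M_mult_lin:
 "y :. M ==> lin S M M (%z. z \<otimes>\<^sub>M y)" "y :. M ==> lin S M M (%z. y \<otimes>\<^sub>M z)"
 by (auto intro!: linI simp: M.mult_closed M.mult_add_left M.mult_add_right M.mult_smult_left M.mult_smult_right)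

text \<open>An induction principle for the equality of two linear maps: it suffices to compare them
  on nested words, where the constructors become \<open>i a\<close>,
  \<open>i a \<otimes>\<^sub>X y\<close> and \<open>v a y\<close>.\<close>

lemma X_struct_induct [consumes 4, case_names one tensor bar]:
 assumes "y :. X"
  and P: "module S P" "lin S X P f" "lin S X P g"
  and "!!a. a :. M ==> f (i a) = g (i a)"
  and "!!a y. a :. M ==> y :. X ==> f y = g y ==> f (i a \<otimes>\<^sub>X y) = g (i a \<otimes>\<^sub>X y)"
  and "!!a y. a :. M ==> y :. X ==> f y = g y ==> f (v a y) = g (v a y)"
 shows "f y = g y"
proof (rule X_lin_ext[OF P _ assms(1)])
 fix ws assume "ws : NW M"
 then show "f (W ws) = g (W ws)"
 proof (induction rule: nested_induct)
  case (one a)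
  then show ?case using assms(5) by (simp add: i_def)
 next
  case (tensor a ws)
  then show ?case using assms(6) by (simp add: W_tensor W_closed)
 next
  case (bar a w ws)
  then show ?case using assms(7) by (simp add: W_bar W_closed)
 qed
qed

abbreviation "joint P F == joint_linear S M X P F"

lemmas joint_def = joint_linear_def

text \<open>\<open>word_rec\<close> gives the equations on nested words; both sides are linear in
  \<open>y\<close>, so they extend to all of \<open>X\<close>.\<close>

lemma structural_rec:
 assumes P: "module S P"
  and lift: "!!g. nmultilin S M P g ==> \<exists>h. lin S X P h \<and> (\<forall>ws\<in>NW M. h (W ws) = g ws)"
  and f: "lin S M P f" and F: "joint_linear S M X P F" and G: "joint_linear S M X P G"
 shows "\<exists>h. lin S X P h \<and> (\<forall>a\<in>carrier M. h (i a) = f a) \<and>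
  (\<forall>a\<in>carrier M. \<forall>y\<in>carrier X. h (i a \<otimes>\<^sub>X y) = F a y (h y)) \<and>
  (\<forall>a\<in>carrier M. \<forall>y\<in>carrier X. h (v a y) = G a y (h y))"
proof -
 let ?g = "word_rec W f F G"
 have ne: "w \<noteq> []" if "w # ws : NW M" for w ws using that by (auto simp: words_def)
 have ne': "ws \<noteq> []" if "ws : NW M" for ws using that by (auto simp: words_def)
 from lift[OF word_rec_multilin[OF W_multilin f F G]] obtain h where h: "lin S X P h" and hW: "!!ws. ws : NW M ==> h (W ws) = ?g ws"
  by blast
 have h1: "h (i a) = f a" if "a :. M" for a
  using hW[of "[[a]]"] that by (simp add: i_def words_def)
 have h2: "h (i a \<otimes>\<^sub>X y) = F a y (h y)" if a: "a :. M" and y: "y :. X" for a y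
 proof (rule X_lin_ext[OF P lin_comp[OF X_mult_lin(2) h] joint_lin[OF F a lin_id h] _ y])
  fix ws assume ws: "ws : NW M"
  then have "[a] # ws : NW M" using a by (simp add: words_def)
  then show "h (i a \<otimes>\<^sub>X W ws) = F a (W ws) (h (W ws))"
   using ws a ne' by (simp add: W_tensor[symmetric] hW)
 qed (rule i_closed[OF a])
 have h3: "h (v a y) = G a y (h y)" if a: "a :. M" and y: "y :. X" for a y
 proof (rule X_lin_ext[OF P lin_comp[OF v_lin[OF a] h] joint_lin[OF G a lin_id h] _ y])
  fix ws assume ws: "ws : NW M"
  then obtain w us where wu: "ws = w # us" by (cases ws) (auto simp: words_def)
  then have "(a # w) # us : NW M" using a ws by (auto simp: words_def)
  then show "h (v a (W ws)) = G a (W ws) (h (W ws))"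
   using ws a ne unfolding wu by (simp add: W_bar[symmetric] hW word_rec_bar)
 qed
 from h h1 h2 h3 show ?thesis by blast
qed

end

lemma (in nonunital_algebra) mult_zero:
 "x :. A ==> \<zero>\<^sub>A \<otimes>\<^sub>A x = \<zero>\<^sub>A" "x :. A ==> x \<otimes>\<^sub>A \<zero>\<^sub>A = \<zero>\<^sub>A"
proof -
 assume x: "x :. A"
 show "\<zero>\<^sub>A \<otimes>\<^sub>A x = \<zero>\<^sub>A"
  using mult_smult_left[OF R.zero_closed x x] x mult_closed mult_smult_left[OF R.zero_closed M.zero_closed x] by simp
 show "x \<otimes>\<^sub>A \<zero>\<^sub>A = \<zero>\<^sub>A"
  using x mult_closed mult_smult_right[OF R.zero_closed x M.zero_closed] by simp
qed

lemma (in nonunital_algebra) mult_neg: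
 "x :. A ==> y :. A ==> (\<ominus>\<^sub>A x) \<otimes>\<^sub>A y = \<ominus>\<^sub>A (x \<otimes>\<^sub>A y)"
 "x :. A ==> y :. A ==> x \<otimes>\<^sub>A (\<ominus>\<^sub>A y) = \<ominus>\<^sub>A (x \<otimes>\<^sub>A y)"
proof -
 assume x: "x :. A" and y: "y :. A"
 have "(\<ominus>\<^sub>A x) \<otimes>\<^sub>A y \<oplus>\<^sub>A x \<otimes>\<^sub>A y = \<zero>\<^sub>A"
  using mult_add_left[of "\<ominus>\<^sub>A x" x y] x y by (simp add: M.l_neg mult_zero)
 then show "(\<ominus>\<^sub>A x) \<otimes>\<^sub>A y = \<ominus>\<^sub>A (x \<otimes>\<^sub>A y)"
  using M.minus_equality[of "(\<ominus>\<^sub>A x) \<otimes>\<^sub>A y" "x \<otimes>\<^sub>A y"] x y by (simp add: mult_closed)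
 have "x \<otimes>\<^sub>A (\<ominus>\<^sub>A y) \<oplus>\<^sub>A x \<otimes>\<^sub>A y = \<zero>\<^sub>A"
  using mult_add_right[of x "\<ominus>\<^sub>A y" y] x y by (simp add: M.l_neg mult_zero)
 then show "x \<otimes>\<^sub>A (\<ominus>\<^sub>A y) = \<ominus>\<^sub>A (x \<otimes>\<^sub>A y)"
  using M.minus_equality[of "x \<otimes>\<^sub>A (\<ominus>\<^sub>A y)" "x \<otimes>\<^sub>A y"] x y by (simp add: mult_closed)
qed

lemma (in abelian_group) signed_closed: "x :. G ==> signed G k x :. G"
 by (simp add: signed_def)

lemma lin_signed: "module R P ==> lin R M P f ==> lin R M P (%x. signed P k (f x))"
 by (cases "even k") (auto simp: signed_def intro: lin_uminus)

lemma (in abelian_group) finsum_shift: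
 assumes "!!j. j : {1..<Suc n} ==> f j :. G" and "n \<ge> 1"
 shows "finsum G f {1..<Suc n} = f 1 \<oplus> finsum G (%k. f (Suc k)) {1..<n}"
proof -
 have eq: "{1..<Suc n} = insert 1 (Suc ` {1..<n})"
  using assms(2) by (auto simp: image_iff)
 have "finsum G f {1..<Suc n} = f 1 \<oplus> finsum G f (Suc ` {1..<n})"
  unfolding eq using assms by (intro finsum_insert) auto
 also have "finsum G f (Suc ` {1..<n}) = finsum G (%k. f (Suc k)) {1..<n}"
  using assms by (intro finsum_reindex) auto
 finally show ?thesis .
qed

section \<open>The differential and its contraction\<close>

definition word_degree :: "'m list list => int" where
 "word_degree ws = (\<Sum>w\<leftarrow>ws. 1 - int (length w))"

lemma word_degree_simps:
 "word_degree [[a]] = 0" "word_degree ([a] # ws) = word_degree ws"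
 "word_degree ((a # w) # ws) = word_degree (w # ws) - 1"
 "word_degree (us @ vs) = word_degree us + word_degree vs"
 "word_degree [w] = 1 - int (length w)"
 by (simp_all add: word_degree_def)

lemma word_degree_nonpos: "ws : nonempty_words (nonempty_words C) ==> word_degree ws \<le> 0"
 by (induction rule: nested_induct) (simp_all add: word_degree_def)

fun word_prod where
 "word_prod X g [] = undefined"
| "word_prod X g (w # ws) = (if ws = [] then g w else g w \<otimes>\<^sub>X word_prod X g ws)"

context word_algebra begin

abbreviation mulM (infixl \<open>\<bullet>\<close> 70) where "a \<bullet> b == a \<otimes>\<^sub>M b"
abbreviation mulX (infixl \<open>\<star>\<close> 70) where "x \<star> y == x \<otimes>\<^sub>X y"
abbreviation plX (infixl \<open>\<^bold>+\<close> 65) where "x \<^bold>+ y == x \<oplus>\<^sub>X y"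
abbreviation neX (\<open>\<^bold>- _\<close> [81] 80) where "\<^bold>- x == \<ominus>\<^sub>X x"

definition "bil N P A \<longleftrightarrow> (\<forall>a\<in>carrier M. lin S N P (A a)) \<and> (\<forall>y\<in>carrier N. lin S M P (%a. A a y))"

lemma bilI: "(!!a. a :. M ==> lin S N P (A a)) ==> (!!y. y :. N ==> lin S M P (%a. A a y)) ==> bil N P A"
 by (simp add: bil_def)

lemma bilD: "bil N P A ==> a :. M ==> lin S N P (A a)"
 "bil N P A ==> y :. N ==> lin S M P (%a. A a y)"
 by (simp_all add: bil_def)

lemma bil_closed: "bil N P A ==> a :. M ==> y :. N ==> A a y :. P"
 by (rule lin_closed[OF bilD(1)])

lemma bil_plus:
 assumes P: "module S P" and A: "bil N P A" and B: "bil N P B"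
 shows "bil N P (%a y. A a y \<oplus>\<^sub>P B a y)"
 by (rule bilI; rule lin_plus[OF P bilD(1)[OF A] bilD(1)[OF B]] lin_plus[OF P bilD(2)[OF A] bilD(2)[OF B]])

lemma bil_neg:
 assumes P: "module S P" and A: "bil N P A" shows "bil N P (%a y. \<ominus>\<^sub>P A a y)"
 by (rule bilI; rule lin_uminus[OF P bilD(1)[OF A]] lin_uminus[OF P bilD(2)[OF A]])

lemma bil_comp1:
 assumes A: "bil N P A" and f: "lin S M M \<phi>" shows "bil N P (%a y. A (\<phi> a) y)"
 by (rule bilI; rule bilD(1)[OF A lin_closed[OF f]] lin_comp[OF f bilD(2)[OF A]])

lemma bil_comp2:
 assumes A: "bil N P A" and f: "lin S N' N \<psi>" shows "bil N' P (%a y. A a (\<psi> y))"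
 by (rule bilI; rule bilD(2)[OF A lin_closed[OF f]] lin_comp[OF f bilD(1)[OF A]])

lemma bil_u: "bil X X (%a y. i a \<star> y)"
 by (intro bilI X_mult_lin i_closed lin_comp[OF i_lin X_mult_lin(1)])

lemma bil_v: "bil X X v"
 by (intro bilI v_lin v_lin1)

lemma joint_plus:
 assumes P: "module S P" and A: "bil X P A" and B: "bil P P B"
 shows "joint P (%a y z. A a y \<oplus>\<^sub>P B a z)"
proof -
 interpret P: module S P by fact
 note c = bil_closed[OF A] bil_closed[OF B]
 show ?thesis unfolding joint_def
  by (auto simp: c lin_add[OF bilD(1)[OF A]] lin_add[OF bilD(1)[OF B]] P.M.a_ac P.smult_r_distr
    lin_smult[OF bilD(1)[OF A]] lin_smult[OF bilD(1)[OF B]]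
    intro!: lin_plus[OF P] bilD(2)[OF A] bilD(2)[OF B])
qed

lemma joint_left:
 assumes A: "bil X P A" shows "joint P (%a y z. A a y)"
 unfolding joint_def
 by (auto simp: bil_closed[OF A] lin_add[OF bilD(1)[OF A]] lin_smult[OF bilD(1)[OF A]] intro!: bilD(2)[OF A])

lemma joint_right:
 assumes B: "bil P P B" shows "joint P (%a y z. B a z)"
 unfolding joint_def
 by (auto simp: bil_closed[OF B] lin_add[OF bilD(1)[OF B]] lin_smult[OF bilD(1)[OF B]] intro!: bilD(2)[OF B])

section \<open>Left multiplication of the first letter, and the differential\<close>

lemmas Xm = X.module_axioms
lemmas Xcl = X.mult_closed i_closed v_closed M.mult_closed

text \<open>Multiplies the first letter of the first generator by \<open>b\<close> from the left. It
  is the contribution to the differential of \<open>[b|a1|...]\<close> that merges \<open>b\<close>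
  with \<open>a1\<close>.\<close>

definition "mm b = (SOME h. lin S X X h \<and> (\<forall>a\<in>carrier M. h (i a) = i (b \<bullet> a)) \<and>
  (\<forall>a\<in>carrier M. \<forall>y\<in>carrier X. h (i a \<star> y) = i (b \<bullet> a) \<star> y) \<and>
  (\<forall>a\<in>carrier M. \<forall>y\<in>carrier X. h (v a y) = v (b \<bullet> a) y))"

lemma mm:
 assumes b: "b :. M"
 shows mm_lin: "lin S X X (mm b)" and mm_i: "!!a. a :. M ==> mm b (i a) = i (b \<bullet> a)"
  and mm_u: "!!a y. a :. M ==> y :. X ==> mm b (i a \<star> y) = i (b \<bullet> a) \<star> y"
  and mm_v: "!!a y. a :. M ==> y :. X ==> mm b (v a y) = v (b \<bullet> a) y"
 using someI_ex[OF structural_rec[OF Xm lift_X lin_comp[OF M_mult_lin(2)[OF b] i_lin]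
   joint_left[OF bil_comp1[OF bil_u M_mult_lin(2)[OF b]]] joint_left[OF bil_comp1[OF bil_v M_mult_lin(2)[OF b]]]],
   folded mm_def] by simp_all

lemma mm_closed: "b :. M ==> y :. X ==> mm b y :. X"
 by (rule lin_closed[OF mm_lin])

lemma bil_mm: "bil X X mm"
proof (intro bilI mm_lin linI)
 fix y b assume y: "y :. X" and b: "b :. M"
 show "mm b y :. X" by (rule mm_closed[OF b y])
 show "mm (b \<oplus>\<^sub>M c) y = mm b y \<^bold>+ mm c y" if c: "c :. M" for c
  using y Xm mm_lin[OF M.M.a_closed[OF b c]] lin_plus[OF Xm mm_lin[OF b] mm_lin[OF c]]
  by (induction rule: X_struct_induct)
    (use b c in \<open>simp_all add: mm_i mm_u mm_v Xcl M.mult_add_left lin_add[OF i_lin] X.mult_add_left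
     lin_add[OF v_lin1]\<close>)
 show "mm (r \<odot>\<^sub>M b) y = r \<odot>\<^sub>X mm b y" if r: "r :. S" for r
  using y Xm mm_lin[OF M.smult_closed[OF r b]] lin_scaled[OF Xm mm_lin[OF b] r]
  by (induction rule: X_struct_induct)
    (use b r in \<open>simp_all add: mm_i mm_u mm_v Xcl M.mult_smult_left lin_smult[OF i_lin] X.mult_smult_left
     lin_smult[OF v_lin1]\<close>)
qed

lemma mm_mm:
 assumes b: "b :. M" and a: "a :. M" and y: "y :. X"
 shows "mm b (mm a y) = mm (b \<bullet> a) y"
 using y Xm lin_comp[OF mm_lin[OF a] mm_lin[OF b]] mm_lin[OF M.mult_closed[OF b a]]
 by (induction rule: X_struct_induct) (use a b in \<open>simp_all add: mm_i mm_u mm_v Xcl M.mult_assoc\<close>)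

lemma v_mult:
 assumes a: "a :. M" and y: "y :. X" and z: "z :. X"
 shows "v a (y \<star> z) = v a y \<star> z"
proof (rule X_lin_ext[OF Xm lin_comp[OF X_mult_lin(2)[OF y] v_lin[OF a]] X_mult_lin(2)[OF v_closed[OF a y]] _ z])
 fix us assume us: "us : NW M"
 show "v a (y \<star> W us) = v a y \<star> W us"
 proof (rule X_lin_ext[OF Xm lin_comp[OF X_mult_lin(1) v_lin[OF a]] lin_comp[OF v_lin[OF a] X_mult_lin(1)] _ y])
  fix ws assume ws: "ws : NW M"
  obtain w vs where wv: "ws = w # vs" using ws by (cases ws) (auto simp: words_def)
  have n: "w # vs @ us : NW M" "w # vs : NW M" "(a # w) # vs : NW M" using us ws a by (auto simp: wv words_def)
  show "v a (W ws \<star> W us) = v a (W ws) \<star> W us"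
   using n us a W_append[of "w # vs" us] W_append[of "(a # w) # vs" us] W_bar[OF a n(1)] W_bar[OF a n(2)] by (simp add: wv)
 qed (use us W_closed in auto)
qed

lemma mm_mult:
 assumes a: "a :. M" and y: "y :. X" and z: "z :. X"
 shows "mm a (y \<star> z) = mm a y \<star> z"
 using y Xm lin_comp[OF X_mult_lin(1)[OF z] mm_lin[OF a]] lin_comp[OF mm_lin[OF a] X_mult_lin(1)[OF z]]
 by (induction rule: X_struct_induct)
   (use a z in \<open>simp_all add: mm_i mm_u mm_v Xcl X.mult_assoc v_mult[symmetric]\<close>)

lemma mm_W: "b :. M ==> (a # w) # ws : NW M ==> mm b (W ((a # w) # ws)) = W (((b \<bullet> a) # w) # ws)"
proof -
 assume b: "b :. M" and w: "(a # w) # ws : NW M"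
 then have a: "a :. M" by (auto simp: words_def)
 show ?thesis
 proof (cases "w = []")
  case False
  then have "w # ws : NW M" using w by (auto simp: words_def)
  then show ?thesis using a b by (simp add: W_bar mm_v W_closed M.mult_closed)
 next
  case t: True
  show ?thesis
  proof (cases "ws = []")
   case True
   then show ?thesis using a b t by (simp add: i_def[symmetric] mm_i)
  next
   case False
   then have "ws : NW M" using w by (auto simp: words_def)
   then show ?thesis using a b t by (simp add: W_tensor mm_u W_closed M.mult_closed)
  qed
 qed
qed

text \<open>The clause for \<open>v a\<close> is the formula for the differential with its terms
  \<open>j = 1\<close> split off: cutting behind \<open>a\<close> gives \<open>i a \<star> y\<close>
  with a minus sign, merging \<open>a\<close> with the next letter gives \<open>mm a y\<close>, and
  in all other terms the index, hence the sign, is shifted by one. The tensor clause has no sign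
  because \<open>i a\<close> is a cycle of degree 0.\<close>

definition "D = (SOME h. lin S X X h \<and> (\<forall>a\<in>carrier M. h (i a) = \<zero>\<^sub>X) \<and>
  (\<forall>a\<in>carrier M. \<forall>y\<in>carrier X. h (i a \<star> y) = i a \<star> h y) \<and>
  (\<forall>a\<in>carrier M. \<forall>y\<in>carrier X. h (v a y) = (\<^bold>- (i a \<star> y) \<^bold>+ mm a y) \<^bold>+ \<^bold>- v a (h y)))"

lemma D: shows D_lin: "lin S X X D" and D_i: "a :. M ==> D (i a) = \<zero>\<^sub>X"
 and D_u: "a :. M ==> y :. X ==> D (i a \<star> y) = i a \<star> D y"
 and D_v: "a :. M ==> y :. X ==> D (v a y) = (\<^bold>- (i a \<star> y) \<^bold>+ mm a y) \<^bold>+ \<^bold>- v a (D y)"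
 using someI_ex[OF structural_rec[OF Xm lift_X lin_const_zero[OF Xm] joint_right[OF bil_u]
   joint_plus[OF Xm bil_plus[OF Xm bil_neg[OF Xm bil_u] bil_mm] bil_neg[OF Xm bil_v]]], folded D_def] by simp_all

lemma D_closed: "y :. X ==> D y :. X"
 by (rule lin_closed[OF D_lin])

lemmas Xcl2 = Xcl mm_closed D_closed
lemmas Xneg = lin_neg[OF Xm Xm] lin_zero[OF Xm Xm]

text \<open>Associativity of \<open>M\<close> enters here, through \<open>mm_mm\<close> in the bar
  case; it is what makes \<open>D\<close> square to zero.\<close>

lemma D_mm:
 assumes a: "a :. M" and y: "y :. X"
 shows "D (mm a y) = mm a (D y)"
 using y Xm lin_comp[OF mm_lin[OF a] D_lin] lin_comp[OF D_lin mm_lin[OF a]]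
proof (induction rule: X_struct_induct)
 case (one b)
 then show ?case using a by (simp add: mm_i D_i Xcl2 Xneg[OF mm_lin])
next
 case (tensor b y)
 then show ?case using a by (simp add: mm_u D_u Xcl2)
next
 case (bar b y)
 then show ?case using a by (simp add: mm_v mm_u D_v Xcl2 lin_add[OF mm_lin] Xneg[OF mm_lin] mm_mm)
qed

text \<open>In the bar case the images of \<open>i a \<star> y\<close> and \<open>mm a y\<close>
  cancel against the first two terms of \<open>D (v a (D y))\<close>, since \<open>D\<close>
  commutes with both operations; \<open>v a (D (D y))\<close> remains and vanishes by
  induction.\<close>

lemma D_D:
 assumes y: "y :. X" shows "D (D y) = \<zero>\<^sub>X"
 using y Xm lin_comp[OF D_lin D_lin] lin_const_zero[OF Xm]
proof (induction rule: X_struct_induct)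
 case (one a)
 then show ?case by (simp add: D_i Xneg[OF D_lin])
next
 case (tensor a y)
 then show ?case by (simp add: D_u Xcl2 X.mult_zero)
next
 case (bar a y)
 then show ?case by (simp add: D_v D_u D_mm Xcl2 lin_add[OF D_lin] Xneg[OF D_lin] Xneg[OF v_lin] X.ab_simps)
qed

section \<open>The grading and the Leibniz rule\<close>

abbreviation "deg == word_degree"
definition "gr k = gen X {W ws | ws. ws : NW M \<and> deg ws = k}"

lemma gr_sub: "{W ws | ws. ws : NW M \<and> deg ws = k} \<subseteq> carrier X"
 using W_closed by auto

lemmas gr_closed = span_closed[OF X.M.abelian_group_axioms gr_sub, folded gr_def]

lemma gr_W: "ws : NW M ==> W ws : gr (deg ws)"
 unfolding gr_def by (rule span_base) auto

lemma gr_i: "a :. M ==> i a : gr 0"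
 using gr_W[of "[[a]]"] by (simp add: i_def word_degree_def words_def)

lemma gr_map:
 assumes "lin S X X f" "!!ws. ws : NW M ==> deg ws = k ==> f (W ws) : gr l" "y : gr k"
 shows "f y : gr l"
 unfolding gr_def
 by (rule additive_image_span[OF X.M.abelian_group_axioms X.M.abelian_group_axioms lin_additive[OF assms(1)] gr_sub gr_sub])
   (use assms(2,3) in \<open>auto simp: gr_def\<close>)

lemma gr_lin_ext:
 assumes "module S P" "lin S X P f" "lin S X P g" "!!ws. ws : NW M ==> deg ws = k ==> f (W ws) = g (W ws)" "y : gr k"
 shows "f y = g y"
 by (rule additive_span_ext[OF X.M.abelian_group_axioms mod_group[OF assms(1)]
   lin_additive[OF assms(2)] lin_additive[OF assms(3)] gr_sub]) (use assms(4,5) gr_def in auto)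

lemma gr_mult: assumes "y : gr k" "z : gr l" shows "y \<star> z : gr (k + l)"
proof (rule gr_map[OF X_mult_lin(1) _ assms(1)])
 show z: "z :. X" using assms gr_closed(1) by blast
 fix ws assume ws: "ws : NW M" "deg ws = k"
 show "W ws \<star> z : gr (k + l)"
 proof (rule gr_map[OF X_mult_lin(2) _ assms(2)])
  show "W ws :. X" using W_closed ws by simp
  fix us assume us: "us : NW M" "deg us = l"
  have "ws @ us : NW M" using us ws by (auto simp: words_def)
  then show "W ws \<star> W us : gr (k + l)"
   using gr_W[of "ws @ us"] us ws by (simp add: W_append word_degree_simps(4))
 qed
qed

lemma gr_u: "a :. M ==> y : gr k ==> i a \<star> y : gr k"
 using gr_mult[OF gr_i] by fastforce

lemma gr_v: assumes a: "a :. M" and "y : gr k" shows "v a y : gr (k - 1)"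
proof (rule gr_map[OF v_lin[OF a] _ assms(2)])
 fix ws assume ws: "ws : NW M" "deg ws = k"
 obtain w vs where wv: "ws = w # vs" using ws by (cases ws) (auto simp: words_def)
 have "(a # w) # vs : NW M" using ws a by (auto simp: wv words_def)
 then show "v a (W ws) : gr (k - 1)"
  using gr_W[of "(a # w) # vs"] ws a by (simp add: wv W_bar word_degree_simps(3))
qed

lemma gr_mm: assumes a: "a :. M" and "y : gr k" shows "mm a y : gr k"
proof (rule gr_map[OF mm_lin[OF a] _ assms(2)])
 fix ws assume ws: "ws : NW M" "deg ws = k"
 obtain b w vs where wv: "ws = (b # w) # vs"
  using ws by (cases ws; cases "hd ws") (auto simp: words_def)
 have "((a \<bullet> b) # w) # vs : NW M" using ws a by (auto simp: wv words_def M.mult_closed)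
 then show "mm a (W ws) : gr k"
  using gr_W[of "((a \<bullet> b) # w) # vs"] ws a by (simp add: wv mm_W word_degree_def)
qed

lemma gr_zero: assumes "k > 0" shows "gr k = {\<zero>\<^sub>X}"
proof -
 have "{W ws | ws. ws : NW M \<and> deg ws = k} = {}" using word_degree_nonpos assms by force
 then show ?thesis unfolding gr_def using X.add.generate_empty by (simp only: ring_record_simps monoid.simps)
qed

lemma D_W: "ws : NW M ==> D (W ws) : gr (deg ws + 1)"
proof (induction rule: nested_induct)
 case (one a)
 then show ?case using gr_closed(2) by (simp add: i_def[symmetric] D_i)
next
 case (tensor a ws)
 then show ?case using gr_u by (simp add: W_tensor D_u W_closed word_degree_simps(2))
next
 case (bar a w ws)
 then show ?case
  using gr_v[OF bar(1,3)] gr_u[OF bar(1) gr_W[OF bar(2)]] gr_mm[OF bar(1) gr_W[OF bar(2)]] gr_closed(3,4)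
  by (simp add: W_bar D_v W_closed word_degree_simps(3))
qed

lemma D_gr: "y : gr k ==> D y : gr (k + 1)"
 by (rule gr_map[OF D_lin]) (use D_W in auto)

lemma signed_mult:
 "x :. X ==> y :. X ==> x \<star> signed X k y = signed X k (x \<star> y)"
 "x :. X ==> y :. X ==> signed X k x \<star> y = signed X k (x \<star> y)"
 by (simp_all add: signed_def X.mult_neg)

lemma D_leibniz_W:
 assumes "ws : NW M" and z: "z :. X"
 shows "D (W ws \<star> z) = D (W ws) \<star> z \<^bold>+ signed X (deg ws) (W ws \<star> D z)"
 using assms(1)
proof (induction rule: nested_induct)
 case (one a)
 then show ?case using z by (simp add: i_def[symmetric] D_i D_u Xcl2 X.mult_zero word_degree_def signed_def)
next
 case (tensor a ws)
 then show ?case using z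
  by (simp add: W_tensor D_u Xcl2 W_closed word_degree_simps(2) X.mult_assoc X.mult_add_right signed_mult X.signed_closed)
next
 case (bar a w ws)
 note cl = W_closed[OF bar(2)] z bar(1)
 have "D (W ((a # w) # ws) \<star> z) = D (v a (W (w # ws) \<star> z))"
  using bar z by (simp add: W_bar v_mult W_closed)
 also have "\<dots> = (\<^bold>- (i a \<star> (W (w # ws) \<star> z)) \<^bold>+ mm a (W (w # ws) \<star> z)) \<^bold>+
   \<^bold>- v a (D (W (w # ws)) \<star> z \<^bold>+ signed X (deg (w # ws)) (W (w # ws) \<star> D z))"
  using cl by (simp add: D_v Xcl2 bar(3))
 also have "\<dots> = D (W ((a # w) # ws)) \<star> z \<^bold>+ signed X (deg ((a # w) # ws)) (W ((a # w) # ws) \<star> D z)"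
  using cl by (simp add: W_bar[OF bar(1,2)] D_v Xcl2 X.mult_add_left X.mult_neg mm_mult v_mult lin_add[OF v_lin] Xneg[OF v_lin]
    X.signed_closed X.mult_assoc word_degree_simps(3) signed_def X.ab_simps)
 finally show ?case .
qed

lemma D_leibniz:
 assumes y: "y : gr k" and z: "z :. X"
 shows "D (y \<star> z) = D y \<star> z \<^bold>+ signed X k (y \<star> D z)"
 by (rule gr_lin_ext[OF Xm lin_comp[OF X_mult_lin(1)[OF z] D_lin]
    lin_plus[OF Xm lin_comp[OF D_lin X_mult_lin(1)[OF z]] lin_signed[OF Xm X_mult_lin(1)[OF D_closed[OF z]]]] _ y])
   (use D_leibniz_W z in auto)

text \<open>The Leibniz rule reduces a word to its first generator and the rest. This is the
  uniqueness behind the definite description of \<open>omega_diff\<close>.\<close>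

lemma odd_derivations_eq:
 assumes d: "d : odd_derivations S X gr" and d': "d' : odd_derivations S X gr"
  and eq: "!!w. w : nonempty_words (carrier M) ==> d (W [w]) = d' (W [w])"
 shows "d = d'"
proof -
 have l: "lin S X X d" "lin S X X d'" and e: "d : extensional (carrier X)" "d' : extensional (carrier X)"
  using d d' by (auto simp: odd_derivations_def maps_iff)
 have "d (W ws) = d' (W ws)" if "ws : NW M" for ws
  using that
 proof (induction ws rule: list.induct)
  case Nil
  then show ?case by (simp add: words_def)
 next
  case (Cons w ws)
  then have w: "w : nonempty_words (carrier M)" by (simp add: words_def)
  show ?case
  proof (cases "ws = []")
   case True
   then show ?thesis using eq[OF w] by simp
  next
   case False
   then have ws: "ws : NW M" and w1: "[w] : NW M" using Cons.prems by (auto simp: words_def)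
   have "W (w # ws) = W [w] \<star> W ws" using W_append[OF w1 ws] by simp
   then show ?thesis using d d' gr_W[OF w1] W_closed[OF ws] eq[OF w] Cons.IH[OF ws]
    by (simp add: odd_derivations_def)
  qed
 qed
 then have "d y = d' y" if "y :. X" for y by (rule X_lin_ext[OF Xm l _ that])
 then show ?thesis using e by (intro extensionalityI) auto
qed

lemma D_odd_derivation: "restrict D (carrier X) : odd_derivations S X gr"
 using lin_restrict[OF Xm D_lin] D_gr gr_closed(1) D_leibniz X.mult_closed
 by (auto simp: odd_derivations_def image_subset_iff subset_iff)

text \<open>By induction on the letters: \<open>finsum_shift\<close> detaches \<open>j = 1\<close>,
  giving the terms with \<open>i a \<star> W [w]\<close> and \<open>mm a (W [w])\<close>, and the
  other terms are \<open>v a\<close> applied to those for \<open>w\<close>, with opposite sign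
  because \<open>j\<close> has grown by one.\<close>

lemma D_word:
 assumes "w : nonempty_words (carrier M)"
 shows "D (W [w]) =
  (\<Oplus>\<^bsub>X\<^esub>j\<in>{1..<length w}. signed X (int j) (W [take j w, drop j w])) \<^bold>+
  (\<Oplus>\<^bsub>X\<^esub>j\<in>{1..<length w}. signed X (int j - 1) (W [take (j - 1) w @ (w ! (j - 1) \<bullet> w ! j) # drop (j + 1) w]))"
proof -
 from assms have "w \<noteq> []" "set w \<subseteq> carrier M" by (auto simp: words_def)
 then show ?thesis
 proof (induction w rule: list_nonempty_induct)
  case (single a)
  then show ?case by (simp add: i_def[symmetric] D_i)
 next
  case (cons a w)
  let ?s = "%w j. signed X (int j) (W [take j w, drop j w])"
  let ?t = "%w j. signed X (int j - 1) (W [take (j - 1) w @ (w ! (j - 1) \<bullet> w ! j) # drop (j + 1) w])"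
  from cons have a: "a :. M" and sw: "set w \<subseteq> carrier M" and w: "w \<noteq> []" by auto
  have w1: "[w] : NW M" using sw w by (simp add: words_def)
  have nth: "w ! j :. M" if "j < length w" for j using that sw by (meson nth_mem subsetD)
  have nws: "[take j u, drop j u] : NW M" if "set u \<subseteq> carrier M" "j : {1..<length u}" for u j
   using that set_take_subset[of j u] set_drop_subset[of j u] by (auto simp: words_def)
  have nwt: "[take (j - 1) u @ (u ! (j - 1) \<bullet> u ! j) # drop (j + 1) u] : NW M" if "set u \<subseteq> carrier M" "j : {1..<length u}" for u j
  proof -
   have "u ! (j - 1) :. M" "u ! j :. M" using that by (auto intro!: subsetD[OF that(1)])
   then show ?thesis using that set_take_subset[of "j - 1" u] set_drop_subset[of "j + 1" u]
    by (auto simp: words_def M.mult_closed)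
  qed
  have sc: "?s u j :. X" if "set u \<subseteq> carrier M" "j : {1..<length u}" for u j
   by (rule X.signed_closed[OF W_closed[OF nws[OF that]]])
  have tc: "?t u j :. X" if "set u \<subseteq> carrier M" "j : {1..<length u}" for u j
   by (rule X.signed_closed[OF W_closed[OF nwt[OF that]]])
  have saw: "set (a # w) \<subseteq> carrier M" using a sw by simp
  have len: "{1..<length (a # w)} = {1..<Suc (length w)}" by simp
  have n1: "length w \<ge> 1" using w by (cases w) auto
  have vs: "lin S X X (%y. \<^bold>- v a y)" by (rule lin_uminus[OF Xm v_lin[OF a]])
  have s1: "finsum X (?s (a # w)) {1..<length (a # w)} = \<^bold>- (i a \<star> W [w]) \<^bold>+ \<^bold>- v a (finsum X (?s w) {1..<length w})"
  proof -
   have "finsum X (?s (a # w)) {1..<length (a # w)} = ?s (a # w) 1 \<^bold>+ finsum X (%k. ?s (a # w) (Suc k)) {1..<length w}"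
    unfolding len by (rule X.finsum_shift[OF _ n1]) (use sc[OF saw] in auto)
   also have "?s (a # w) 1 = \<^bold>- (i a \<star> W [w])" using W_tensor[OF a w1] by (simp add: signed_def)
   also have "finsum X (%k. ?s (a # w) (Suc k)) {1..<length w} = finsum X (%k. \<^bold>- v a (?s w k)) {1..<length w}"
   proof (rule X.finsum_cong')
    fix k assume k: "k : {1..<length w}"
    show "?s (a # w) (Suc k) = \<^bold>- v a (?s w k)"
     using W_bar[OF a nws[OF sw k]] W_closed[OF nws[OF sw k]] a
     by (simp add: signed_def Xneg[OF v_lin] Xcl X.minus_minus)
   qed (use sc[OF sw] a Xcl in auto)
   also have "\<dots> = \<^bold>- v a (finsum X (?s w) {1..<length w})"
    by (rule lin_finsum[OF Xm Xm vs, symmetric]) (use sc[OF sw] in auto)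
   finally show ?thesis .
  qed
  have t1: "finsum X (?t (a # w)) {1..<length (a # w)} = mm a (W [w]) \<^bold>+ \<^bold>- v a (finsum X (?t w) {1..<length w})"
  proof -
   have "finsum X (?t (a # w)) {1..<length (a # w)} = ?t (a # w) 1 \<^bold>+ finsum X (%k. ?t (a # w) (Suc k)) {1..<length w}"
    unfolding len by (rule X.finsum_shift[OF _ n1]) (use tc[OF saw] in auto)
   also have "?t (a # w) 1 = mm a (W [w])"
    using w w1 a by (cases w) (simp_all add: signed_def mm_W)
   also have "finsum X (%k. ?t (a # w) (Suc k)) {1..<length w} = finsum X (%k. \<^bold>- v a (?t w k)) {1..<length w}"
   proof (rule X.finsum_cong')
    fix k assume k: "k : {1..<length w}"
    \<comment> \<open>Truncated subtraction: with \<open>k\<close> written as a successor,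
      \<open>k - 1\<close> and \<open>Suc k - 1\<close> simplify inside \<open>take\<close> and the
      list lookup.\<close>
    then obtain l where l: "k = Suc l" by (cases k) auto
    show "?t (a # w) (Suc k) = \<^bold>- v a (?t w k)"
     using W_bar[OF a nwt[OF sw k]] W_closed[OF nwt[OF sw k]] a l
     by (simp add: signed_def Xneg[OF v_lin] Xcl X.minus_minus)
   qed (use tc[OF sw] a Xcl in auto)
   also have "\<dots> = \<^bold>- v a (finsum X (?t w) {1..<length w})"
    by (rule lin_finsum[OF Xm Xm vs, symmetric]) (use tc[OF sw] in auto)
   finally show ?thesis .
  qed
  have c: "finsum X (?s w) {1..<length w} :. X" "finsum X (?t w) {1..<length w} :. X"
   using sc[OF sw] tc[OF sw] by (auto intro!: X.finsum_closed)
  have "D (W [a # w]) = (\<^bold>- (i a \<star> W [w]) \<^bold>+ mm a (W [w])) \<^bold>+ \<^bold>- v a (D (W [w]))"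
   using a w1 W_bar[OF a w1] by (simp add: D_v W_closed)
  also have "\<dots> = finsum X (?s (a # w)) {1..<length (a # w)} \<^bold>+ finsum X (?t (a # w)) {1..<length (a # w)}"
   unfolding s1 t1 cons.IH[OF sw] using a w1 W_closed[OF w1] c
   by (simp add: lin_add[OF v_lin] Xcl2 X.ab_simps)
  finally show ?case .
 qed
qed

section \<open>The augmentation onto the algebra\<close>

definition "p = (SOME h. lin S X M h \<and> (\<forall>a\<in>carrier M. h (i a) = a) \<and>
  (\<forall>a\<in>carrier M. \<forall>y\<in>carrier X. h (i a \<star> y) = a \<bullet> h y) \<and>
  (\<forall>a\<in>carrier M. \<forall>y\<in>carrier X. h (v a y) = \<zero>\<^sub>M))"

text \<open>\<open>p\<close> multiplies out words of one-letter generators; the zero on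
  \<open>v a y\<close> makes it kill each word that has a generator with at least two
  letters.\<close>

lemma p: shows p_lin: "lin S X M p" and p_i: "a :. M ==> p (i a) = a"
 and p_u: "a :. M ==> y :. X ==> p (i a \<star> y) = a \<bullet> p y"
 and p_v: "a :. M ==> y :. X ==> p (v a y) = \<zero>\<^sub>M"
proof -
 have 1: "bil M M (%a y. a \<bullet> y)" by (intro bilI M_mult_lin)
 have 2: "bil M M (%a y. \<zero>\<^sub>M)" by (intro bilI lin_const_zero M.module_axioms)
 show "lin S X M p" "a :. M ==> p (i a) = a"
  "a :. M ==> y :. X ==> p (i a \<star> y) = a \<bullet> p y"
  "a :. M ==> y :. X ==> p (v a y) = \<zero>\<^sub>M"
  using someI_ex[OF structural_rec[OF M.module_axioms lift_M lin_id joint_right[OF 1] joint_right[OF 2]], folded p_def]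
  by simp_all
qed

lemma p_closed: "y :. X ==> p y :. M"
 by (rule lin_closed[OF p_lin])

lemma p_mm:
 assumes a: "a :. M" and y: "y :. X" shows "p (mm a y) = a \<bullet> p y"
 using y M.module_axioms lin_comp[OF mm_lin[OF a] p_lin] lin_comp[OF p_lin M_mult_lin(2)[OF a]]
 by (induction rule: X_struct_induct)
   (use a in \<open>simp_all add: mm_i mm_u mm_v p_i p_u p_v Xcl p_closed M.mult_assoc M.mult_zero\<close>)

lemma p_mult:
 assumes y: "y :. X" and z: "z :. X" shows "p (y \<star> z) = p y \<bullet> p z"
 using y M.module_axioms lin_comp[OF X_mult_lin(1)[OF z] p_lin] lin_comp[OF p_lin M_mult_lin(1)[OF p_closed[OF z]]]
 by (induction rule: X_struct_induct)
   (use z in \<open>simp_all add: p_i p_u p_v Xcl p_closed M.mult_assoc M.mult_zero X.mult_assoc v_mult[symmetric]\<close>)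

text \<open>In the bar case \<open>i a \<star> y\<close> and \<open>mm a y\<close> enter
  \<open>D\<close> with opposite signs and have the same image
  \<open>a \<bullet> p y\<close>.\<close>

lemma p_D:
 assumes y: "y :. X" shows "p (D y) = \<zero>\<^sub>M"
 using y M.module_axioms lin_comp[OF D_lin p_lin] lin_const_zero[OF M.module_axioms]
proof (induction rule: X_struct_induct)
 case (one a)
 then show ?case by (simp add: D_i lin_zero[OF Xm M.module_axioms p_lin])
next
 case (tensor a y)
 then show ?case by (simp add: D_u p_u Xcl2 M.mult_zero)
next
 case (bar a y)
 then show ?case by (simp add: D_v Xcl2 lin_add[OF p_lin] lin_neg[OF Xm M.module_axioms p_lin] p_u p_mm p_v p_closed M.l_neg)
qed

lemma p_gr:
 assumes "y : gr k" "k \<noteq> 0" shows "p y = \<zero>\<^sub>M"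
proof (rule gr_lin_ext[OF M.module_axioms p_lin lin_const_zero[OF M.module_axioms] _ assms(1)])
 fix ws assume "ws : NW M" "deg ws = k"
 then have "ws : NW M" "deg ws \<noteq> 0" using assms(2) by auto
 then show "p (W ws) = \<zero>\<^sub>M"
 proof (induction rule: nested_induct)
  case (one a)
  then show ?case by (simp add: word_degree_def)
 next
  case (tensor a ws)
  then show ?case by (simp add: W_tensor p_u W_closed word_degree_simps(2) M.mult_zero)
 next
  case (bar a w ws)
  then show ?case by (simp add: W_bar p_v W_closed)
 qed
qed

section \<open>The contracting homotopy\<close>

definition "H = (SOME h. lin S X X h \<and> (\<forall>a\<in>carrier M. h (i a) = \<zero>\<^sub>X) \<and>
  (\<forall>a\<in>carrier M. \<forall>y\<in>carrier X. h (i a \<star> y) = \<^bold>- v a (i (p y)) \<^bold>+ i a \<star> h y) \<and>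
  (\<forall>a\<in>carrier M. \<forall>y\<in>carrier X. h (v a y) = \<^bold>- v a (h y)))"

text \<open>\<open>H\<close> replaces the tensor sign behind a leading one-letter generator by a bar
  and multiplies out what follows. The differential of this term,
  \<open>i a \<star> i (p y) - i (a \<bullet> p y)\<close>, is precisely what separates
  \<open>i a\<close> times the homotopy identity for \<open>y\<close> from the identity for
  \<open>i a \<star> y\<close>.\<close>

lemma H: shows H_lin: "lin S X X H" and H_i: "a :. M ==> H (i a) = \<zero>\<^sub>X"
 and H_u: "a :. M ==> y :. X ==> H (i a \<star> y) = \<^bold>- v a (i (p y)) \<^bold>+ i a \<star> H y"
 and H_v: "a :. M ==> y :. X ==> H (v a y) = \<^bold>- v a (H y)"
 using someI_ex[OF structural_rec[OF Xm lift_X lin_const_zero[OF Xm]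
   joint_plus[OF Xm bil_neg[OF Xm bil_comp2[OF bil_v lin_comp[OF p_lin i_lin]]] bil_u]
   joint_right[OF bil_neg[OF Xm bil_v]]], folded H_def] by simp_all

lemma H_closed: "y :. X ==> H y :. X"
 by (rule lin_closed[OF H_lin])

lemmas Xcl3 = Xcl2 p_closed H_closed

lemma H_mm:
 assumes a: "a :. M" and y: "y :. X"
 shows "H (mm a y) = mm a (H y)"
 using y Xm lin_comp[OF mm_lin[OF a] H_lin] lin_comp[OF H_lin mm_lin[OF a]]
 by (induction rule: X_struct_induct)
   (use a in \<open>simp_all add: mm_i mm_u mm_v H_i H_u H_v Xcl3 lin_add[OF mm_lin] Xneg[OF mm_lin]\<close>)

text \<open>Since \<open>H\<close> and \<open>D\<close> commute with left multiplication of the first letter, the homotopy identity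
 can be checked along the structural recursion.\<close>

lemma homotopy:
 assumes y: "y :. X"
 shows "D (H y) \<^bold>+ H (D y) = y \<ominus>\<^sub>X i (p y)"
 using y Xm lin_plus[OF Xm lin_comp[OF H_lin D_lin] lin_comp[OF D_lin H_lin]]
  lin_minus[OF Xm lin_id lin_comp[OF p_lin i_lin]]
proof (induction rule: X_struct_induct)
 case (one a)
 then show ?case by (simp add: H_i D_i p_i Xneg[OF H_lin] Xneg[OF D_lin] i_closed X.ab_simps)
next
 case (tensor a y)
 have cl: "a :. M" "y :. X" using tensor by auto
 have "D (H (i a \<star> y)) \<^bold>+ H (D (i a \<star> y)) =
  (i a \<star> i (p y) \<^bold>+ \<^bold>- i (a \<bullet> p y)) \<^bold>+ i a \<star> (D (H y) \<^bold>+ H (D y))"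
  using cl by (simp add: H_u D_u D_v D_i p_D lin_add[OF D_lin] Xneg[OF D_lin] Xneg[OF v_lin] Xcl3 mm_i
    lin_zero[OF M.module_axioms Xm i_lin] X.mult_add_right X.ab_simps)
 also have "\<dots> = i a \<star> y \<ominus>\<^sub>X i (p (i a \<star> y))"
  unfolding tensor(3) using cl by (simp add: p_u Xcl3 a_minus_def X.mult_add_right X.mult_neg X.ab_simps)
 finally show ?case .
next
 case (bar a y)
 have cl: "a :. M" "y :. X" using bar by auto
 \<comment> \<open>\<open>H\<close> of the term \<open>i a \<star> y\<close> in
   \<open>D (v a y)\<close> leaves \<open>v a (i (p y))\<close>, which restores what the identity
   for \<open>y\<close> subtracts; nothing is subtracted from \<open>v a y\<close> itself, as
   \<open>p (v a y)\<close> is zero.\<close>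
 have "D (H (v a y)) \<^bold>+ H (D (v a y)) = v a (i (p y)) \<^bold>+ v a (D (H y) \<^bold>+ H (D y))"
  using cl by (simp add: H_u H_v D_v H_mm lin_add[OF D_lin] Xneg[OF D_lin] Xneg[OF H_lin] lin_add[OF H_lin] lin_add[OF v_lin] Xcl3
    X.mult_neg X.ab_simps)
 also have "\<dots> = v a y \<ominus>\<^sub>X i (p (v a y))"
  unfolding bar(3) using cl
  by (simp add: p_v Xcl3 a_minus_def lin_add[OF v_lin] Xneg[OF v_lin] lin_zero[OF M.module_axioms Xm i_lin] X.ab_simps)
 finally show ?case .
qed

lemma gr_H: assumes "y : gr k" shows "H y : gr (k - 1)"
proof (rule gr_map[OF H_lin _ assms])
 fix ws assume "ws : NW M" "deg ws = k"
 then have "ws : NW M" by simp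
 then have "H (W ws) : gr (deg ws - 1)"
 proof (induction rule: nested_induct)
  case (one a)
  then show ?case using gr_closed(2) by (simp add: i_def[symmetric] H_i)
 next
  case (tensor a ws)
  \<comment> \<open>This element lies in degree -1 for every \<open>ws\<close>; that is the required
    degree when \<open>deg ws\<close> is 0, and otherwise \<open>p\<close> makes it vanish.\<close>
  have "v a (i (p (W ws))) : gr (deg ws - 1)"
  proof (cases "deg ws = 0")
   case True
   then show ?thesis using gr_v[OF tensor(1) gr_i[OF p_closed[OF W_closed[OF tensor(2)]]]] by simp
  next
   case False
   then show ?thesis using p_gr[OF gr_W[OF tensor(2)]] gr_closed(2) tensor(1)
    by (simp add: lin_zero[OF M.module_axioms Xm i_lin] Xneg[OF v_lin])
  qed
  then show ?case using tensor gr_u gr_closed(3,4) by (simp add: W_tensor H_u W_closed word_degree_simps(2))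
 next
  case (bar a w ws)
  then show ?case using gr_v[OF bar(1,3)] gr_closed(4) by (simp add: W_bar H_v W_closed word_degree_simps(3))
 qed
 then show "H (W ws) : gr (k - 1)" using \<open>deg ws = k\<close> by simp
qed

text \<open>Freeness of \<open>X\<close> on its generators: the product \<open>word_prod\<close> of
  the prescribed values is linear in every letter, hence lifts, and it turns concatenation into
  multiplication.\<close>

lemma algebra_hom_extension:
 assumes g: "multilin S M X g"
 shows "\<exists>h. lin S X X h \<and> (\<forall>w\<in>nonempty_words (carrier M). h (W [w]) = g w) \<and>
  (\<forall>y\<in>carrier X. \<forall>z\<in>carrier X. h (y \<star> z) = h y \<star> h z)"
proof -
 let ?Wd = "nonempty_words (carrier M)"
 note gc = multilin_closed[OF g]
 have cl: "ws \<noteq> [] ==> set ws \<subseteq> ?Wd ==> word_prod X g ws :. X" for ws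
  by (induction ws) (auto simp: gc X.mult_closed)
 have app: "us \<noteq> [] ==> vs \<noteq> [] ==> set us \<subseteq> ?Wd ==> set vs \<subseteq> ?Wd ==>
   word_prod X g (us @ vs) = word_prod X g us \<star> word_prod X g vs" for us vs
  by (induction us) (auto simp: gc cl X.mult_assoc)
 have 1: "lin S M X (%x. word_prod X g ((xs @ x # ys) # vs))"
  if "set vs \<subseteq> ?Wd" "set xs \<subseteq> carrier M" "set ys \<subseteq> carrier M" for xs ys vs
  using lin_comp[OF multilinD[OF g that(2,3)] X_mult_lin(1)[OF cl[OF _ that(1)]]] multilinD[OF g that(2,3)]
  by (cases "vs = []") auto
 have 2: "lin S M X (%x. word_prod X g (us @ (xs @ x # ys) # vs))"
  if "set us \<subseteq> ?Wd" "set vs \<subseteq> ?Wd" "set xs \<subseteq> carrier M" "set ys \<subseteq> carrier M" for us xs ys vs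
  using that(1)
 proof (induction us)
  case Nil
  then show ?case using 1[OF that(2-4)] by simp
 next
  case (Cons u us)
  then have "lin S M X (%x. word_prod X g (us @ (xs @ x # ys) # vs))" and u: "u : ?Wd" by auto
  from lin_comp[OF this(1) X_mult_lin(2)[OF gc[OF u]]] show ?case by simp
 qed
 have "nmultilin S M X (word_prod X g)" unfolding nmultilin_def using 2 by blast
 from lift_X[OF this] obtain h where h: "lin S X X h" "!!ws. ws : NW M ==> h (W ws) = word_prod X g ws"
  by blast
 have hw: "h (W [w]) = g w" if "w : ?Wd" for w using h(2)[of "[w]"] that by (simp add: words_def)
 have hc: "!!y. y :. X ==> h y :. X" by (rule lin_closed[OF h(1)])
 have "h (y \<star> z) = h y \<star> h z" if y: "y :. X" and z: "z :. X" for y z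
 proof (rule X_lin_ext[OF Xm lin_comp[OF X_mult_lin(1)[OF z] h(1)] lin_comp[OF h(1) X_mult_lin(1)[OF hc[OF z]]] _ y])
  fix ws assume ws: "ws : NW M"
  show "h (W ws \<star> z) = h (W ws) \<star> h z"
  proof (rule X_lin_ext[OF Xm lin_comp[OF X_mult_lin(2)[OF W_closed[OF ws]] h(1)]
     lin_comp[OF h(1) X_mult_lin(2)[OF hc[OF W_closed[OF ws]]]] _ z])
   fix us assume us: "us : NW M"
   have wu: "ws @ us : NW M" using us ws by (auto simp: words_def)
   show "h (W ws \<star> W us) = h (W ws) \<star> h (W us)"
    using app[of ws us] ws us by (simp add: W_append[symmetric] h(2)[OF wu] h(2)[OF ws] h(2)[OF us] words_def)
  qed
 qed
 with h(1) hw show ?thesis by blast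
qed

end

section \<open>The canonical resolution and its extension of scalars\<close>

lemma (in scalar_extension) bc_neg: "\<ominus>\<^sub>BC X = \<ominus>\<^sub>T X"
 by (simp add: a_inv_def m_inv_def bc_simps)

lemma (in scalar_extension) lin_map_extension:
 assumes N: "module R N" and f: "lin R M N f"
 shows "base_change_map R M N S f : linear_maps S BC (base_change R N S)"
  and "!!x s. x :. M ==> s :. S ==> base_change_map R M N S f (pure x s) = pure_tensor R N S (f x) s"
proof -
 interpret N: scalar_extension R N S
  using N M.module_axioms N.module_axioms S.algebra_axioms
  by (simp add: scalar_extension_def tensor_modules_def)
 note fc = lin_closed[OF f]
 have b: "balanced N.BC (%x s. N.pure (f x) s)"
  by (rule balancedI) (simp_all add: fc N.bc_pure_closed lin_add[OF f] N.bc_pure_add lin_smult[OF f] N.pure_smult)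
 show "base_change_map R M N S f : linear_maps S BC N.BC"
  unfolding base_change_map_def
  by (rule bc_lift_lin[OF N.bc_module b]) (simp add: N.bc_smult(2) fc)
 show "base_change_map R M N S f (pure x s) = N.pure (f x) s" if "x :. M" "s :. S" for x s
  unfolding base_change_map_def by (rule bc_lift(3)[OF N.bc_group b that])
qed

lemma omega_word_algebra:
 assumes "nonunital_algebra K A"
 shows "word_algebra K A (omega K A) (omega_word K A)"
proof -
 interpret A: nonunital_algebra K A by fact
 interpret t: tensor_alg K A by (simp add: tensor_alg_def A.module_axioms)
 interpret n: nested_tensor_alg K A
  by (simp add: nested_tensor_alg_def tensor_alg_def A.module_axioms t.TA_module)
 interpret O: nonunital_algebra K "omega K A" unfolding omega_def by (rule n.TT.TA_algebra)
 have W: "omega_word K A = (%ws. n.TT.tw (map t.tw ws))" by (rule ext) (simp add: omega_word_def)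
 have X: "omega K A = n.TT.TA" by (simp add: omega_def)
 show ?thesis
 proof (intro word_algebra.intro assms O.nonunital_algebra_axioms word_algebra_axioms.intro)
  show "nmultilin K A (omega K A) (omega_word K A)"
   unfolding W X by (rule n.nested_word_multilin)
  show "omega_word K A (us @ vs) = omega_word K A us \<otimes>\<^bsub>omega K A\<^esub> omega_word K A vs"
   if "us : NW A" "vs : NW A" for us vs
   using n.TT.TA_mult_tw[OF n.nested_word_closed[OF that(1)] n.nested_word_closed[OF that(2)]] by (simp add: W X)
  show "carrier (omega K A) = generate (add_monoid (omega K A)) (omega_word K A ` NW A)"
   unfolding W X by (rule n.nested_word_span)
  show "\<exists>h. lin K (omega K A) (omega K A) h \<and> (\<forall>ws\<in>NW A. h (omega_word K A ws) = g ws)"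
   if "nmultilin K A (omega K A) g" for g
   using n.nested_lift[OF O.module_axioms that] by (simp add: W X)
  show "\<exists>h. lin K (omega K A) A h \<and> (\<forall>ws\<in>NW A. h (omega_word K A ws) = g' ws)"
   if "nmultilin K A A g'" for g'
   using n.nested_lift[OF A.module_axioms that] by (simp add: W X)
 qed
qed

text \<open>Unlike the lifts in \<open>word_algebra\<close> the target is arbitrary; it is applied
  to \<open>B\<close>-modules with scalars restricted to \<open>K\<close>.\<close>

lemma omega_lift:
 assumes A: "nonunital_algebra K A" and P: "module K P" and g: "nmultilin K A P g"
 shows "\<exists>h. lin K (omega K A) P h \<and> (\<forall>ws\<in>NW A. h (omega_word K A ws) = g ws)"
proof -
 interpret A: nonunital_algebra K A by fact
 interpret t: tensor_alg K A by (simp add: tensor_alg_def A.module_axioms)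
 interpret n: nested_tensor_alg K A
  by (simp add: nested_tensor_alg_def tensor_alg_def A.module_axioms t.TA_module)
 show ?thesis using n.nested_lift[OF P g] by (simp add: omega_word_def omega_def)
qed

context word_algebra begin

lemma algebra_homs_eq:
 assumes "module S P" "f : algebra_homs S X P" "g : algebra_homs S X P"
  and eq: "!!w. w : nonempty_words (carrier M) ==> f (W [w]) = g (W [w])"
 shows "f = g"
proof -
 have l: "lin S X P f" "lin S X P g" and e: "f : extensional (carrier X)" "g : extensional (carrier X)"
  using assms by (auto simp: algebra_homs_def maps_iff)
 have "f (W ws) = g (W ws)" if "ws : NW M" for ws
  using that
 proof (induction ws rule: list.induct)
  case Nil
  then show ?case by (simp add: words_def)
 next
  case (Cons w ws)
  then have w: "w : nonempty_words (carrier M)" by (simp add: words_def)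
  show ?case
  proof (cases "ws = []")
   case True
   then show ?thesis using eq[OF w] by simp
  next
   case False
   then have ws: "ws : NW M" and w1: "[w] : NW M" using Cons.prems by (auto simp: words_def)
   have "W (w # ws) = W [w] \<star> W ws" using W_append[OF w1 ws] by simp
   then show ?thesis using assms(2,3) W_closed[OF w1] W_closed[OF ws] eq[OF w] Cons.IH[OF ws]
    by (simp add: algebra_homs_def)
  qed
 qed
 then have "f y = g y" if "y :. X" for y by (rule X_lin_ext[OF assms(1) l _ that])
 then show ?thesis using e by (intro extensionalityI) auto
qed

lemma p_word: "w : nonempty_words (carrier M) ==> p (W [w]) = (if length w = 1 then hd w else \<zero>\<^sub>M)"
proof -
 assume w: "w : nonempty_words (carrier M)"
 then obtain a u where au: "w = a # u" "a :. M" "set u \<subseteq> carrier M"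
  by (cases w) (auto simp: words_def)
 show ?thesis
 proof (cases "u = []")
  case True
  then show ?thesis using au p_i by (simp add: i_def)
 next
  case False
  then have "[u] : NW M" using au by (auto simp: words_def)
  then show ?thesis using au False W_bar[OF au(2)] p_v[OF au(2)] W_closed by simp
 qed
qed

end

locale resolution = nonunital_algebra K A for K :: "'k ring" and A :: "('k, 'a) module"
begin

sublocale O: word_algebra K A "omega K A" "omega_word K A"
 by (rule omega_word_algebra[OF nonunital_algebra_axioms])

lemma omega_degree_eq: "omega_degree K A = O.gr"
 by (rule ext) (simp add: omega_degree_def O.gr_def word_degree_def)

lemma omega_diff_eq: "omega_diff K A = restrict O.D (carrier (omega K A))"
proof -
 let ?Q = "%d. d : odd_derivations K (omega K A) (omega_degree K A) \<and>
    (\<forall>w \<in> nonempty_words (carrier A).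
      d (omega_word K A [w]) =
       (\<Oplus>\<^bsub>omega K A\<^esub>j\<in>{1..<length w}.
        signed (omega K A) (int j) (omega_word K A [take j w, drop j w])) \<oplus>\<^bsub>omega K A\<^esub>
       (\<Oplus>\<^bsub>omega K A\<^esub>j\<in>{1..<length w}.
        signed (omega K A) (int j - 1)
         (omega_word K A [take (j - 1) w @ (w ! (j - 1) \<otimes>\<^sub>A w ! j) # drop (j + 1) w])))"
 have 1: "?Q (restrict O.D (carrier (omega K A)))"
  using O.D_odd_derivation O.D_word O.W_closed
  by (simp add: omega_degree_eq words_def)
 have "d = restrict O.D (carrier (omega K A))" if "?Q d" for d
  by (rule O.odd_derivations_eq) (use that 1 in \<open>auto simp: omega_degree_eq\<close>)
 then show ?thesis unfolding omega_diff_def using 1 by (intro the_equality) auto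
qed

lemma omega_proj_eq: "omega_proj K A = restrict O.p (carrier (omega K A))"
proof -
 let ?Q = "%p. p : algebra_homs K (omega K A) A \<and>
    (\<forall>w \<in> nonempty_words (carrier A).
      p (omega_word K A [w]) = (if length w = 1 then hd w else \<zero>\<^sub>A))"
 have w: "[w] : NW A" if "w : nonempty_words (carrier A)" for w using that by (simp add: words_def)
 have 1: "?Q (restrict O.p (carrier (omega K A)))"
  using lin_restrict[OF O.Xm O.p_lin] O.p_word O.W_closed[OF w] O.p_mult O.X.mult_closed
  by (simp add: algebra_homs_def)
 have "d = restrict O.p (carrier (omega K A))" if "?Q d" for d
  by (rule O.algebra_homs_eq[OF module_axioms]) (use that 1 in auto)
 then show ?thesis unfolding omega_proj_def using 1 by (intro the_equality) auto
qed

end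

text \<open>Restriction of scalars from \<open>B\<close> to \<open>K\<close>. A
  \<open>K\<close>-linear map into \<open>restr B P\<close> is what extends to a
  \<open>B\<close>-linear map from a base change to \<open>P\<close>.\<close>

definition restr :: "('k, 'b) module => ('b, 'p) module => ('k, 'p) module" where
 "restr B P = \<lparr>carrier = carrier P, mult = mult P, one = one P, zero = zero P, add = add P,
   smult = %c y. (c \<odot>\<^sub>B \<one>\<^sub>B) \<odot>\<^sub>P y\<rparr>"

lemma restr_simps [simp]:
 "carrier (restr B P) = carrier P" "zero (restr B P) = zero P"
 "add (restr B P) = add P" "smult (restr B P) c y = (c \<odot>\<^sub>B \<one>\<^sub>B) \<odot>\<^sub>P y"
 by (simp_all add: restr_def)

locale extended_resolution = resolution K A + B: algebra K B
 for K :: "'k ring" and A :: "('k, 'a) module" and B :: "('k, 'b) module"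
begin

sublocale AB: algebra_extension K A B
 by (intro algebra_extension.intro scalar_extension.intro tensor_modules.intro nonunital_algebra_axioms
   module_axioms B.module B.algebra_axioms)

sublocale OB: algebra_extension K "omega K A" B
 by (intro algebra_extension.intro scalar_extension.intro tensor_modules.intro O.X.nonunital_algebra_axioms
   O.X.module_axioms B.module B.algebra_axioms)

abbreviation "Am == algB K A B"
abbreviation "Om == omegaB K A B"

sublocale Am: nonunital_algebra B Am by (rule AB.bc_algebra)
sublocale Om: nonunital_algebra B Om by (rule OB.bc_algebra)

lemma scalar_mult:
 "c :. K ==> d :. K ==> (c \<odot>\<^sub>B \<one>\<^sub>B) \<otimes>\<^sub>B (d \<odot>\<^sub>B \<one>\<^sub>B) = (c \<otimes>\<^sub>K d) \<odot>\<^sub>B \<one>\<^sub>B"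
 by (simp add: B.smult_assoc2 B.smult_assoc1)

lemma restr_module:
 assumes "module B P" shows "module K (restr B P)"
proof -
 interpret P: module B P by fact
 show ?thesis
 proof (rule moduleI)
  show "cring K" by (rule B.R_cring)
  show "abelian_group (restr B P)"
  proof (rule abelian_groupI)
   show "\<exists>y\<in>carrier (restr B P). y \<oplus>\<^bsub>restr B P\<^esub> x = \<zero>\<^bsub>restr B P\<^esub>"
    if "x :. (restr B P)" for x
    using that P.M.l_neg[of x] P.M.a_inv_closed[of x] by auto
  qed (simp_all add: P.M.a_ac)
 qed (simp_all add: P.smult_l_distr P.smult_r_distr B.smult_l_distr scalar_mult[symmetric] P.smult_assoc1 B.smult_one)
qed

definition "\<iota> a = AB.pure a \<one>\<^sub>B"

lemma \<iota>_closed: "a :. A ==> \<iota> a :. Am"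
 by (simp add: \<iota>_def AB.bc_pure_closed)

lemma \<iota>_lin: "lin K A (restr B Am) \<iota>"
proof (rule linI)
 fix a assume a: "a :. A"
 show "\<iota> a :. (restr B Am)" using a by (simp add: \<iota>_closed)
 show "\<iota> (a \<oplus>\<^sub>A b) = \<iota> a \<oplus>\<^bsub>restr B Am\<^esub> \<iota> b" if "b :. A" for b
  using a that by (simp add: \<iota>_def AB.bc_pure_add)
 show "\<iota> (r \<odot>\<^sub>A a) = r \<odot>\<^bsub>restr B Am\<^esub> \<iota> a" if "r :. K" for r
  using a that by (simp add: \<iota>_def AB.pure_smult AB.bc_smult(2) B.smult_assoc2)
qed

lemma Am_lin_ext:
 "module B P ==> lin B Am P f ==> lin B Am P g ==> (!!a. a :. A ==> f (\<iota> a) = g (\<iota> a)) ==>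
  x :. Am ==> f x = g x"
 using AB.bc_lin_ext[of P f g x] by (simp add: \<iota>_def)

lemma map_\<iota>_words:
 "set w \<subseteq> carrier A ==> set (map \<iota> w) \<subseteq> carrier Am"
 "w : nonempty_words (carrier A) ==> map \<iota> w : nonempty_words (carrier Am)"
 "ws : NW A ==> map (map \<iota>) ws : NW Am"
 using \<iota>_closed by (auto simp: words_def subset_iff)

text \<open>Letters of \<open>A_B\<close> are exchanged for letters of \<open>A\<close> from the
  front, by \<open>B\<close>-linearity in one slot. \<open>f\<close> and \<open>g\<close> are
  generalised because the letters already exchanged are absorbed into them.\<close>

lemma nmultilin_eq:
 assumes P: "module B P" and ws: "ws : NW Am"
 shows "nmultilin B Am P f ==> nmultilin B Am P g ==>
  (!!us. us : NW A ==> f (map (map \<iota>) us) = g (map (map \<iota>) us)) ==> f ws = g ws"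
 using ws
proof (induction ws arbitrary: f g rule: nested_induct)
 case (one x)
 have "(%x. f [[x]]) x = (%x. g [[x]]) x"
 proof (rule Am_lin_ext[OF P _ _ _ one(1)])
  show "lin B Am P (%x. f [[x]])" "lin B Am P (%x. g [[x]])"
   using nmultilinD[OF one(2), of "[]" "[]" "[]" "[]"] nmultilinD[OF one(3), of "[]" "[]" "[]" "[]"] by auto
  show "f [[\<iota> a]] = g [[\<iota> a]]" if "a :. A" for a
   using one(4)[of "[[a]]"] that by (simp add: words_def)
 qed
 then show ?case by simp
next
 case (tensor x ws)
 then have ws: "set ws \<subseteq> nonempty_words (carrier Am)" by (simp add: words_def)
 have "(%x. f ([x] # ws)) x = (%x. g ([x] # ws)) x"
 proof (rule Am_lin_ext[OF P _ _ _ tensor(1)])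
  show "lin B Am P (%x. f ([x] # ws))" "lin B Am P (%x. g ([x] # ws))"
   using nmultilinD[OF tensor(4), of "[]" ws "[]" "[]"] nmultilinD[OF tensor(5), of "[]" ws "[]" "[]"] ws by auto
  show "f ([\<iota> a] # ws) = g ([\<iota> a] # ws)" if a: "a :. A" for a
  proof (rule tensor.IH[OF nmultilin_tensor[OF tensor(4)] nmultilin_tensor[OF tensor(5)]])
   fix us assume "us : NW A"
   then show "f ([\<iota> a] # map (map \<iota>) us) = g ([\<iota> a] # map (map \<iota>) us)"
    using tensor(6)[of "[a] # us"] a by (simp add: words_def)
  qed (use a \<iota>_closed in auto)
 qed
 then show ?case by simp
next
 case (bar x w ws)
 then have ws: "set ws \<subseteq> nonempty_words (carrier Am)" "set w \<subseteq> carrier Am" by (auto simp: words_def)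
 have "(%x. f ((x # w) # ws)) x = (%x. g ((x # w) # ws)) x"
 proof (rule Am_lin_ext[OF P _ _ _ bar(1)])
  show "lin B Am P (%x. f ((x # w) # ws))" "lin B Am P (%x. g ((x # w) # ws))"
   using nmultilinD[OF bar(4), of "[]" ws "[]" w] nmultilinD[OF bar(5), of "[]" ws "[]" w] ws by auto
  show "f ((\<iota> a # w) # ws) = g ((\<iota> a # w) # ws)" if a: "a :. A" for a
  proof -
   have "f ((\<iota> a # hd (w # ws)) # tl (w # ws)) = g ((\<iota> a # hd (w # ws)) # tl (w # ws))"
   proof (rule bar.IH[OF nmultilin_bar[OF bar(4)] nmultilin_bar[OF bar(5)]])
    fix us assume u: "us : NW A"
    then obtain u1 u2 where "us = u1 # u2" by (cases us) (auto simp: words_def)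
    then show "f ((\<iota> a # hd (map (map \<iota>) us)) # tl (map (map \<iota>) us)) =
     g ((\<iota> a # hd (map (map \<iota>) us)) # tl (map (map \<iota>) us))"
     using bar(6)[of "(a # u1) # u2"] a u by (simp add: words_def)
   qed (use a \<iota>_closed in auto)
   then show ?thesis by simp
  qed
 qed
 then show ?case by simp
qed

lemma Om_lin_ext:
 "module B P ==> lin B Om P f ==> lin B Om P g ==>
  (!!ws. ws : NW A ==> f (OB.pure (omega_word K A ws) \<one>\<^sub>B) = g (OB.pure (omega_word K A ws) \<one>\<^sub>B)) ==>
  y :. Om ==> f y = g y"
proof (rule OB.bc_lin_ext)
 assume P: "module B P" and f: "lin B Om P f" and g: "lin B Om P g" and
  eq: "!!ws. ws : NW A ==> f (OB.pure (omega_word K A ws) \<one>\<^sub>B) = g (OB.pure (omega_word K A ws) \<one>\<^sub>B)"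
 fix x assume x: "x :. (omega K A)"
 have a: "additive (omega K A) P (%x. h (OB.pure x \<one>\<^sub>B))" if "lin B Om P h" for h
  using that by (intro additiveI) (auto simp: lin_closed OB.bc_pure_closed OB.bc_pure_add lin_add)
 show "f (OB.pure x \<one>\<^sub>B) = g (OB.pure x \<one>\<^sub>B)"
  by (rule additive_span_ext[OF O.X.M.abelian_group_axioms mod_group[OF P] a[OF f] a[OF g], of "omega_word K A ` NW A"])
    (use eq x O.W_closed O.W_span in auto)
qed

definition "iB = base_change_map K A (omega K A) B O.i"

lemma iB: shows iB_lin: "lin B Am Om iB"
 and iB_pure: "!!a b. a :. A ==> b :. B ==> iB (AB.pure a b) = OB.pure (O.i a) b"
 using AB.lin_map_extension[OF O.Xm O.i_lin] by (simp_all add: iB_def maps_iff)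

definition "bm a = base_change_map K (omega K A) (omega K A) B (O.v a)"

lemma bm: assumes "a :. A" shows bm_lin: "lin B Om Om (bm a)"
 and bm_pure: "!!y b. y :. (omega K A) ==> b :. B ==> bm a (OB.pure y b) = OB.pure (O.v a y) b"
 using OB.lin_map_extension[OF O.Xm O.v_lin[OF assms]] by (simp_all add: bm_def maps_iff)

text \<open>Extends \<open>bm\<close>, which puts a letter of \<open>A\<close> in front,
  \<open>B\<close>-linearly to letters of \<open>A_B\<close>; together with \<open>iB\<close> it
  lets nested words over \<open>A_B\<close> be read in the base-changed resolution.\<close>

definition "vB x y = tensor_lift K A B Om (%a b. b \<odot>\<^sub>Om bm a y) x"

lemma bm_lin1: assumes y: "y :. Om" shows "lin K A (restr B Om) (%a. bm a y)"
proof (rule linI)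
 fix a assume a: "a :. A"
 show "bm a y :. (restr B Om)" using lin_closed[OF bm_lin[OF a] y] by simp
 have "bm (a \<oplus>\<^sub>A c) y = bm a y \<oplus>\<^sub>Om bm c y" if c: "c :. A" for c
  by (rule OB.bc_lin_ext[OF Om.module_axioms bm_lin lin_plus[OF Om.module_axioms bm_lin bm_lin] _ y])
    (use a c in \<open>simp_all add: bm_pure lin_add[OF O.v_lin1] OB.bc_pure_add O.v_closed\<close>)
 then show "bm (a \<oplus>\<^sub>A c) y = bm a y \<oplus>\<^bsub>restr B Om\<^esub> bm c y" if "c :. A" for c
  using that by simp
 have "bm (r \<odot>\<^sub>A a) y = (r \<odot>\<^sub>B \<one>\<^sub>B) \<odot>\<^sub>Om bm a y" if r: "r :. K" for r
  by (rule OB.bc_lin_ext[OF Om.module_axioms bm_lin lin_scaled[OF Om.module_axioms bm_lin] _ y])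
    (use a r in \<open>simp_all add: bm_pure lin_smult[OF O.v_lin1] OB.pure_smult OB.bc_smult(2) O.v_closed B.smult_assoc2\<close>)
 then show "bm (r \<odot>\<^sub>A a) y = r \<odot>\<^bsub>restr B Om\<^esub> bm a y" if "r :. K" for r
  using that by simp
qed

lemma lift_scaled:
 assumes P: "module B P" and f: "lin K A (restr B P) f"
 shows "lin B Am P (tensor_lift K A B P (%a b. b \<odot>\<^sub>P f a))"
  "!!a b. a :. A ==> b :. B ==> tensor_lift K A B P (%a b. b \<odot>\<^sub>P f a) (AB.pure a b) = b \<odot>\<^sub>P f a"
  "!!a. a :. A ==> tensor_lift K A B P (%a b. b \<odot>\<^sub>P f a) (\<iota> a) = f a"
proof -
 interpret P: module B P by fact
 have fc: "!!a. a :. A ==> f a :. P" using lin_closed[OF f] by simp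
 have b: "AB.balanced P (%a b. b \<odot>\<^sub>P f a)"
 proof (rule AB.balancedI)
  fix r a b assume r: "r :. K" and a: "a :. A" and b: "b :. B"
  have "b \<odot>\<^sub>P f (r \<odot>\<^sub>A a) = b \<odot>\<^sub>P ((r \<odot>\<^sub>B \<one>\<^sub>B) \<odot>\<^sub>P f a)" using lin_smult[OF f r a] by simp
  also have "\<dots> = (b \<otimes>\<^sub>B (r \<odot>\<^sub>B \<one>\<^sub>B)) \<odot>\<^sub>P f a" using r a b fc by (simp add: P.smult_assoc1)
  also have "b \<otimes>\<^sub>B (r \<odot>\<^sub>B \<one>\<^sub>B) = r \<odot>\<^sub>B b" using r b AB.S_smult2[of r b "\<one>\<^sub>B"] by simp
  finally show "b \<odot>\<^sub>P f (r \<odot>\<^sub>A a) = (r \<odot>\<^sub>B b) \<odot>\<^sub>P f a" .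
 next
  fix a a' b assume "a :. A" "a' :. A" "b :. B"
  then show "b \<odot>\<^sub>P f (a \<oplus>\<^sub>A a') = b \<odot>\<^sub>P f a \<oplus>\<^sub>P b \<odot>\<^sub>P f a'"
   using lin_add[OF f] by (simp add: fc P.smult_r_distr)
 qed (simp_all add: fc P.smult_l_distr)
 show "lin B Am P (tensor_lift K A B P (%a b. b \<odot>\<^sub>P f a))"
  using AB.bc_lift_lin[OF P b] by (simp add: fc P.smult_assoc1 maps_iff)
 show *: "!!a b. a :. A ==> b :. B ==> tensor_lift K A B P (%a b. b \<odot>\<^sub>P f a) (AB.pure a b) = b \<odot>\<^sub>P f a"
  by (rule AB.bc_lift(3)[OF mod_group[OF P] b])
 show "!!a. a :. A ==> tensor_lift K A B P (%a b. b \<odot>\<^sub>P f a) (\<iota> a) = f a"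
  by (simp add: * \<iota>_def fc)
qed

lemma vB_\<iota>: "a :. A ==> y :. Om ==> vB (\<iota> a) y = bm a y"
 unfolding vB_def by (rule lift_scaled(3)[OF Om.module_axioms bm_lin1])

lemma vB_lin1: "y :. Om ==> lin B Am Om (%x. vB x y)"
 unfolding vB_def[abs_def] by (rule lift_scaled(1)[OF Om.module_axioms bm_lin1])

lemma vB_lin: assumes x: "x :. Am" shows "lin B Om Om (vB x)"
proof (rule linI)
 fix y assume y: "y :. Om"
 show "vB x y :. Om" by (rule lin_closed[OF vB_lin1[OF y] x])
 show "vB x (y \<oplus>\<^sub>Om z) = vB x y \<oplus>\<^sub>Om vB x z" if z: "z :. Om" for z
  by (rule Am_lin_ext[OF Om.module_axioms vB_lin1 lin_plus[OF Om.module_axioms vB_lin1 vB_lin1] _ x])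
    (use y z in \<open>simp_all add: vB_\<iota> lin_add[OF bm_lin]\<close>)
 show "vB x (r \<odot>\<^sub>Om y) = r \<odot>\<^sub>Om vB x y" if r: "r :. B" for r
  by (rule Am_lin_ext[OF Om.module_axioms vB_lin1 lin_scaled[OF Om.module_axioms vB_lin1] _ x])
    (use y r in \<open>simp_all add: vB_\<iota> lin_smult[OF bm_lin]\<close>)
qed

lemma Om_mult_lin:
 "y :. Om ==> lin B Om Om (%z. z \<otimes>\<^sub>Om y)" "y :. Om ==> lin B Om Om (%z. y \<otimes>\<^sub>Om z)"
 by (auto intro!: linI simp: Om.mult_closed Om.mult_add_left Om.mult_add_right Om.mult_smult_left Om.mult_smult_right)

lemma vB_mult:
 assumes x: "x :. Am" and y: "y :. Om" and z: "z :. Om"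
 shows "vB x (y \<otimes>\<^sub>Om z) = vB x y \<otimes>\<^sub>Om z"
proof (rule Am_lin_ext[OF Om.module_axioms vB_lin1[OF Om.mult_closed[OF y z]] lin_comp[OF vB_lin1[OF y] Om_mult_lin(1)[OF z]] _ x])
 fix a assume a: "a :. A"
 note bl = bm_lin[OF a]
 have "bm a (y \<otimes>\<^sub>Om z) = bm a y \<otimes>\<^sub>Om z"
 proof (rule OB.bc_lin_ext[OF Om.module_axioms lin_comp[OF Om_mult_lin(1)[OF z] bl] lin_comp[OF bl Om_mult_lin(1)[OF z]] _ y])
  fix u assume u: "u :. (omega K A)"
  then have uc: "OB.pure u \<one>\<^sub>B :. Om" by (simp add: OB.bc_pure_closed)
  show "bm a (OB.pure u \<one>\<^sub>B \<otimes>\<^sub>Om z) = bm a (OB.pure u \<one>\<^sub>B) \<otimes>\<^sub>Om z"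
   by (rule OB.bc_lin_ext[OF Om.module_axioms lin_comp[OF Om_mult_lin(2)[OF uc] bl] Om_mult_lin(2)[OF lin_closed[OF bl uc]] _ z])
     (use a u in \<open>simp_all add: bm_pure OB.bc_mult_pure O.v_mult O.X.mult_closed O.v_closed\<close>)
 qed
 then show "vB (\<iota> a) (y \<otimes>\<^sub>Om z) = vB (\<iota> a) y \<otimes>\<^sub>Om z"
  using a y z by (simp add: vB_\<iota> Om.mult_closed)
qed

text \<open>Nested words over the \<open>B\<close>-algebra \<open>A_B\<close>, evaluated in the base
  change of the resolution of \<open>A\<close>. In effect this identifies the latter with the
  resolution formed over \<open>B\<close>, for which no separate quotient is constructed.\<close>

definition "WB = word_rec (%_. \<zero>\<^sub>Om) iB (%x _ z. iB x \<otimes>\<^sub>Om z) (%x _ z. vB x z)"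

lemma WB_multilin: "nmultilin B Am Om WB"
proof -
 have 0: "nmultilin B Am Om (%_. \<zero>\<^sub>Om)"
  unfolding nmultilin_def using lin_const_zero[OF Om.module_axioms, of Am] by simp
 have 1: "joint_linear B Am Om Om (%x _ z. iB x \<otimes>\<^sub>Om z)"
  unfolding joint_linear_def
  by (auto simp: Om.mult_closed lin_closed[OF iB_lin] Om.mult_add_right Om.mult_smult_right
    intro!: lin_comp[OF iB_lin Om_mult_lin(1)])
 have 2: "joint_linear B Am Om Om (%x _ z. vB x z)"
  unfolding joint_linear_def
  by (auto simp: lin_closed[OF vB_lin] lin_add[OF vB_lin] lin_smult[OF vB_lin] intro!: vB_lin1)
 show ?thesis unfolding WB_def by (rule word_rec_multilin[OF 0 iB_lin 1 2])
qed

lemma WB_closed: "ws : NW Am ==> WB ws :. Om"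
 by (rule nmultilin_closed[OF WB_multilin])

lemma WB_simps:
 "WB [[x]] = iB x"
 "ws : NW Am ==> WB ([x] # ws) = iB x \<otimes>\<^sub>Om WB ws"
 "w # ws : NW Am ==> WB ((x # w) # ws) = vB x (WB (w # ws))"
 by (auto simp: WB_def words_def word_rec_bar)

lemma WB_append: "us : NW Am ==> vs : NW Am ==> WB (us @ vs) = WB us \<otimes>\<^sub>Om WB vs"
proof (induction us rule: nested_induct)
 case (one x)
 then show ?case by (simp add: WB_simps)
next
 case (tensor x ws)
 then have "ws @ vs : NW Am" by (auto simp: words_def)
 then show ?case using tensor by (simp add: WB_simps Om.mult_assoc WB_closed lin_closed[OF iB_lin])
next
 case (bar x w ws)
 then have "w # (ws @ vs) : NW Am" by (auto simp: words_def)
 then show ?case using bar by (simp add: WB_simps vB_mult WB_closed)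
qed

lemma WB_\<iota>: "ws : NW A ==> WB (map (map \<iota>) ws) = OB.pure (omega_word K A ws) \<one>\<^sub>B"
proof (induction ws rule: nested_induct)
 case (one a)
 then show ?case by (simp add: WB_simps \<iota>_def iB_pure O.i_def)
next
 case (tensor a ws)
 then show ?case using map_\<iota>_words(3)[of ws]
  by (simp add: WB_simps \<iota>_def[of a] iB_pure OB.bc_mult_pure O.W_tensor O.W_closed O.i_closed)
next
 case (bar a w ws)
 then show ?case using map_\<iota>_words(3)[of "w # ws"]
  by (simp add: WB_simps vB_\<iota> OB.bc_pure_closed O.W_closed bm_pure O.W_bar)
qed

text \<open>The predicate \<open>Q\<close> lets one argument serve the whole algebra and each
  degree. A scalar \<open>b\<close> is absorbed into the first letter, which does not alter the
  degree.\<close>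

lemma WB_span_degree:
 assumes y: "y : generate (add_monoid (omega K A)) {omega_word K A ws | ws. ws : NW A \<and> Q (word_degree ws)}"
  and b: "b :. B"
 shows "OB.pure y b : gen Om {WB ws | ws. ws : NW Am \<and> Q (word_degree ws)}"
proof -
 have sub: "{omega_word K A ws | ws. ws : NW A \<and> Q (word_degree ws)} \<subseteq> carrier (omega K A)"
  "{WB ws | ws. ws : NW Am \<and> Q (word_degree ws)} \<subseteq> carrier Om"
  using O.W_closed WB_closed by auto
 have "additive (omega K A) Om (%y. OB.pure y b)"
  using b by (intro additiveI) (simp_all add: OB.bc_pure_closed OB.bc_pure_add)
 then show ?thesis
 proof (rule additive_image_span[OF O.X.M.abelian_group_axioms Om.M.abelian_group_axioms _ sub _ y])
  fix s assume "s : {omega_word K A ws | ws. ws : NW A \<and> Q (word_degree ws)}"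
  then obtain ws where s: "s = omega_word K A ws" and ws: "ws : NW A" "Q (word_degree ws)" by auto
  then obtain a w vs where aw: "ws = (a # w) # vs" by (cases ws; cases "hd ws") (auto simp: words_def)
  let ?u = "(b \<odot>\<^sub>Am \<iota> a # map \<iota> w) # map (map \<iota>) vs"
  have a: "a :. A" using ws aw by (simp add: words_def)
  have m: "map (map \<iota>) ws : NW Am" by (rule map_\<iota>_words(3)[OF ws(1)])
  have "lin B Am Om (%x. WB ((x # map \<iota> w) # map (map \<iota>) vs))"
   using nmultilinD[OF WB_multilin, of "[]" "map (map \<iota>) vs" "[]" "map \<iota> w"] m aw by (auto simp: words_def)
  then have "WB ?u = b \<odot>\<^sub>Om WB (map (map \<iota>) ws)"
   using lin_smult b \<iota>_closed[OF a] aw by fastforce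
  also have "\<dots> = OB.pure s b" using ws(1) b s by (simp add: WB_\<iota> OB.bc_smult(2) O.W_closed)
  finally have "OB.pure s b = WB ?u" ..
  moreover have "?u : NW Am" using m aw b \<iota>_closed[OF a] by (auto simp: words_def)
  moreover have "word_degree ?u = word_degree ws" by (simp add: aw word_degree_def comp_def)
  ultimately show "OB.pure s b : gen Om {WB ws | ws. ws : NW Am \<and> Q (word_degree ws)}"
   using ws(2) by (intro span_base) (auto intro!: exI[of _ ?u])
 qed
qed

lemma WB_span: "carrier Om = gen Om (WB ` NW Am)"
proof
 have e: "WB ` NW Am = {WB ws | ws. ws : NW Am \<and> True}" by auto
 have sub: "WB ` NW Am \<subseteq> carrier Om" using WB_closed by auto
 note sp = span_closed[OF Om.M.abelian_group_axioms sub]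
 show "gen Om (WB ` NW Am) \<subseteq> carrier Om" by (rule sp(1))
 show "carrier Om \<subseteq> gen Om (WB ` NW Am)"
 proof
  fix y assume "y :. Om"
  then have "y :. (tensor K (omega K A) B)" by (simp add: OB.bc_simps)
  then show "y : gen Om (WB ` NW Am)"
  proof (induction rule: OB.tensor_induct)
   case zero
   then show ?case using sp(2) by (simp add: OB.bc_simps)
  next
   case (pure x b)
   have "x : generate (add_monoid (omega K A)) {omega_word K A ws | ws. ws : NW A \<and> True}"
    using pure(1) O.W_span by (simp add: image_def Bex_def conj_commute)
   then show ?case unfolding e by (rule WB_span_degree[OF _ pure(2), of _ "%_. True"])
  next
   case (neg X)
   then show ?case using sp(4)[of X] by (simp add: OB.bc_neg)
  next
   case (add X Y)
   then show ?case using sp(3)[of X Y] by (simp add: OB.bc_simps)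
  qed
 qed
qed

text \<open>The universal property comes down to the one over \<open>K\<close>: lift the restriction
  of \<open>g\<close> to letters from \<open>A\<close>, extend the result \<open>B\<close>-linearly,
  and compare with \<open>g\<close> by \<open>nmultilin_eq\<close>.\<close>

lemma WB_lift:
 assumes P: "module B P" and g: "nmultilin B Am P g"
 shows "\<exists>h. lin B Om P h \<and> (\<forall>ws\<in>NW Am. h (WB ws) = g ws)"
proof -
 interpret P: module B P by fact
 have "nmultilin K A (restr B P) (%ws. g (map (map \<iota>) ws))"
  unfolding nmultilin_def
 proof (intro allI impI)
  fix us xs ys vs assume s: "set us \<subseteq> nonempty_words (carrier A)" "set vs \<subseteq> nonempty_words (carrier A)"
   "set xs \<subseteq> carrier A" "set ys \<subseteq> carrier A"
  have "lin B Am P (%x. g (map (map \<iota>) us @ (map \<iota> xs @ x # map \<iota> ys) # map (map \<iota>) vs))"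
   by (rule nmultilinD[OF g]) (use s \<iota>_closed in \<open>auto simp: words_def subset_iff\<close>)
  then have "lin K (restr B Am) (restr B P) (%x. g (map (map \<iota>) us @ (map \<iota> xs @ x # map \<iota> ys) # map (map \<iota>) vs))"
   by (auto simp: lin_def additive_def)
  from lin_comp[OF \<iota>_lin this] show "lin K A (restr B P) (%x. g (map (map \<iota>) (us @ (xs @ x # ys) # vs)))"
   by simp
 qed
 from omega_lift[OF nonunital_algebra_axioms restr_module[OF P] this]
 obtain h where h: "lin K (omega K A) (restr B P) h" "!!ws. ws : NW A ==> h (omega_word K A ws) = g (map (map \<iota>) ws)"
  by blast
 have hc: "!!y. y :. (omega K A) ==> h y :. P" using lin_closed[OF h(1)] by simp
 have b: "OB.balanced P (%y b. b \<odot>\<^sub>P h y)"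
 proof (rule OB.balancedI)
  fix r a b assume r: "r :. K" and a: "a :. (omega K A)" and b: "b :. B"
  have "b \<odot>\<^sub>P h (r \<odot>\<^bsub>omega K A\<^esub> a) = b \<odot>\<^sub>P ((r \<odot>\<^sub>B \<one>\<^sub>B) \<odot>\<^sub>P h a)" using lin_smult[OF h(1) r a] by simp
  also have "\<dots> = (b \<otimes>\<^sub>B (r \<odot>\<^sub>B \<one>\<^sub>B)) \<odot>\<^sub>P h a" using r a b hc by (simp add: P.smult_assoc1)
  also have "b \<otimes>\<^sub>B (r \<odot>\<^sub>B \<one>\<^sub>B) = r \<odot>\<^sub>B b" using r b AB.S_smult2[of r b "\<one>\<^sub>B"] by simp
  finally show "b \<odot>\<^sub>P h (r \<odot>\<^bsub>omega K A\<^esub> a) = (r \<odot>\<^sub>B b) \<odot>\<^sub>P h a" .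
 next
  fix a a' b assume "a :. (omega K A)" "a' :. (omega K A)" "b :. B"
  then show "b \<odot>\<^sub>P h (a \<oplus>\<^bsub>omega K A\<^esub> a') = b \<odot>\<^sub>P h a \<oplus>\<^sub>P b \<odot>\<^sub>P h a'"
   using lin_add[OF h(1)] by (simp add: hc P.smult_r_distr)
 qed (simp_all add: hc P.smult_l_distr)
 define hB where "hB = tensor_lift K (omega K A) B P (%y b. b \<odot>\<^sub>P h y)"
 have hl: "lin B Om P hB" using OB.bc_lift_lin[OF P b] by (simp add: hc P.smult_assoc1 maps_iff hB_def)
 have hv: "hB (OB.pure y \<one>\<^sub>B) = h y" if "y :. (omega K A)" for y
  using OB.bc_lift(3)[OF mod_group[OF P] b that B.one_closed] hc[OF that] by (simp add: hB_def)
 have "hB (WB ws) = g ws" if ws: "ws : NW Am" for ws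
 proof (rule nmultilin_eq[OF P ws _ g])
  show "nmultilin B Am P (%ws. hB (WB ws))"
   unfolding nmultilin_def using lin_comp[OF nmultilinD[OF WB_multilin] hl] by blast
  show "hB (WB (map (map \<iota>) us)) = g (map (map \<iota>) us)" if "us : NW A" for us
   using that by (simp add: WB_\<iota> hv h(2) O.W_closed)
 qed
 with hl show ?thesis by blast
qed

text \<open>All deformed products live on this module, and \<open>Om\<close> with \<open>WB\<close>
  is a word algebra for each of them (\<open>WB_word_algebra\<close>); what varies are the
  operations that see the product, such as \<open>mm\<close>, \<open>D\<close> and
  \<open>p\<close>.\<close>

definition "same_module M \<longleftrightarrow> carrier M = carrier Am \<and> zero M = zero Am \<and> add M = add Am \<and> smult M = smult Am"

lemma same_module_lin: "same_module M ==> lin B M P f \<longleftrightarrow> lin B Am P f" "same_module M ==> lin B P' M g \<longleftrightarrow> lin B P' Am g"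
 by (simp_all add: same_module_def lin_def additive_def)

lemma same_module_multilin:
 assumes "same_module M" shows "nmultilin B M P f \<longleftrightarrow> nmultilin B Am P f"
proof -
 have "carrier M = carrier Am" using assms by (simp add: same_module_def)
 then show ?thesis unfolding nmultilin_def same_module_lin(1)[OF assms] by simp
qed

lemma WB_word_algebra:
 assumes M: "nonunital_algebra B M" "same_module M"
 shows "word_algebra B M Om WB"
proof -
 interpret M: nonunital_algebra B M by fact
 have c: "carrier M = carrier Am" using M(2) by (simp add: same_module_def)
 show ?thesis
 proof (intro word_algebra.intro M Om.nonunital_algebra_axioms word_algebra_axioms.intro)
  show "nmultilin B M Om WB" using WB_multilin same_module_multilin[OF M(2)] by blast
  show "WB (us @ vs) = WB us \<otimes>\<^sub>Om WB vs" if "us : NW M" "vs : NW M" for us vs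
   using WB_append that by (simp add: c)
  show "carrier Om = gen Om (WB ` NW M)" using WB_span by (simp add: c)
  show "\<exists>h. lin B Om Om h \<and> (\<forall>ws\<in>NW M. h (WB ws) = g ws)" if "nmultilin B M Om g" for g
   using WB_lift[OF Om.module_axioms, of g] that same_module_multilin[OF M(2)] c by metis
  show "\<exists>h. lin B Om M h \<and> (\<forall>ws\<in>NW M. h (WB ws) = g' ws)" if "nmultilin B M M g'" for g'
   using WB_lift[OF M.module_axioms, of g'] that same_module_multilin[OF M(2)] c by metis
 qed
qed

end

text \<open>Of linearity only additivity is asked, because the lemma is applied both to the unit of
  the base change, where the ground ring changes from \<open>K\<close> to \<open>B\<close>, and to
  the letterwise action of a homomorphism of deformed algebras.\<close>

lemma word_morphism:
 assumes W: "word_algebra S M X W" and W': "word_algebra S' M' X' W'"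
  and \<theta>: "additive X X' \<theta>" and \<phi>: "additive M M' \<phi>"
  and \<phi>m: "!!a b. a :. M ==> b :. M ==> \<phi> (a \<otimes>\<^sub>M b) = \<phi> a \<otimes>\<^sub>M' \<phi> b"
  and eq: "!!ws. ws : NW M ==> \<theta> (W ws) = W' (map (map \<phi>) ws)"
 shows word_morphism_mult: "y :. X ==> z :. X ==> \<theta> (y \<otimes>\<^sub>X z) = \<theta> y \<otimes>\<^sub>X' \<theta> z"
  and word_morphism_D: "y :. X ==> \<theta> (word_algebra.D S M X W y) = word_algebra.D S' M' X' W' (\<theta> y)"
  and word_morphism_p: "y :. X ==> \<phi> (word_algebra.p S M X W y) = word_algebra.p S' M' X' W' (\<theta> y)"
proof -
 interpret W: word_algebra S M X W by fact
 interpret W': word_algebra S' M' X' W' by fact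
 note Xg = W.X.M.abelian_group_axioms and Xg' = W'.X.M.abelian_group_axioms
 note \<phi>c = additive_closed[OF \<phi>] and \<theta>c = additive_closed[OF \<theta>]
 have mw: "map (map \<phi>) ws : NW M'" if "ws : NW M" for ws
  using that \<phi>c by (auto simp: words_def subset_iff)
 have ext: "f y = g y" if "additive X P f" "additive X P g" "abelian_group P" "!!ws. ws : NW M ==> f (W ws) = g (W ws)" "y :. X"
  for f g y and P :: "('z, 'w) ring_scheme"
  by (rule additive_span_ext[OF Xg that(3,1,2), of "W ` NW M"]) (use that(4,5) W.W_span W.W_closed in auto)
 have mult: "\<theta> (y \<otimes>\<^sub>X z) = \<theta> y \<otimes>\<^sub>X' \<theta> z" if y: "y :. X" and z: "z :. X" for y z
 proof -
  note L = lin_additive[OF W.X_mult_lin(1)] and R = lin_additive[OF W.X_mult_lin(2)]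
  note L' = lin_additive[OF W'.X_mult_lin(1)] and R' = lin_additive[OF W'.X_mult_lin(2)]
  have 1: "additive X X' (%y. \<theta> (y \<otimes>\<^sub>X z))" if "z :. X" for z by (rule additive_comp[OF L[OF that] \<theta>])
  have 2: "additive X X' (%y. \<theta> y \<otimes>\<^sub>X' \<theta> z)" if "z :. X" for z by (rule additive_comp[OF \<theta> L'[OF \<theta>c[OF that]]])
  have 3: "additive X X' (%z. \<theta> (y \<otimes>\<^sub>X z))" if "y :. X" for y by (rule additive_comp[OF R[OF that] \<theta>])
  have 4: "additive X X' (%z. \<theta> y \<otimes>\<^sub>X' \<theta> z)" if "y :. X" for y by (rule additive_comp[OF \<theta> R'[OF \<theta>c[OF that]]])
  have "\<theta> (W us \<otimes>\<^sub>X z) = \<theta> (W us) \<otimes>\<^sub>X' \<theta> z" if us: "us : NW M" for us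
  proof (rule additive_span_ext[OF Xg Xg' 3[OF W.W_closed[OF us]] 4[OF W.W_closed[OF us]], of "W ` NW M"])
   fix s assume "s : W ` NW M"
   then obtain vs where s: "s = W vs" "vs : NW M" by auto
   then have "us @ vs : NW M" using us by (auto simp: words_def)
   then have "\<theta> (W us \<otimes>\<^sub>X W vs) = W' (map (map \<phi>) us @ map (map \<phi>) vs)"
    using W.W_append[OF us s(2)] eq[of "us @ vs"] by simp
   then show "\<theta> (W us \<otimes>\<^sub>X s) = \<theta> (W us) \<otimes>\<^sub>X' \<theta> s"
    using W'.W_append[OF mw[OF us] mw[OF s(2)]] eq us s by simp
  qed (use z W.W_span W.W_closed in auto)
  then show ?thesis
   by (intro additive_span_ext[OF Xg Xg' 1[OF z] 2[OF z], of "W ` NW M" y]) (use y W.W_span W.W_closed in auto)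
 qed
 have i: "\<theta> (W.i a) = W'.i (\<phi> a)" if "a :. M" for a
  using eq[of "[[a]]"] that by (simp add: W.i_def W'.i_def words_def)
 have v: "\<theta> (W.v a y) = W'.v (\<phi> a) (\<theta> y)" if a: "a :. M" and y: "y :. X" for a y
 proof (rule additive_span_ext[OF Xg Xg' additive_comp[OF lin_additive[OF W.v_lin[OF a]] \<theta>]
    additive_comp[OF \<theta> lin_additive[OF W'.v_lin[OF \<phi>c[OF a]]]], of "W ` NW M"])
  fix s assume "s : W ` NW M"
  then obtain ws where ws: "s = W ws" "ws : NW M" by auto
  obtain w vs where wv: "ws = w # vs" using ws(2) by (cases ws) (auto simp: words_def)
  have s: "s = W (w # vs)" and n: "w # vs : NW M" using ws wv by auto
  have "(a # w) # vs : NW M" using a n by (auto simp: words_def)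
  then show "\<theta> (W.v a s) = W'.v (\<phi> a) (\<theta> s)"
   using W.W_bar[OF a n] W'.W_bar[OF \<phi>c[OF a], of "map \<phi> w" "map (map \<phi>) vs"] mw[OF n] eq[OF n] eq[of "(a # w) # vs"] s by simp
 qed (use y W.W_span W.W_closed in auto)
 have mm: "\<theta> (W.mm a (W ws)) = W'.mm (\<phi> a) (\<theta> (W ws))" if a: "a :. M" and ws: "ws : NW M" for a ws
 proof -
  obtain b w vs where wv: "ws = (b # w) # vs"
   using ws by (cases ws; cases "hd ws") (auto simp: words_def)
  have "((a \<otimes>\<^sub>M b) # w) # vs : NW M" and b: "b :. M"
   using ws a by (auto simp: wv words_def W.M.mult_closed)
  then show ?thesis using W.mm_W[OF a, of b w vs] W'.mm_W[OF \<phi>c[OF a], of "\<phi> b" "map \<phi> w" "map (map \<phi>) vs"] ws mw[OF ws]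
    eq[OF ws] eq[of "((a \<otimes>\<^sub>M b) # w) # vs"] \<phi>m[OF a b] by (simp add: wv)
 qed
 have DW: "\<theta> (W.D (W ws)) = W'.D (\<theta> (W ws))" if "ws : NW M" for ws
  using that
 proof (induction rule: nested_induct)
  case (one a)
  then show ?case using i by (simp add: W.i_def[symmetric] W.D_i W'.D_i \<phi>c additive_zero[OF Xg Xg' \<theta>])
 next
  case (tensor a ws)
  then show ?case
   by (simp add: W.W_tensor W.D_u W.W_closed mult W.D_closed W.i_closed i W'.D_u \<phi>c \<theta>c)
 next
  case (bar a w ws)
  note cl = W.W_closed[OF bar(2)]
  show ?case using bar cl
   by (simp add: W.W_bar W.D_v v W'.D_v \<phi>c \<theta>c W.Xcl2 additive_add[OF \<theta>] additive_neg[OF Xg Xg' \<theta>] mult i mm)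
 qed
 have pW: "\<phi> (W.p (W ws)) = W'.p (\<theta> (W ws))" if "ws : NW M" for ws
  using that
 proof (induction rule: nested_induct)
  case (one a)
  then show ?case using i by (simp add: W.i_def[symmetric] W.p_i W'.p_i \<phi>c)
 next
  case (tensor a ws)
  then show ?case
   by (simp add: W.W_tensor W.p_u W.W_closed mult W.i_closed i W'.p_u \<phi>c \<theta>c \<phi>m W.p_closed)
 next
  case (bar a w ws)
  then show ?case by (simp add: W.W_bar W.p_v v W'.p_v \<phi>c \<theta>c W.W_closed
    additive_zero[OF W.M.M.abelian_group_axioms W'.M.M.abelian_group_axioms \<phi>])
 qed
 show "\<theta> (y \<otimes>\<^sub>X z) = \<theta> y \<otimes>\<^sub>X' \<theta> z" if "y :. X" "z :. X" using mult that by simp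
 show "\<theta> (W.D y) = W'.D (\<theta> y)" if "y :. X"
  by (rule additive_span_ext[OF Xg Xg' additive_comp[OF lin_additive[OF W.D_lin] \<theta>] additive_comp[OF \<theta> lin_additive[OF W'.D_lin]], of "W ` NW M"])
    (use that DW W.W_span W.W_closed in auto)
 show "\<phi> (W.p y) = W'.p (\<theta> y)" if "y :. X"
  by (rule additive_span_ext[OF Xg W'.M.M.abelian_group_axioms additive_comp[OF lin_additive[OF W.p_lin] \<phi>] additive_comp[OF \<theta> lin_additive[OF W'.p_lin]], of "W ` NW M"])
    (use that pW W.W_span W.W_closed in auto)
qed

context extended_resolution begin

abbreviation "DP P == word_algebra.D B P Om WB"
lemma same_module_self: "same_module Am"
 by (simp add: same_module_def)

sublocale W0: word_algebra B Am Om WB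
 by (rule WB_word_algebra[OF Am.nonunital_algebra_axioms same_module_self])

text \<open>The degree is defined by pure tensors and has to be compared with the span of words over
  \<open>A_B\<close>. For the harder inclusion the letters are expanded into multiples of letters
  from \<open>A\<close>, from left to right.\<close>

lemma omegaB_degree_eq: "omegaB_degree K A B k = W0.gr k"
proof -
 let ?G = "{OB.pure x b | x b. x : omega_degree K A k \<and> b :. B}"
 have gc: "omega_degree K A k \<subseteq> carrier (omega K A)" using O.gr_closed(1) by (simp add: omega_degree_eq)
 have sub: "?G \<subseteq> carrier Om" using gc OB.bc_pure_closed by auto
 have 1: "?G \<subseteq> W0.gr k"
 proof clarify
  fix x b assume x: "x : omega_degree K A k" and b: "b :. B"
  have "x : generate (add_monoid (omega K A)) {omega_word K A ws | ws. ws : NW A \<and> word_degree ws = k}"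
   using x unfolding omega_degree_eq O.gr_def .
  from WB_span_degree[OF this b] show "OB.pure x b : W0.gr k" unfolding W0.gr_def .
 qed
 have 2: "WB ws : gen Om ?G" if wsn: "ws : NW Am" and wsk: "word_degree ws = k" for ws
 proof -
  note sp = span_closed[OF Om.M.abelian_group_axioms sub]
  have sm: "b \<odot>\<^sub>Om y : gen Om ?G" if y: "y : gen Om ?G" and b: "b :. B" for b y
  proof (rule additive_image_span[OF Om.M.abelian_group_axioms Om.M.abelian_group_axioms OB.bc_smult(1)[OF b] sub sub _ y])
   fix s assume "s : ?G"
   then obtain x c where "s = OB.pure x c" "x : omega_degree K A k" "c :. B" by auto
   then show "b \<odot>\<^sub>Om s : gen Om ?G"
    using b gc by (intro span_base) (auto simp: OB.bc_smult(2) subset_iff intro!: exI[of _ x] exI[of _ "b \<otimes>\<^sub>B c"])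
  qed
  have gen: "x : gen Om ?G" if "ws : NW A" "word_degree ws = k" "x = WB (map (map \<iota>) ws)" for x ws
  proof -
   have "omega_word K A ws : omega_degree K A k" using O.gr_W[OF that(1)] that(2) by (simp add: omega_degree_eq)
   then show ?thesis using that(1,3) by (intro span_base) (auto simp: WB_\<iota>)
  qed
  \<comment> \<open>\<open>us\<close> and \<open>xs\<close> are the part already expanded,
    \<open>ys\<close> and \<open>vs\<close> the rest. The measure counts the remaining letters and
    also the remaining generators, so that closing a finished generator makes progress.\<close>
  have step: "WB (map (map \<iota>) us @ (map \<iota> xs @ ys) # vs) : gen Om ?G"
   if "set us \<subseteq> nonempty_words (carrier A)" "set xs \<subseteq> carrier A" "set ys \<subseteq> carrier Am" "xs \<noteq> [] \<or> ys \<noteq> []"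
    "set vs \<subseteq> nonempty_words (carrier Am)"
    "word_degree (map (map \<iota>) us @ (map \<iota> xs @ ys) # vs) = k" for us xs ys vs
   using that
  proof (induction "length (concat (ys # vs)) + length vs" arbitrary: us xs ys vs rule: less_induct)
   case less
   show ?case
   proof (cases ys)
    case yn: Nil
    show ?thesis
    proof (cases vs)
     case Nil
     have "us @ [xs] : NW A" using less.prems yn by (auto simp: words_def)
     moreover have "word_degree (us @ [xs]) = k" using less.prems yn Nil by (simp add: word_degree_def comp_def)
     ultimately show ?thesis using gen[of "us @ [xs]"] yn Nil by simp
    next
     case (Cons y' vs')
     have "WB (map (map \<iota>) (us @ [xs]) @ (map \<iota> [] @ y') # vs') : gen Om ?G"
      by (rule less.hyps) (use less.prems yn Cons in \<open>auto simp: words_def\<close>)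
     then show ?thesis using yn Cons by simp
    qed
   next
    case (Cons y ys')
    have us': "set (map (map \<iota>) us) \<subseteq> nonempty_words (carrier Am)" using less.prems(1) map_\<iota>_words(2) by auto
    have xs': "set (map \<iota> xs) \<subseteq> carrier Am" using less.prems(2) by (rule map_\<iota>_words(1))
    have l: "lin B Am Om (%y. WB (map (map \<iota>) us @ (map \<iota> xs @ y # ys') # vs))"
     by (rule nmultilinD[OF WB_multilin us' less.prems(5) xs']) (use less.prems Cons in auto)
    have y: "y :. Am" using less.prems Cons by simp
    have IH: "WB (map (map \<iota>) us @ (map \<iota> xs @ \<iota> a # ys') # vs) : gen Om ?G" if a: "a :. A" for a
    proof -
     have "WB (map (map \<iota>) us @ (map \<iota> (xs @ [a]) @ ys') # vs) : gen Om ?G"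
      by (rule less.hyps) (use less.prems Cons a in \<open>auto simp: word_degree_def\<close>)
     then show ?thesis by simp
    qed
    have "y :. (tensor K A B)" using y by (simp add: AB.bc_simps)
    then have "y :. Am \<and> WB (map (map \<iota>) us @ (map \<iota> xs @ y # ys') # vs) : gen Om ?G"
    proof (induction rule: AB.tensor_induct)
     case zero
     then show ?case using lin_zero[OF Am.module_axioms Om.module_axioms l] sp(2) by (simp add: AB.bc_simps)
    next
     case (pure a b)
     have "AB.pure a b = b \<odot>\<^sub>Am \<iota> a" unfolding \<iota>_def by (rule AB.pure_one[OF pure])
     then show ?case using lin_smult[OF l pure(2) \<iota>_closed[OF pure(1)]] sm[OF IH[OF pure(1)] pure(2)] AB.bc_pure_closed[OF pure] by simp
    next
     case (neg z)
     then show ?case using lin_neg[OF Am.module_axioms Om.module_axioms l, of z] sp(4) by (simp add: AB.bc_neg[symmetric])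
    next
     case (add z z')
     then show ?case using lin_add[OF l, of z z'] sp(3) Am.M.a_closed[of z z'] by (simp add: AB.bc_simps)
    qed
    then show ?thesis using Cons by simp
   qed
  qed
  obtain w vs where "ws = w # vs" using wsn by (cases ws) (auto simp: words_def)
  then show ?thesis using step[of "[]" "[]" w vs] wsn wsk by (auto simp: words_def)
 qed
 show ?thesis unfolding omegaB_degree_def
 proof
  show "gen Om ?G \<subseteq> W0.gr k"
   unfolding W0.gr_def
   by (rule group.generate_subgroup_incl[OF Om.add.is_group])
     (use 1 WB_closed in \<open>auto simp: W0.gr_def intro!: Om.add.generate_is_subgroup\<close>)
  show "W0.gr k \<subseteq> gen Om ?G"
   unfolding W0.gr_def
   by (rule group.generate_subgroup_incl[OF Om.add.is_group])
     (use 2 sub in \<open>auto intro!: Om.add.generate_is_subgroup\<close>)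
 qed
qed

lemma same_module_gr:
 assumes "nonunital_algebra B P" "same_module P" shows "word_algebra.gr P Om WB = W0.gr"
proof -
 interpret W: word_algebra B P Om WB by (rule WB_word_algebra[OF assms])
 have "carrier P = carrier Am" using assms(2) by (simp add: same_module_def)
 then show ?thesis by (intro ext) (simp add: W.gr_def W0.gr_def)
qed

lemma mult_slot_eq:
 assumes xs: "set xs \<subseteq> carrier A" and ys: "set ys \<subseteq> carrier A" and x: "x :. Am"
 shows "mult_slot K A B xs ys x = WB [map \<iota> xs @ x # map \<iota> ys]"
proof -
 have nw: "[xs @ a # ys] : NW A" if "a :. A" for a using that xs ys by (simp add: words_def)
 have lA: "lin K A (omega K A) (%a. omega_word K A [xs @ a # ys])"
  using nmultilinD[OF O.W_multilin, of "[]" "[]" xs ys] xs ys by simp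
 have lB: "lin B Am Om (%x. WB [map \<iota> xs @ x # map \<iota> ys])"
  using nmultilinD[OF WB_multilin, of "[]" "[]" "map \<iota> xs" "map \<iota> ys"] map_\<iota>_words(1)[OF xs] map_\<iota>_words(1)[OF ys] by simp
 have "mult_slot K A B xs ys = base_change_map K A (omega K A) B (%a. omega_word K A [xs @ a # ys])"
  by (simp add: mult_slot_def base_change_map_def)
 then have 1: "lin B Am Om (mult_slot K A B xs ys)"
  and 2: "mult_slot K A B xs ys (AB.pure a b) = OB.pure (omega_word K A [xs @ a # ys]) b" if "a :. A" "b :. B" for a b
  using AB.lin_map_extension[OF O.Xm lA] that by (simp_all add: maps_iff)
 show ?thesis
 proof (rule Am_lin_ext[OF Om.module_axioms _ lB _ x])
  show "lin B Am Om (mult_slot K A B xs ys)" using AB.lin_map_extension(1)[OF O.Xm lA]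
   by (simp add: mult_slot_def base_change_map_def maps_iff)
  fix a assume a: "a :. A"
  show "mult_slot K A B xs ys (\<iota> a) = WB [map \<iota> xs @ \<iota> a # map \<iota> ys]"
   using 2[OF a B.one_closed] WB_\<iota>[OF nw[OF a]] by (simp add: \<iota>_def)
 qed
qed

text \<open>\<open>D_word\<close> for the product \<open>P\<close> yields the prescribed values.
  Uniqueness has only generators with letters from \<open>A\<close> at its disposal, which suffice
  since their words span \<open>Om\<close> over \<open>B\<close>.\<close>

lemma cobar_bar_diff_eq:
 assumes P: "nonunital_algebra B P" "same_module P"
 shows "cobar_bar_diff K A B P = restrict (DP P) (carrier Om)"
proof -
 interpret W: word_algebra B P Om WB by (rule WB_word_algebra[OF P])
 have c: "carrier P = carrier Am" using P(2) by (simp add: same_module_def)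
 have gr: "W.gr = omegaB_degree K A B" using same_module_gr[OF P] omegaB_degree_eq by auto
 let ?rhs = "%w. (\<Oplus>\<^bsub>Om\<^esub>j\<in>{1..<length w}. signed Om (int j)
         (OB.pure (omega_word K A [take j w, drop j w]) \<one>\<^sub>B))
       \<oplus>\<^sub>Om
       (\<Oplus>\<^bsub>Om\<^esub>j\<in>{1..<length w}.
        signed Om (int j - 1)
         (mult_slot K A B (take (j - 1) w) (drop (j + 1) w)
          (AB.pure (w ! (j - 1)) \<one>\<^sub>B \<otimes>\<^sub>P AB.pure (w ! j) \<one>\<^sub>B)))"
 let ?Q = "%D. D : odd_derivations B Om (omegaB_degree K A B) \<and>
    (\<forall>w \<in> nonempty_words (carrier A). D (OB.pure (omega_word K A [w]) \<one>\<^sub>B) = ?rhs w)"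
 have 1: "?Q (restrict W.D (carrier Om))"
 proof (intro conjI ballI)
  show "restrict W.D (carrier Om) : odd_derivations B Om (omegaB_degree K A B)"
   using W.D_odd_derivation by (simp add: gr)
  fix w assume w: "w : nonempty_words (carrier A)"
  then have ww: "[w] : NW A" and sw: "set w \<subseteq> carrier A" by (auto simp: words_def)
  note st = set_take_subset[THEN subset_trans, OF sw] set_drop_subset[THEN subset_trans, OF sw]
  have nws: "[take j w, drop j w] : NW A" if "j : {1..<length w}" for j
   using that st by (auto simp: words_def)
  have nth: "w ! j :. A" if "j < length w" for j using that sw by (meson nth_mem subsetD)
  have "restrict W.D (carrier Om) (OB.pure (omega_word K A [w]) \<one>\<^sub>B) = W.D (WB [map \<iota> w])"
   using WB_\<iota>[OF ww] OB.bc_pure_closed[OF O.W_closed[OF ww]] by simp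
  also have "\<dots> = ?rhs w"
  proof -
   have mc: "\<iota> (w ! (j - 1)) \<otimes>\<^sub>P \<iota> (w ! j) :. Am" if "j : {1..<length w}" for j
   proof -
    have "j - 1 < length w" "j < length w" using that by auto
    from nth[OF this(1)] nth[OF this(2)] show ?thesis
     using W.M.mult_closed[of "\<iota> (w ! (j - 1))" "\<iota> (w ! j)"] \<iota>_closed by (simp add: c)
   qed
   have 2: "WB [take (j - 1) (map \<iota> w) @ (map \<iota> w ! (j - 1) \<otimes>\<^sub>P map \<iota> w ! j) # drop (j + 1) (map \<iota> w)] =
    mult_slot K A B (take (j - 1) w) (drop (j + 1) w) (AB.pure (w ! (j - 1)) \<one>\<^sub>B \<otimes>\<^sub>P AB.pure (w ! j) \<one>\<^sub>B)"
    if "j : {1..<length w}" for j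
   proof -
    have "map \<iota> w ! (j - 1) = \<iota> (w ! (j - 1))" "map \<iota> w ! j = \<iota> (w ! j)"
     using that by (intro nth_map; auto)+
    then show ?thesis
     using mult_slot_eq[OF st(1) st(2) mc[OF that], of "j - 1" "j + 1"] by (simp add: take_map drop_map \<iota>_def)
   qed
   have 3: "WB [take j (map \<iota> w), drop j (map \<iota> w)] = OB.pure (omega_word K A [take j w, drop j w]) \<one>\<^sub>B"
    if "j : {1..<length w}" for j
    using WB_\<iota>[OF nws[OF that]] by (simp add: take_map drop_map)
   have cl2: "WB [take (j - 1) (map \<iota> w) @ (map \<iota> w ! (j - 1) \<otimes>\<^sub>P map \<iota> w ! j) # drop (j + 1) (map \<iota> w)] :. Om"
    if "j : {1..<length w}" for j
    using mc[OF that] that map_\<iota>_words(1)[OF st(1)] map_\<iota>_words(1)[OF st(2)]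
    by (intro WB_closed) (auto simp: words_def take_map drop_map)
   have cl3: "WB [take j (map \<iota> w), drop j (map \<iota> w)] :. Om" if "j : {1..<length w}" for j
    using 3[OF that] OB.bc_pure_closed[OF O.W_closed[OF nws[OF that]] B.one_closed] by simp
   have D: "W.D (WB [map \<iota> w]) =
    (\<Oplus>\<^bsub>Om\<^esub>j\<in>{1..<length w}. signed Om (int j) (WB [take j (map \<iota> w), drop j (map \<iota> w)])) \<oplus>\<^sub>Om
    (\<Oplus>\<^bsub>Om\<^esub>j\<in>{1..<length w}. signed Om (int j - 1) (WB [take (j - 1) (map \<iota> w) @ (map \<iota> w ! (j - 1) \<otimes>\<^sub>P map \<iota> w ! j) # drop (j + 1) (map \<iota> w)]))"
    using W.D_word[of "map \<iota> w"] map_\<iota>_words(2)[OF w] by (simp add: c)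
   show ?thesis unfolding D
    by (intro arg_cong2[where f = "add Om"] Om.finsum_cong')
      (use 2 3 cl2 cl3 Om.signed_closed in auto)
  qed
  finally show "restrict W.D (carrier Om) (OB.pure (omega_word K A [w]) \<one>\<^sub>B) = ?rhs w" .
 qed
 have 2: "d = d'" if d: "?Q d" and d': "?Q d'" for d d'
 proof -
  have l: "lin B Om Om d" "lin B Om Om d'" and e: "d : extensional (carrier Om)" "d' : extensional (carrier Om)"
   using d d' by (auto simp: odd_derivations_def maps_iff)
  have "d (WB (map (map \<iota>) ws)) = d' (WB (map (map \<iota>) ws))" if "ws : NW A" for ws
   using that
  proof (induction ws rule: list.induct)
   case Nil
   then show ?case by (simp add: words_def)
  next
   case (Cons w ws)
   then have w: "w : nonempty_words (carrier A)" and w1: "[w] : NW A" by (auto simp: words_def)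
   have e1: "d (WB [map \<iota> w]) = d' (WB [map \<iota> w])" using d d' w WB_\<iota>[OF w1] by simp
   show ?case
   proof (cases "ws = []")
    case True
    then show ?thesis using e1 by simp
   next
    case False
    then have ws: "ws : NW A" using Cons.prems by (auto simp: words_def)
    have m: "map (map \<iota>) ws : NW Am" "[map \<iota> w] : NW Am" using map_\<iota>_words(3)[OF ws] map_\<iota>_words(3)[OF w1] by auto
    have "WB (map (map \<iota>) (w # ws)) = WB [map \<iota> w] \<otimes>\<^sub>Om WB (map (map \<iota>) ws)"
     using WB_append[OF m(2,1)] by simp
    moreover have "WB [map \<iota> w] : omegaB_degree K A B (word_degree [map \<iota> w])"
     using W0.gr_W[OF m(2)] by (simp add: omegaB_degree_eq)
    ultimately show ?thesis using d d' WB_closed[OF m(1)] e1 Cons.IH[OF ws]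
     unfolding odd_derivations_def by simp
   qed
  qed
  then have "d y = d' y" if "y :. Om" for y
   by (intro Om_lin_ext[OF Om.module_axioms l _ that]) (simp add: WB_\<iota>)
  then show ?thesis using e by (intro extensionalityI) auto
 qed
 show ?thesis unfolding cobar_bar_diff_def using 1 2[OF _ 1] by (intro the_equality) blast+
qed

lemma pure_one_map: "additive (omega K A) Om (%y. OB.pure y \<one>\<^sub>B)" "additive A Am \<iota>"
 by (auto intro!: additiveI simp: OB.bc_pure_closed OB.bc_pure_add \<iota>_def AB.bc_pure_closed AB.bc_pure_add)

lemma \<iota>_mult: "a :. A ==> b :. A ==> \<iota> (a \<otimes>\<^sub>A b) = \<iota> a \<otimes>\<^sub>Am \<iota> b"
 by (simp add: \<iota>_def AB.bc_mult_pure)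

lemma resolution_morphism:
 assumes y: "y :. (omega K A)"
 shows "OB.pure (O.D y) \<one>\<^sub>B = W0.D (OB.pure y \<one>\<^sub>B)" "\<iota> (O.p y) = W0.p (OB.pure y \<one>\<^sub>B)"
 by (rule word_morphism_D[OF O.word_algebra_axioms W0.word_algebra_axioms pure_one_map]
   word_morphism_p[OF O.word_algebra_axioms W0.word_algebra_axioms pure_one_map];
   use \<iota>_mult WB_\<iota> y in simp)+

lemma base_change_diff: "y :. Om ==> base_change_map K (omega K A) (omega K A) B (omega_diff K A) y = W0.D y"
proof -
 have l: "lin K (omega K A) (omega K A) (omega_diff K A)"
  unfolding omega_diff_eq using lin_restrict[OF O.Xm O.D_lin] by (simp add: maps_iff)
 assume y: "y :. Om"
 show ?thesis
 proof (rule OB.bc_lin_ext[OF Om.module_axioms _ W0.D_lin _ y])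
  show "lin B Om Om (base_change_map K (omega K A) (omega K A) B (omega_diff K A))"
   using OB.lin_map_extension(1)[OF O.Xm l] by (simp add: maps_iff)
  fix x assume x: "x :. (omega K A)"
  show "base_change_map K (omega K A) (omega K A) B (omega_diff K A) (OB.pure x \<one>\<^sub>B) = W0.D (OB.pure x \<one>\<^sub>B)"
   using OB.lin_map_extension(2)[OF O.Xm l x B.one_closed] x resolution_morphism(1)[OF x] by (simp add: omega_diff_eq)
 qed
qed

lemma base_change_proj: "y :. Om ==> base_change_map K (omega K A) A B (omega_proj K A) y = W0.p y"
proof -
 have l: "lin K (omega K A) A (omega_proj K A)"
  unfolding omega_proj_eq using lin_restrict[OF O.Xm O.p_lin] by (simp add: maps_iff)
 assume y: "y :. Om"
 show ?thesis
 proof (rule OB.bc_lin_ext[OF Am.module_axioms _ W0.p_lin _ y])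
  show "lin B Om Am (base_change_map K (omega K A) A B (omega_proj K A))"
   using OB.lin_map_extension(1)[OF module_axioms l] by (simp add: maps_iff)
  fix x assume x: "x :. (omega K A)"
  show "base_change_map K (omega K A) A B (omega_proj K A) (OB.pure x \<one>\<^sub>B) = W0.p (OB.pure x \<one>\<^sub>B)"
   using OB.lin_map_extension(2)[OF module_axioms l x B.one_closed] x resolution_morphism(2)[OF x]
   by (simp add: omega_proj_eq \<iota>_def)
 qed
qed

end

section \<open>Local artinian algebras and nilpotent filtrations\<close>

primrec ideal_power :: "('b, 'z) ring_scheme => 'b set => nat => 'b set" where
 "ideal_power B m 0 = carrier B"
| "ideal_power B m (Suc k) = gen B {b \<otimes>\<^sub>B c | b c. b : m \<and> c : ideal_power B m k}"

text \<open>The submodules \<open>m^k P\<close> of the \<open>m\<close>-adic filtration.\<close>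

definition fil :: "('b, 'z) ring_scheme => 'b set => ('b, 'p) module => nat => 'p set" where
 "fil B m P k = gen P {c \<odot>\<^sub>P x | c x. c : ideal_power B m k \<and> x :. P}"

text \<open>For additive \<open>g\<close> this is the sum of the first \<open>k\<close> iterates of
  \<open>g\<close> at \<open>x\<close>, in Horner form; for nilpotent \<open>g\<close> it computes
  the inverse of \<open>1 - g\<close>.\<close>

primrec geometric :: "('p, 'z) ring_scheme => ('p => 'p) => nat => 'p => 'p" where
 "geometric P g 0 x = \<zero>\<^sub>P"
| "geometric P g (Suc k) x = x \<oplus>\<^sub>P g (geometric P g k x)"

lemma (in abelian_group) diff_zero [simp]: "a :. G ==> a \<ominus> \<zero> = a"
 using add.inv_one by (simp add: a_minus_def a_inv_def)

lemma (in abelian_group) plus_diff_fixed: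
 assumes "t :. G" "x :. G" "y :. G" "t = x \<oplus> (t \<ominus> y)"
 shows "y = x"
proof -
 have "x \<oplus> (t \<ominus> y) = t \<oplus> (x \<ominus> y)" using assms(1-3) by (simp add: ab_simps)
 then have "\<ominus> t \<oplus> (t \<oplus> (x \<ominus> y)) = \<ominus> t \<oplus> t" using assms(4) by simp
 then have "x \<ominus> y = \<zero>" using assms(1-3) by (simp add: r_neg1 l_neg)
 then show ?thesis using assms(2,3) diff_zero_iff by simp
qed

locale filtered_base = cring B + ideal m B for B :: "('b, 'z) ring_scheme" (structure) and m
begin

abbreviation "mp == ideal_power B m"

lemma mp_sub: "mp k \<subseteq> carrier B"
proof (induction k)
 case (Suc k)
 then have "{b \<otimes> c | b c. b : m \<and> c : mp k} \<subseteq> carrier B" using Icarr by auto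
 then show ?case using span_closed(1)[OF abelian_group_axioms] by simp
qed simp

lemma mp_gen_sub: "{b \<otimes> c | b c. b : m \<and> c : mp k} \<subseteq> carrier B"
 using mp_sub[of k] Icarr by auto

lemma mp_closed:
 "\<zero> : mp k" "x : mp k ==> y : mp k ==> x \<oplus> y : mp k" "x : mp k ==> \<ominus> x : mp k"
 using span_closed[OF abelian_group_axioms mp_gen_sub] by (cases k; simp)+

lemma smult_additive: "r :. B ==> additive B B (%x. r \<otimes> x)"
 by (intro additiveI) (simp_all add: r_distr)

lemma mp_mult: "r :. B ==> x : mp k ==> r \<otimes> x : mp k"
proof (cases k)
 case (Suc l)
 assume r: "r :. B" and x: "x : mp k"
 have "r \<otimes> x : gen B {b \<otimes> c | b c. b : m \<and> c : mp l}"
 proof (rule additive_image_span[OF abelian_group_axioms abelian_group_axioms smult_additive[OF r] mp_gen_sub mp_gen_sub])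
  show "x : gen B {b \<otimes> c | b c. b : m \<and> c : mp l}" using x Suc by simp
  fix s assume "s : {b \<otimes> c | b c. b : m \<and> c : mp l}"
  then obtain b c where s: "s = b \<otimes> c" "b : m" "c : mp l" by auto
  then have "b :. B" "c :. B" using Icarr mp_sub by blast+
  then have "r \<otimes> s = (r \<otimes> b) \<otimes> c" using r s by (simp add: m_assoc)
  then show "r \<otimes> s : gen B {b \<otimes> c | b c. b : m \<and> c : mp l}"
   using s I_l_closed[OF s(2) r] by (intro span_base) blast
 qed
 then show ?thesis using Suc by simp
qed (auto)

lemma mp_ideal: "ideal (mp k) B"
proof (rule idealI[OF ring_axioms])
 show "subgroup (mp k) (add_monoid B)"
 proof (rule add.subgroupI)
  show "mp k \<noteq> {}" using mp_closed(1) by blast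
 qed (use mp_sub mp_closed in \<open>auto simp: a_inv_def\<close>)
next
 fix a x assume a: "a : mp k" and x: "x :. B"
 show "x \<otimes> a : mp k" by (rule mp_mult[OF x a])
 moreover have "a :. B" using a mp_sub by blast
 ultimately show "a \<otimes> x : mp k" using x by (simp add: m_comm)
qed

lemma mp_Suc_step: "b : m ==> c : mp k ==> b \<otimes> c : mp (Suc k)"
 by (auto intro!: span_base)

lemma mp_decreasing: "mp (Suc k) \<subseteq> mp k"
proof
 fix x assume "x : mp (Suc k)"
 then have "x : gen B {b \<otimes> c | b c. b : m \<and> c : mp k}" by simp
 then show "x : mp k"
  by (rule span_induct[OF abelian_group_axioms mp_gen_sub]) (use mp_closed mp_mult Icarr in auto)
qed

lemma mp_1: "mp (Suc 0) = m"
proof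
 show "m \<subseteq> mp (Suc 0)" using mp_Suc_step[of _ \<one> 0] Icarr by fastforce
 show "mp (Suc 0) \<subseteq> m"
 proof
  fix x assume "x : mp (Suc 0)"
  then have "x : gen B {b \<otimes> c | b c. b : m \<and> c : mp 0}" by simp
  then show "x : m"
   by (rule span_induct[OF abelian_group_axioms mp_gen_sub])
     (use I_r_closed in \<open>auto simp: a_closed a_inv_closed\<close>)
 qed
qed

text \<open>Makes a power of \<open>m\<close> idempotent once the chain of powers is stationary, as
  the proof of \<open>m_nilpotent\<close> requires.\<close>

lemma mp_prod:
 assumes "x : mp (j + k)" shows "x : gen B {b \<otimes> c | b c. b : mp j \<and> c : mp k}"
proof -
 have sub: "{b \<otimes> c | b c. b : mp j \<and> c : mp k} \<subseteq> carrier B" for j k using mp_sub by auto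
 show ?thesis using assms
 proof (induction j arbitrary: x)
  case 0
  then have "x :. B" using mp_sub by auto
  then have "x = \<one> \<otimes> x" by simp
  then show ?case using 0 by (intro span_base) auto
 next
  case (Suc j)
  note sp = span_closed[OF abelian_group_axioms sub[of "Suc j" k]]
  have "x : gen B {b \<otimes> c | b c. b : m \<and> c : mp (j + k)}" using Suc.prems by simp
  with abelian_group_axioms mp_gen_sub show ?case
  proof (induction rule: span_induct)
   case (base s)
   then obtain b c where s: "s = b \<otimes> c" "b : m" "c : mp (j + k)" by auto
   have b: "b :. B" using s Icarr by simp
   show ?case unfolding s
   proof (rule additive_image_span[OF abelian_group_axioms abelian_group_axioms smult_additive[OF b] sub sub _ Suc.IH[OF s(3)]])
    fix t assume "t : {b \<otimes> c | b c. b : mp j \<and> c : mp k}"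
    then obtain b' c' where t: "t = b' \<otimes> c'" "b' : mp j" "c' : mp k" by auto
    have "b' :. B" "c' :. B" using t mp_sub by auto
    then have "b \<otimes> t = (b \<otimes> b') \<otimes> c'" unfolding t using b by (simp add: m_assoc)
    then show "b \<otimes> t : gen B {b \<otimes> c | b c. b : mp (Suc j) \<and> c : mp k}"
     using mp_Suc_step[OF s(2) t(2)] t(3) by (intro span_base) blast
   qed
  qed (use sp in auto)
 qed
qed

lemma fil_gen_sub:
 assumes "module B P" shows "{c \<odot>\<^sub>P x | c x. c : mp k \<and> x :. P} \<subseteq> carrier P"
proof -
 interpret P: module B P by fact
 show ?thesis using mp_sub by auto
qed

lemma fil_closed:
 assumes P: "module B P"
 shows "fil B m P k \<subseteq> carrier P" "\<zero>\<^sub>P : fil B m P k"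
  "x : fil B m P k ==> y : fil B m P k ==> x \<oplus>\<^sub>P y : fil B m P k"
  "x : fil B m P k ==> \<ominus>\<^sub>P x : fil B m P k"
  "x : fil B m P k ==> y : fil B m P k ==> x \<ominus>\<^sub>P y : fil B m P k"
 using span_closed[OF mod_group[OF P] fil_gen_sub[OF P]] by (simp_all add: fil_def)

lemma fil_base: "c : mp k ==> x :. P ==> c \<odot>\<^sub>P x : fil B m P k"
 unfolding fil_def by (rule span_base) auto

lemma fil_image:
 assumes P: "module B P" and P': "module B P'" and f: "additive P P' f"
  and "!!c x. c : mp k ==> x :. P ==> f (c \<odot>\<^sub>P x) : fil B m P' l" and "y : fil B m P k"
 shows "f y : fil B m P' l"
 unfolding fil_def
 by (rule additive_image_span[OF mod_group[OF P] mod_group[OF P'] f fil_gen_sub[OF P] fil_gen_sub[OF P']])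
   (use assms(4,5) in \<open>auto simp: fil_def\<close>)

lemma fil_0: assumes "module B P" shows "fil B m P 0 = carrier P"
proof -
 interpret P: module B P by fact
 have "x : fil B m P 0" if "x :. P" for x
  using fil_base[of \<one> 0 x P] that by simp
 then show ?thesis using fil_closed(1)[OF assms] by auto
qed

lemma lin_fil:
 assumes "module B P" "module B P'" "lin B P P' f" "y : fil B m P k"
 shows "f y : fil B m P' k"
 by (rule fil_image[OF assms(1,2) lin_additive[OF assms(3)] _ assms(4)])
   (use mp_sub in \<open>auto simp: lin_smult[OF assms(3)] subset_iff intro!: fil_base lin_closed[OF assms(3)]\<close>)

lemma smult_fil:
 assumes P: "module B P" and c: "c : mp j" and y: "y : fil B m P 1"
 shows "c \<odot>\<^sub>P y : fil B m P (Suc j)"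
proof -
 interpret P: module B P by fact
 have cc: "c :. B" using c mp_sub by auto
 show ?thesis
 proof (rule fil_image[OF P P _ _ y])
  show "additive P P (%y. c \<odot>\<^sub>P y)" using cc by (intro additiveI) (simp_all add: P.smult_r_distr)
  fix b x assume b: "b : mp 1" and x: "x :. P"
  have b': "b : m" using b mp_1 by simp
  have "c \<odot>\<^sub>P (b \<odot>\<^sub>P x) = (b \<otimes> c) \<odot>\<^sub>P x"
   using cc Icarr[OF b'] x by (simp add: P.smult_assoc1[symmetric] m_comm)
  then show "c \<odot>\<^sub>P (b \<odot>\<^sub>P x) : fil B m P (Suc j)"
   using fil_base[OF mp_Suc_step[OF b' c] x] by simp
 qed
qed

text \<open>The source of all nilpotency below: a linear map with values in \<open>m P'\<close>
  raises the filtration by one, so that the iterates of such an endomorphism run into the zero power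
  of \<open>m\<close>.\<close>

lemma lin_shift:
 assumes P: "module B P" and P': "module B P'" and f: "lin B P P' f"
  and sh: "!!x. x :. P ==> f x : fil B m P' 1" and y: "y : fil B m P k"
 shows "f y : fil B m P' (Suc k)"
 by (rule fil_image[OF P P' lin_additive[OF f] _ y])
   (use mp_sub sh smult_fil[OF P'] in \<open>auto simp: lin_smult[OF f] subset_iff\<close>)

lemma fil_zero: "module B P ==> mp n \<subseteq> {\<zero>} ==> y : fil B m P n ==> y = \<zero>\<^sub>P"
proof -
 assume P: "module B P" and n: "mp n \<subseteq> {\<zero>}" and y: "y : fil B m P n"
 interpret P: module B P by fact
 have "y : gen P {c \<odot>\<^sub>P x | c x. c : mp n \<and> x :. P}" using y by (simp add: fil_def)
 then show "y = \<zero>\<^sub>P"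
  by (rule span_induct[OF P.M.abelian_group_axioms fil_gen_sub[OF P]]) (use n in auto)
qed

lemma lin_geometric:
 assumes P: "module B P" and g: "lin B P P g"
 shows "lin B P P (geometric P g k)"
proof (induction k)
 case 0
 show ?case using lin_const_zero[OF P, of P] by (simp add: geometric.simps(1)[abs_def])
next
 case (Suc k)
 show ?case using lin_plus[OF P lin_id lin_comp[OF Suc g]] by (simp add: geometric.simps(2)[abs_def])
qed

lemma funpow_fil:
 assumes P: "module B P" and g: "lin B P P g" and sh: "!!x. x :. P ==> g x : fil B m P 1" and x: "x :. P"
 shows "(g ^^ k) x : fil B m P k"
 by (induction k) (use x lin_shift[OF P P g sh] in \<open>auto simp: fil_0[OF P]\<close>)

text \<open>The remainder after \<open>k\<close> terms is \<open>(g ^^ k) x\<close>, which lies in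
  \<open>m^k P\<close> and so is zero at \<open>k = n\<close>: the finite sum is an exact
  solution.\<close>

lemma geometric_fixed:
 assumes P: "module B P" and g: "lin B P P g" and sh: "!!x. x :. P ==> g x : fil B m P 1"
  and n: "mp n \<subseteq> {\<zero>}" and x: "x :. P"
 shows "geometric P g n x = x \<oplus>\<^sub>P g (geometric P g n x)"
proof -
 interpret P: module B P by fact
 have c: "(g ^^ k) x :. P" "geometric P g k x :. P" for k
  using funpow_fil[OF P g sh x] fil_closed(1)[OF P] lin_closed[OF lin_geometric[OF P g] x] by auto
 have "x \<oplus>\<^sub>P g (geometric P g k x) = geometric P g k x \<oplus>\<^sub>P (g ^^ k) x" for k
 proof (induction k)
  case 0
  then show ?case using x by (simp add: lin_zero[OF P P g])
 next
  case (Suc k)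
  have "g (geometric P g (Suc k) x) = g (geometric P g k x \<oplus>\<^sub>P (g ^^ k) x)" using Suc by simp
  also have "\<dots> = g (geometric P g k x) \<oplus>\<^sub>P (g ^^ Suc k) x" using c by (simp add: lin_add[OF g])
  finally show ?case using x c lin_closed[OF g] by (simp add: P.M.a_assoc)
 qed
 from this[of n] show ?thesis
  using fil_zero[OF P n funpow_fil[OF P g sh x]] c by simp
qed

lemma fixed_zero:
 assumes P: "module B P" and g: "lin B P P g" and sh: "!!x. x :. P ==> g x : fil B m P 1"
  and n: "mp n \<subseteq> {\<zero>}" and x: "x :. P" "g x = x"
 shows "x = \<zero>\<^sub>P"
proof -
 have "(g ^^ k) x = x" for k by (induction k) (use x in auto)
 then show ?thesis using fil_zero[OF P n] funpow_fil[OF P g sh x(1), of n] by simp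
qed

lemma geometric_sub:
 assumes "!!x y. x : G ==> y : G ==> x \<oplus>\<^sub>P y : G" "\<zero>\<^sub>P : G" "!!x. x : G ==> g x : G" "x : G"
 shows "geometric P g k x : G"
 by (induction k) (use assms in auto)

text \<open>Write \<open>f\<close> as \<open>1 - g\<close> with \<open>g\<close> nilpotent and
  invert it by the geometric series. The inverse is a sum of iterates of \<open>g\<close>, so it
  respects each subgroup that \<open>f\<close> respects; this is applied to the graded
  components.\<close>

lemma near_identity:
 assumes P: "module B P" and f: "lin B P P f" and near: "!!x. x :. P ==> f x \<ominus>\<^sub>P x : fil B m P 1"
  and n: "mp n \<subseteq> {\<zero>}"
 shows near_identity_bij: "bij_betw f (carrier P) (carrier P)"
  and near_identity_sub: "!!G. G \<subseteq> carrier P ==> \<zero>\<^sub>P : G ==> (!!x y. x : G ==> y : G ==> x \<oplus>\<^sub>P y : G) ==>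
   (!!x. x : G ==> \<ominus>\<^sub>P x : G) ==> (!!x. x : G ==> f x : G) ==> f ` G = G"
proof -
 interpret P: module B P by fact
 define g where "g x = x \<ominus>\<^sub>P f x" for x
 note fc = lin_closed[OF f]
 have g: "lin B P P g" unfolding g_def by (rule lin_minus[OF P lin_id f])
 have neg: "g x = \<ominus>\<^sub>P (f x \<ominus>\<^sub>P x)" if "x :. P" for x
  using that fc by (simp add: g_def P.M.ab_simps)
 have sh: "g x : fil B m P 1" if "x :. P" for x
  using fil_closed(4)[OF P near[OF that]] neg[OF that] by simp
 have fT: "f (geometric P g n x) = x" if x: "x :. P" for x
 proof -
  let ?T = "geometric P g n x"
  have T: "?T :. P" by (rule lin_closed[OF lin_geometric[OF P g] x])
  have "?T = x \<oplus>\<^sub>P (?T \<ominus>\<^sub>P f ?T)" using geometric_fixed[OF P g sh n x] by (simp add: g_def[of "geometric P g n x"])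
  from P.M.plus_diff_fixed[OF T x fc[OF T] this] show ?thesis .
 qed
 have inj: "x = y" if "x :. P" "y :. P" "f x = f y" for x y
 proof -
  have "f (x \<ominus>\<^sub>P y) = \<zero>\<^sub>P" using that fc by (simp add: lin_diff[OF P P f] P.M.diff_zero_iff)
  then have "g (x \<ominus>\<^sub>P y) = x \<ominus>\<^sub>P y" using that by (simp add: g_def P.M.ab_simps)
  from fixed_zero[OF P g sh n _ this] show ?thesis using that P.M.diff_zero_iff by simp
 qed
 show "bij_betw f (carrier P) (carrier P)"
  unfolding bij_betw_def
 proof
  show "inj_on f (carrier P)" using inj by (auto intro: inj_onI)
  show "f ` carrier P = carrier P"
  proof
   show "f ` carrier P \<subseteq> carrier P" using fc by auto
   show "carrier P \<subseteq> f ` carrier P"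
   proof
    fix x assume x: "x :. P"
    show "x : f ` carrier P"
     by (rule image_eqI[where x = "geometric P g n x"])
       (use fT[OF x] lin_closed[OF lin_geometric[OF P g, of n] x] in auto)
   qed
  qed
 qed
 fix G assume G: "G \<subseteq> carrier P" "\<zero>\<^sub>P : G" "!!x y. x : G ==> y : G ==> x \<oplus>\<^sub>P y : G"
   "!!x. x : G ==> \<ominus>\<^sub>P x : G" "!!x. x : G ==> f x : G"
 have gG: "g x : G" if "x : G" for x using that G by (simp add: g_def a_minus_def)
 show "f ` G = G"
 proof
  show "f ` G \<subseteq> G" using G by auto
  show "G \<subseteq> f ` G"
  proof
   fix x assume x: "x : G"
   have "geometric P g n x : G" by (rule geometric_sub[OF G(3,2) gG x])
   moreover have "x = f (geometric P g n x)" using fT x G(1) by auto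
   ultimately show "x : f ` G" by (rule rev_image_eqI)
  qed
 qed
qed

end

lemma (in cring) exists_maximal_ideal:
 assumes I: "ideal I R" "I \<noteq> carrier R"
 shows "\<exists>n. maximalideal n R \<and> I \<subseteq> n"
proof -
 let ?F = "{J. ideal J R \<and> I \<subseteq> J \<and> J \<noteq> carrier R}"
 have "\<exists>M\<in>?F. \<forall>X\<in>?F. M \<subseteq> X --> X = M"
 proof (rule subset_Zorn_nonempty)
  show "?F \<noteq> {}" using I by auto
  fix C assume C: "C \<noteq> {}" "subset.chain ?F C"
  have Ci: "ideal J R" if "J : C" for J using C(2) that by (auto simp: subset.chain_def)
  have Ct: "\<exists>J\<in>C. x : J \<and> y : J" if xy: "x : \<Union>C" "y : \<Union>C" for x y
  proof -
   obtain J J' where "J : C" "J' : C" "x : J" "y : J'" using xy by auto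
   moreover have "J \<subseteq> J' \<or> J' \<subseteq> J" using C(2) calculation by (auto simp: subset.chain_def)
   ultimately show ?thesis by blast
  qed
  have id: "ideal (\<Union>C) R"
  proof (rule idealI[OF ring_axioms])
   show "subgroup (\<Union>C) (add_monoid R)"
   proof (rule add.subgroupI)
    show "\<Union>C \<subseteq> carrier R" using Ci ideal.Icarr by fastforce
    show "\<Union>C \<noteq> {}" using C(1) Ci additive_subgroup.zero_closed[OF ideal.axioms(1)] by blast
    fix x assume x: "x : \<Union>C"
    then obtain J where J: "J : C" "x : J" by auto
    have "\<ominus> x : J" by (rule additive_subgroup.a_inv_closed[OF ideal.axioms(1)[OF Ci[OF J(1)]] J(2)])
    then show "\<ominus> x : \<Union>C" using J by auto
    fix y assume "y : \<Union>C"
    then obtain J' where J': "J' : C" "x : J'" "y : J'" using Ct[OF x] by blast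
    have "x \<oplus> y : J'" by (rule additive_subgroup.a_closed[OF ideal.axioms(1)[OF Ci[OF J'(1)]] J'(2,3)])
    then show "x \<oplus> y : \<Union>C" using J' by auto
   qed
   fix x r assume "x : \<Union>C" and r: "r :. R"
   then obtain J where J: "J : C" "x : J" by auto
   show "r \<otimes> x : \<Union>C" using ideal.I_l_closed[OF Ci[OF J(1)] J(2) r] J(1) by auto
   show "x \<otimes> r : \<Union>C" using ideal.I_r_closed[OF Ci[OF J(1)] J(2) r] J(1) by auto
  qed
  have "\<one> \<notin> \<Union>C"
  proof
   assume "\<one> : \<Union>C"
   then obtain J where J: "J : C" "\<one> : J" by auto
   then have "ideal J R" "J \<noteq> carrier R" using C(2) by (auto simp: subset.chain_def)
   then show False using ideal.one_imp_carrier[of J R] J by auto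
  qed
  moreover have "I \<subseteq> \<Union>C"
  proof -
   obtain J where "J : C" using C(1) by auto
   moreover have "I \<subseteq> J" using C(2) calculation by (auto simp: subset.chain_def)
   ultimately show ?thesis by auto
  qed
  ultimately show "\<Union>C : ?F" using id by auto
 qed
 then obtain M where M: "M : ?F" and max: "\<forall>X\<in>?F. M \<subseteq> X --> X = M" by (rule bexE)
 have Mi: "ideal M R" "M \<noteq> carrier R" "I \<subseteq> M" using M by auto
 have "maximalideal M R"
 proof (rule maximalidealI[OF Mi(1) Mi(2)[symmetric]])
  fix J assume J: "ideal J R" "M \<subseteq> J" "J \<subseteq> carrier R"
  show "J = M \<or> J = carrier R"
  proof (cases "J = carrier R")
   case False
   then have "J : ?F" using J Mi by auto
   then show ?thesis using max J by auto
  qed simp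
 qed
 then show ?thesis using Mi(3) by blast
qed

locale local_artinian =
 fixes K :: "'k ring" and B :: "('k, 'b) module" and m :: "'b set"
 assumes la: "local_artinian_algebra K B m"
begin

sublocale B: algebra K B
 using la by (simp add: local_artinian_algebra_def)

sublocale m: maximalideal m B
 using la by (simp add: local_artinian_algebra_def)

sublocale F: filtered_base B m
 by (simp add: filtered_base_def B.M_cring m.ideal_axioms)

lemma stationary:
 assumes "!!i. ideal (I i) B" "!!i. I (Suc i) \<subseteq> I i"
 obtains i0 :: nat where "!!i. i \<ge> i0 ==> I i = I i0"
proof -
 have "\<forall>I :: nat => 'b set. (\<forall>i. ideal (I i) B \<and> I (Suc i) \<subseteq> I i) --> (\<exists>i0. \<forall>i\<ge>i0. I i = I i0)"
  using la unfolding local_artinian_algebra_def by (elim conjE)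
 from this[rule_format, of I] assms show ?thesis using that by auto
qed

lemma dcc:
 assumes "\<F> \<noteq> {}" "!!I. I : \<F> ==> ideal I B"
 shows "\<exists>I\<in>\<F>. \<forall>J\<in>\<F>. J \<subseteq> I --> J = I"
proof (rule ccontr)
 assume c: "\<not> ?thesis"
 then have c': "\<exists>J\<in>\<F>. J \<subset> I" if "I : \<F>" for I using that by blast
 have "\<exists>f. \<forall>i. f i : \<F> \<and> f (Suc i) \<subset> f i"
  by (rule dependent_nat_choice) (use assms(1) c' in auto)
 then obtain f where ff: "\<forall>i. f i : \<F> \<and> f (Suc i) \<subset> f i" by (rule exE)
 have f: "f i : \<F>" "f (Suc i) \<subset> f i" for i using ff by auto
 obtain i0 where "!!i. i \<ge> i0 ==> f i = f i0"
  by (rule stationary[of f]) (use f assms(2) in auto)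
 from this[of "Suc i0"] show False using f(2)[of i0] by simp
qed

lemma unit_outside: assumes "u :. B" "u \<notin> m" shows "\<exists>w\<in>carrier B. w \<otimes>\<^sub>B u = \<one>\<^sub>B"
proof -
 have "PIdl\<^bsub>B\<^esub> u = carrier B"
 proof (rule ccontr)
  assume "PIdl\<^bsub>B\<^esub> u \<noteq> carrier B"
  from B.exists_maximal_ideal[OF B.cgenideal_ideal[OF assms(1)] this]
  obtain n where "maximalideal n B" "PIdl\<^bsub>B\<^esub> u \<subseteq> n" by blast
  moreover have "n = m" using la calculation(1) by (simp add: local_artinian_algebra_def)
  ultimately show False using B.cgenideal_self[OF assms(1)] assms(2) by blast
 qed
 then have "\<one>\<^sub>B : PIdl\<^bsub>B\<^esub> u" by simp
 then show ?thesis by (auto simp: cgenideal_def)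
qed

text \<open>The stable power \<open>J\<close> of \<open>m\<close> satisfies \<open>J J = J\<close>.
  If it is nonzero, the descending chain condition gives a minimal ideal \<open>I\<close> with
  \<open>J I\<close> nonzero. For \<open>c\<close> in \<open>I\<close> with \<open>J c\<close>
  nonzero, minimality yields \<open>J c = I\<close>, so \<open>c = b c\<close> with \<open>b\<close>
  in \<open>J\<close>. As \<open>1 - b\<close> lies outside \<open>m\<close>, it is a unit, and
  \<open>c = 0\<close>.\<close>

lemma m_nilpotent: "\<exists>n. F.mp n \<subseteq> {\<zero>\<^sub>B}"
proof -
 obtain i0 where st: "!!i. i \<ge> i0 ==> F.mp i = F.mp i0"
  by (rule stationary[of F.mp]) (use F.mp_ideal F.mp_decreasing in auto)
 \<comment> \<open>The successor ensures that \<open>J\<close> lies in \<open>m\<close> even if the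
   chain is stationary from the start.\<close>
 define J where "J = F.mp (Suc i0)"
 have JJ: "F.mp (Suc i0 + Suc i0) = J" using st[of "Suc i0"] st[of "Suc i0 + Suc i0"] J_def by simp
 have Jm: "J \<subseteq> m" using F.mp_decreasing F.mp_1 unfolding J_def
  by (metis lift_Suc_antimono_le Suc_le_mono le0)
 have Jc: "J \<subseteq> carrier B" unfolding J_def by (rule F.mp_sub)
 interpret J: ideal J B unfolding J_def by (rule F.mp_ideal)
 have "J \<subseteq> {\<zero>\<^sub>B}"
 proof (rule ccontr)
  assume "\<not> J \<subseteq> {\<zero>\<^sub>B}"
  then obtain x where x: "x : J" "x \<noteq> \<zero>\<^sub>B" by auto
  let ?F = "{I. ideal I B \<and> (\<exists>a\<in>J. \<exists>c\<in>I. a \<otimes>\<^sub>B c \<noteq> \<zero>\<^sub>B)}"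
  have "carrier B : ?F"
  proof -
   have "x \<otimes>\<^sub>B \<one>\<^sub>B \<noteq> \<zero>\<^sub>B" using x Jc by auto
   then show ?thesis using x(1) B.oneideal B.one_closed by blast
  qed
  then have "?F \<noteq> {}" by blast
  then have "\<exists>I\<in>?F. \<forall>J\<in>?F. J \<subseteq> I --> J = I" by (rule dcc) simp
  then obtain I where IF: "I : ?F" and minF: "\<forall>J\<in>?F. J \<subseteq> I --> J = I" by (rule bexE)
  have I: "ideal I B" "\<exists>a\<in>J. \<exists>c\<in>I. a \<otimes>\<^sub>B c \<noteq> \<zero>\<^sub>B" using IF by auto
  have min: "L = I" if "ideal L B" "\<exists>a\<in>J. \<exists>c\<in>L. a \<otimes>\<^sub>B c \<noteq> \<zero>\<^sub>B" "L \<subseteq> I" for L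
   using minF[rule_format, of L] that by simp
  interpret I: ideal I B by fact
  obtain a c where a: "a : J" and c: "c : I" and ac: "a \<otimes>\<^sub>B c \<noteq> \<zero>\<^sub>B" using I(2) by blast
  have cc: "c :. B" using c I.Icarr by simp
  define L where "L = (%b. b \<otimes>\<^sub>B c) ` J"
  have Li: "ideal L B"
  proof (rule idealI[OF B.ring_axioms])
   show "subgroup L (add_monoid B)"
   proof (rule B.M.add.subgroupI)
    show "L \<subseteq> carrier B" using cc Jc by (auto simp: L_def)
    show "L \<noteq> {}" using a by (auto simp: L_def)
    fix x assume "x : L"
    then obtain b where b: "b : J" "x = b \<otimes>\<^sub>B c" by (auto simp: L_def)
    then have "\<ominus>\<^sub>B x = (\<ominus>\<^sub>B b) \<otimes>\<^sub>B c" using cc J.Icarr by (simp add: B.l_minus)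
    then show "\<ominus>\<^sub>B x : L" using b by (auto simp: L_def)
    fix y assume "y : L"
    then obtain d where d: "d : J" "y = d \<otimes>\<^sub>B c" by (auto simp: L_def)
    have "x \<oplus>\<^sub>B y = (b \<oplus>\<^sub>B d) \<otimes>\<^sub>B c" using b d cc J.Icarr by (simp add: B.l_distr)
    then show "x \<oplus>\<^sub>B y : L" using b d by (auto simp: L_def)
   qed
   fix x r assume "x : L" and r: "r :. B"
   then obtain b where b: "b : J" "x = b \<otimes>\<^sub>B c" by (auto simp: L_def)
   have "r \<otimes>\<^sub>B x = (r \<otimes>\<^sub>B b) \<otimes>\<^sub>B c" using b r cc J.Icarr by (simp add: B.m_assoc)
   then show "r \<otimes>\<^sub>B x : L" using b J.I_l_closed[OF b(1) r] by (auto simp: L_def)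
   then show "x \<otimes>\<^sub>B r : L" using b r cc J.Icarr B.m_comm by simp
  qed
  \<comment> \<open>If \<open>J\<close> annihilated \<open>L\<close>, all products of two elements
    of \<open>J\<close> would kill \<open>c\<close>; they span \<open>J\<close>, so \<open>a\<close>
    would kill \<open>c\<close> as well.\<close>
  have "\<exists>a\<in>J. \<exists>y\<in>L. a \<otimes>\<^sub>B y \<noteq> \<zero>\<^sub>B"
  proof (rule ccontr)
   assume "\<not> ?thesis"
   then have z: "b \<otimes>\<^sub>B (d \<otimes>\<^sub>B c) = \<zero>\<^sub>B" if "b : J" "d : J" for b d using that by (auto simp: L_def)
   have s: "{b \<otimes>\<^sub>B d | b d. b : J \<and> d : J} \<subseteq> carrier B" using Jc by auto
   have "a : gen B {b \<otimes>\<^sub>B d | b d. b : J \<and> d : J}"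
    using F.mp_prod[of a "Suc i0" "Suc i0"] a JJ by (simp add: J_def)
   then have "a \<otimes>\<^sub>B c = \<zero>\<^sub>B"
   proof (rule span_induct[OF B.M.abelian_group_axioms s])
    fix s assume "s : {b \<otimes>\<^sub>B d | b d. b : J \<and> d : J}"
    then obtain b d where "s = b \<otimes>\<^sub>B d" "b : J" "d : J" by auto
    then show "s \<otimes>\<^sub>B c = \<zero>\<^sub>B" using z cc J.Icarr by (simp add: B.m_assoc)
   qed (use cc in \<open>simp_all add: B.l_distr B.l_minus\<close>)
   then show False using ac by simp
  qed
  moreover have "L \<subseteq> I" using c Jc I.I_l_closed by (auto simp: L_def)
  ultimately have "L = I" by (rule min[OF Li])
  then obtain b where b: "b : J" "c = b \<otimes>\<^sub>B c" using c by (auto simp: L_def)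
  have bc: "b :. B" using b J.Icarr by simp
  have nm: "\<one>\<^sub>B \<ominus>\<^sub>B b \<notin> m"
  proof
   assume "\<one>\<^sub>B \<ominus>\<^sub>B b : m"
   then have "(\<one>\<^sub>B \<ominus>\<^sub>B b) \<oplus>\<^sub>B b : m" using b Jm by (intro m.a_closed) auto
   then have "\<one>\<^sub>B : m" using bc by (simp add: B.M.minus_add_cancel)
   then show False using m.one_imp_carrier m.I_notcarr by simp
  qed
  have "\<one>\<^sub>B \<ominus>\<^sub>B b :. B" using bc by simp
  from unit_outside[OF this nm] obtain w
   where w: "w :. B" "w \<otimes>\<^sub>B (\<one>\<^sub>B \<ominus>\<^sub>B b) = \<one>\<^sub>B" by (rule bexE)
  have "(\<one>\<^sub>B \<ominus>\<^sub>B b) \<otimes>\<^sub>B c = c \<ominus>\<^sub>B b \<otimes>\<^sub>B c" using bc cc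
   by (simp add: a_minus_def B.l_distr B.l_minus)
  also have "\<dots> = \<zero>\<^sub>B" using b(2) cc by (simp add: B.diff_zero_iff)
  finally have "w \<otimes>\<^sub>B ((\<one>\<^sub>B \<ominus>\<^sub>B b) \<otimes>\<^sub>B c) = \<zero>\<^sub>B" using w by simp
  then have "c = \<zero>\<^sub>B" using w bc cc by (simp add: B.m_assoc[symmetric])
  then show False using ac a Jc by auto
 qed
 then show ?thesis unfolding J_def by blast
qed

abbreviation "res == residue_map K B m"

lemma scalar_closed: "c :. K ==> c \<odot>\<^sub>B \<one>\<^sub>B :. B"
 by simp

lemma res_ex1: assumes b: "b :. B" shows "\<exists>!c. c :. K \<and> b \<ominus>\<^sub>B (c \<odot>\<^sub>B \<one>\<^sub>B) : m"
proof -
 let ?h = "%c. m +>\<^sub>B (c \<odot>\<^sub>B \<one>\<^sub>B)"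
 have h: "?h : ring_iso K (B Quot m)" using la by (simp add: local_artinian_algebra_def)
 have bij: "bij_betw ?h (carrier K) (carrier (B Quot m))" using h by (simp add: ring_iso_def)
 have eq: "(m +>\<^sub>B b = ?h c) \<longleftrightarrow> b \<ominus>\<^sub>B (c \<odot>\<^sub>B \<one>\<^sub>B) : m" if "c :. K" for c
  by (rule B.quotient_eq_iff_same_a_r_cos[OF m.ideal_axioms b scalar_closed[OF that], symmetric])
 have "m +>\<^sub>B b :. (B Quot m)" using b by (auto simp: FactRing_def A_RCOSETS_def')
 then obtain c where c: "c :. K" "m +>\<^sub>B b = ?h c" using bij by (auto simp: bij_betw_def)
 show ?thesis
 proof (rule ex1I[of _ c])
  show "c :. K \<and> b \<ominus>\<^sub>B (c \<odot>\<^sub>B \<one>\<^sub>B) : m" using c eq by simp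
  fix d assume "d :. K \<and> b \<ominus>\<^sub>B (d \<odot>\<^sub>B \<one>\<^sub>B) : m"
  then have "?h d = ?h c" "d :. K" using eq c by auto
  then show "d = c" using bij c(1) by (auto simp: bij_betw_def dest: inj_onD)
 qed
qed

lemma res: assumes "b :. B"
 shows res_closed: "res b :. K" and res_in: "b \<ominus>\<^sub>B (res b \<odot>\<^sub>B \<one>\<^sub>B) : m"
 using theI'[OF res_ex1[OF assms]] by (simp_all add: residue_map_def)

lemma res_unique: "b :. B ==> c :. K ==> b \<ominus>\<^sub>B (c \<odot>\<^sub>B \<one>\<^sub>B) : m ==> res b = c"
 using res_ex1 res by blast

lemma res_add:
 assumes b: "b :. B" and c: "c :. B" shows "res (b \<oplus>\<^sub>B c) = res b \<oplus>\<^sub>K res c"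
proof (rule res_unique)
 have "(b \<oplus>\<^sub>B c) \<ominus>\<^sub>B (res b \<oplus>\<^sub>K res c) \<odot>\<^sub>B \<one>\<^sub>B =
  (b \<ominus>\<^sub>B res b \<odot>\<^sub>B \<one>\<^sub>B) \<oplus>\<^sub>B (c \<ominus>\<^sub>B res c \<odot>\<^sub>B \<one>\<^sub>B)"
  using b c res_closed by (simp add: B.smult_l_distr B.M.ab_simps)
 then show "(b \<oplus>\<^sub>B c) \<ominus>\<^sub>B (res b \<oplus>\<^sub>K res c) \<odot>\<^sub>B \<one>\<^sub>B : m"
  using m.a_closed[OF res_in[OF b] res_in[OF c]] by simp
qed (use b c res_closed in auto)

lemma res_mult:
 assumes b: "b :. B" and c: "c :. B" shows "res (b \<otimes>\<^sub>B c) = res b \<otimes>\<^sub>K res c"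
proof (rule res_unique)
 note rc = res_closed[OF b] res_closed[OF c]
 have "b \<otimes>\<^sub>B c \<ominus>\<^sub>B (res b \<otimes>\<^sub>K res c) \<odot>\<^sub>B \<one>\<^sub>B =
  (b \<ominus>\<^sub>B res b \<odot>\<^sub>B \<one>\<^sub>B) \<otimes>\<^sub>B c \<oplus>\<^sub>B (res b \<odot>\<^sub>B \<one>\<^sub>B) \<otimes>\<^sub>B (c \<ominus>\<^sub>B res c \<odot>\<^sub>B \<one>\<^sub>B)"
  using b c rc by (simp add: B.smult_assoc2 B.smult_assoc1 a_minus_def B.l_distr B.r_distr B.l_minus B.r_minus
    B.smult_r_minus B.smult_r_distr B.M.ab_simps)
 moreover have "\<dots> : m"
  using m.I_r_closed[OF res_in[OF b] c] m.I_l_closed[OF res_in[OF c] scalar_closed[OF rc(1)]] by (rule m.a_closed)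
 ultimately show "b \<otimes>\<^sub>B c \<ominus>\<^sub>B (res b \<otimes>\<^sub>K res c) \<odot>\<^sub>B \<one>\<^sub>B : m" by simp
qed (use b c res_closed in auto)

lemma res_scalar: "c :. K ==> res (c \<odot>\<^sub>B \<one>\<^sub>B) = c"
 by (rule res_unique) (simp_all add: a_minus_def B.M.r_neg)

lemma res_one: "res \<one>\<^sub>B = \<one>\<^sub>K"
 using res_scalar[of "\<one>\<^sub>K"] by simp

lemma res_m: "b : m ==> res b = \<zero>\<^sub>K"
 by (rule res_unique) (simp_all add: m.Icarr)

lemma res_smult: "c :. K ==> b :. B ==> res (c \<odot>\<^sub>B b) = c \<otimes>\<^sub>K res b"
 using res_mult[of "c \<odot>\<^sub>B \<one>\<^sub>B" b] by (simp add: res_scalar B.smult_assoc2)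

end

locale residue_extension = scalar_extension K M B + local_artinian K B m
 for K :: "'k ring" and M :: "('k, 'x) module" and B :: "('k, 'b) module" and m
begin

abbreviation "red == reduction K M B m"

lemma red: shows red_additive: "additive BC M red"
 and red_pure: "!!x b. x :. M ==> b :. B ==> red (pure x b) = res b \<odot>\<^sub>M x"
proof -
 have b: "balanced M (%x b. res b \<odot>\<^sub>M x)"
  by (intro balancedI)
    (simp_all add: res_closed M.smult_r_distr res_add M.smult_l_distr res_smult M.smult_assoc1[symmetric] M.R.m_comm)
 show "additive BC M red" "!!x b. x :. M ==> b :. B ==> red (pure x b) = res b \<odot>\<^sub>M x"
  unfolding reduction_def using bc_lift[OF M.M.abelian_group_axioms b] by auto
qed

lemma red_closed: "X :. BC ==> red X :. M"
 by (rule additive_closed[OF red_additive])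

lemma red_smult:
 assumes b: "b :. B" and X: "X :. BC" shows "red (b \<odot>\<^sub>BC X) = res b \<odot>\<^sub>M red X"
proof (rule bc_ext[OF M.M.abelian_group_axioms additive_comp[OF bc_smult(1)[OF b] red_additive] _ _ X])
 show "additive BC M (%X. res b \<odot>\<^sub>M red X)"
  using b by (intro additiveI) (simp_all add: red_closed res_closed additive_add[OF red_additive] M.smult_r_distr)
qed (use b in \<open>simp_all add: bc_smult(2) red_pure res_mult M.smult_assoc1 res_closed\<close>)

text \<open>Lets the submodule of the definitions be handled as a step of the filtration, for which
  \<open>lin_fil\<close> and nilpotency are available.\<close>

lemma m_part_eq: "m_part K M B m = fil B m BC 1"
proof -
 have g: "{pure x b | x b. x :. M \<and> b : m} \<subseteq> carrier BC" using bc_pure_closed m.Icarr by auto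
 have f: "pure x b : fil B m BC 1" if "x :. M" "b : m" for x b
  using F.fil_base[of b 1 "pure x \<one>\<^sub>B" BC] F.mp_1 pure_one[of x b] that m.Icarr bc_pure_closed by simp
 have h: "b \<odot>\<^sub>BC X : m_part K M B m" if b: "b : m" and X: "X :. BC" for b X
 proof -
  note sp = span_closed[OF bc_group g, folded m_part_def] and sm = bc_smult[OF m.Icarr[OF b]]
  have "X :. T" using X by (simp add: bc_simps)
  then have "X :. BC \<and> b \<odot>\<^sub>BC X : m_part K M B m"
  proof (induction rule: tensor_induct)
   case zero
   then show ?case using additive_zero[OF bc_group bc_group sm(1)] sp(1,2) by (auto simp: bc_simps(2)[symmetric])
  next
   case (pure x y)
   then have "b \<odot>\<^sub>BC pure x y = pure x (b \<otimes>\<^sub>B y)" "b \<otimes>\<^sub>B y : m" using sm(2) m.I_r_closed[OF b] by auto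
   then show ?case using pure bc_pure_closed by (auto simp: m_part_def intro!: span_base)
  next
   case (neg X)
   then show ?case using additive_neg[OF bc_group bc_group sm(1), of X] additive_closed[OF sm(1), of X] sp(4)
     abelian_group.a_inv_closed[OF bc_group, of X] by (simp add: bc_neg[symmetric])
  next
   case (add X Y)
   then show ?case using additive_add[OF sm(1), of X Y] sp(3) abelian_monoid.a_closed[OF abelian_group.axioms(1)[OF bc_group], of X Y]
    by (simp add: bc_simps(3)[symmetric])
  qed
  then show ?thesis by simp
 qed
 interpret BC: module B BC by (rule bc_module)
 show ?thesis
 proof
  show "m_part K M B m \<subseteq> fil B m BC 1"
  proof
   fix X assume "X : m_part K M B m"
   then have "X : gen BC {pure x b | x b. x :. M \<and> b : m}" by (simp add: m_part_def)
   then show "X : fil B m BC 1"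
    by (rule span_induct[OF bc_group g]) (use f F.fil_closed[OF bc_module] in auto)
  qed
  show "fil B m BC 1 \<subseteq> m_part K M B m"
  proof
   fix X assume "X : fil B m BC 1"
   then have "X : gen BC {c \<odot>\<^sub>BC x | c x. c : F.mp 1 \<and> x :. BC}" by (simp add: fil_def)
   then show "X : m_part K M B m"
    by (rule span_induct[OF bc_group F.fil_gen_sub[OF bc_module]])
      (use h F.mp_1 span_closed[OF bc_group g] in \<open>auto simp: m_part_def\<close>)
  qed
 qed
qed

text \<open>On a pure tensor this is the splitting of \<open>b\<close> into its residue and an
  element of \<open>m\<close>. It shows that the kernel of \<open>red\<close> is no larger than the
  \<open>m\<close>-part.\<close>

lemma near_pure: assumes X: "X :. BC" shows "X \<ominus>\<^sub>BC pure (red X) \<one>\<^sub>B : fil B m BC 1"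
proof -
 interpret BC: module B BC by (rule bc_module)
 have "X :. T" using X by (simp add: bc_simps)
 then have "X :. BC \<and> X \<ominus>\<^sub>BC pure (red X) \<one>\<^sub>B : fil B m BC 1"
 proof (induction rule: tensor_induct)
  case zero
  have "pure \<zero>\<^sub>M \<one>\<^sub>B = \<zero>\<^sub>BC"
   using bc_pure_add(1)[of "\<zero>\<^sub>M" "\<zero>\<^sub>M" "\<one>\<^sub>B"] bc_pure_closed[of "\<zero>\<^sub>M" "\<one>\<^sub>B"] by simp
  then show ?case using F.fil_closed(2)[OF bc_module]
   additive_zero[OF bc_group M.M.abelian_group_axioms red_additive] by (simp add: bc_simps(2)[symmetric] BC.M.ab_simps)
 next
  case (pure x b)
  let ?c = "res b \<odot>\<^sub>B \<one>\<^sub>B"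
  have c: "?c :. B" using pure res_closed by simp
  have "pure x b = pure x ((b \<ominus>\<^sub>B ?c) \<oplus>\<^sub>B ?c)" using pure c by (simp add: N.M.minus_add_cancel)
  also have "\<dots> = pure x (b \<ominus>\<^sub>B ?c) \<oplus>\<^sub>BC pure (red (pure x b)) \<one>\<^sub>B"
   using pure c res_closed by (simp add: bc_pure_add red_pure pure_smult)
  finally have e: "pure x b = pure x (b \<ominus>\<^sub>B ?c) \<oplus>\<^sub>BC pure (red (pure x b)) \<one>\<^sub>B" .
  have z: "(u \<oplus>\<^sub>BC w) \<ominus>\<^sub>BC w = u" if "u :. BC" "w :. BC" for u w
   using that by (simp add: BC.M.ab_simps)
  have "pure x b \<ominus>\<^sub>BC pure (red (pure x b)) \<one>\<^sub>B = pure x (b \<ominus>\<^sub>B ?c)"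
   by (subst e, rule z) (use pure c bc_pure_closed red_closed in simp_all)
  also have "\<dots> = (b \<ominus>\<^sub>B ?c) \<odot>\<^sub>BC pure x \<one>\<^sub>B" using pure c by (intro pure_one) auto
  also have "\<dots> : fil B m BC 1"
   using F.fil_base[of "b \<ominus>\<^sub>B ?c" 1 "pure x \<one>\<^sub>B" BC] F.mp_1 res_in[OF pure(2)] bc_pure_closed[OF pure(1)] by simp
  finally show ?case using pure bc_pure_closed by simp
 next
  case (neg X)
  then have X: "X :. BC" by simp
  have "\<ominus>\<^sub>BC X \<ominus>\<^sub>BC pure (red (\<ominus>\<^sub>BC X)) \<one>\<^sub>B = \<ominus>\<^sub>BC (X \<ominus>\<^sub>BC pure (red X) \<one>\<^sub>B)"
  proof -
   have "additive M BC (%x. pure x \<one>\<^sub>B)" by (intro additiveI) (simp_all add: bc_pure_closed bc_pure_add)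
   from additive_neg[OF M.M.abelian_group_axioms bc_group this] show ?thesis
    using X red_closed[OF X] bc_pure_closed[OF red_closed[OF X] S.one_closed]
    by (simp add: additive_neg[OF bc_group M.M.abelian_group_axioms red_additive] BC.M.ab_simps)
  qed
  then show ?case using neg F.fil_closed(4)[OF bc_module] X by (simp add: bc_neg[symmetric])
 next
  case (add X Y)
  then have XY: "X :. BC" "Y :. BC" by auto
  have "(X \<oplus>\<^sub>BC Y) \<ominus>\<^sub>BC pure (red (X \<oplus>\<^sub>BC Y)) \<one>\<^sub>B =
   (X \<ominus>\<^sub>BC pure (red X) \<one>\<^sub>B) \<oplus>\<^sub>BC (Y \<ominus>\<^sub>BC pure (red Y) \<one>\<^sub>B)"
   using XY red_closed by (simp add: additive_add[OF red_additive] bc_pure_add bc_pure_closed BC.M.ab_simps)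
  then show ?case using add F.fil_closed(3)[OF bc_module] XY by (simp add: bc_simps(3)[symmetric])
 qed
 then show ?thesis by simp
qed

lemma red_zero_iff: assumes X: "X :. BC" shows "red X = \<zero>\<^sub>M \<longleftrightarrow> X : fil B m BC 1"
proof
 interpret BC: module B BC by (rule bc_module)
 assume "red X = \<zero>\<^sub>M"
 moreover have "pure \<zero>\<^sub>M \<one>\<^sub>B = \<zero>\<^sub>BC"
  using bc_pure_add(1)[of "\<zero>\<^sub>M" "\<zero>\<^sub>M" "\<one>\<^sub>B"] bc_pure_closed[of "\<zero>\<^sub>M" "\<one>\<^sub>B"] by simp
 ultimately show "X : fil B m BC 1" using near_pure[OF X] X by simp
next
 interpret BC: module B BC by (rule bc_module)
 assume "X : fil B m BC 1"
 then have "X : gen BC {c \<odot>\<^sub>BC x | c x. c : F.mp 1 \<and> x :. BC}" by (simp add: fil_def)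
 then show "red X = \<zero>\<^sub>M"
  by (rule span_induct[OF bc_group F.fil_gen_sub[OF bc_module]])
    (use F.mp_1 m.Icarr red_closed in \<open>auto simp: red_smult res_m additive_zero[OF bc_group M.M.abelian_group_axioms red_additive]
     additive_neg[OF bc_group M.M.abelian_group_axioms red_additive] additive_add[OF red_additive]\<close>)
qed

text \<open>Translates compatibility with the projection to the special fibre into congruence modulo
  \<open>m\<close>, the form in which the filtration can be applied to equivalences.\<close>

lemma red_eq_iff:
 assumes X: "X :. BC" "Y :. BC" shows "red X = red Y \<longleftrightarrow> X \<ominus>\<^sub>BC Y : fil B m BC 1"
proof -
 interpret BC: module B BC by (rule bc_module)
 have "red (X \<ominus>\<^sub>BC Y) = red X \<ominus>\<^sub>M red Y"
  by (rule additive_diff[OF bc_group M.M.abelian_group_axioms red_additive X])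
 then show ?thesis using red_zero_iff[of "X \<ominus>\<^sub>BC Y"] X red_closed M.M.diff_zero_iff by auto
qed

end

section \<open>Associative deformations and perturbations of the resolution\<close>

lemma algebra_isosI:
 assumes "module R X" "lin R X Y f" "!!x y. x :. X ==> y :. X ==> f (x \<otimes>\<^sub>X y) = f x \<otimes>\<^sub>Y f y"
  and "bij_betw f (carrier X) (carrier Y)" "!!x y. x :. X ==> y :. X ==> x \<otimes>\<^sub>X y :. X"
 shows "restrict f (carrier X) : algebra_isos R X Y"
 using lin_restrict[OF assms(1,2)] assms(3,4,5)
 by (auto simp: algebra_isos_def algebra_homs_def cong: bij_betw_cong)

lemma isosD:
 assumes "f : algebra_isos R X Y"
 shows "lin R X Y f" "!!x y. x :. X ==> y :. X ==> f (x \<otimes>\<^sub>X y) = f x \<otimes>\<^sub>Y f y"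
  "bij_betw f (carrier X) (carrier Y)" "f : extensional (carrier X)"
 using assms by (auto simp: algebra_isos_def algebra_homs_def maps_iff)

lemma algebra_isos_comp:
 assumes "nonunital_algebra R X" "f : algebra_isos R X Y" "g : algebra_isos R Y Z"
 shows "restrict (%x. g (f x)) (carrier X) : algebra_isos R X Z"
proof -
 interpret X: nonunital_algebra R X by fact
 note f = isosD[OF assms(2)] and g = isosD[OF assms(3)]
 show ?thesis
 proof (rule algebra_isosI[OF X.module_axioms lin_comp[OF f(1) g(1)]])
  show "bij_betw (%x. g (f x)) (carrier X) (carrier Z)"
   using bij_betw_trans[OF f(3) g(3)] by (simp add: comp_def)
 qed (use f g lin_closed[OF f(1)] X.mult_closed in auto)
qed

lemma algebra_isos_inv:
 assumes X: "nonunital_algebra R X" and Y: "nonunital_algebra R Y" and f: "f : algebra_isos R X Y"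
 shows "restrict (inv_into (carrier X) f) (carrier Y) : algebra_isos R Y X"
  and "!!x. x :. X ==> restrict (inv_into (carrier X) f) (carrier Y) (f x) = x"
  and "!!y. y :. Y ==> f (restrict (inv_into (carrier X) f) (carrier Y) y) = y"
proof -
 interpret X: nonunital_algebra R X by fact
 interpret Y: nonunital_algebra R Y by fact
 note f = isosD[OF f]
 let ?g = "inv_into (carrier X) f"
 have im: "f ` carrier X = carrier Y" and inj: "inj_on f (carrier X)" using f(3) by (auto simp: bij_betw_def)
 have gf: "?g (f x) = x" if "x :. X" for x by (rule inv_into_f_f[OF inj that])
 have fg: "f (?g y) = y" if "y :. Y" for y using that im by (simp add: f_inv_into_f)
 have gc: "?g y :. X" if "y :. Y" for y using that im by (simp add: inv_into_into)
 have eq: "x = x'" if "f x = f x'" "x :. X" "x' :. X" for x x'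
  using inj_onD[OF inj that] .
 show "restrict ?g (carrier Y) : algebra_isos R Y X"
 proof (rule algebra_isosI[OF Y.module_axioms])
  show "lin R Y X ?g"
   by (rule linI; (rule eq)?) (simp_all add: gc fg lin_add[OF f(1)] lin_smult[OF f(1)])
  show "?g (x \<otimes>\<^sub>Y y) = ?g x \<otimes>\<^sub>X ?g y" if "x :. Y" "y :. Y" for x y
   by (rule eq) (use that in \<open>simp_all add: gc fg f(2) X.mult_closed Y.mult_closed\<close>)
  show "bij_betw ?g (carrier Y) (carrier X)" using bij_betw_inv_into[OF f(3)] .
 qed (rule Y.mult_closed)
 show "!!x. x :. X ==> restrict ?g (carrier Y) (f x) = x" using gf lin_closed[OF f(1)] by simp
 show "!!y. y :. Y ==> f (restrict ?g (carrier Y) y) = y" using fg by simp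
qed

locale deformation = extended_resolution K A B + local_artinian K B m
 for K :: "'k ring" and A :: "('k, 'a) module" and B :: "('k, 'b) module" and m
begin

sublocale RA: residue_extension K A B m
 by (intro residue_extension.intro AB.scalar_extension_axioms local_artinian_axioms)

sublocale RO: residue_extension K "omega K A" B m
 by (intro residue_extension.intro OB.scalar_extension_axioms local_artinian_axioms)

abbreviation "pd == perturbed_diff K A B"
abbreviation "MCa == MC_ass K A B m"
abbreviation "MCr == MC_rel K A B m"
abbreviation "eqa == equiv_ass K A B m"
abbreviation "eqr == equiv_rel K A B m"
abbreviation "FA == fil B m Am 1"
abbreviation "FO == fil B m Om 1"

sublocale AA: tensor_modules B Am Am
 by (intro tensor_modules.intro Am.module_axioms)

abbreviation "tAA == tensor B Am Am"
abbreviation "Df \<beta> == deformed_algebra K A B \<beta>"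
abbreviation "\<Delta> \<beta> == cobar_perturbation K A B \<beta>"

definition "nil = (SOME n. F.mp n \<subseteq> {\<zero>\<^sub>B})"

lemma nil: "F.mp nil \<subseteq> {\<zero>\<^sub>B}"
 unfolding nil_def by (rule someI_ex[OF m_nilpotent])

lemmas Am_m = Am.module_axioms
lemmas Om_m = Om.module_axioms
lemmas FAc = F.fil_closed[OF Am_m]
lemmas FOc = F.fil_closed[OF Om_m]

lemma Df_simps: "carrier (Df \<beta>) = carrier Am" "zero (Df \<beta>) = zero Am" "add (Df \<beta>) = add Am" "smult (Df \<beta>) = smult Am"
 "x \<otimes>\<^bsub>Df \<beta>\<^esub> y = (x \<otimes>\<^sub>Am y) \<oplus>\<^sub>Am \<beta> (AA.pure x y)"
 by (simp_all add: deformed_algebra_def)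

lemma Df_same: "same_module (Df \<beta>)"
 by (simp add: same_module_def Df_simps)

lemma MC_assD:
 assumes "\<beta> : MCa"
 shows "lin B tAA Am \<beta>" "\<beta> : extensional (carrier tAA)" "!!X. X :. tAA ==> \<beta> X : FA"
  "nonunital_algebra B (Df \<beta>)"
 using assms by (auto simp: MC_ass_def maps_iff RA.m_part_eq)

lemma MC_ass_word_algebra: "\<beta> : MCa ==> word_algebra B (Df \<beta>) Om WB"
 by (rule WB_word_algebra[OF MC_assD(4) Df_same])

text \<open>\<open>v\<close> and \<open>gr\<close> are constants of a word algebra for
  \<open>P\<close> but depend on \<open>P\<close> only through its carrier, so all deformed products
  share them.\<close>

lemma same_v:
 assumes "word_algebra B P Om WB" "carrier P = carrier Am"
 shows "word_algebra.v B P Om WB = W0.v"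
 by (intro ext) (simp add: word_algebra.v_def[OF assms(1)] W0.v_def assms(2))

lemma same_gr:
 assumes "word_algebra B P Om WB" "carrier P = carrier Am"
 shows "word_algebra.gr P Om WB = W0.gr"
 by (intro ext) (simp add: word_algebra.gr_def[OF assms(1)] W0.gr_def assms(2))

lemma W0_sub: "WB ` NW Am \<subseteq> carrier Om"
 using WB_closed by auto

lemma FO_from_words:
 assumes f: "lin B Om Om f" and w: "!!ws. ws : NW Am ==> f (WB ws) : FO" and y: "y :. Om"
 shows "f y : FO"
 unfolding fil_def
 by (rule additive_image_span[OF Om.M.abelian_group_axioms Om.M.abelian_group_axioms lin_additive[OF f] W0_sub F.fil_gen_sub[OF Om_m]])
   (use w y WB_span in \<open>auto simp: fil_def\<close>)

lemma FO_mult: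
 "y : FO ==> z :. Om ==> y \<otimes>\<^sub>Om z : FO" "y : FO ==> z :. Om ==> z \<otimes>\<^sub>Om y : FO"
 by (rule F.lin_fil[OF Om_m Om_m W0.X_mult_lin(1)] F.lin_fil[OF Om_m Om_m W0.X_mult_lin(2)]; assumption)+

text \<open>The product enters \<open>D\<close> through \<open>mm\<close> only, and
  \<open>mm\<close> changes a single letter; so congruent products give congruent
  differentials.\<close>

lemma D_near:
 assumes P: "word_algebra B P Om WB" "carrier P = carrier Am"
  and near: "!!x y. x :. Am ==> y :. Am ==> (x \<otimes>\<^sub>P y) \<ominus>\<^sub>Am (x \<otimes>\<^sub>Am y) : FA"
  and y: "y :. Om"
 shows "DP P y \<ominus>\<^sub>Om W0.D y : FO"
proof -
 interpret W: word_algebra B P Om WB by fact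
 have v: "W.v = W0.v" by (rule same_v[OF P])
 have l: "lin B Om Om (%y. W.D y \<ominus>\<^sub>Om W0.D y)" by (rule lin_minus[OF Om_m W.D_lin W0.D_lin])
 have mm: "W.mm a (WB ws) \<ominus>\<^sub>Om W0.mm a (WB ws) : FO" if a: "a :. Am" and ws: "ws : NW Am" for a ws
 proof -
  obtain b w vs where wv: "ws = (b # w) # vs"
   using ws by (cases ws; cases "hd ws") (auto simp: words_def)
  have b: "b :. Am" using ws wv by (simp add: words_def)
  have lx: "lin B Am Om (%x. WB ((x # w) # vs))"
   using nmultilinD[OF WB_multilin, of "[]" vs "[]" w] ws wv by (auto simp: words_def)
  have mc: "a \<otimes>\<^sub>P b :. Am" using W.M.mult_closed[of a b] a b P(2) by simp
  have "W.mm a (WB ws) \<ominus>\<^sub>Om W0.mm a (WB ws) = WB ((((a \<otimes>\<^sub>P b) \<ominus>\<^sub>Am (a \<otimes>\<^sub>Am b)) # w) # vs)"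
   using W.mm_W[of a b w vs] W0.mm_W[of a b w vs] a ws wv P(2) lin_diff[OF Am_m Om_m lx mc Am.mult_closed[OF a b]] by simp
  then show ?thesis using F.lin_fil[OF Am_m Om_m lx near[OF a b]] by simp
 qed
 have "W.D (WB ws) \<ominus>\<^sub>Om W0.D (WB ws) : FO" if "ws : NW Am" for ws
  using that
 proof (induction rule: nested_induct)
  case (one a)
  have "W.D (WB [[a]]) = \<zero>\<^sub>Om" "W0.D (WB [[a]]) = \<zero>\<^sub>Om"
   using one P(2) W.D_i W0.D_i by (simp_all add: W.i_def[symmetric] W0.i_def[symmetric])
  then show ?case using FOc(2) by simp
 next
  case (tensor a ws)
  have c: "WB ws :. Om" "a :. P" using tensor WB_closed P(2) by auto
  have "W.D (WB ([a] # ws)) = W0.i a \<otimes>\<^sub>Om W.D (WB ws)" "W0.D (WB ([a] # ws)) = W0.i a \<otimes>\<^sub>Om W0.D (WB ws)"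
   using tensor c W.D_u[OF c(2,1)] by (simp_all add: W0.W_tensor W0.D_u)
  then show ?case
   using FO_mult(2)[OF tensor(3) W0.i_closed[OF tensor(1)]] lin_diff[OF Om_m Om_m W0.X_mult_lin(2)[OF W0.i_closed[OF tensor(1)]]
     W.D_closed[OF c(1)] W0.D_closed[OF c(1)]] by simp
 next
  case (bar a w ws)
  let ?y = "WB (w # ws)"
  have c: "?y :. Om" "a :. P" using bar WB_closed P(2) by auto
  note vl = W0.v_lin[OF bar(1)]
  have d: "!!s t t' r r'. s :. Om ==> t :. Om ==> t' :. Om ==> r :. Om ==> r' :. Om ==>
   ((\<ominus>\<^sub>Om s \<oplus>\<^sub>Om t) \<oplus>\<^sub>Om \<ominus>\<^sub>Om r) \<ominus>\<^sub>Om ((\<ominus>\<^sub>Om s \<oplus>\<^sub>Om t') \<oplus>\<^sub>Om \<ominus>\<^sub>Om r') = (t \<ominus>\<^sub>Om t') \<ominus>\<^sub>Om (r \<ominus>\<^sub>Om r')"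
   by (simp add: Om.M.ab_simps)
  have "W.D (WB ((a # w) # ws)) \<ominus>\<^sub>Om W0.D (WB ((a # w) # ws)) =
   (W.mm a ?y \<ominus>\<^sub>Om W0.mm a ?y) \<ominus>\<^sub>Om (W0.v a (W.D ?y) \<ominus>\<^sub>Om W0.v a (W0.D ?y))"
   using W.D_v[OF c(2,1)] W0.D_v[OF bar(1) c(1)] bar(1,2) c
   by (simp add: W0.W_bar v d W0.Xcl2 W.mm_closed W.D_closed)
  also have "W0.v a (W.D ?y) \<ominus>\<^sub>Om W0.v a (W0.D ?y) = W0.v a (W.D ?y \<ominus>\<^sub>Om W0.D ?y)"
   using lin_diff[OF Om_m Om_m vl W.D_closed[OF c(1)] W0.D_closed[OF c(1)]] by simp
  finally show ?case using FOc(5)[OF mm[OF bar(1,2)] F.lin_fil[OF Om_m Om_m vl bar(3)]] by simp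
 qed
 then show ?thesis by (rule FO_from_words[OF l _ y])
qed

lemma MC_ass_near:
 assumes \<beta>: "\<beta> : MCa" and x: "x :. Am" and y: "y :. Am"
 shows "(x \<otimes>\<^bsub>Df \<beta>\<^esub> y) \<ominus>\<^sub>Am (x \<otimes>\<^sub>Am y) = \<beta> (AA.pure x y)" "(x \<otimes>\<^bsub>Df \<beta>\<^esub> y) \<ominus>\<^sub>Am (x \<otimes>\<^sub>Am y) : FA"
proof -
 have c: "\<beta> (AA.pure x y) : FA" by (rule MC_assD(3)[OF \<beta> AA.pure_closed[OF x y]])
 then have "\<beta> (AA.pure x y) :. Am" using FAc(1) by blast
 then show "(x \<otimes>\<^bsub>Df \<beta>\<^esub> y) \<ominus>\<^sub>Am (x \<otimes>\<^sub>Am y) = \<beta> (AA.pure x y)"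
  using Am.mult_closed[OF x y] by (simp add: Df_simps Am.M.ab_simps)
 then show "(x \<otimes>\<^bsub>Df \<beta>\<^esub> y) \<ominus>\<^sub>Am (x \<otimes>\<^sub>Am y) : FA" using c by simp
qed

lemma \<Delta>_eq:
 assumes \<beta>: "\<beta> : MCa"
 shows "\<Delta> \<beta> = restrict (%y. DP (Df \<beta>) y \<ominus>\<^sub>Om W0.D y) (carrier Om)"
 unfolding cobar_perturbation_def
 by (rule restrict_ext)
   (simp add: cobar_bar_diff_eq[OF MC_assD(4)[OF \<beta>] Df_same] cobar_bar_diff_eq[OF Am.nonunital_algebra_axioms same_module_self])

lemma perturbed_eq: "y :. Om ==> pd \<delta> y = W0.D y \<oplus>\<^sub>Om \<delta> y"
 by (simp add: perturbed_diff_def base_change_diff)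

lemma perturbed_\<Delta>:
 assumes \<beta>: "\<beta> : MCa" and y: "y :. Om"
 shows "pd (\<Delta> \<beta>) y = DP (Df \<beta>) y"
proof -
 interpret W: word_algebra B "Df \<beta>" Om WB by (rule MC_ass_word_algebra[OF \<beta>])
 show ?thesis using y W.D_closed[OF y] W0.D_closed[OF y] by (simp add: perturbed_eq \<Delta>_eq[OF \<beta>] Om.M.ab_simps)
qed

text \<open>\<open>pd (\<Delta> \<beta>)\<close> is the differential of the word algebra for the
  product \<open>\<alpha> + \<beta>\<close>, so the Maurer-Cartan equation is \<open>D_D\<close>;
  the image lies in the \<open>m\<close>-part by \<open>D_near\<close>.\<close>

lemma \<Delta>_MC_rel:
 assumes \<beta>: "\<beta> : MCa" shows "\<Delta> \<beta> : MCr"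
proof -
 interpret W: word_algebra B "Df \<beta>" Om WB by (rule MC_ass_word_algebra[OF \<beta>])
 have c: "carrier (Df \<beta>) = carrier Am" by (simp add: Df_simps)
 have gr: "W.gr = W0.gr" by (rule same_gr[OF W.word_algebra_axioms c])
 have l: "lin B Om Om (%y. W.D y \<ominus>\<^sub>Om W0.D y)" by (rule lin_minus[OF Om_m W.D_lin W0.D_lin])
 have "\<Delta> \<beta> : odd_derivations B Om (omegaB_degree K A B)"
  unfolding odd_derivations_def omegaB_degree_eq
 proof (intro CollectI conjI allI ballI)
  show "\<Delta> \<beta> : linear_maps B Om Om" unfolding \<Delta>_eq[OF \<beta>] by (rule lin_restrict[OF Om_m l])
  show "\<Delta> \<beta> ` W0.gr k \<subseteq> W0.gr (k + 1)" for k
  proof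
   fix z assume "z : \<Delta> \<beta> ` W0.gr k"
   then obtain y where y: "y : W0.gr k" "z = \<Delta> \<beta> y" by auto
   then have "y :. Om" using W0.gr_closed(1) by auto
   then show "z : W0.gr (k + 1)"
    using y W0.gr_closed(5)[OF W.D_gr[unfolded gr, OF y(1)] W0.D_gr[OF y(1)]] by (simp add: \<Delta>_eq[OF \<beta>])
  qed
  fix k y z assume y: "y : W0.gr k" and z: "z :. Om"
  then have yc: "y :. Om" using W0.gr_closed(1) by auto
  show "\<Delta> \<beta> (y \<otimes>\<^sub>Om z) = \<Delta> \<beta> y \<otimes>\<^sub>Om z \<oplus>\<^sub>Om signed Om k (y \<otimes>\<^sub>Om \<Delta> \<beta> z)"
   using yc z W.D_leibniz[unfolded gr, OF y z] W0.D_leibniz[OF y z]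
   by (simp add: \<Delta>_eq[OF \<beta>] Om.mult_closed W.D_closed W0.D_closed a_minus_def Om.mult_add_left Om.mult_add_right Om.mult_neg
     signed_def Om.M.ab_simps)
 qed
 moreover have "\<Delta> \<beta> ` carrier Om \<subseteq> m_part K (omega K A) B m"
  using D_near[OF W.word_algebra_axioms c MC_ass_near(2)[OF \<beta>]] by (auto simp: \<Delta>_eq[OF \<beta>] RO.m_part_eq)
 moreover have "\<forall>x\<in>carrier Om. pd (\<Delta> \<beta>) (pd (\<Delta> \<beta>) x) = \<zero>\<^sub>Om"
  using W.D_D W.D_closed by (simp add: perturbed_\<Delta>[OF \<beta>])
 ultimately show ?thesis by (simp add: MC_rel_def)
qed

text \<open>On a generator \<open>[x|y]\<close> the two differentials share the term in which
  \<open>x\<close> and \<open>y\<close> are separated; what is left of their difference is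
  \<open>i\<close> of the difference of the products, and \<open>p\<close> undoes
  \<open>i\<close>.\<close>

lemma compose_p_\<Delta>:
 assumes \<beta>: "\<beta> : MCa" shows "compose_p K A B (\<Delta> \<beta>) = \<beta>"
proof -
 interpret W: word_algebra B "Df \<beta>" Om WB by (rule MC_ass_word_algebra[OF \<beta>])
 have c: "carrier (Df \<beta>) = carrier Am" by (simp add: Df_simps)
 have v: "W.v = W0.v" by (rule same_v[OF W.word_algebra_axioms c])
 let ?Q = "%\<beta>'. \<beta>' : linear_maps B tAA Am \<and> (\<forall>a\<in>carrier A. \<forall>a'\<in>carrier A.
   \<beta>' (AA.pure (AB.pure a \<one>\<^sub>B) (AB.pure a' \<one>\<^sub>B)) =
   base_change_map K (omega K A) A B (omega_proj K A) (\<Delta> \<beta> (OB.pure (omega_word K A [[a, a']]) \<one>\<^sub>B)))"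
 have val: "base_change_map K (omega K A) A B (omega_proj K A) (\<Delta> \<beta> (OB.pure (omega_word K A [[a, a']]) \<one>\<^sub>B)) =
  \<beta> (AA.pure (\<iota> a) (\<iota> a'))" if a: "a :. A" and a': "a' :. A" for a a'
 proof -
  let ?x = "\<iota> a" and ?y = "\<iota> a'"
  note x = \<iota>_closed[OF a] and y = \<iota>_closed[OF a']
  have nw: "[[a, a']] : NW A" "[[?x, ?y]] : NW Am" "[[?y]] : NW Am" using a a' x y by (auto simp: words_def)
  have bc: "\<beta> (AA.pure ?x ?y) :. Am" using lin_closed[OF MC_assD(1)[OF \<beta>] AA.pure_closed[OF x y]] .
  have w: "OB.pure (omega_word K A [[a, a']]) \<one>\<^sub>B = W0.v ?x (W0.i ?y)"
   using WB_\<iota>[OF nw(1)] W0.W_bar[OF x nw(3)] by (simp add: W0.i_def)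
  have "W.D (W0.v ?x (W0.i ?y)) = \<ominus>\<^sub>Om (W0.i ?x \<otimes>\<^sub>Om W0.i ?y) \<oplus>\<^sub>Om W0.i (?x \<otimes>\<^bsub>Df \<beta>\<^esub> ?y)"
   using W.D_v[of ?x "W0.i ?y"] W.D_i[of ?y] W.mm_i[of ?x ?y] W.i_closed[of ?y] W.Xneg[OF W.v_lin[of ?x]] x y
    W.M.mult_closed[of ?x ?y]
   by (simp add: c v W0.Xcl Om.mult_closed)
  moreover have "W0.D (W0.v ?x (W0.i ?y)) = \<ominus>\<^sub>Om (W0.i ?x \<otimes>\<^sub>Om W0.i ?y) \<oplus>\<^sub>Om W0.i (?x \<otimes>\<^sub>Am ?y)"
   using x y by (simp add: W0.D_v W0.D_i W0.mm_i W0.Xcl W0.Xneg[OF W0.v_lin])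
  moreover have "?x \<otimes>\<^bsub>Df \<beta>\<^esub> ?y :. Am" using W.M.mult_closed[of ?x ?y] x y by (simp add: c)
  ultimately have "\<Delta> \<beta> (W0.v ?x (W0.i ?y)) = W0.i (?x \<otimes>\<^bsub>Df \<beta>\<^esub> ?y) \<ominus>\<^sub>Om W0.i (?x \<otimes>\<^sub>Am ?y)"
   using x y by (simp add: \<Delta>_eq[OF \<beta>] W0.Xcl Om.M.ab_simps)
  also have "\<dots> = W0.i (\<beta> (AA.pure ?x ?y))"
   using lin_diff[OF Am_m Om_m W0.i_lin \<open>?x \<otimes>\<^bsub>Df \<beta>\<^esub> ?y : carrier Am\<close> Am.mult_closed[OF x y]] MC_ass_near(1)[OF \<beta> x y] by simp
  finally show ?thesis using base_change_proj[OF W0.i_closed[OF bc]] W0.p_i[OF bc] by (simp add: w)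
 qed
 have 1: "?Q \<beta>" using val MC_assD(1,2)[OF \<beta>] by (simp add: maps_iff \<iota>_def)
 have 2: "\<gamma> = \<beta>" if g: "?Q \<gamma>" for \<gamma>
 proof -
  have l: "lin B tAA Am \<gamma>" and e: "\<gamma> : extensional (carrier tAA)" using g by (auto simp: maps_iff)
  note lb = MC_assD(1)[OF \<beta>]
  have p1: "lin B Am tAA (%x. AA.pure x y)" if "y :. Am" for y
   using that by (intro linI) (simp_all add: AA.pure_closed AA.pure_add_left AA.tensor_smult_additive(2))
  have p2: "lin B Am tAA (%y. AA.pure x y)" if "x :. Am" for x
   using that by (intro linI) (simp_all add: AA.pure_closed AA.pure_add_right AA.tensor_smult_additive(2) AA.pure_smult[symmetric])
  have s1: "\<gamma> (AA.pure (\<iota> a) y) = \<beta> (AA.pure (\<iota> a) y)" if a: "a :. A" and y: "y :. Am" for a y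
   by (rule Am_lin_ext[OF Am_m lin_comp[OF p2[OF \<iota>_closed[OF a]] l] lin_comp[OF p2[OF \<iota>_closed[OF a]] lb] _ y])
     (use g val a in \<open>simp add: \<iota>_def\<close>)
  have s2: "\<gamma> (AA.pure x y) = \<beta> (AA.pure x y)" if x: "x :. Am" and y: "y :. Am" for x y
   by (rule Am_lin_ext[OF Am_m lin_comp[OF p1[OF y] l] lin_comp[OF p1[OF y] lb] s1[OF _ y] x])
  have "\<gamma> X = \<beta> X" if "X :. tAA" for X
   by (rule AA.tensor_ext[OF Am.M.abelian_group_axioms lin_additive[OF l] lin_additive[OF lb] s2 that])
  then show ?thesis using e MC_assD(2)[OF \<beta>] by (intro extensionalityI) auto
 qed
 show ?thesis unfolding compose_p_def using 1 2 by (intro the_equality)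
qed

lemma MC_relD:
 assumes "\<delta> : MCr"
 shows "lin B Om Om \<delta>" "!!y k. y : W0.gr k ==> \<delta> y : W0.gr (k + 1)"
  "!!y k z. y : W0.gr k ==> z :. Om ==>
   \<delta> (y \<otimes>\<^sub>Om z) = \<delta> y \<otimes>\<^sub>Om z \<oplus>\<^sub>Om signed Om k (y \<otimes>\<^sub>Om \<delta> z)"
  "!!y. y :. Om ==> \<delta> y : FO"
  "!!y. y :. Om ==> pd \<delta> (pd \<delta> y) = \<zero>\<^sub>Om"
 using assms unfolding MC_rel_def odd_derivations_def omegaB_degree_eq
 by (auto simp: maps_iff RO.m_part_eq image_subset_iff)

text \<open>By \<open>near_identity\<close>, congruence to the identity modulo \<open>m\<close>
  already gives bijectivity, also in each degree, so it is enough to produce a homomorphism of DG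
  algebras.\<close>

lemma equiv_relI:
 assumes \<delta>: "\<delta> : MCr" "\<delta>' : MCr"
  and f: "lin B Om Om f" and mult: "!!y z. y :. Om ==> z :. Om ==> f (y \<otimes>\<^sub>Om z) = f y \<otimes>\<^sub>Om f z"
  and near: "!!y. y :. Om ==> f y \<ominus>\<^sub>Om y : FO"
  and gr: "!!y k. y : W0.gr k ==> f y : W0.gr k"
  and eq: "!!y. y :. Om ==> f (pd \<delta> y) = pd \<delta>' (f y)"
 shows "(\<delta>, \<delta>') : eqr"
proof -
 have pc: "pd \<delta> y :. Om" if "y :. Om" for y
  using that lin_closed[OF MC_relD(1)[OF \<delta>(1)]] W0.D_closed by (simp add: perturbed_eq)
 have bij: "bij_betw f (carrier Om) (carrier Om)" by (rule F.near_identity_bij[OF Om_m f near nil])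
 have iso: "restrict f (carrier Om) : algebra_isos B Om Om"
  by (rule algebra_isosI[OF Om_m f mult bij Om.mult_closed])
 have img: "f ` W0.gr k = W0.gr k" for k
  by (rule F.near_identity_sub[OF Om_m f near nil]) (use W0.gr_closed gr in auto)
 have red: "RO.red (f y) = RO.red y" if "y :. Om" for y
  using RO.red_eq_iff[OF lin_closed[OF f that] that] near[OF that] by simp
 have img': "restrict f (carrier Om) ` W0.gr k = W0.gr k" for k
 proof -
  have "restrict f (carrier Om) ` W0.gr k = f ` W0.gr k"
   by (rule image_cong[OF refl]) (use W0.gr_closed(1)[of k] in auto)
  then show ?thesis using img[of k] by simp
 qed
 show ?thesis unfolding equiv_rel_def omegaB_degree_eq
  by (intro CollectI case_prodI conjI \<delta> bexI[OF _ iso] allI ballI img') (simp_all add: red eq pc)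
qed

lemma equiv_relD:
 assumes "(\<delta>, \<delta>') : eqr"
 obtains f where "f : algebra_isos B Om Om" "!!k. f ` W0.gr k = W0.gr k"
  "!!y. y :. Om ==> f (pd \<delta> y) = pd \<delta>' (f y)"
  "!!y. y :. Om ==> f y \<ominus>\<^sub>Om y : FO"
proof -
 from assms obtain f where f: "f : algebra_isos B Om Om" "\<forall>k. f ` W0.gr k = W0.gr k"
  "\<forall>y\<in>carrier Om. f (pd \<delta> y) = pd \<delta>' (f y)"
  "\<forall>y\<in>carrier Om. RO.red (f y) = RO.red y"
  unfolding equiv_rel_def omegaB_degree_eq by auto
 have "f y \<ominus>\<^sub>Om y : FO" if "y :. Om" for y
  using RO.red_eq_iff[OF lin_closed[OF isosD(1)[OF f(1)] that] that] f(4) that by simp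
 then show thesis using that f by blast
qed

lemma equiv_ass_iff:
 "(\<beta>, \<beta>') : eqa \<longleftrightarrow> \<beta> : MCa \<and> \<beta>' : MCa \<and>
  (\<exists>\<Phi>\<in>algebra_isos B (Df \<beta>) (Df \<beta>'). \<forall>x\<in>carrier Am. RA.red (\<Phi> x) = RA.red x)"
 by (simp add: equiv_ass_def)

lemma equiv_assI:
 assumes \<beta>: "\<beta> : MCa" "\<beta>' : MCa"
  and f: "lin B Am Am f" and mult: "!!x y. x :. Am ==> y :. Am ==> f (x \<otimes>\<^bsub>Df \<beta>\<^esub> y) = f x \<otimes>\<^bsub>Df \<beta>'\<^esub> f y"
  and near: "!!x. x :. Am ==> f x \<ominus>\<^sub>Am x : FA"
 shows "(\<beta>, \<beta>') : eqa"
proof -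
 interpret P: nonunital_algebra B "Df \<beta>" by (rule MC_assD(4)[OF \<beta>(1)])
 have bij: "bij_betw f (carrier Am) (carrier Am)" by (rule F.near_identity_bij[OF Am_m f near nil])
 have l: "lin B (Df \<beta>) (Df \<beta>') f" using f by (simp add: same_module_lin[OF Df_same])
 have "restrict f (carrier (Df \<beta>)) : algebra_isos B (Df \<beta>) (Df \<beta>')"
  by (rule algebra_isosI[OF P.module_axioms l]) (use mult bij P.mult_closed in \<open>simp_all add: Df_simps(1)\<close>)
 moreover have "RA.red (f x) = RA.red x" if "x :. Am" for x
  using RA.red_eq_iff[OF lin_closed[OF f that] that] near[OF that] by simp
 ultimately show ?thesis unfolding equiv_ass_iff using \<beta>
  by (auto simp: Df_simps(1) intro!: bexI[of _ "restrict f (carrier (Df \<beta>))"])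
qed

lemma equiv_assD:
 assumes "(\<beta>, \<beta>') : eqa"
 obtains f where "f : algebra_isos B (Df \<beta>) (Df \<beta>')" "lin B Am Am f"
  "!!x y. x :. Am ==> y :. Am ==> f (x \<otimes>\<^bsub>Df \<beta>\<^esub> y) = f x \<otimes>\<^bsub>Df \<beta>'\<^esub> f y"
  "!!x. x :. Am ==> f x \<ominus>\<^sub>Am x : FA"
proof -
 from assms obtain f where f: "f : algebra_isos B (Df \<beta>) (Df \<beta>')" "\<forall>x\<in>carrier Am. RA.red (f x) = RA.red x"
  unfolding equiv_ass_iff by auto
 have l: "lin B Am Am f" using isosD(1)[OF f(1)] by (simp add: same_module_lin[OF Df_same])
 have "f x \<ominus>\<^sub>Am x : FA" if "x :. Am" for x
  using RA.red_eq_iff[OF lin_closed[OF l that] that] f(2) that by simp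
 then show thesis using that f(1) l isosD(2)[OF f(1)] by (simp add: Df_simps(1))
qed

text \<open>The construction is functorial: a homomorphism \<open>f\<close> of deformed algebras
  acts letterwise on nested words, and this action commutes with the differentials by
  \<open>word_morphism_D\<close>.\<close>

lemma ass_to_rel:
 assumes e: "(\<beta>, \<beta>') : eqa" shows "(\<Delta> \<beta>, \<Delta> \<beta>') : eqr"
proof -
 have \<beta>: "\<beta> : MCa" "\<beta>' : MCa" using e by (auto simp: equiv_ass_iff)
 interpret W: word_algebra B "Df \<beta>" Om WB by (rule MC_ass_word_algebra[OF \<beta>(1)])
 interpret W': word_algebra B "Df \<beta>'" Om WB by (rule MC_ass_word_algebra[OF \<beta>(2)])
 obtain f where f: "lin B Am Am f"
  and fm: "!!x y. x :. Am ==> y :. Am ==> f (x \<otimes>\<^bsub>Df \<beta>\<^esub> y) = f x \<otimes>\<^bsub>Df \<beta>'\<^esub> f y"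
  and near: "!!x. x :. Am ==> f x \<ominus>\<^sub>Am x : FA" using equiv_assD[OF e] by metis
 note fc = lin_closed[OF f]
 have "multilin B Am Om (%w. WB [map f w])"
  unfolding multilin_def
 proof (intro allI impI)
  fix xs ys assume s: "set xs \<subseteq> carrier Am" "set ys \<subseteq> carrier Am"
  then have "lin B Am Om (%x. WB [map f xs @ x # map f ys])"
   using nmultilinD[OF WB_multilin, of "[]" "[]" "map f xs" "map f ys"] fc by (auto simp: subset_iff)
  from lin_comp[OF f this] show "lin B Am Om (%x. WB [map f (xs @ x # ys)])" by simp
 qed
 from W0.algebra_hom_extension[OF this] obtain h where h: "lin B Om Om h"
  "!!w. w : nonempty_words (carrier Am) ==> h (WB [w]) = WB [map f w]"
  "!!y z. y :. Om ==> z :. Om ==> h (y \<otimes>\<^sub>Om z) = h y \<otimes>\<^sub>Om h z" by auto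
 have mw: "map (map f) ws : NW Am" if "ws : NW Am" for ws
  using that fc by (auto simp: words_def subset_iff)
 have hW: "h (WB ws) = WB (map (map f) ws)" if "ws : NW Am" for ws
  using that
 proof (induction ws rule: list.induct)
  case Nil
  then show ?case by (simp add: words_def)
 next
  case (Cons w ws)
  then have w: "w : nonempty_words (carrier Am)" "[w] : NW Am" by (auto simp: words_def)
  show ?case
  proof (cases "ws = []")
   case True
   then show ?thesis using h(2)[OF w(1)] by simp
  next
   case False
   then have ws: "ws : NW Am" using Cons.prems by (auto simp: words_def)
   have "h (WB (w # ws)) = h (WB [w]) \<otimes>\<^sub>Om h (WB ws)"
    using WB_append[OF w(2) ws] h(3)[OF WB_closed[OF w(2)] WB_closed[OF ws]] by simp
   then show ?thesis using WB_append[OF mw[OF w(2)] mw[OF ws]] h(2)[OF w(1)] Cons.IH[OF ws] by simp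
  qed
 qed
 show ?thesis
 proof (rule equiv_relI[OF \<Delta>_MC_rel[OF \<beta>(1)] \<Delta>_MC_rel[OF \<beta>(2)] h(1) h(3)])
  have l: "lin B Om Om (%y. h y \<ominus>\<^sub>Om y)" by (rule lin_minus[OF Om_m h(1) lin_id])
  \<comment> \<open>The two words are compared by changing one letter at a time; each change
    contributes a term containing the difference of \<open>f a\<close> and \<open>a\<close>.\<close>
  have "h (WB ws) \<ominus>\<^sub>Om WB ws : FO" if "ws : NW Am" for ws
   using that
  proof (induction rule: nested_induct)
   case (one a)
   have "h (WB [[a]]) \<ominus>\<^sub>Om WB [[a]] = W0.i (f a \<ominus>\<^sub>Am a)"
    using hW[of "[[a]]"] one lin_diff[OF Am_m Om_m W0.i_lin fc[OF one] one] by (simp add: W0.i_def words_def)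
   then show ?case using F.lin_fil[OF Am_m Om_m W0.i_lin near[OF one]] by simp
  next
   case (tensor a ws)
   let ?y = "WB ws"
   have c: "?y :. Om" "h ?y :. Om" using WB_closed[OF tensor(2)] lin_closed[OF h(1)] by auto
   have e: "h (WB ([a] # ws)) = W0.i (f a) \<otimes>\<^sub>Om h ?y"
    using hW[of "[a] # ws"] hW[OF tensor(2)] tensor W0.W_tensor[OF fc[OF tensor(1)] mw[OF tensor(2)]] by (simp add: words_def)
   have "h (WB ([a] # ws)) \<ominus>\<^sub>Om WB ([a] # ws) =
    (W0.i (f a \<ominus>\<^sub>Am a) \<otimes>\<^sub>Om h ?y) \<oplus>\<^sub>Om (W0.i a \<otimes>\<^sub>Om (h ?y \<ominus>\<^sub>Om ?y))"
    unfolding e unfolding W0.W_tensor[OF tensor(1,2)] lin_diff[OF Am_m Om_m W0.i_lin fc[OF tensor(1)] tensor(1)]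
    using c tensor(1) fc by (simp add: a_minus_def Om.mult_add_left Om.mult_add_right Om.mult_neg W0.Xcl Om.M.ab_simps)
   then show ?case using FOc(3)[OF FO_mult(1)[OF F.lin_fil[OF Am_m Om_m W0.i_lin near[OF tensor(1)]] c(2)]
     FO_mult(2)[OF tensor(3) W0.i_closed[OF tensor(1)]]] by simp
  next
   case (bar a w ws)
   let ?y = "WB (w # ws)"
   have c: "?y :. Om" "h ?y :. Om" using WB_closed[OF bar(2)] lin_closed[OF h(1)] by auto
   have nw: "(a # w) # ws : NW Am" using bar by (auto simp: words_def)
   have e: "h (WB ((a # w) # ws)) = W0.v (f a) (h ?y)"
    using hW[OF nw] hW[OF bar(2)] W0.W_bar[OF fc[OF bar(1)], of "map f w" "map (map f) ws"] mw[OF bar(2)] by simp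
   have "W0.v (f a \<ominus>\<^sub>Am a) (h ?y) = W0.v (f a) (h ?y) \<ominus>\<^sub>Om W0.v a (h ?y)"
    by (rule lin_diff[OF Am_m Om_m W0.v_lin1[OF c(2)] fc[OF bar(1)] bar(1)])
   moreover have "W0.v a (h ?y \<ominus>\<^sub>Om ?y) = W0.v a (h ?y) \<ominus>\<^sub>Om W0.v a ?y"
    by (rule lin_diff[OF Om_m Om_m W0.v_lin[OF bar(1)] c(2,1)])
   ultimately have "h (WB ((a # w) # ws)) \<ominus>\<^sub>Om WB ((a # w) # ws) =
    W0.v (f a \<ominus>\<^sub>Am a) (h ?y) \<oplus>\<^sub>Om W0.v a (h ?y \<ominus>\<^sub>Om ?y)"
    unfolding e unfolding W0.W_bar[OF bar(1,2)] using c bar(1) fc by (simp add: W0.Xcl Om.M.ab_simps)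
   then show ?case using FOc(3)[OF F.lin_fil[OF Am_m Om_m W0.v_lin1[OF c(2)] near[OF bar(1)]]
     F.lin_fil[OF Om_m Om_m W0.v_lin[OF bar(1)] bar(3)]] by simp
  qed
  then show "h y \<ominus>\<^sub>Om y : FO" if "y :. Om" for y by (rule FO_from_words[OF l _ that])
  show "h y : W0.gr k" if "y : W0.gr k" for y k
  proof (rule W0.gr_map[OF h(1) _ that])
   fix ws assume "ws : NW Am" "word_degree ws = k"
   then show "h (WB ws) : W0.gr k" using W0.gr_W[OF mw, of ws] by (simp add: hW word_degree_def comp_def)
  qed
  fix y assume y: "y :. Om"
  have ad: "additive (Df \<beta>) (Df \<beta>') f" using lin_additive[OF f] by (simp add: additive_def Df_simps)
  have "h (W.D y) = W'.D (h y)"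
   by (rule word_morphism_D[OF W.word_algebra_axioms W'.word_algebra_axioms lin_additive[OF h(1)] ad _ _ y])
     (use fm hW in \<open>simp_all add: Df_simps(1)\<close>)
  then show "h (pd (\<Delta> \<beta>) y) = pd (\<Delta> \<beta>') (h y)"
   using y lin_closed[OF h(1) y] by (simp add: perturbed_\<Delta> \<beta>)
 qed
qed

text \<open>This is how a differential remembers its product: modulo boundaries, the product of
  \<open>i x\<close> and \<open>i y\<close> in the resolution is \<open>i\<close> of the product of
  \<open>x\<close> and \<open>y\<close>.\<close>

lemma D_v_i:
 assumes P: "word_algebra B P Om WB" "carrier P = carrier Am" and x: "x :. Am" and y: "y :. Am"
 shows "DP P (W0.v x (W0.i y)) = \<ominus>\<^sub>Om (W0.i x \<otimes>\<^sub>Om W0.i y) \<oplus>\<^sub>Om W0.i (x \<otimes>\<^sub>P y)"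
proof -
 interpret W: word_algebra B P Om WB by fact
 have "x \<otimes>\<^sub>P y :. Am" using W.M.mult_closed[of x y] x y P(2) by simp
 then show ?thesis
  using W.D_v[of x "W0.i y"] W.D_i[of y] W.mm_i[of x y] W.Xneg[OF W.v_lin[of x]] x y
  by (simp add: P(2) same_v[OF P] W0.Xcl)
qed

text \<open>An isomorphism \<open>f\<close> of resolutions may send \<open>i x\<close> to longer
  words, so it is followed by the augmentation for \<open>\<beta>'\<close>. The composite is
  multiplicative because \<open>f\<close> carries boundaries to boundaries, which the augmentation
  kills.\<close>

lemma rel_to_ass:
 assumes \<beta>: "\<beta> : MCa" "\<beta>' : MCa" and e: "(\<Delta> \<beta>, \<Delta> \<beta>') : eqr"
 shows "(\<beta>, \<beta>') : eqa"
proof -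
 interpret W: word_algebra B "Df \<beta>" Om WB by (rule MC_ass_word_algebra[OF \<beta>(1)])
 interpret W': word_algebra B "Df \<beta>'" Om WB by (rule MC_ass_word_algebra[OF \<beta>(2)])
 have c: "carrier (Df \<gamma>) = carrier Am" for \<gamma> by (simp add: Df_simps)
 obtain f where f: "f : algebra_isos B Om Om"
  and D: "!!y. y :. Om ==> f (pd (\<Delta> \<beta>) y) = pd (\<Delta> \<beta>') (f y)"
  and near: "!!y. y :. Om ==> f y \<ominus>\<^sub>Om y : FO"
  using equiv_relD[OF e] by metis
 note fl = isosD(1)[OF f] and fm = isosD(2)[OF f]
 note fc = lin_closed[OF fl]
 have fD: "f (W.D y) = W'.D (f y)" if "y :. Om" for y
  using D[OF that] that fc[OF that] by (simp add: perturbed_\<Delta> \<beta>)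
 have pl: "lin B Om Am W'.p" using W'.p_lin by (simp add: same_module_lin[OF Df_same])
 define g where "g x = W'.p (f (W0.i x))" for x
 have gl: "lin B Am Am g" unfolding g_def by (rule lin_comp[OF lin_comp[OF W0.i_lin fl] pl])
 have pi: "W'.p (W0.i x) = x" if "x :. Am" for x using W'.p_i[of x] that by (simp add: c)
 show ?thesis
 proof (rule equiv_assI[OF \<beta> gl])
  fix x assume x: "x :. Am"
  have ix: "W0.i x :. Om" by (rule W0.i_closed[OF x])
  have "g x \<ominus>\<^sub>Am x = W'.p (f (W0.i x) \<ominus>\<^sub>Om W0.i x)"
   using lin_diff[OF Om_m Am_m pl fc[OF ix] ix] pi[OF x] by (simp add: g_def)
  then show "g x \<ominus>\<^sub>Am x : FA" using F.lin_fil[OF Om_m Am_m pl near[OF ix]] by simp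
  fix y assume y: "y :. Am"
  have iy: "W0.i y :. Om" by (rule W0.i_closed[OF y])
  let ?v = "W0.v x (W0.i y)"
  have vc: "?v :. Om" by (rule W0.v_closed[OF x iy])
  have mc: "x \<otimes>\<^bsub>Df \<beta>\<^esub> y :. Am" using W.M.mult_closed[of x y] x y by (simp add: c)
  have "W0.i (x \<otimes>\<^bsub>Df \<beta>\<^esub> y) = W0.i x \<otimes>\<^sub>Om W0.i y \<oplus>\<^sub>Om W.D ?v"
   using D_v_i[OF W.word_algebra_axioms c x y] ix iy W0.i_closed[OF mc] Om.mult_closed[OF ix iy] by (simp add: Om.M.ab_simps)
  then have "f (W0.i (x \<otimes>\<^bsub>Df \<beta>\<^esub> y)) = f (W0.i x) \<otimes>\<^sub>Om f (W0.i y) \<oplus>\<^sub>Om W'.D (f ?v)"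
   using lin_add[OF fl Om.mult_closed[OF ix iy] W.D_closed[OF vc]] fm[OF ix iy] fD[OF vc] by simp
  then show "g (x \<otimes>\<^bsub>Df \<beta>\<^esub> y) = g x \<otimes>\<^bsub>Df \<beta>'\<^esub> g y"
   using lin_add[OF pl Om.mult_closed[OF fc[OF ix] fc[OF iy]] W'.D_closed[OF fc[OF vc]]] W'.p_D[OF fc[OF vc]]
    W'.p_mult[OF fc[OF ix] fc[OF iy]] W'.M.mult_closed[OF W'.p_closed[OF fc[OF ix]] W'.p_closed[OF fc[OF iy]]]
   by (simp add: g_def Df_simps(1,2))
 qed
qed

end

section \<open>Every perturbation comes from an associative deformation\<close>

context deformation
begin

text \<open>Passes from a product \<open>\<mu>\<close> on \<open>A_B\<close> to the cochain
  \<open>\<mu> - \<alpha>\<close>. It serves both the product found on cohomology and the one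
  carried over from a flat deformation.\<close>

lemma product_cochain:
 assumes l1: "!!y. y :. Am ==> lin B Am Am (%x. \<mu> x y)" and l2: "!!x. x :. Am ==> lin B Am Am (\<mu> x)"
  and assoc: "!!x y z. x :. Am ==> y :. Am ==> z :. Am ==> \<mu> (\<mu> x y) z = \<mu> x (\<mu> y z)"
  and near: "!!x y. x :. Am ==> y :. Am ==> \<mu> x y \<ominus>\<^sub>Am (x \<otimes>\<^sub>Am y) : FA"
 shows "\<exists>\<beta>. \<beta> : MCa \<and> (\<forall>x\<in>carrier Am. \<forall>y\<in>carrier Am. x \<otimes>\<^bsub>Df \<beta>\<^esub> y = \<mu> x y)"
proof -
 let ?d = "%x y. \<mu> x y \<ominus>\<^sub>Am (x \<otimes>\<^sub>Am y)"
 define \<beta> where "\<beta> = tensor_lift B Am Am Am ?d"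
 note d1 = lin_minus[OF Am_m l1 W0.M_mult_lin(1)] and d2 = lin_minus[OF Am_m l2 W0.M_mult_lin(2)]
 have bal: "AA.balanced Am ?d"
 proof (rule AA.balancedI)
  fix r x y assume r: "r :. B" and x: "x :. Am" and y: "y :. Am"
  show "?d (r \<odot>\<^sub>Am x) y = ?d x (r \<odot>\<^sub>Am y)" using lin_smult[OF d1[OF y y] r x] lin_smult[OF d2[OF x x] r y] by simp
 qed (use lin_closed[OF d2] lin_add[OF d1] lin_add[OF d2] in auto)
 have val: "\<beta> (AA.pure x y) = ?d x y" if "x :. Am" "y :. Am" for x y
  unfolding \<beta>_def by (rule AA.tensor_lift_pure[OF Am.M.abelian_group_axioms bal that])
 have bl: "\<beta> : linear_maps B tAA Am"
  unfolding \<beta>_def by (rule AA.tensor_lift_lin[OF Am_m bal]) (rule lin_smult[OF d1])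
 have c: "\<mu> x y :. Am" if "x :. Am" "y :. Am" for x y by (rule lin_closed[OF l2[OF that(1)] that(2)])
 have m: "x \<otimes>\<^bsub>Df \<beta>\<^esub> y = \<mu> x y" if "x :. Am" "y :. Am" for x y
  using that by (simp add: Df_simps val c Am.mult_closed Am.M.ab_simps)
 have "\<beta> : MCa" unfolding MC_ass_def RA.m_part_eq
 proof (intro CollectI conjI bl)
  have l: "lin B tAA Am \<beta>" using bl by (simp add: maps_iff)
  show "\<beta> ` carrier tAA \<subseteq> FA"
  proof
   fix s assume "s : \<beta> ` carrier tAA"
   then obtain X where X: "X :. tAA" "s = \<beta> X" by auto
   have "\<beta> X : FA" using X(1)
   proof (induction rule: AA.tensor_induct)
    case zero
    then show ?case using lin_zero[OF AA.tensor_module Am_m l] FAc(2) by simp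
   next
    case (pure x y)
    then show ?case using near[OF pure] by (simp add: val)
   next
    case (neg X)
    then show ?case using lin_neg[OF AA.tensor_module Am_m l] FAc(4) by simp
   next
    case (add X Y)
    then show ?case using lin_add[OF l] FAc(3) by simp
   qed
   then show "s : FA" using X(2) by simp
  qed
  have "module B (Df \<beta>)"
   using Am_m by (simp add: module_def module_axioms_def abelian_group_def abelian_monoid_def abelian_group_axioms_def Df_simps)
  moreover have "x \<oplus>\<^sub>Am y :. Am" "r \<odot>\<^sub>Am x :. Am" if "x :. Am" "y :. Am" "r :. B" for x y r
   using that by simp_all
  ultimately show "nonunital_algebra B (Df \<beta>)"
   by (auto simp: nonunital_algebra_def nonunital_algebra_axioms_def m Df_simps(1,3,4) c assoc
     lin_add[OF l1] lin_add[OF l2] lin_smult[OF l1] lin_smult[OF l2])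
 qed
 then show ?thesis using m by (intro exI[of _ \<beta>] conjI ballI)
qed

end

section \<open>The perturbed contraction\<close>

locale perturbation = deformation +
 fixes \<delta>
 assumes \<delta>: "\<delta> : MCr"
begin

abbreviation plO (infixl \<open>\<boxplus>\<close> 65) where "x \<boxplus> y == x \<oplus>\<^sub>Om y"
abbreviation miO (infixl \<open>\<boxminus>\<close> 65) where "x \<boxminus> y == x \<ominus>\<^sub>Om y"
abbreviation neO (\<open>\<^bold>- _\<close> [81] 80) where "\<^bold>- x == \<ominus>\<^sub>Om x"
abbreviation muO (infixl \<open>\<boxtimes>\<close> 70) where "x \<boxtimes> y == x \<otimes>\<^sub>Om y"
abbreviation "CO == carrier Om"
abbreviation "CA == carrier Am"
abbreviation "zO == \<zero>\<^sub>Om"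

definition "E y = W0.D y \<boxplus> \<delta> y"
text \<open>With this sign \<open>E H + H E = 1 - i p - g\<close>. As \<open>g\<close> has values in
  the \<open>m\<close>-part, \<open>T\<close> is the inverse of \<open>1 - g\<close>;
  \<open>Q\<close> and \<open>q\<close> are the corrected versions of the homotopy and the
  augmentation.\<close>

definition "g z = \<^bold>- (\<delta> (W0.H z) \<boxplus> W0.H (\<delta> z))"
definition "T = geometric Om g nil"
definition "Q z = W0.H (T z)"
definition "q z = W0.p (T z)"

lemmas \<delta>D = MC_relD[OF \<delta>]
lemmas gr_sub = W0.gr_closed(1)[THEN subsetD]

lemma \<delta>_closed: "y : CO ==> \<delta> y : CO"
 by (rule lin_closed[OF \<delta>D(1)])

lemma E_lin: "lin B Om Om E"
 unfolding E_def by (rule lin_plus[OF Om_m W0.D_lin \<delta>D(1)])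

lemmas E_closed = lin_closed[OF E_lin]
lemmas E_diff = lin_diff[OF Om_m Om_m E_lin]
lemmas E_add = lin_add[OF E_lin]
lemmas E_neg = lin_neg[OF Om_m Om_m E_lin]
lemmas E_zero = lin_zero[OF Om_m Om_m E_lin]

lemma E_perturbed: "y : CO ==> pd \<delta> y = E y"
 by (simp add: perturbed_eq E_def)

lemma E_E: "y : CO ==> E (E y) = zO"
 using \<delta>D(5)[of y] by (simp add: E_perturbed E_closed)

lemma E_gr: "y : W0.gr k ==> E y : W0.gr (k + 1)"
 unfolding E_def by (intro W0.gr_closed(3) W0.D_gr \<delta>D(2))

lemma gr_pos: "y : W0.gr k ==> k > 0 ==> y = zO"
 using W0.gr_zero by auto

lemma E_gr0: "y : W0.gr 0 ==> E y = zO"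
 using E_gr[of y 0] gr_pos by simp

lemma E_i: "x : CA ==> E (W0.i x) = zO"
 by (rule E_gr0[OF W0.gr_i])

lemma E_leibniz:
 assumes y: "y : W0.gr k" and z: "z : CO"
 shows "E (y \<boxtimes> z) = E y \<boxtimes> z \<boxplus> signed Om k (y \<boxtimes> E z)"
 using W0.D_leibniz[OF y z] \<delta>D(3)[OF y z] gr_sub[OF y] z
 by (simp add: E_def Om.mult_add_left Om.mult_add_right Om.mult_closed W0.D_closed \<delta>_closed signed_def Om.M.ab_simps)

lemma g_lin: "lin B Om Om g"
 unfolding g_def by (intro lin_uminus lin_plus Om_m lin_comp[OF W0.H_lin \<delta>D(1)] lin_comp[OF \<delta>D(1) W0.H_lin])

lemmas g_closed = lin_closed[OF g_lin]

lemma g_FO: "z : CO ==> g z : FO"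
 unfolding g_def by (intro FOc(3,4) \<delta>D(4) W0.H_closed F.lin_fil[OF Om_m Om_m W0.H_lin])

lemma g_gr: "z : W0.gr k ==> g z : W0.gr k"
 using \<delta>D(2)[OF W0.gr_H, of z k] W0.gr_H[OF \<delta>D(2), of z k] unfolding g_def by (intro W0.gr_closed(3,4)) simp_all

lemma E_homotopy:
 assumes z: "z : CO" shows "E (W0.H z) \<boxplus> W0.H (E z) = z \<boxminus> W0.i (W0.p z) \<boxminus> g z"
proof -
 have "W0.H (E z) = W0.H (W0.D z) \<boxplus> W0.H (\<delta> z)"
  using z by (simp add: E_def lin_add[OF W0.H_lin] W0.D_closed \<delta>_closed)
 then have "E (W0.H z) \<boxplus> W0.H (E z) = (W0.D (W0.H z) \<boxplus> W0.H (W0.D z)) \<boxminus> g z"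
  using z by (simp add: E_def g_def W0.Xcl3 \<delta>_closed Om.M.ab_simps)
 then show ?thesis using W0.homotopy[OF z] by simp
qed

lemma T_lin: "lin B Om Om T"
 unfolding T_def by (rule F.lin_geometric[OF Om_m g_lin])

lemmas T_closed = lin_closed[OF T_lin]

lemma T_fixed: "z : CO ==> T z = z \<boxplus> g (T z)"
 unfolding T_def by (rule F.geometric_fixed[OF Om_m g_lin g_FO nil])

lemma T_gr: "z : W0.gr k ==> T z : W0.gr k"
 unfolding T_def by (rule F.geometric_sub[of "W0.gr k"]) (simp_all add: W0.gr_closed g_gr)

lemma Q_lin: "lin B Om Om Q" and q_lin: "lin B Om Am q"
 unfolding Q_def q_def by (rule lin_comp[OF T_lin W0.H_lin] lin_comp[OF T_lin W0.p_lin])+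

lemmas Q_closed = lin_closed[OF Q_lin]
lemmas q_closed = lin_closed[OF q_lin]

lemma Q_gr: "z : W0.gr k ==> Q z : W0.gr (k - 1)"
 unfolding Q_def by (intro W0.gr_H T_gr)

lemma Q_zero: "Q zO = zO"
 by (rule lin_zero[OF Om_m Om_m Q_lin])

text \<open>On a cycle \<open>y\<close> the homotopy formula reads
  \<open>E (H y) = y - i (p y) - g y\<close>. Hence \<open>g\<close>, and with it \<open>T\<close>,
  preserves cycles, and for \<open>y = T z\<close> the right-hand side is
  \<open>z - i (q z)\<close>, because \<open>T z - g (T z) = z\<close>. In negative degrees
  \<open>q\<close> vanishes.\<close>

lemma cycle:
 assumes z: "z : W0.gr k" and Ez: "E z = zO"
 shows "z = E (Q z) \<boxplus> W0.i (q z)" "k < 0 ==> z = E (Q z)"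
proof -
 note zc = gr_sub[OF z]
 have ip: "E (W0.i (W0.p y)) = zO" if "y : CO" for y using E_i[OF W0.p_closed[OF that]] .
 let ?G = "{y : W0.gr k. E y = zO}"
 have hom: "E (W0.H y) = y \<boxminus> W0.i (W0.p y) \<boxminus> g y" if y: "y : CO" "E y = zO" for y
  using E_homotopy[OF y(1)] y lin_zero[OF Om_m Om_m W0.H_lin] by (simp add: E_closed W0.H_closed)
 have gG: "g y : ?G" if "y : ?G" for y
 proof -
  have y: "y : CO" "E y = zO" "y : W0.gr k" using that gr_sub by auto
  have "E (E (W0.H y)) = zO \<boxminus> E (g y)"
   unfolding hom[OF y(1,2)] using y ip[OF y(1)] by (simp add: E_diff W0.Xcl3 g_closed)
  then have "E (g y) = zO" using E_E[OF W0.H_closed[OF y(1)]] E_closed[OF g_closed[OF y(1)]]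
    Om.M.diff_zero_iff[of zO "E (g y)"] by simp
  then show ?thesis using g_gr[OF y(3)] by simp
 qed
 have "T z : ?G"
  unfolding T_def by (rule F.geometric_sub[of ?G]) (use gG z Ez gr_sub in \<open>auto simp: W0.gr_closed E_add E_zero\<close>)
 then have t: "T z : CO" "E (T z) = zO" using gr_sub by auto
 have "E (Q z) = T z \<boxminus> W0.i (q z) \<boxminus> g (T z)" using hom[OF t] by (simp add: Q_def q_def)
 moreover have "u \<boxminus> v = z" if "u = z \<boxplus> v" "v : CO" for u v using that zc by (simp add: Om.M.ab_simps)
 from this[OF T_fixed[OF zc] g_closed[OF t(1)]] have "T z \<boxminus> g (T z) = z" .
 ultimately show r: "z = E (Q z) \<boxplus> W0.i (q z)"
  using t(1) g_closed[OF t(1)] W0.i_closed[OF q_closed[OF zc]] by (simp add: Om.M.ab_simps)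
 assume k: "k < 0"
 have "q z = \<zero>\<^sub>Am" unfolding q_def by (rule W0.p_gr[OF T_gr[OF z]]) (use k in simp)
 then have "W0.i (q z) = zO" using lin_zero[OF Am_m Om_m W0.i_lin] by simp
 then show "z = E (Q z)" using r zc by (simp add: E_closed Q_closed)
qed

text \<open>If \<open>E w = i x\<close> then also \<open>E (g w) = i x\<close>: in degree -1 the map
  \<open>p\<close> vanishes, and \<open>H (i x) = 0\<close>, so that
  \<open>w - g w = E (H w)\<close> is a cycle. Iterating \<open>g\<close> until it vanishes gives
  \<open>i x = 0\<close>. Thus \<open>i\<close> is injective into cohomology.\<close>

lemma i_boundary:
 assumes w: "w : W0.gr (- 1)" and x: "x : CA" and e: "E w = W0.i x"
 shows "x = \<zero>\<^sub>Am"
proof -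
 have step: "E (g y) = W0.i x" if y: "y : W0.gr (- 1)" "E y = W0.i x" for y
 proof -
  note yc = gr_sub[OF y(1)]
  have "W0.p y = \<zero>\<^sub>Am" by (rule W0.p_gr[OF y(1)]) simp
  then have "W0.i (W0.p y) = zO" using lin_zero[OF Am_m Om_m W0.i_lin] by simp
  then have "E (W0.H y) = y \<boxminus> g y"
   using E_homotopy[OF yc] yc y(2) W0.H_i[OF x] by (simp add: E_closed W0.H_closed)
  then have "E (E (W0.H y)) = E y \<boxminus> E (g y)" using yc by (simp add: E_diff g_closed)
  then show ?thesis using E_E[OF W0.H_closed[OF yc]] y yc W0.i_closed[OF x]
    Om.M.diff_zero_iff[of "E y" "E (g y)"] by (simp add: E_closed g_closed)
 qed
 have it: "(g ^^ n) w : W0.gr (- 1) \<and> E ((g ^^ n) w) = W0.i x" for n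
  by (induction n) (use w e step g_gr in auto)
 have "(g ^^ nil) w = zO" by (rule F.fil_zero[OF Om_m nil F.funpow_fil[OF Om_m g_lin g_FO gr_sub[OF w]]])
 then have "W0.i x = zO" using it[of nil] E_zero by simp
 then show ?thesis using W0.p_i[OF x] lin_zero[OF Om_m Am_m W0.p_lin] by simp
qed

lemma i_eqI:
 assumes w: "w : W0.gr (- 1)" and x: "x : CA" "y : CA" and e: "W0.i x \<boxminus> W0.i y = E w"
 shows "x = y"
 using i_boundary[OF w, of "x \<ominus>\<^sub>Am y"] x e lin_diff[OF Am_m Om_m W0.i_lin x] Am.M.diff_zero_iff by simp

section \<open>The product on zeroth cohomology\<close>

definition "\<mu> x y = q (W0.i x \<boxtimes> W0.i y)"

lemma \<mu>_closed: "x : CA ==> y : CA ==> \<mu> x y : CA"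
 by (simp add: \<mu>_def q_closed W0.Xcl)

lemma \<mu>_lin: "y : CA ==> lin B Am Am (%x. \<mu> x y)" "y : CA ==> lin B Am Am (\<mu> y)"
 unfolding \<mu>_def by (rule lin_comp[OF lin_comp[OF W0.i_lin W0.X_mult_lin(1)] q_lin] lin_comp[OF lin_comp[OF W0.i_lin W0.X_mult_lin(2)] q_lin];
  erule W0.i_closed)+

text \<open>A primitive of the difference between the product of \<open>i x\<close> and
  \<open>i y\<close> and its representative \<open>i (\<mu> x y)\<close>. It is needed for
  associativity of \<open>\<mu>\<close> and again for generators with two letters in
  \<open>intertwine_word\<close>.\<close>

definition "b x y = Q (W0.i x \<boxtimes> W0.i y)"

lemma b:
 assumes x: "x : CA" and y: "y : CA"
 shows b_gr: "b x y : W0.gr (- 1)" and b_closed: "b x y : CO"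
  and E_b: "W0.i x \<boxtimes> W0.i y = E (b x y) \<boxplus> W0.i (\<mu> x y)"
proof -
 have g0: "W0.i x \<boxtimes> W0.i y : W0.gr 0" using W0.gr_mult[OF W0.gr_i[OF x] W0.gr_i[OF y]] by simp
 show "b x y : W0.gr (- 1)" using Q_gr[OF g0] by (simp add: b_def)
 then show "b x y : CO" by (rule gr_sub)
 show "W0.i x \<boxtimes> W0.i y = E (b x y) \<boxplus> W0.i (\<mu> x y)"
  unfolding b_def \<mu>_def by (rule cycle(1)[OF g0 E_gr0[OF g0]])
qed

lemma \<mu>_assoc:
 assumes x: "x : CA" and y: "y : CA" and z: "z : CA"
 shows "\<mu> (\<mu> x y) z = \<mu> x (\<mu> y z)"
proof -
 note xy = \<mu>_closed[OF x y] and yz = \<mu>_closed[OF y z]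
 note i = W0.i_closed[OF x] W0.i_closed[OF y] W0.i_closed[OF z] W0.i_closed[OF xy] W0.i_closed[OF yz]
 note b = b_closed[OF x y] b_closed[OF y z] b_closed[OF xy z] b_closed[OF x yz]
 \<comment> \<open>Both ways of evaluating the triple product leave a primitive; \<open>?w\<close>
   is the difference of these, so that \<open>i\<close> of the two results differ by
   \<open>E ?w\<close>.\<close>
 let ?w = "(b x (\<mu> y z) \<boxplus> W0.i x \<boxtimes> b y z) \<boxminus> (b (\<mu> x y) z \<boxplus> b x y \<boxtimes> W0.i z)"
 show ?thesis
 proof (rule i_eqI[of ?w])
  have "W0.i x \<boxtimes> b y z : W0.gr (- 1)" "b x y \<boxtimes> W0.i z : W0.gr (- 1)"
   using W0.gr_mult[OF W0.gr_i[OF x] b_gr[OF y z]] W0.gr_mult[OF b_gr[OF x y] W0.gr_i[OF z]] by simp_all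
  then show "?w : W0.gr (- 1)" using b_gr[OF xy z] b_gr[OF x yz] by (intro W0.gr_closed(3,5))
  show "\<mu> (\<mu> x y) z : CA" "\<mu> x (\<mu> y z) : CA" by (intro \<mu>_closed xy yz x z)+
  then have ii: "W0.i (\<mu> (\<mu> x y) z) : CO" "W0.i (\<mu> x (\<mu> y z)) : CO" by (auto intro: W0.i_closed)
  have l1: "E (W0.i x \<boxtimes> b y z) = W0.i x \<boxtimes> E (b y z)"
   using E_leibniz[OF W0.gr_i[OF x] b(2)] b i by (simp add: E_i[OF x] Om.mult_zero signed_def Om.mult_closed E_closed)
  have l2: "E (b x y \<boxtimes> W0.i z) = E (b x y) \<boxtimes> W0.i z"
   using E_leibniz[OF b_gr[OF x y] i(3)] b i by (simp add: E_i[OF z] Om.mult_zero signed_def Om.mult_closed E_closed)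
  have "(E (b x y) \<boxplus> W0.i (\<mu> x y)) \<boxtimes> W0.i z = W0.i x \<boxtimes> (E (b y z) \<boxplus> W0.i (\<mu> y z))"
   using E_b[OF x y] E_b[OF y z] Om.mult_assoc[OF i(1-3)] by simp
  then have "E (b x y) \<boxtimes> W0.i z \<boxplus> W0.i (\<mu> x y) \<boxtimes> W0.i z = W0.i x \<boxtimes> E (b y z) \<boxplus> W0.i x \<boxtimes> W0.i (\<mu> y z)"
   using i b by (simp add: Om.mult_add_left Om.mult_add_right E_closed)
  then have e: "E (b x y \<boxtimes> W0.i z) \<boxplus> (E (b (\<mu> x y) z) \<boxplus> W0.i (\<mu> (\<mu> x y) z)) =
    E (W0.i x \<boxtimes> b y z) \<boxplus> (E (b x (\<mu> y z)) \<boxplus> W0.i (\<mu> x (\<mu> y z)))"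
   using E_b[OF xy z] E_b[OF x yz] by (simp add: l1 l2)
  have grp: "s \<boxminus> s' = (c' \<boxplus> a') \<boxminus> (c \<boxplus> a)" if "a \<boxplus> (c \<boxplus> s) = a' \<boxplus> (c' \<boxplus> s')"
   "a : CO" "c : CO" "s : CO" "a' : CO" "c' : CO" "s' : CO" for a c s a' c' s'
  proof -
   have "s \<boxminus> s' = (a \<boxplus> (c \<boxplus> s)) \<boxminus> s' \<boxminus> a \<boxminus> c" using that(2-) by (simp add: Om.M.ab_simps)
   also have "\<dots> = (c' \<boxplus> a') \<boxminus> (c \<boxplus> a)" unfolding that(1) using that(2-) by (simp add: Om.M.ab_simps)
   finally show ?thesis .
  qed
  have "E ?w = (E (b x (\<mu> y z)) \<boxplus> E (W0.i x \<boxtimes> b y z)) \<boxminus> (E (b (\<mu> x y) z) \<boxplus> E (b x y \<boxtimes> W0.i z))"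
   using i b by (simp add: E_diff E_add Om.mult_closed)
  then show "W0.i (\<mu> (\<mu> x y) z) \<boxminus> W0.i (\<mu> x (\<mu> y z)) = E ?w"
   using grp[OF e] i b ii by (simp add: Om.mult_closed E_closed)
 qed
qed

lemma \<mu>_near:
 assumes x: "x : CA" and y: "y : CA" shows "\<mu> x y \<ominus>\<^sub>Am (x \<otimes>\<^sub>Am y) : FA"
proof -
 let ?z = "W0.i x \<boxtimes> W0.i y"
 have z: "?z : CO" using x y by (simp add: W0.Xcl)
 note gz = g_closed[OF T_closed[OF z]]
 have "\<mu> x y = W0.p (?z \<boxplus> g (T ?z))" unfolding \<mu>_def q_def by (rule arg_cong[OF T_fixed[OF z]])
 also have "\<dots> = x \<otimes>\<^sub>Am y \<oplus>\<^sub>Am W0.p (g (T ?z))"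
  using x y by (simp add: lin_add[OF W0.p_lin z gz] W0.p_mult W0.i_closed W0.p_i)
 finally have "\<mu> x y \<ominus>\<^sub>Am (x \<otimes>\<^sub>Am y) = W0.p (g (T ?z))"
  using Am.mult_closed[OF x y] W0.p_closed[OF gz] by (simp add: Am.M.ab_simps)
 then show ?thesis using F.lin_fil[OF Om_m Am_m W0.p_lin g_FO[OF T_closed[OF z]]] by simp
qed

definition "\<beta> = (SOME \<beta>. \<beta> : MCa \<and> (\<forall>x\<in>CA. \<forall>y\<in>CA. x \<otimes>\<^bsub>Df \<beta>\<^esub> y = \<mu> x y))"

lemma \<beta>: shows \<beta>_MC: "\<beta> : MCa" and Df_mult: "x : CA ==> y : CA ==> x \<otimes>\<^bsub>Df \<beta>\<^esub> y = \<mu> x y"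
 using someI_ex[OF product_cochain[OF \<mu>_lin \<mu>_assoc \<mu>_near]] unfolding \<beta>_def[symmetric] by auto

sublocale W: word_algebra B "Df \<beta>" Om WB
 by (rule MC_ass_word_algebra[OF \<beta>_MC])

lemma W_eqs: "W.v = W0.v" "W.gr = W0.gr" "carrier (Df \<beta>) = CA" "NW (Df \<beta>) = NW Am"
 using same_v[OF W.word_algebra_axioms] same_gr[OF W.word_algebra_axioms]
 by (simp_all add: Df_simps)

lemma WD_gr: "y : W0.gr k ==> W.D y : W0.gr (k + 1)"
 using W.D_gr unfolding W_eqs .

lemma WD_leibniz:
 "y : W0.gr k ==> z : CO ==> W.D (y \<boxtimes> z) = W.D y \<boxtimes> z \<boxplus> signed Om k (y \<boxtimes> W.D z)"
 using W.D_leibniz unfolding W_eqs .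

lemma WD_near: "y : CO ==> W.D y \<boxminus> W0.D y : FO"
 by (rule D_near[OF W.word_algebra_axioms W_eqs(3) MC_ass_near(2)[OF \<beta>_MC]])

section \<open>Words with generators of bounded length, and the comparison map\<close>

abbreviation "words == nonempty_words CA"

text \<open>The bound concerns the length of each generator and not their number: the differential
  shortens a generator but may split it in two.\<close>

definition "bounded_words n = {ws : NW Am. \<forall>w\<in>set ws. length w \<le> n}"
definition "bounded_span n = gen Om (WB ` bounded_words n)"

lemma bounded_sub: "WB ` bounded_words n \<subseteq> CO"
 using W0_sub by (auto simp: bounded_words_def)

lemmas bounded_closed = span_closed[OF Om.M.abelian_group_axioms bounded_sub, folded bounded_span_def]

lemma bounded_base: "ws : NW Am ==> (!!w. w : set ws ==> length w \<le> n) ==> WB ws : bounded_span n"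
 unfolding bounded_span_def by (rule span_base) (auto simp: bounded_words_def)

lemma bounded_words_induct [consumes 1, case_names one cons]:
 assumes "ws : bounded_words n"
  and "!!w. w : words ==> length w \<le> n ==> P [w]"
  and "!!w ws. w : words ==> length w \<le> n ==> ws : bounded_words n ==> P [w] ==> P ws ==> P (w # ws)"
 shows "P ws"
 using assms(1)
proof (induction ws)
 case Nil
 then show ?case by (simp add: bounded_words_def words_def)
next
 case (Cons w ws)
 then have w: "w : words" "length w \<le> n" by (auto simp: bounded_words_def words_def)
 show ?case
 proof (cases "ws = []")
  case False
  then have "ws : bounded_words n" using Cons.prems by (auto simp: bounded_words_def words_def)
  then show ?thesis using assms(2,3) w Cons.IH by blast
 qed (use assms(2) w in simp)
qed

lemma WB_Cons: "w : words ==> ws : NW Am ==> WB (w # ws) = WB [w] \<boxtimes> WB ws"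
 using WB_append[of "[w]" ws] by (auto simp: words_def)

lemma WB_single: "w : words ==> [w] : NW Am" "w : words ==> WB [w] : CO" "w : words ==> WB [w] : W0.gr (1 - int (length w))"
 using WB_closed[of "[w]"] W0.gr_W[of "[w]"] by (auto simp: words_def word_degree_def)

lemma bounded_eq:
 assumes f: "lin B Om Om f" "lin B Om Om f'" and e: "!!ws. ws : bounded_words n ==> f (WB ws) = f' (WB ws)" and y: "y : bounded_span n"
 shows "f y = f' y"
 by (rule additive_span_ext[OF Om.M.abelian_group_axioms Om.M.abelian_group_axioms lin_additive[OF f(1)] lin_additive[OF f(2)] bounded_sub])
   (use e y in \<open>auto simp: bounded_span_def\<close>)

lemma v_bounded:
 assumes a: "a : CA" and y: "y : bounded_span n" shows "W0.v a y : bounded_span (Suc n)"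
 unfolding bounded_span_def
proof (rule additive_image_span[OF Om.M.abelian_group_axioms Om.M.abelian_group_axioms lin_additive[OF W0.v_lin[OF a]] bounded_sub bounded_sub])
 show "y : gen Om (WB ` bounded_words n)" using y by (simp add: bounded_span_def)
 fix s assume "s : WB ` bounded_words n"
 then obtain ws where ws: "ws : bounded_words n" "s = WB ws" by auto
 then obtain w vs where wv: "ws = w # vs" by (cases ws) (auto simp: bounded_words_def words_def)
 then have nw: "w # vs : NW Am" using ws by (simp add: bounded_words_def)
 then have "(a # w) # vs : NW Am" using a by (auto simp: words_def)
 moreover have "length u \<le> Suc n" if "u : set ((a # w) # vs)" for u
  using ws(1) that unfolding wv by (auto simp: bounded_words_def)
 ultimately show "W0.v a s : gen Om (WB ` bounded_words (Suc n))"
  using bounded_base[of "(a # w) # vs" "Suc n"] W0.W_bar[OF a nw] ws(2) wv by (simp add: bounded_span_def)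
qed

text \<open>Both kinds of terms of the differential, splitting and merging, consist of generators
  strictly shorter than the given one.\<close>

lemma WD_bounded: "w : words ==> length w \<le> Suc n ==> W.D (WB [w]) : bounded_span n"
proof (induction w arbitrary: n)
 case Nil
 then show ?case by (simp add: words_def)
next
 case (Cons a w)
 then have a: "a : CA" "a :. (Df \<beta>)" by (auto simp: words_def W_eqs)
 show ?case
 proof (cases w)
  case Nil
  then show ?thesis using W.D_i[OF a(2)] bounded_closed(2) by (simp add: W.i_def)
 next
  case (Cons b u)
  then have w: "w : words" using Cons.prems by (auto simp: words_def)
  \<comment> \<open>The word \<open>a # w\<close> has at least two letters here, so the bound can be
    lowered once more for its tail.\<close>
  obtain n' where n': "n = Suc n'" using Cons Cons.prems by (cases n) auto
  have lw: "length w \<le> Suc n'" using Cons.prems n' by simp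
  note nw = WB_single(1)[OF w]
  have b: "b : CA" "set u \<subseteq> CA" using w Cons by (auto simp: words_def)
  have 1: "W0.i a \<boxtimes> WB [w] : bounded_span n"
  proof -
   have "[[a], w] : NW Am" using nw a by (auto simp: words_def)
   moreover have "length u \<le> n" if "u : set [[a], w]" for u using that lw n' by auto
   ultimately show ?thesis using bounded_base[of "[[a], w]" n] unfolding W0.W_tensor[OF a(1) nw] by simp
  qed
  have m: "a \<otimes>\<^bsub>Df \<beta>\<^esub> b : CA" using a b by (simp add: Df_mult \<mu>_closed)
  have "W.mm a (WB [w]) = WB [(a \<otimes>\<^bsub>Df \<beta>\<^esub> b) # u]" using W.mm_W[OF a(2), of b u "[]"] nw Cons by (simp add: W_eqs)
  moreover have "[(a \<otimes>\<^bsub>Df \<beta>\<^esub> b) # u] : NW Am" using m b by (auto simp: words_def)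
  ultimately have 2: "W.mm a (WB [w]) : bounded_span n"
   using bounded_base[of "[(a \<otimes>\<^bsub>Df \<beta>\<^esub> b) # u]" n] lw n' Cons by simp
  have 3: "W0.v a (W.D (WB [w])) : bounded_span n" using v_bounded[OF a(1) Cons.IH[OF w lw]] n' by simp
  have "W.D (WB [a # w]) = \<^bold>- (W0.i a \<boxtimes> WB [w]) \<boxplus> W.mm a (WB [w]) \<boxplus> \<^bold>- W0.v a (W.D (WB [w]))"
   using W.D_v[OF a(2) WB_single(2)[OF w]] unfolding W0.W_bar[OF a(1) nw] W_eqs .
  then show ?thesis using 1 2 3 by (simp add: bounded_closed)
 qed
qed

text \<open>An isomorphism \<open>\<psi>\<close> onto the perturbed resolution has to satisfy \<open>\<psi> y = y + Q (\<psi> (D y) - E y)\<close> on one-letter words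
 \<open>y = [a\<^sub>1|\<dots>|a\<^sub>n]\<close> of the resolution. As \<open>D y\<close> only involves shorter letters, iterating this from the identity
 becomes stationary on letters of bounded length.\<close>

definition "alg h \<longleftrightarrow> lin B Om Om h \<and> (\<forall>y\<in>CO. \<forall>z\<in>CO. h (y \<boxtimes> z) = h y \<boxtimes> h z)"
definition "nice h \<longleftrightarrow> alg h \<and> (\<forall>k. \<forall>y\<in>W0.gr k. h y : W0.gr k) \<and> (\<forall>y\<in>CO. h y \<boxminus> y : FO)"
definition "step h y = y \<boxplus> Q (h (W.D y) \<boxminus> E y)"

lemma algD: assumes "alg h" shows "lin B Om Om h" "y : CO ==> z : CO ==> h (y \<boxtimes> z) = h y \<boxtimes> h z"
 using assms by (auto simp: alg_def)

lemma niceD: assumes "nice h" shows "alg h" "y : W0.gr k ==> h y : W0.gr k" "y : CO ==> h y \<boxminus> y : FO"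
 using assms by (auto simp: nice_def)

lemma all_bounded: "ws : NW Am ==> \<exists>n. ws : bounded_words n"
 by (auto simp: bounded_words_def intro!: exI[of _ "Max (length ` set ws)"])

lemma words_induct [consumes 1, case_names one cons]:
 assumes "ws : NW Am" "!!w. w : words ==> P [w]" "!!w ws. w : words ==> ws : NW Am ==> P [w] ==> P ws ==> P (w # ws)"
 shows "P ws"
proof (rule exE[OF all_bounded[OF assms(1)]])
 fix n assume "ws : bounded_words n"
 then show ?thesis by (induction rule: bounded_words_induct) (simp_all add: assms bounded_words_def)
qed

lemma niceI:
 assumes h: "alg h" and gr: "!!w. w : words ==> h (WB [w]) : W0.gr (1 - int (length w))"
  and near: "!!w. w : words ==> h (WB [w]) \<boxminus> WB [w] : FO"
 shows "nice h"
proof -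
 note hl = algD(1)[OF h] and hm = algD(2)[OF h]
 note hc = lin_closed[OF hl]
 have 1: "h (WB ws) : W0.gr (word_degree ws) \<and> h (WB ws) \<boxminus> WB ws : FO" if "ws : NW Am" for ws
  using that
 proof (induction rule: words_induct)
  case (one w)
  then show ?case using gr near by (simp add: word_degree_def)
 next
  case (cons w ws)
  note c = WB_single(2)[OF cons(1)] WB_closed[OF cons(2)]
  have e: "h (WB (w # ws)) = h (WB [w]) \<boxtimes> h (WB ws)" using hm[OF c] WB_Cons[OF cons(1,2)] by simp
  have d: "word_degree (w # ws) = word_degree [w] + word_degree ws" by (simp add: word_degree_def)
  have "h (WB (w # ws)) \<boxminus> WB (w # ws) = (h (WB [w]) \<boxminus> WB [w]) \<boxtimes> h (WB ws) \<boxplus> WB [w] \<boxtimes> (h (WB ws) \<boxminus> WB ws)"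
   unfolding e unfolding WB_Cons[OF cons(1,2)] using c hc
   by (simp add: a_minus_def Om.mult_add_left Om.mult_add_right Om.mult_neg Om.mult_closed Om.M.ab_simps)
  then show ?case
   using FOc(3)[OF FO_mult(1)[OF conjunct2[OF cons(3)] hc[OF c(2)]] FO_mult(2)[OF conjunct2[OF cons(4)] c(1)]]
    W0.gr_mult[OF conjunct1[OF cons(3)] conjunct1[OF cons(4)]] e d by simp
 qed
 have "h y : W0.gr k" if "y : W0.gr k" for y k
  by (rule W0.gr_map[OF hl _ that]) (use 1 in auto)
 moreover have "h y \<boxminus> y : FO" if "y : CO" for y
  by (rule FO_from_words[OF lin_minus[OF Om_m hl lin_id] _ that]) (use 1 in auto)
 ultimately show ?thesis using h by (simp add: nice_def)
qed

lemma alg_extension: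
 assumes "multilin B Am Om f" shows "\<exists>h. alg h \<and> (\<forall>w\<in>words. h (WB [w]) = f w)"
 using W0.algebra_hom_extension[OF assms] unfolding alg_def by auto

lemma WB_slot: "set xs \<subseteq> CA ==> set ys \<subseteq> CA ==> lin B Am Om (%x. WB [xs @ x # ys])"
 using nmultilinD[OF WB_multilin, of "[]" "[]" xs ys] by simp

lemma step_lin: "lin B Om Om h ==> lin B Om Om (step h)"
 unfolding step_def by (intro lin_plus Om_m lin_id lin_comp[OF _ Q_lin] lin_minus lin_comp[OF W.D_lin] E_lin)

primrec psi where
 "psi 0 = (%y. y)"
| "psi (Suc n) = (SOME h. alg h \<and> (\<forall>w\<in>words. h (WB [w]) = step (psi n) (WB [w])))"

lemma psi_Suc:
 assumes "alg (psi n)"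
 shows "alg (psi (Suc n))" "w : words ==> psi (Suc n) (WB [w]) = step (psi n) (WB [w])"
proof -
 have "multilin B Am Om (%w. step (psi n) (WB [w]))" unfolding multilin_def
  by (intro allI impI lin_comp[OF WB_slot step_lin[OF algD(1)[OF assms]]])
 from someI_ex[OF alg_extension[OF this]]
 show "alg (psi (Suc n))" "w : words ==> psi (Suc n) (WB [w]) = step (psi n) (WB [w])" by simp_all
qed

lemma psi_nice: "nice (psi n)"
proof (induction n)
 case 0
 show ?case using FOc(2) by (simp add: nice_def alg_def lin_id Om.M.ab_simps)
next
 case (Suc n)
 note n = niceD[OF Suc]
 note nc = lin_closed[OF algD(1)[OF n(1)]]
 show ?case
 proof (rule niceI[OF psi_Suc(1)[OF n(1)]])
  fix w assume w: "w : words"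
  let ?y = "WB [w]" and ?k = "1 - int (length w)"
  note y = WB_single(2,3)[OF w]
  note D = W.D_closed[OF y(1)]
  let ?c = "psi n (W.D ?y) \<boxminus> E ?y"
  have "?c : W0.gr (?k + 1)" by (intro W0.gr_closed(5) n(2) WD_gr E_gr y(2))
  then have "Q ?c : W0.gr ?k" using Q_gr by fastforce
  then show "psi (Suc n) ?y : W0.gr ?k" unfolding psi_Suc(2)[OF n(1) w] step_def by (rule W0.gr_closed(3)[OF y(2)])
  \<comment> \<open>Three contributions from the \<open>m\<close>-part: \<open>psi n\<close> against
    the identity, the differential of the deformed product against the original one, and
    \<open>\<delta>\<close>.\<close>
  have "?c = (psi n (W.D ?y) \<boxminus> W.D ?y) \<boxplus> (W.D ?y \<boxminus> W0.D ?y) \<boxminus> \<delta> ?y"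
   using y(1) D nc[OF D] W0.D_closed[OF y(1)] \<delta>_closed[OF y(1)] by (simp add: E_def Om.M.ab_simps)
  then have "?c : FO" using FOc(5)[OF FOc(3)[OF n(3)[OF D] WD_near[OF y(1)]] \<delta>D(4)[OF y(1)]] by simp
  then have f: "Q ?c : FO" by (rule F.lin_fil[OF Om_m Om_m Q_lin])
  moreover have "u \<boxplus> v \<boxminus> u = v" if "u : CO" "v : CO" for u v using that by (simp add: Om.M.ab_simps)
  from this[OF y(1) subsetD[OF FOc(1) f]] have "step (psi n) ?y \<boxminus> ?y = Q ?c" unfolding step_def .
  ultimately show "psi (Suc n) ?y \<boxminus> ?y : FO" using f psi_Suc(2)[OF n(1) w] by simp
 qed
qed

lemmas psi_alg = niceD(1)[OF psi_nice]

lemma alg_eq_bounded: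
 assumes h: "alg h" "alg h'" and e: "!!w. w : words ==> length w \<le> n ==> h (WB [w]) = h' (WB [w])" and y: "y : bounded_span n"
 shows "h y = h' y"
proof (rule bounded_eq[OF algD(1)[OF h(1)] algD(1)[OF h(2)] _ y])
 fix ws assume "ws : bounded_words n"
 then show "h (WB ws) = h' (WB ws)"
 proof (induction rule: bounded_words_induct)
  case (cons w ws)
  then have ws: "ws : NW Am" by (simp add: bounded_words_def)
  show ?case using cons WB_single(2)[OF cons(1)] WB_closed[OF ws] by (simp add: WB_Cons[OF cons(1) ws] algD(2)[OF h(1)] algD(2)[OF h(2)])
 qed (rule e)
qed

text \<open>At a generator the next iterate consults the previous one only on the differential,
  which has shorter generators; so one more length is settled with each iteration.\<close>

lemma psi_stable: "y : bounded_span n ==> psi (Suc n) y = psi n y"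
proof (induction n arbitrary: y)
 case 0
 show ?case by (rule alg_eq_bounded[OF psi_alg psi_alg _ 0]) (simp add: words_def)
next
 case (Suc n)
 show ?case
 proof (rule alg_eq_bounded[OF psi_alg psi_alg _ Suc.prems])
  fix w assume w: "w : words" "length w \<le> Suc n"
  show "psi (Suc (Suc n)) (WB [w]) = psi (Suc n) (WB [w])"
   unfolding psi_Suc(2)[OF psi_alg w(1)] step_def Suc.IH[OF WD_bounded[OF w]] ..
 qed
qed

lemma bounded_mono: "n \<le> j ==> bounded_span n \<subseteq> bounded_span j"
 unfolding bounded_span_def by (intro Om.M.add.mono_generate image_mono) (auto simp: bounded_words_def)

lemma psi_le: "n \<le> j ==> y : bounded_span n ==> psi j y = psi n y"
proof (induction j rule: dec_induct)
 case (step j)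
 then have "y : bounded_span j" using bounded_mono by blast
 then show ?case using psi_stable step by simp
qed simp

text \<open>Each generator receives its value from the iterate at which it has become stationary.
  The index depends only on the length, so the assignment is still multilinear.\<close>

definition "Psi = (SOME h. alg h \<and> (\<forall>w\<in>words. h (WB [w]) = psi (length w) (WB [w])))"

lemma Psi: shows Psi_alg: "alg Psi" and Psi_word: "w : words ==> Psi (WB [w]) = psi (length w) (WB [w])"
proof -
 have "multilin B Am Om (%w. psi (length w) (WB [w]))" unfolding multilin_def
 proof (intro allI impI)
  fix xs ys assume s: "set xs \<subseteq> CA" "set ys \<subseteq> CA"
  show "lin B Am Om (%x. psi (length (xs @ x # ys)) (WB [xs @ x # ys]))"
   using lin_comp[OF WB_slot[OF s] algD(1)[OF psi_alg[of "length xs + Suc (length ys)"]]] by simp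
 qed
 from someI_ex[OF alg_extension[OF this]]
 show "alg Psi" "w : words ==> Psi (WB [w]) = psi (length w) (WB [w])" unfolding Psi_def by simp_all
qed

lemma Psi_nice: "nice Psi"
 using niceD[OF psi_nice] WB_single by (intro niceI Psi_alg) (simp_all add: Psi_word)

lemmas Psi_lin = algD(1)[OF Psi_alg]
lemmas Psi_closed = lin_closed[OF Psi_lin]

lemma Psi_bounded: "y : bounded_span n ==> Psi y = psi n y"
proof (rule alg_eq_bounded[OF Psi_alg psi_alg])
 fix w assume w: "w : words" "length w \<le> n"
 have "WB [w] : bounded_span (length w)" by (rule bounded_base[OF WB_single(1)[OF w(1)]]) simp
 then show "Psi (WB [w]) = psi n (WB [w])" using psi_le[OF w(2)] Psi_word[OF w(1)] by simp
qed

lemma Psi_fixed: "w : words ==> Psi (WB [w]) = step Psi (WB [w])"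
proof -
 assume w: "w : words"
 then obtain n where n: "length w = Suc n" by (cases w) (auto simp: words_def)
 have "Psi (W.D (WB [w])) = psi n (W.D (WB [w]))" by (rule Psi_bounded[OF WD_bounded[OF w]]) (simp add: n)
 then show ?thesis using Psi_word[OF w] psi_Suc(2)[OF psi_alg w, of n] by (simp add: n step_def)
qed

lemma Psi_i: assumes a: "a : CA" shows "Psi (W0.i a) = W0.i a"
proof -
 have "W.D (W0.i a) = zO" using W.D_i[of a] a by (simp add: W_eqs)
 then show ?thesis using Psi_fixed[of "[a]"] a
  by (simp add: words_def step_def W0.i_def[symmetric] E_i lin_zero[OF Om_m Om_m Psi_lin] W0.i_closed Q_zero)
qed

lemma intertwine_bounded:
 assumes e: "!!w. w : words ==> length w \<le> n ==> E (Psi (WB [w])) = Psi (W.D (WB [w]))" and y: "y : bounded_span n"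
 shows "E (Psi y) = Psi (W.D y)"
proof (rule bounded_eq[OF lin_comp[OF Psi_lin E_lin] lin_comp[OF W.D_lin Psi_lin] _ y])
 fix ws assume "ws : bounded_words n"
 then show "E (Psi (WB ws)) = Psi (W.D (WB ws))"
 proof (induction rule: bounded_words_induct)
  case (cons w ws)
  then have ws: "ws : NW Am" by (simp add: bounded_words_def)
  let ?y = "WB [w]" and ?z = "WB ws"
  note y = WB_single(2,3)[OF cons(1)] and z = WB_closed[OF ws]
  note c = y(1) z Psi_closed[OF y(1)] Psi_closed[OF z] W.D_closed[OF y(1)] W.D_closed[OF z]
  note mult = algD(2)[OF Psi_alg]
  have "E (Psi (?y \<boxtimes> ?z)) = Psi (W.D (?y \<boxtimes> ?z))"
   unfolding mult[OF y(1) z] WD_leibniz[OF y(2) z] E_leibniz[OF niceD(2)[OF Psi_nice y(2)] c(4)] cons(4,5)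
   using c by (simp add: lin_add[OF Psi_lin] lin_neg[OF Om_m Om_m Psi_lin] mult Om.mult_closed signed_def)
  then show ?case by (simp add: WB_Cons[OF cons(1) ws])
 qed (rule e)
qed

text \<open>By induction \<open>Psi (W.D y)\<close> is a cycle, hence so is \<open>?c\<close>, of
  degree \<open>2 - length w\<close>. Since \<open>Psi y = y + Q ?c\<close>, the claim reduces to
  \<open>?c = E (Q ?c)\<close>. This is \<open>cycle\<close> in negative degrees and trivial in
  degree 1; in degree 0, for two letters, the obstruction \<open>q ?c\<close> has to vanish, and it
  does by the choice of \<open>\<mu>\<close>.\<close>

lemma intertwine_word: "w : words ==> length w \<le> n ==> E (Psi (WB [w])) = Psi (W.D (WB [w]))"
proof (induction n arbitrary: w)
 case 0
 then show ?case by (simp add: words_def)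
next
 case (Suc n)
 note w = Suc.prems
 let ?y = "WB [w]"
 let ?c = "Psi (W.D ?y) \<boxminus> E ?y"
 note y = WB_single(2,3)[OF w(1)]
 note Dy = W.D_closed[OF y(1)]
 have cc: "?c : CO" using y(1) Psi_closed[OF Dy] by (simp add: E_closed)
 have "E (Psi (W.D ?y)) = Psi (W.D (W.D ?y))" by (rule intertwine_bounded[OF Suc.IH WD_bounded[OF w]])
 then have Ec: "E ?c = zO"
  using y(1) by (simp add: E_diff Psi_closed[OF Dy] E_closed E_E W.D_D lin_zero[OF Om_m Om_m Psi_lin])
 have "?c : W0.gr (1 - int (length w) + 1)"
  by (intro W0.gr_closed(5) niceD(2)[OF Psi_nice] WD_gr E_gr y(2))
 then have cgr: "?c : W0.gr (2 - int (length w))" by simp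
 have fin: ?case if "?c = E (Q ?c)"
 proof -
  have "E (Psi ?y) = E ?y \<boxplus> E (Q ?c)"
   unfolding Psi_fixed[OF w(1)] step_def using y(1) cc by (simp add: E_add Q_closed)
  also have "\<dots> = Psi (W.D ?y)" unfolding that[symmetric] using y(1) Psi_closed[OF Dy] by (simp add: E_closed Om.M.ab_simps)
  finally show ?thesis .
 qed
 have "length w > 0" using w(1) by (cases w) (auto simp: words_def)
 then consider "length w = 1" | "length w = 2" | "length w > 2" by linarith
 then show ?case
 proof cases
  case 1
  then have "?c = zO" using cgr gr_pos by auto
  then show ?thesis by (intro fin) (simp add: Q_zero E_zero)
 next
  case 3
  then show ?thesis by (intro fin cycle(2)[OF cgr Ec]) simp
 next
  case 2
  then obtain x x' where xx: "w = [x, x']" by (auto simp: numeral_2_eq_2 length_Suc_conv)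
  then have x: "x : CA" "x' : CA" using w(1) by (auto simp: words_def)
  have yv: "?y = W0.v x (W0.i x')" using W0.W_bar[OF x(1), of "[x']" "[]"] x xx by (simp add: W0.i_def words_def)
  note i = W0.i_closed[OF x(1)] W0.i_closed[OF x(2)] W0.i_closed[OF \<mu>_closed[OF x]] b_closed[OF x]
  have "W.D ?y = \<^bold>- (W0.i x \<boxtimes> W0.i x') \<boxplus> W0.i (\<mu> x x')"
   using D_v_i[OF W.word_algebra_axioms W_eqs(3) x] Df_mult[OF x] yv by simp
  then have "Psi (W.D ?y) = \<^bold>- (W0.i x \<boxtimes> W0.i x') \<boxplus> W0.i (\<mu> x x')"
   using i x by (simp add: lin_add[OF Psi_lin] lin_neg[OF Om_m Om_m Psi_lin] algD(2)[OF Psi_alg] Psi_i \<mu>_closed Om.mult_closed)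
  also have "\<dots> = E (\<^bold>- b x x')" unfolding E_b[OF x] using i by (simp add: E_neg E_closed Om.M.ab_simps)
  finally have c: "?c = E (\<^bold>- b x x' \<boxminus> ?y)" using i y(1) by (simp add: E_diff)
  have c0: "?c : W0.gr 0" using cgr 2 by simp
  have qc: "q ?c : CA" by (rule q_closed[OF cc])
  \<comment> \<open>A primitive of \<open>i (q ?c)\<close>: by \<open>c\<close> the cycle
    \<open>?c\<close> is the boundary of an explicit element, and it differs from
    \<open>E (Q ?c)\<close> by \<open>i (q ?c)\<close>.\<close>
  let ?w = "\<^bold>- b x x' \<boxminus> ?y \<boxminus> Q ?c"
  have bc: "\<^bold>- b x x' \<boxminus> ?y : CO" using i y(1) by simp
  have "q ?c = \<zero>\<^sub>Am"
  proof (rule i_boundary[OF _ qc])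
   have "Q ?c : W0.gr (- 1)" using Q_gr[OF c0] by simp
   moreover have "?y : W0.gr (- 1)" using y(2) 2 by simp
   ultimately show "?w : W0.gr (- 1)" by (intro W0.gr_closed(4,5) b_gr[OF x])
   have "E ?w = ?c \<boxminus> E (Q ?c)" unfolding c[symmetric] E_diff[OF bc Q_closed[OF cc]] ..
   moreover have "u \<boxminus> v = z" if "u = v \<boxplus> z" "v : CO" "z : CO" for u v z using that by (simp add: Om.M.ab_simps)
   from this[OF cycle(1)[OF cgr Ec] E_closed[OF Q_closed[OF cc]] W0.i_closed[OF qc]] have "?c \<boxminus> E (Q ?c) = W0.i (q ?c)" .
   ultimately show "E ?w = W0.i (q ?c)" by simp
  qed
  then have "W0.i (q ?c) = zO" using lin_zero[OF Am_m Om_m W0.i_lin] by simp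
  then show ?thesis using cycle(1)[OF cgr Ec] E_closed[OF Q_closed[OF cc]] by (intro fin) simp
 qed
qed

theorem perturbation_equiv: "(\<Delta> \<beta>, \<delta>) : eqr"
proof (rule equiv_relI[OF \<Delta>_MC_rel[OF \<beta>_MC] \<delta> Psi_lin algD(2)[OF Psi_alg] niceD(3)[OF Psi_nice] niceD(2)[OF Psi_nice]])
 fix y assume y: "y : CO"
 have "Psi (W.D y) = E (Psi y)"
 proof (rule W0.X_lin_ext[OF Om_m lin_comp[OF W.D_lin Psi_lin] lin_comp[OF Psi_lin E_lin] _ y])
  fix ws assume "ws : NW Am"
  from all_bounded[OF this] obtain n where n: "ws : bounded_words n" by (rule exE)
  then have "WB ws : bounded_span n" unfolding bounded_span_def by (intro span_base) auto
  from intertwine_bounded[OF intertwine_word this] show "Psi (W.D (WB ws)) = E (Psi (WB ws))" by simp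
 qed
 then show "Psi (pd (\<Delta> \<beta>) y) = pd \<delta> (Psi y)"
  using y by (simp add: perturbed_\<Delta>[OF \<beta>_MC] E_perturbed Psi_closed)
qed

end

context deformation
begin

lemma rel_surj: "\<delta> : MCr ==> \<exists>\<beta>\<in>MCa. (\<Delta> \<beta>, \<delta>) : eqr"
proof -
 assume "\<delta> : MCr"
 then interpret perturbation K A B m \<delta> by unfold_locales
 show ?thesis using perturbation_equiv \<beta>_MC by (intro bexI[of _ \<beta>])
qed

end

section \<open>Splittings over a field, quotients and transport of structure\<close>

definition "lin_sub K W C \<longleftrightarrow> C \<subseteq> carrier W \<and> \<zero>\<^sub>W : C \<and> (\<forall>x\<in>C. \<forall>y\<in>C. x \<oplus>\<^sub>W y : C) \<and>
 (\<forall>c\<in>carrier K. \<forall>x\<in>C. c \<odot>\<^sub>W x : C)"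

lemma lin_subD:
 assumes "lin_sub K W C"
 shows "x : C ==> x :. W" "\<zero>\<^sub>W : C" "x : C ==> y : C ==> x \<oplus>\<^sub>W y : C"
  "c :. K ==> x : C ==> c \<odot>\<^sub>W x : C"
 using assms by (auto simp: lin_sub_def)

lemma lin_sub_neg: assumes "module K W" "lin_sub K W C" "x : C" shows "\<ominus>\<^sub>W x : C"
proof -
 interpret module K W by fact
 show ?thesis using lin_subD(4)[OF assms(2) _ assms(3), of "\<ominus>\<^sub>K \<one>\<^sub>K"] lin_subD(1)[OF assms(2,3)]
  by (simp add: smult_l_minus)
qed

text \<open>Take a maximal subspace \<open>C\<close> meeting \<open>U\<close> trivially. Were
  \<open>w\<close> outside \<open>C + U\<close>, the line of \<open>w\<close> could be added to
  \<open>C\<close>, since a nonzero multiple of \<open>w\<close> in \<open>C + U\<close> can be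
  divided by its coefficient.\<close>

lemma complement_exists:
 assumes K: "field K" and W: "module K W" and U: "lin_sub K W U"
 shows "\<exists>C. lin_sub K W C \<and> C \<inter> U = {\<zero>\<^sub>W} \<and> (\<forall>w\<in>carrier W. \<exists>c\<in>C. \<exists>u\<in>U. w = c \<oplus>\<^sub>W u)"
proof -
 interpret K: field K by fact
 interpret W: module K W by fact
 let ?F = "{C. lin_sub K W C \<and> C \<inter> U = {\<zero>\<^sub>W}}"
 have "\<exists>M\<in>?F. \<forall>X\<in>?F. M \<subseteq> X --> X = M"
 proof (rule subset_Zorn_nonempty)
  have "{\<zero>\<^sub>W} : ?F" using lin_subD(2)[OF U] by (auto simp: lin_sub_def)
  then show "?F \<noteq> {}" by blast
  fix Ch assume Ch: "Ch \<noteq> {}" "subset.chain ?F Ch"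
  have Ci: "lin_sub K W J" "J \<inter> U = {\<zero>\<^sub>W}" if "J : Ch" for J using Ch(2) that by (auto simp: subset.chain_def)
  have Ct: "\<exists>J\<in>Ch. x : J \<and> y : J" if xy: "x : \<Union>Ch" "y : \<Union>Ch" for x y
  proof -
   obtain J J' where "J : Ch" "J' : Ch" "x : J" "y : J'" using xy by auto
   moreover have "J \<subseteq> J' \<or> J' \<subseteq> J" using Ch(2) calculation by (auto simp: subset.chain_def)
   ultimately show ?thesis by blast
  qed
  have "lin_sub K W (\<Union>Ch)" unfolding lin_sub_def
  proof (intro conjI ballI)
   show "\<Union>Ch \<subseteq> carrier W" using lin_subD(1)[OF Ci(1)] by blast
   show "\<zero>\<^sub>W : \<Union>Ch" using lin_subD(2)[OF Ci(1)] Ch(1) by blast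
   show "x \<oplus>\<^sub>W y : \<Union>Ch" if "x : \<Union>Ch" "y : \<Union>Ch" for x y
    using Ct[OF that] lin_subD(3)[OF Ci(1)] by blast
   show "c \<odot>\<^sub>W x : \<Union>Ch" if "c :. K" "x : \<Union>Ch" for c x
    using that lin_subD(4)[OF Ci(1)] by blast
  qed
  moreover have "\<Union>Ch \<inter> U = {\<zero>\<^sub>W}" using Ci(2) Ch(1) by blast
  ultimately show "\<Union>Ch : ?F" by blast
 qed
 then obtain C where C: "lin_sub K W C" "C \<inter> U = {\<zero>\<^sub>W}"
  and max: "!!X. lin_sub K W X ==> X \<inter> U = {\<zero>\<^sub>W} ==> C \<subseteq> X ==> X = C" by auto
 note Cd = lin_subD[OF C(1)] and Ud = lin_subD[OF U]
 have "\<exists>c\<in>C. \<exists>u\<in>U. w = c \<oplus>\<^sub>W u" if w: "w :. W" for w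
 proof (rule ccontr)
  assume no: "\<not> ?thesis"
  let ?X = "{c \<oplus>\<^sub>W k \<odot>\<^sub>W w | c k. c : C \<and> k :. K}"
  have X: "c \<oplus>\<^sub>W k \<odot>\<^sub>W w : ?X" if "c : C" "k :. K" for c k using that by blast
  have sub: "lin_sub K W ?X" unfolding lin_sub_def
  proof (intro conjI ballI)
   show "?X \<subseteq> carrier W" using Cd(1) w by auto
   show "\<zero>\<^sub>W : ?X" using X[OF Cd(2) K.zero_closed] w by simp
  next
   fix x y assume "x : ?X" "y : ?X"
   then obtain c k c' k' where e: "x = c \<oplus>\<^sub>W k \<odot>\<^sub>W w" "y = c' \<oplus>\<^sub>W k' \<odot>\<^sub>W w"
    and c: "c : C" "c' : C" "k :. K" "k' :. K" by blast
   have "x \<oplus>\<^sub>W y = (c \<oplus>\<^sub>W c') \<oplus>\<^sub>W (k \<oplus>\<^sub>K k') \<odot>\<^sub>W w"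
    unfolding e using c w Cd(1) by (simp add: W.smult_l_distr W.M.a_ac)
   then show "x \<oplus>\<^sub>W y : ?X" using X[OF Cd(3)[OF c(1,2)]] c(3,4) by simp
  next
   fix r x assume r: "r :. K" and "x : ?X"
   then obtain c k where e: "x = c \<oplus>\<^sub>W k \<odot>\<^sub>W w" and c: "c : C" "k :. K" by blast
   have "r \<odot>\<^sub>W x = r \<odot>\<^sub>W c \<oplus>\<^sub>W (r \<otimes>\<^sub>K k) \<odot>\<^sub>W w"
    unfolding e using c r w Cd(1) by (simp add: W.smult_r_distr W.smult_assoc1)
   then show "r \<odot>\<^sub>W x : ?X" using X[OF Cd(4)[OF r c(1)]] c r by simp
  qed
  have "x = \<zero>\<^sub>W" if x: "x : ?X" "x : U" for x
  proof -
   obtain c k where e: "x = c \<oplus>\<^sub>W k \<odot>\<^sub>W w" and c: "c : C" "k :. K" using x(1) by blast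
   have cc: "c :. W" "x :. W" using Cd(1) Ud(1) c x by auto
   show ?thesis
   proof (cases "k = \<zero>\<^sub>K")
    case True
    then have "x = c" using e w cc by simp
    then show ?thesis using C(2) c(1) x(2) by blast
   next
    case False
    then have k: "k : Units K" using c(2) K.field_Units by blast
    have "w = (inv\<^bsub>K\<^esub> k \<otimes>\<^sub>K k) \<odot>\<^sub>W w" using k w by simp
    also have "\<dots> = inv\<^bsub>K\<^esub> k \<odot>\<^sub>W (k \<odot>\<^sub>W w)"
     by (rule W.smult_assoc1[OF K.Units_inv_closed[OF k] c(2) w])
    also have "k \<odot>\<^sub>W w = \<ominus>\<^sub>W c \<oplus>\<^sub>W x" using e c w cc by (simp add: W.M.ab_simps)
    also have "inv\<^bsub>K\<^esub> k \<odot>\<^sub>W (\<ominus>\<^sub>W c \<oplus>\<^sub>W x) = inv\<^bsub>K\<^esub> k \<odot>\<^sub>W (\<ominus>\<^sub>W c) \<oplus>\<^sub>W inv\<^bsub>K\<^esub> k \<odot>\<^sub>W x"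
     using k cc by (simp add: W.smult_r_distr)
    finally have "w = inv\<^bsub>K\<^esub> k \<odot>\<^sub>W (\<ominus>\<^sub>W c) \<oplus>\<^sub>W inv\<^bsub>K\<^esub> k \<odot>\<^sub>W x" .
    moreover have "inv\<^bsub>K\<^esub> k \<odot>\<^sub>W (\<ominus>\<^sub>W c) : C" "inv\<^bsub>K\<^esub> k \<odot>\<^sub>W x : U"
     using Cd(4)[OF K.Units_inv_closed[OF k] lin_sub_neg[OF W C(1) c(1)]] Ud(4)[OF K.Units_inv_closed[OF k] x(2)] by auto
    ultimately show ?thesis using no by blast
   qed
  qed
  then have "?X \<inter> U = {\<zero>\<^sub>W}" using lin_subD(2)[OF sub] Ud(2) by blast
  moreover have "C \<subseteq> ?X"
  proof
   fix c assume c: "c : C"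
   show "c : ?X" using X[OF c K.zero_closed] Cd(1)[OF c] w by simp
  qed
  ultimately have "?X = C" by (intro max sub)
  moreover have "w : ?X" using X[OF Cd(2) K.one_closed] w by simp
  ultimately have "w : C" "w = w \<oplus>\<^sub>W \<zero>\<^sub>W" using w by auto
  then show False using no Ud(2) by blast
 qed
 with C show ?thesis by blast
qed

text \<open>A relation that is total, compatible with the operations and single-valued over zero is
  the graph of a linear map. With complements this gives retractions and sections without
  bases.\<close>

lemma linear_choice:
 assumes V: "module K V" and W: "module K W"
  and tot: "!!x. x :. V ==> \<exists>y\<in>carrier W. P x y"
  and uniq: "!!y. y :. W ==> P \<zero>\<^sub>V y ==> y = \<zero>\<^sub>W"
  and add: "!!x x' y y'. x :. V ==> x' :. V ==> y :. W ==> y' :. W ==>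
   P x y ==> P x' y' ==> P (x \<oplus>\<^sub>V x') (y \<oplus>\<^sub>W y')"
  and smult: "!!r x y. r :. K ==> x :. V ==> y :. W ==> P x y ==> P (r \<odot>\<^sub>V x) (r \<odot>\<^sub>W y)"
 shows "\<exists>f. lin K V W f \<and> (\<forall>x\<in>carrier V. P x (f x))"
proof -
 interpret V: module K V by fact
 interpret W: module K W by fact
 have neg: "P (\<ominus>\<^sub>V x) (\<ominus>\<^sub>W y)" if "x :. V" "y :. W" "P x y" for x y
  using smult[OF _ that, of "\<ominus>\<^sub>K \<one>\<^sub>K"] that by (simp add: V.smult_l_minus W.smult_l_minus)
 have eq: "y = y'" if "x :. V" "y :. W" "y' :. W" "P x y" "P x y'" for x y y'
 proof -
  have "P (x \<oplus>\<^sub>V \<ominus>\<^sub>V x) (y \<oplus>\<^sub>W \<ominus>\<^sub>W y')" by (rule add[OF _ _ _ _ _ neg]) (use that in auto)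
  then have "y \<ominus>\<^sub>W y' = \<zero>\<^sub>W" using uniq[of "y \<ominus>\<^sub>W y'"] that by (simp add: a_minus_def V.M.r_neg)
  then show ?thesis using W.M.diff_zero_iff that by simp
 qed
 define f where "f x = (SOME y. y :. W \<and> P x y)" for x
 have f: "f x :. W" "P x (f x)" if "x :. V" for x
  using someI_ex[of "%y. y :. W \<and> P x y"] tot[OF that] by (auto simp: f_def)
 have "lin K V W f"
 proof (rule linI)
  show "f (x \<oplus>\<^sub>V y) = f x \<oplus>\<^sub>W f y" if "x :. V" "y :. V" for x y
   by (rule eq[of "x \<oplus>\<^sub>V y"]) (use that f add in auto)
  show "f (r \<odot>\<^sub>V x) = r \<odot>\<^sub>W f x" if "r :. K" "x :. V" for r x
   by (rule eq[of "r \<odot>\<^sub>V x"]) (use that f smult in auto)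
 qed (rule f)
 then show ?thesis using f by blast
qed

lemma linear_retraction:
 assumes K: "field K" and V: "module K V" and W: "module K W" and f: "lin K V W f" and inj: "inj_on f (carrier V)"
 shows "\<exists>r. lin K W V r \<and> (\<forall>x\<in>carrier V. r (f x) = x)"
proof -
 interpret V: module K V by fact
 interpret W: module K W by fact
 note fc = lin_closed[OF f]
 have "lin_sub K W (f ` carrier V)"
  unfolding lin_sub_def
  by (auto simp: fc lin_add[OF f, symmetric] lin_smult[OF f, symmetric] lin_zero[OF V W f, symmetric])
 from complement_exists[OF K W this] obtain C where C: "lin_sub K W C" "C \<inter> f ` carrier V = {\<zero>\<^sub>W}"
  and dec: "!!w. w :. W ==> \<exists>c\<in>C. \<exists>u\<in>f ` carrier V. w = c \<oplus>\<^sub>W u" by auto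
 note Cd = lin_subD[OF C(1)]
 have f0: "x = \<zero>\<^sub>V" if "x :. V" "f x = \<zero>\<^sub>W" for x
  using inj_onD[OF inj, of x "\<zero>\<^sub>V"] that lin_zero[OF V W f] by simp
 have "\<exists>r. lin K W V r \<and> (\<forall>w\<in>carrier W. w \<ominus>\<^sub>W f (r w) : C)"
 proof (rule linear_choice[OF W V])
  fix w assume w: "w :. W"
  from dec[OF w] obtain c x where c: "c : C" "x :. V" "w = c \<oplus>\<^sub>W f x" by auto
  have "w \<ominus>\<^sub>W f x = c" unfolding c(3) using c(2) fc Cd(1)[OF c(1)] by (simp add: W.M.ab_simps)
  then show "\<exists>x\<in>carrier V. w \<ominus>\<^sub>W f x : C" using c(1,2) by (intro bexI[of _ x]) simp_all
 next
  fix y assume y: "y :. V" and c: "\<zero>\<^sub>W \<ominus>\<^sub>W f y : C"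
  have "\<ominus>\<^sub>W (\<zero>\<^sub>W \<ominus>\<^sub>W f y) = f y" using fc[OF y] by (simp add: W.M.ab_simps)
  then have "f y : C \<inter> f ` carrier V" using lin_sub_neg[OF W C(1) c] y by auto
  then show "y = \<zero>\<^sub>V" using C(2) f0 y by auto
 next
  fix x x' y y' assume c: "x :. W" "x' :. W" "y :. V" "y' :. V"
   and P: "x \<ominus>\<^sub>W f y : C" "x' \<ominus>\<^sub>W f y' : C"
  have "(x \<oplus>\<^sub>W x') \<ominus>\<^sub>W f (y \<oplus>\<^sub>V y') = (x \<ominus>\<^sub>W f y) \<oplus>\<^sub>W (x' \<ominus>\<^sub>W f y')"
   using c fc by (simp add: lin_add[OF f] W.M.ab_simps)
  then show "(x \<oplus>\<^sub>W x') \<ominus>\<^sub>W f (y \<oplus>\<^sub>V y') : C" using Cd(3)[OF P] by simp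
 next
  fix r x y assume c: "r :. K" "x :. W" "y :. V" and P: "x \<ominus>\<^sub>W f y : C"
  have "r \<odot>\<^sub>W x \<ominus>\<^sub>W f (r \<odot>\<^sub>V y) = r \<odot>\<^sub>W (x \<ominus>\<^sub>W f y)"
   using c fc by (simp add: lin_smult[OF f] a_minus_def W.smult_r_distr W.smult_r_minus)
  then show "r \<odot>\<^sub>W x \<ominus>\<^sub>W f (r \<odot>\<^sub>V y) : C" using Cd(4)[OF c(1) P] by simp
 qed
 then obtain r where r: "lin K W V r" "!!w. w :. W ==> w \<ominus>\<^sub>W f (r w) : C" by auto
 have "r (f x) = x" if x: "x :. V" for x
 proof -
  have rx: "r (f x) :. V" by (rule lin_closed[OF r(1) fc[OF x]])
  have e: "f x \<ominus>\<^sub>W f (r (f x)) = f (x \<ominus>\<^sub>V r (f x))" using x rx lin_diff[OF V W f] by simp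
  then have "f (x \<ominus>\<^sub>V r (f x)) : C \<inter> f ` carrier V" using r(2)[OF fc[OF x]] x rx by auto
  then have "x \<ominus>\<^sub>V r (f x) = \<zero>\<^sub>V" using C(2) f0 x rx by auto
  then show ?thesis using V.M.diff_zero_iff x rx by simp
 qed
 then show ?thesis using r(1) by blast
qed

lemma linear_section:
 assumes K: "field K" and W: "module K W" and A: "module K A" and f: "lin K W A f" and surj: "f ` carrier W = carrier A"
 shows "\<exists>s. lin K A W s \<and> (\<forall>a\<in>carrier A. f (s a) = a)"
proof -
 interpret W: module K W by fact
 interpret A: module K A by fact
 let ?U = "{w : carrier W. f w = \<zero>\<^sub>A}"
 have "lin_sub K W ?U" unfolding lin_sub_def by (auto simp: lin_add[OF f] lin_smult[OF f] lin_zero[OF W A f])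
 from complement_exists[OF K W this] obtain C where C: "lin_sub K W C" "C \<inter> ?U = {\<zero>\<^sub>W}"
  and dec: "!!w. w :. W ==> \<exists>c\<in>C. \<exists>u\<in>?U. w = c \<oplus>\<^sub>W u" by auto
 note Cd = lin_subD[OF C(1)]
 have "\<exists>s. lin K A W s \<and> (\<forall>a\<in>carrier A. s a : C \<and> f (s a) = a)"
 proof (rule linear_choice[OF A W])
  fix a assume "a :. A"
  then have "a : f ` carrier W" using surj by simp
  then obtain w where w: "w :. W" "f w = a" by auto
  from dec[OF w(1)] obtain c u where c: "c : C" "u :. W" "f u = \<zero>\<^sub>A" "w = c \<oplus>\<^sub>W u" by auto
  then have "f c = a" using w(2) Cd(1)[OF c(1)] lin_closed[OF f] by (simp add: lin_add[OF f])
  then show "\<exists>y\<in>carrier W. y : C \<and> f y = a" using c(1) Cd(1) by blast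
 next
  fix y assume "y :. W" "y : C \<and> f y = \<zero>\<^sub>A"
  then show "y = \<zero>\<^sub>W" using C(2) by blast
 qed (use Cd in \<open>auto simp: lin_add[OF f] lin_smult[OF f]\<close>)
 then show ?thesis by auto
qed

text \<open>Turns membership in \<open>N\<close> into vanishing under an additive map, so that it
  can be derived from the vanishing of an element of a tensor product.\<close>

lemma quotient_exists:
 fixes X :: "('r, 'x) module"
 assumes X: "abelian_group X" and N: "N \<subseteq> carrier X" "\<zero>\<^sub>X : N" "!!x y. x : N ==> y : N ==> x \<oplus>\<^sub>X y : N"
  "!!x. x : N ==> \<ominus>\<^sub>X x : N"
 shows "\<exists>(P :: ('r, 'x set) module) f. abelian_group P \<and> additive X P f \<and> (\<forall>x\<in>carrier X. f x = \<zero>\<^sub>P \<longleftrightarrow> x : N)"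
proof -
 interpret X: abelian_group X by fact
 have sg: "subgroup N (add_monoid X)"
  by (rule X.add.subgroupI) (use N in \<open>auto simp: a_inv_def\<close>)
 interpret S: abelian_subgroup N X
  by (rule abelian_subgroupI3[OF additive_subgroup.intro[OF sg] X])
 define P :: "('r, 'x set) module" where
  "P = \<lparr>carrier = (%x. N +>\<^sub>X x) ` carrier X, mult = undefined, one = undefined, zero = N, add = set_add X, smult = undefined\<rparr>"
 have z: "N +>\<^sub>X x = N \<longleftrightarrow> x : N" if "x :. X" for x
  using X.a_coset_join1[OF _ that sg] X.a_coset_join2[OF that sg] by auto
 have N0: "N = N +>\<^sub>X \<zero>\<^sub>X" by (rule sym[OF iffD2[OF z[OF X.zero_closed] N(2)]])
 note sum = S.a_rcos_sum
 have "abelian_group P"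
 proof (rule abelian_groupI)
  fix u assume "u :. P"
  then obtain x where x: "x :. X" "u = N +>\<^sub>X x" by (auto simp: P_def)
  have "(N +>\<^sub>X \<zero>\<^sub>X) <+>\<^sub>X u = u" using sum[of "\<zero>\<^sub>X" x] x by simp
  then show "\<zero>\<^sub>P \<oplus>\<^sub>P u = u" using N0 by (simp add: P_def)
  have "(N +>\<^sub>X (\<ominus>\<^sub>X x)) <+>\<^sub>X u = N" using sum[of "\<ominus>\<^sub>X x" x] x N0 by (simp add: X.l_neg)
  then show "\<exists>v\<in>carrier P. v \<oplus>\<^sub>P u = \<zero>\<^sub>P" using x by (auto simp: P_def)
 next
  show "\<zero>\<^sub>P :. P" using N0 by (auto simp: P_def)
 qed (auto simp: P_def sum X.a_ac)
 moreover have "additive X P (%x. N +>\<^sub>X x)" by (rule additiveI) (simp_all add: P_def sum)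
 moreover have "N +>\<^sub>X x = \<zero>\<^sub>P \<longleftrightarrow> x : N" if "x :. X" for x
  using z[OF that] by (simp add: P_def)
 ultimately show ?thesis by (intro exI conjI ballI)
qed

lemma transport_algebra:
 assumes X: "nonunital_algebra R X" and bij: "bij_betw f (carrier X) (carrier Y)" and zero: "f \<zero>\<^sub>X = \<zero>\<^sub>Y"
  and add: "!!x y. x :. X ==> y :. X ==> f (x \<oplus>\<^sub>X y) = f x \<oplus>\<^sub>Y f y"
  and mult: "!!x y. x :. X ==> y :. X ==> f (x \<otimes>\<^sub>X y) = f x \<otimes>\<^sub>Y f y"
  and smult: "!!r x. r :. R ==> x :. X ==> f (r \<odot>\<^sub>X x) = r \<odot>\<^sub>Y f x"
 shows "nonunital_algebra R Y" "restrict f (carrier X) : algebra_isos R X Y"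
proof -
 interpret X: nonunital_algebra R X by fact
 have im: "carrier Y = f ` carrier X" using bij by (simp add: bij_betw_def)
 note pull = add[symmetric] mult[symmetric] smult[symmetric] zero[symmetric]
 note cl = X.mult_closed
 have neg: "\<exists>y\<in>carrier X. f (y \<oplus>\<^sub>X x) = f \<zero>\<^sub>X" if "x :. X" for x
  using that by (intro bexI[of _ "\<ominus>\<^sub>X x"]) (simp_all add: X.M.l_neg)
 have Y: "module R Y"
 proof (rule moduleI)
  show "cring R" by (rule X.R.is_cring)
  show "abelian_group Y"
   by (rule abelian_groupI) (use neg in \<open>auto simp: im pull X.M.a_ac\<close>)
 qed (auto simp: im pull X.smult_l_distr X.smult_r_distr X.smult_assoc1)
 then show "nonunital_algebra R Y"
  by (auto simp: nonunital_algebra_def nonunital_algebra_axioms_def im pull cl X.mult_assoc X.mult_add_left X.mult_add_right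
    X.mult_smult_left X.mult_smult_right)
 show "restrict f (carrier X) : algebra_isos R X Y"
  by (rule algebra_isosI[OF X.module_axioms linI mult bij cl]) (auto simp: im add smult)
qed

text \<open>Transport of structure along an injection \<open>j\<close>, to place a copy of an
  algebra in another type.\<close>

definition copy_algebra :: "('x => 'u) => ('r, 'x) module => ('r, 'u) module" where
 "copy_algebra j X = (let i = inv_into (carrier X) j in
   \<lparr>carrier = j ` carrier X, mult = %u v. j (i u \<otimes>\<^sub>X i v), one = undefined, zero = j \<zero>\<^sub>X,
   add = %u v. j (i u \<oplus>\<^sub>X i v), smult = %r u. j (r \<odot>\<^sub>X i u)\<rparr>)"

lemma copy_algebra:
 assumes X: "nonunital_algebra R X" and j: "inj_on j (carrier X)"
 shows "nonunital_algebra R (copy_algebra j X)" "restrict j (carrier X) : algebra_isos R X (copy_algebra j X)"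
proof -
 have bij: "bij_betw j (carrier X) (carrier (copy_algebra j X))" using j by (simp add: bij_betw_def copy_algebra_def Let_def)
 show "nonunital_algebra R (copy_algebra j X)" "restrict j (carrier X) : algebra_isos R X (copy_algebra j X)"
  by (rule transport_algebra[OF X bij]; use j in \<open>simp add: copy_algebra_def Let_def\<close>)+
qed

section \<open>Flatness\<close>

lemma tensor_map:
 assumes "module R M" "module R N" "module R M'" "module R N'" and g: "lin R M M' g" and h: "lin R N N' h"
 shows "additive (tensor R M N) (tensor R M' N') (tensor_lift R M N (tensor R M' N') (%x y. pure_tensor R M' N' (g x) (h y)))"
  and "x :. M ==> y :. N ==>
   tensor_lift R M N (tensor R M' N') (%x y. pure_tensor R M' N' (g x) (h y)) (pure_tensor R M N x y) = pure_tensor R M' N' (g x) (h y)"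
proof -
 interpret S: tensor_modules R M N by (intro tensor_modules.intro assms)
 interpret T: tensor_modules R M' N' by (intro tensor_modules.intro assms)
 have "S.balanced (tensor R M' N') (%x y. pure_tensor R M' N' (g x) (h y))"
  by (rule S.balancedI)
    (simp_all add: lin_closed[OF g] lin_closed[OF h] lin_add[OF g] lin_add[OF h] lin_smult[OF g] lin_smult[OF h]
     T.pure_closed T.pure_add_left T.pure_add_right T.pure_smult)
 from S.tensor_lift[OF mod_group[OF T.tensor_module] this]
 show "additive (tensor R M N) (tensor R M' N') (tensor_lift R M N (tensor R M' N') (%x y. pure_tensor R M' N' (g x) (h y)))"
  and "x :. M ==> y :. N ==>
   tensor_lift R M N (tensor R M' N') (%x y. pure_tensor R M' N' (g x) (h y)) (pure_tensor R M N x y) = pure_tensor R M' N' (g x) (h y)"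
  by auto
qed

text \<open>By naturality the map for \<open>Y\<close> followed by \<open>N \<otimes> u\<close>
  equals \<open>N' \<otimes> u\<close> followed by the map for \<open>X\<close>. Here
  \<open>N' \<otimes> u\<close> is injective because \<open>v\<close> provides a left inverse, so
  flatness passes to retracts.\<close>

lemma flat_iso:
 assumes X: "module B X" and Y: "module B Y" and u: "lin B Y X u" and v: "lin B X Y v"
  and vu: "!!y. y :. Y ==> v (u y) = y" and fl: "flat_module B X"
 shows "flat_module B Y"
 unfolding flat_module_def
proof (intro allI impI; elim conjE)
 fix N' N :: "('a, nat => 'a) module" and f
 assume N': "module B N'" and N: "module B N" and fm: "f : linear_maps B N' N" and inj: "inj_on f (carrier N')"
 have f: "lin B N' N f" using fm by (simp add: maps_iff)
 interpret Y': tensor_modules B N' Y by (intro tensor_modules.intro N' Y)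
 interpret X': tensor_modules B N X by (intro tensor_modules.intro N X)
 let ?FX = "tensor_lift B N' X (tensor B N X) (%n x. pure_tensor B N X (f n) x)"
 let ?FY = "tensor_lift B N' Y (tensor B N Y) (%n x. pure_tensor B N Y (f n) x)"
 let ?U' = "tensor_lift B N' Y (tensor B N' X) (%n y. pure_tensor B N' X n (u y))"
 let ?V' = "tensor_lift B N' X (tensor B N' Y) (%n x. pure_tensor B N' Y n (v x))"
 let ?U = "tensor_lift B N Y (tensor B N X) (%n y. pure_tensor B N X n (u y))"
 note FX = tensor_map[OF N' X N X f lin_id] and FY = tensor_map[OF N' Y N Y f lin_id]
  and U' = tensor_map[OF N' Y N' X lin_id u] and V' = tensor_map[OF N' X N' Y lin_id v] and U = tensor_map[OF N Y N X lin_id u]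
 note uc = lin_closed[OF u] and fc = lin_closed[OF f]
 have 1: "?U (?FY Z) = ?FX (?U' Z)" if "Z :. (tensor B N' Y)" for Z
  by (rule Y'.tensor_ext[OF mod_group[OF X'.tensor_module] additive_comp[OF FY(1) U(1)] additive_comp[OF U'(1) FX(1)] _ that])
    (simp add: FX(2) FY(2) U'(2) U(2) uc fc)
 have 2: "?V' (?U' Z) = Z" if "Z :. (tensor B N' Y)" for Z
  by (rule Y'.tensor_ext[OF mod_group[OF Y'.tensor_module] additive_comp[OF U'(1) V'(1)] lin_additive[OF lin_id] _ that])
    (simp add: V'(2) U'(2) uc vu)
 have injX: "inj_on ?FX (carrier (tensor B N' X))" using fl N' N fm inj unfolding flat_module_def by simp
 show "inj_on ?FY (carrier (tensor B N' Y))"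
 proof (rule inj_onI)
  fix Z Z' assume Z: "Z :. (tensor B N' Y)" "Z' :. (tensor B N' Y)" and e: "?FY Z = ?FY Z'"
  have "?FX (?U' Z) = ?FX (?U' Z')" using 1[OF Z(1)] 1[OF Z(2)] e by simp
  from inj_onD[OF injX this additive_closed[OF U'(1) Z(1)] additive_closed[OF U'(1) Z(2)]]
  have "?V' (?U' Z) = ?V' (?U' Z')" by (rule arg_cong)
  then show "Z = Z'" unfolding 2[OF Z(1)] 2[OF Z(2)] .
 qed
qed

section \<open>Flat deformations\<close>

context local_artinian
begin

abbreviation "kk == residue_algebra K B m"

lemma kk_simps [simp]:
 "carrier kk = carrier K" "mult kk = mult K" "one kk = one K" "zero kk = zero K" "add kk = add K"
 "b \<odot>\<^sub>kk c = res b \<otimes>\<^sub>K c"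
 by (simp_all add: residue_algebra_def)

lemma kk_algebra: "algebra B kk"
proof (rule algebraI)
 show "cring B" by (rule B.M_cring)
 show "cring kk"
 proof (rule cringI)
  show "abelian_group kk"
   by (rule abelian_groupI) (auto simp: B.R.a_ac intro: B.R.l_neg B.R.a_inv_closed bexI[of _ "\<ominus>\<^sub>K x" for x])
  show "comm_monoid kk" by (rule comm_monoidI) (auto simp: B.R.m_ac)
 qed (simp add: B.R.l_distr)
qed (simp_all add: res_closed res_add res_mult res_one B.R.l_distr B.R.r_distr B.R.m_assoc)

end

locale flat_setting = deformation K A B m
 for K :: "'k ring" and A :: "('k, 'a) module" and B :: "('k, 'b) module" and m +
 assumes fieldK: "field K"
begin

text \<open>A flat deformation \<open>(X, \<phi>)\<close> is handled through the projection \<open>\<pi> x = \<phi> (x \<otimes> 1)\<close> of \<open>X\<close> onto \<open>A\<close>.\<close>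

definition "proj X \<pi> \<longleftrightarrow> nonunital_algebra B X \<and> additive X A \<pi> \<and>
 (\<forall>b\<in>carrier B. \<forall>x\<in>carrier X. \<pi> (b \<odot>\<^sub>X x) = res b \<odot>\<^sub>A \<pi> x) \<and>
 (\<forall>x\<in>carrier X. \<forall>y\<in>carrier X. \<pi> (x \<otimes>\<^sub>X y) = \<pi> x \<otimes>\<^sub>A \<pi> y) \<and> \<pi> ` carrier X = carrier A \<and>
 (\<forall>x\<in>carrier X. \<pi> x = \<zero>\<^sub>A --> x : fil B m X 1)"

lemma projD:
 assumes "proj X \<pi>"
 shows "nonunital_algebra B X" "additive X A \<pi>"
  "!!b x. b :. B ==> x :. X ==> \<pi> (b \<odot>\<^sub>X x) = res b \<odot>\<^sub>A \<pi> x"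
  "!!x y. x :. X ==> y :. X ==> \<pi> (x \<otimes>\<^sub>X y) = \<pi> x \<otimes>\<^sub>A \<pi> y" "\<pi> ` carrier X = carrier A"
  "!!x. x :. X ==> \<pi> x = \<zero>\<^sub>A ==> x : fil B m X 1"
 using assms by (auto simp: proj_def)

text \<open>Recovers the isomorphism from its projection; for the projections at hand it unfolds to
  the second components written in \<open>map_F\<close> and \<open>map_G\<close>.\<close>

definition "lift X \<pi> = tensor_lift B X kk A (%x r. r \<odot>\<^sub>A \<pi> x)"

lemma A_module: "module K A"
 by (rule module_axioms)

lemma A_group: "abelian_group A"
 by (rule mod_group[OF A_module])

lemma kk_extension: "nonunital_algebra B X ==> algebra_extension B X kk"
 using kk_algebra
 by (simp add: algebra_extension_def scalar_extension_def tensor_modules_def nonunital_algebra_def algebra.axioms(1) algebra_def)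

abbreviation "red1 X x == pure_tensor B X kk x \<one>\<^sub>K"

text \<open>Since \<open>c\<close> in \<open>K\<close> is the residue of \<open>c 1\<close>, each
  tensor in \<open>X \<otimes> k\<close> has the form \<open>x \<otimes> 1\<close>; the reduction is
  thus a quotient of \<open>X\<close>, and \<open>m X\<close> goes to zero.\<close>

lemma reduction_pure:
 assumes X: "nonunital_algebra B X"
 shows red1_additive: "additive X (tensor B X kk) (red1 X)"
  and red1_smult: "x :. X ==> c :. K ==> pure_tensor B X kk x c = red1 X ((c \<odot>\<^sub>B \<one>\<^sub>B) \<odot>\<^sub>X x)"
  and red1_surj: "Z :. (tensor B X kk) ==> \<exists>x\<in>carrier X. Z = red1 X x"
  and red1_fil: "x : fil B m X 1 ==> red1 X x = \<zero>\<^bsub>tensor B X kk\<^esub>"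
proof -
 interpret E: algebra_extension B X kk by (rule kk_extension[OF X])
 have X_m: "module B X" by (rule E.module_axioms)
 have one: "\<one>\<^sub>K :. kk" by simp
 show ad: "additive X E.T (red1 X)"
  using one by (intro additiveI) (simp_all only: E.pure_closed E.pure_add_left)
 show sm: "pure_tensor B X kk x c = red1 X ((c \<odot>\<^sub>B \<one>\<^sub>B) \<odot>\<^sub>X x)" if "x :. X" "c :. K" for x c
  using E.pure_smult[of "c \<odot>\<^sub>B \<one>\<^sub>B" x "\<one>\<^sub>K"] that by (simp add: res_scalar)
 have Tg: "abelian_group E.T" by (rule mod_group[OF E.tensor_module])
 note Xg = mod_group[OF X_m]
 show "\<exists>x\<in>carrier X. Z = red1 X x" if "Z :. E.T"
  using that
 proof (induction rule: E.tensor_induct)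
  case zero
  show ?case by (rule bexI[of _ "\<zero>\<^sub>X"]) (simp_all add: additive_zero[OF Xg Tg ad])
 next
  case (pure x c)
  then show ?case by (intro bexI[of _ "(c \<odot>\<^sub>B \<one>\<^sub>B) \<odot>\<^sub>X x"] sm) simp_all
 next
  case (neg Z)
  then obtain x where x: "x :. X" "Z = red1 X x" by auto
  then show ?case by (intro bexI[of _ "\<ominus>\<^sub>X x"]) (simp_all add: additive_neg[OF Xg Tg ad])
 next
  case (add Y Z)
  then obtain x y where x: "x :. X" "Y = red1 X x" "y :. X" "Z = red1 X y" by auto
  then show ?case by (intro bexI[of _ "x \<oplus>\<^sub>X y"]) (simp_all add: additive_add[OF ad])
 qed
 have p0: "pure_tensor B X kk y \<zero>\<^sub>K = \<zero>\<^sub>E.T" if "y :. X" for y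
  using sm[OF that, of "\<zero>\<^sub>K"] additive_zero[OF Xg Tg ad] that by simp
 show "red1 X x = \<zero>\<^sub>E.T" if "x : fil B m X 1"
 proof (rule additive_span_ext[OF Xg Tg ad _ F.fil_gen_sub[OF X_m]])
  show "additive X E.T (%x. \<zero>\<^sub>E.T)" using lin_additive[OF lin_const_zero[OF E.tensor_module]] .
  show "x : gen X {c \<odot>\<^sub>X x |c x. c : F.mp 1 \<and> x :. X}" using that by (simp add: fil_def)
  fix s assume "s : {c \<odot>\<^sub>X x |c x. c : F.mp 1 \<and> x :. X}"
  then obtain c y where s: "s = c \<odot>\<^sub>X y" "c : m" "y :. X" using F.mp_1 by auto
  then show "red1 X s = \<zero>\<^sub>E.T" using E.pure_smult[of c y "\<one>\<^sub>K"] p0 m.Icarr by (simp add: res_m)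
 qed
qed

lemma kk_module: "module kk M ==> module K M"
 using A_module by (simp add: module_def module_axioms_def)

lemma lift_iso:
 assumes P: "proj X \<pi>"
 shows lift_red1: "!!x. x :. X ==> lift X \<pi> (red1 X x) = \<pi> x"
  and "lift X \<pi> : algebra_isos K (base_change B X kk) A"
proof -
 note P = projD[OF P]
 interpret E: algebra_extension B X kk by (rule kk_extension[OF P(1)])
 have X_m: "module B X" by (rule E.module_axioms)
 note \<pi>c = additive_closed[OF P(2)]
 have bal: "E.balanced A (%x r. r \<odot>\<^sub>A \<pi> x)"
  by (rule E.balancedI)
    (simp_all add: \<pi>c P(3) additive_add[OF P(2)] smult_r_distr smult_l_distr smult_assoc1[symmetric] res_closed R.m_comm)
 note L = E.bc_lift[OF A_group bal, folded lift_def]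
 have Lp: "lift X \<pi> (pure_tensor B X kk x c) = c \<odot>\<^sub>A \<pi> x" if "x :. X" "c :. K" for x c
  using L(3) that by simp
 show L1: "lift X \<pi> (red1 X x) = \<pi> x" if "x :. X" for x using Lp[OF that, of "\<one>\<^sub>K"] \<pi>c[OF that] by simp
 note surj = red1_surj[OF P(1), unfolded E.bc_simps(1)[symmetric]]
 have r1c: "red1 X x :. E.BC" if "x :. X" for x using E.bc_pure_closed[OF that] by simp
 have lin: "lin K E.BC A (lift X \<pi>)"
 proof (rule linI)
  show "lift X \<pi> Z :. A" if "Z :. E.BC" for Z by (rule additive_closed[OF L(1) that])
  show "lift X \<pi> (Y \<oplus>\<^sub>E.BC Z) = lift X \<pi> Y \<oplus>\<^sub>A lift X \<pi> Z" if "Y :. E.BC" "Z :. E.BC" for Y Z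
   by (rule additive_add[OF L(1) that])
  fix r Z assume r: "r :. K" and "Z :. E.BC"
  then obtain x where x: "x :. X" "Z = red1 X x" using surj by blast
  have "r \<odot>\<^sub>E.BC Z = pure_tensor B X kk x r" using E.bc_smult(2)[of r x "\<one>\<^sub>K"] x r by simp
  then show "lift X \<pi> (r \<odot>\<^sub>E.BC Z) = r \<odot>\<^sub>A lift X \<pi> Z" using Lp[OF x(1) r] L1[OF x(1)] x(2) by simp
 qed
 have "bij_betw (lift X \<pi>) (carrier E.BC) (carrier A)" unfolding bij_betw_def
 proof
  show "inj_on (lift X \<pi>) (carrier E.BC)"
  proof (rule inj_onI)
   fix Y Z assume "Y :. E.BC" "Z :. E.BC" and e: "lift X \<pi> Y = lift X \<pi> Z"
   then obtain x y where x: "x :. X" "Y = red1 X x" "y :. X" "Z = red1 X y" using surj by blast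
   have "\<pi> (x \<ominus>\<^sub>X y) = \<zero>\<^sub>A"
    using e x L1 \<pi>c M.diff_zero_iff by (simp add: additive_diff[OF mod_group[OF X_m] A_group P(2)])
   then have "red1 X (x \<ominus>\<^sub>X y) = \<zero>\<^sub>E.T" using P(6) x by (intro red1_fil[OF P(1)]) simp
   then have "red1 X x \<ominus>\<^sub>E.T red1 X y = \<zero>\<^sub>E.T"
    using additive_diff[OF mod_group[OF X_m] mod_group[OF E.tensor_module] red1_additive[OF P(1)] x(1,3)] by simp
   then show "Y = Z" using x additive_closed[OF red1_additive[OF P(1)]]
     abelian_group.diff_zero_iff[OF mod_group[OF E.tensor_module]] by simp
  qed
  show "lift X \<pi> ` carrier E.BC = carrier A"
  proof
   show "lift X \<pi> ` carrier E.BC \<subseteq> carrier A" using lin_closed[OF lin] by auto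
   show "carrier A \<subseteq> lift X \<pi> ` carrier E.BC"
   proof
    fix a assume "a :. A"
    then have "a : \<pi> ` carrier X" using P(5) by simp
    then obtain x where "x :. X" "a = \<pi> x" by (rule imageE)
    then show "a : lift X \<pi> ` carrier E.BC" using L1 r1c by (intro image_eqI[of _ _ "red1 X x"]) auto
   qed
  qed
 qed
 moreover have "lift X \<pi> (Y \<otimes>\<^sub>E.BC Z) = lift X \<pi> Y \<otimes>\<^sub>A lift X \<pi> Z" if YZ: "Y :. E.BC" "Z :. E.BC" for Y Z
 proof -
  obtain x y where x: "x :. X" "Y = red1 X x" "y :. X" "Z = red1 X y" using surj[OF YZ(1)] surj[OF YZ(2)] by auto
  have "Y \<otimes>\<^sub>E.BC Z = red1 X (x \<otimes>\<^sub>X y)" using E.bc_mult_pure[of x "\<one>\<^sub>K" y "\<one>\<^sub>K"] x by simp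
  then show ?thesis using L1 x P(4) E.mult_closed by simp
 qed
 moreover have "lift X \<pi> : linear_maps K E.BC A" using lin L(2) by (simp add: maps_iff)
 ultimately show "lift X \<pi> : algebra_isos K E.BC A" by (simp add: algebra_isos_def algebra_homs_def)
qed

lemma proj_of_iso:
 fixes X :: "('b, 'x) module"
 assumes X: "nonunital_algebra B X" and \<phi>: "\<phi> : algebra_isos K (base_change B X kk) A"
 shows "proj X (%x. \<phi> (red1 X x))"
proof -
 interpret E: algebra_extension B X kk by (rule kk_extension[OF X])
 have X_m: "module B X" by (rule E.module_axioms)
 note Xg = mod_group[OF X_m]
 have BC: "module K E.BC" by (rule kk_module[OF E.bc_module])
 note \<phi> = isosD[OF \<phi>]
 have r1: "additive X E.BC (red1 X)" using red1_additive[OF X] by (simp add: E.additive_bc)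
 have ad: "additive X A (%x. \<phi> (red1 X x))" by (rule additive_comp[OF r1 lin_additive[OF \<phi>(1)]])
 note r1c = additive_closed[OF r1]
 show ?thesis unfolding proj_def
 proof (intro conjI ballI impI X ad)
  fix b x assume b: "b :. B" and x: "x :. X"
  have "red1 X (b \<odot>\<^sub>X x) = res b \<odot>\<^sub>E.BC red1 X x"
   using E.pure_smult[of b x "\<one>\<^sub>K"] E.bc_smult(2)[of "res b" x "\<one>\<^sub>K"] b x res_closed[OF b] by simp
  then show "\<phi> (red1 X (b \<odot>\<^sub>X x)) = res b \<odot>\<^sub>A \<phi> (red1 X x)"
   using lin_smult[OF \<phi>(1) res_closed[OF b] r1c[OF x]] by simp
 next
  fix x y assume x: "x :. X" and y: "y :. X"
  show "\<phi> (red1 X (x \<otimes>\<^sub>X y)) = \<phi> (red1 X x) \<otimes>\<^sub>A \<phi> (red1 X y)"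
   using E.bc_mult_pure[of x "\<one>\<^sub>K" y "\<one>\<^sub>K"] x y \<phi>(2)[OF r1c[OF x] r1c[OF y]] by simp
 next
  show "(%x. \<phi> (red1 X x)) ` carrier X = carrier A"
  proof
   show "(%x. \<phi> (red1 X x)) ` carrier X \<subseteq> carrier A" using additive_closed[OF ad] by auto
   show "carrier A \<subseteq> (%x. \<phi> (red1 X x)) ` carrier X"
   proof
    fix a assume "a :. A"
    then have "a : \<phi> ` carrier E.BC" using \<phi>(3) by (simp add: bij_betw_def)
    then obtain Z where Z: "Z :. E.BC" "a = \<phi> Z" by auto
    from red1_surj[OF X Z(1)[unfolded E.bc_simps(1)]] obtain x where "x :. X" "Z = red1 X x" by auto
    then show "a : (%x. \<phi> (red1 X x)) ` carrier X" using Z(2) by auto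
   qed
  qed
 next
  fix x assume x: "x :. X" and e: "\<phi> (red1 X x) = \<zero>\<^sub>A"
  have r0: "red1 X x = \<zero>\<^sub>E.BC"
   using inj_onD[OF bij_betw_imp_inj_on[OF \<phi>(3)], of "red1 X x" "\<zero>\<^sub>E.BC"] e r1c[OF x] lin_zero[OF BC A_module \<phi>(1)]
    abelian_monoid.zero_closed[OF abelian_group.axioms(1)[OF mod_group[OF BC]]] by simp
  note fc = F.fil_closed[OF X_m]
  \<comment> \<open>The reduction maps to \<open>X / m X\<close> by sending
    \<open>x \<otimes> c\<close> to the class of \<open>c x\<close>. As \<open>x \<otimes> 1\<close>
    vanishes, so does the class of \<open>x\<close>.\<close>
  from quotient_exists[OF Xg fc(1-4), of 1] obtain P :: "('b, 'x set) module" and q where P: "abelian_group P" "additive X P q"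
   and q0: "!!x. x :. X ==> q x = \<zero>\<^sub>P \<longleftrightarrow> x : fil B m X 1" by auto
  have qeq: "q y = q z" if "y :. X" "z :. X" "y \<ominus>\<^sub>X z : fil B m X 1" for y z
   using additive_diff[OF Xg P(1,2) that(1,2)] q0[of "y \<ominus>\<^sub>X z"] that abelian_group.diff_zero_iff[OF P(1)] additive_closed[OF P(2)]
   by simp
  have bal: "E.balanced P (%x c. q ((c \<odot>\<^sub>B \<one>\<^sub>B) \<odot>\<^sub>X x))"
  proof (rule E.balancedI)
   fix b x c assume b: "b :. B" and x: "x :. X" and c': "c :. kk"
   then have c: "c :. K" by simp
   let ?c = "c \<odot>\<^sub>B \<one>\<^sub>B" and ?r = "res b \<odot>\<^sub>B \<one>\<^sub>B"
   have bc: "b \<ominus>\<^sub>B ?r : F.mp 1" using res_in[OF b] F.mp_1 by simp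
   have cc: "?c :. B" "?r :. B" using c res_closed[OF b] by auto
   have e: "(res b \<otimes>\<^sub>K c) \<odot>\<^sub>B \<one>\<^sub>B = ?c \<otimes>\<^sub>B ?r"
    using c res_closed[OF b] by (simp add: B.smult_assoc1 B.smult_assoc2 R.m_comm)
   have "?c \<odot>\<^sub>X (b \<odot>\<^sub>X x) \<ominus>\<^sub>X (?c \<otimes>\<^sub>B ?r) \<odot>\<^sub>X x = (b \<ominus>\<^sub>B ?r) \<odot>\<^sub>X (?c \<odot>\<^sub>X x)"
    using b x cc by (simp add: a_minus_def E.smult_l_distr E.smult_l_minus E.smult_assoc1[symmetric] B.m_comm B.r_distr B.r_minus)
   then have "?c \<odot>\<^sub>X (b \<odot>\<^sub>X x) \<ominus>\<^sub>X (?c \<otimes>\<^sub>B ?r) \<odot>\<^sub>X x : fil B m X 1"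
    using F.fil_base[OF bc E.smult_closed[OF cc(1) x]] by simp
   from qeq[OF _ _ this] show "q (?c \<odot>\<^sub>X (b \<odot>\<^sub>X x)) = q ((b \<odot>\<^sub>kk c \<odot>\<^sub>B \<one>\<^sub>B) \<odot>\<^sub>X x)" using b x cc by (simp add: e)
  qed (simp_all add: additive_closed[OF P(2)] additive_add[OF P(2)] E.smult_r_distr E.smult_l_distr B.smult_l_distr)
  from E.tensor_universal[OF P(1) bal] obtain h where h: "additive E.T P h"
   "!!x c. x :. X ==> c :. kk ==> h (E.pure x c) = q ((c \<odot>\<^sub>B \<one>\<^sub>B) \<odot>\<^sub>X x)" by auto
  have "h (red1 X x) = \<zero>\<^sub>P" unfolding r0 E.bc_simps(2) by (rule additive_zero[OF mod_group[OF E.tensor_module] P(1) h(1)])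
  then show "x : fil B m X 1" using h(2)[OF x, of "\<one>\<^sub>K"] x q0 by (simp add: B.smult_one)
 qed
qed

lemma flat_deformationI: "proj X \<pi> ==> flat_module B X ==> flat_deformation K A B m (X, lift X \<pi>)"
 by (simp add: flat_deformation_def projD(1) lift_iso(2))

abbreviation "fe == flat_equivalent K A B m"

lemma feI:
 assumes "flat_deformation K A B m (X, \<phi>)" "flat_deformation K A B m (Y, \<psi>)" "f : algebra_isos B X Y"
  "!!x. x :. X ==> \<psi> (red1 Y (f x)) = \<phi> (red1 X x)"
 shows "fe (X, \<phi>) (Y, \<psi>)"
 using assms unfolding flat_equivalent_def by auto

lemma feE:
 assumes "fe (X, \<phi>) (Y, \<psi>)"
 obtains f where "flat_deformation K A B m (X, \<phi>)" "flat_deformation K A B m (Y, \<psi>)" "f : algebra_isos B X Y"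
  "\<forall>x\<in>carrier X. \<psi> (red1 Y (f x)) = \<phi> (red1 X x)"
 using assms unfolding flat_equivalent_def by auto

lemma fe_refl: "flat_deformation K A B m S ==> fe S S"
proof -
 assume S: "flat_deformation K A B m S"
 obtain X \<phi> where X: "S = (X, \<phi>)" by (cases S)
 interpret X: nonunital_algebra B X using S X by (simp add: flat_deformation_def)
 have "restrict (%x. x) (carrier X) : algebra_isos B X X"
  by (rule algebra_isosI[OF X.module_axioms lin_id]) (auto simp: X.mult_closed bij_betw_def)
 then show ?thesis using S X by (auto intro: feI)
qed

lemma fe_sym: "fe S S' ==> fe S' S"
proof -
 assume e: "fe S S'"
 obtain X \<phi> Y \<psi> where S: "S = (X, \<phi>)" "S' = (Y, \<psi>)" by (cases S; cases S')
 from e[unfolded S] obtain f where f: "flat_deformation K A B m (X, \<phi>)" "flat_deformation K A B m (Y, \<psi>)" "f : algebra_isos B X Y"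
  "\<forall>x\<in>carrier X. \<psi> (red1 Y (f x)) = \<phi> (red1 X x)" by (rule feE)
 have X: "nonunital_algebra B X" and Y: "nonunital_algebra B Y" using f(1,2) by (simp_all add: flat_deformation_def)
 note g = algebra_isos_inv[OF X Y f(3)]
 show ?thesis unfolding S
 proof (rule feI[OF f(2,1) g(1)])
  fix y assume y: "y :. Y"
  show "\<phi> (red1 X (restrict (inv_into (carrier X) f) (carrier Y) y)) = \<psi> (red1 Y y)"
   using bspec[OF f(4) lin_closed[OF isosD(1)[OF g(1)] y]] g(3)[OF y] by simp
 qed
qed

lemma fe_trans:
 assumes e: "fe S S'" and e': "fe S' S''"
 shows "fe S S''"
proof -
 obtain X \<phi> Y \<psi> Z \<chi> where S: "S = (X, \<phi>)" "S' = (Y, \<psi>)" "S'' = (Z, \<chi>)" by (cases S; cases S'; cases S'')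
 from e[unfolded S] obtain f where f: "flat_deformation K A B m (X, \<phi>)" "flat_deformation K A B m (Y, \<psi>)" "f : algebra_isos B X Y"
  "\<forall>x\<in>carrier X. \<psi> (red1 Y (f x)) = \<phi> (red1 X x)" by (rule feE)
 from e'[unfolded S] obtain g where g: "flat_deformation K A B m (Y, \<psi>)" "flat_deformation K A B m (Z, \<chi>)" "g : algebra_isos B Y Z"
  "\<forall>x\<in>carrier Y. \<chi> (red1 Z (g x)) = \<psi> (red1 Y x)" by (rule feE)
 have X: "nonunital_algebra B X" using f(1) by (simp add: flat_deformation_def)
 show ?thesis unfolding S
  by (rule feI[OF f(1) g(2) algebra_isos_comp[OF X f(3) g(3)]]) (use f(4) g(4) lin_closed[OF isosD(1)[OF f(3)]] in auto)
qed

text \<open>Flatness and the projection conditions move along an algebra isomorphism, whatever the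
  carrier types; this compares deformed algebras with their copies and with cohomology.\<close>

lemma fe_transport:
 assumes P: "proj X \<pi>" and fl: "flat_module B X" and Y: "nonunital_algebra B Y" and f: "f : algebra_isos B X Y"
  and \<rho>: "!!x. x :. X ==> \<rho> (f x) = \<pi> x"
 shows "fe (X, lift X \<pi>) (Y, lift Y \<rho>)"
proof -
 note Pd = projD[OF P]
 interpret X: nonunital_algebra B X by (rule Pd(1))
 interpret Y: nonunital_algebra B Y by (rule Y)
 note g = algebra_isos_inv[OF Pd(1) Y f]
 define u where "u = restrict (inv_into (carrier X) f) (carrier Y)"
 note g = g[folded u_def]
 note gl = isosD(1)[OF g(1)] and fl' = isosD(1)[OF f]
 note uc = lin_closed[OF gl]
 have \<rho>u: "\<rho> y = \<pi> (u y)" if "y :. Y" for y using \<rho>[OF uc[OF that]] g(3)[OF that] by simp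
 have "flat_module B Y" by (rule flat_iso[OF X.module_axioms Y.module_axioms gl fl' g(3) fl])
 moreover have PY: "proj Y \<rho>" unfolding proj_def
 proof (intro conjI ballI impI Y)
  show "additive Y A \<rho>"
   by (rule additiveI) (simp_all add: \<rho>u lin_add[OF gl] uc additive_add[OF Pd(2)] additive_closed[OF Pd(2)])
  show "\<rho> (b \<odot>\<^sub>Y y) = res b \<odot>\<^sub>A \<rho> y" if "b :. B" "y :. Y" for b y
   using that by (simp add: \<rho>u lin_smult[OF gl] uc Pd(3))
  show "\<rho> (y \<otimes>\<^sub>Y z) = \<rho> y \<otimes>\<^sub>A \<rho> z" if "y :. Y" "z :. Y" for y z
   using that by (simp add: \<rho>u isosD(2)[OF g(1)] uc Pd(4) Y.mult_closed)
  have "\<rho> ` (f ` carrier X) = \<pi> ` carrier X" by (auto simp: image_image \<rho> intro!: image_cong)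
  then show "\<rho> ` carrier Y = carrier A" using isosD(3)[OF f] Pd(5) by (simp add: bij_betw_def)
  show "y : fil B m Y 1" if "y :. Y" "\<rho> y = \<zero>\<^sub>A" for y
   using F.lin_fil[OF X.module_axioms Y.module_axioms fl' Pd(6)[OF uc[OF that(1)]]] that g(3)[OF that(1)] by (simp add: \<rho>u)
 qed
 ultimately show ?thesis
  by (intro feI[OF flat_deformationI[OF P fl] flat_deformationI f])
    (simp_all add: lift_red1[OF P] lift_red1[OF PY] lin_closed[OF fl'] \<rho>)
qed

text \<open>\<open>N \<otimes> A_B\<close> over \<open>B\<close> is \<open>N \<otimes> A\<close>
  over \<open>K\<close>, so a retraction of \<open>f\<close> that is only \<open>K\<close>-linear,
  which exists over a field, still induces a left inverse after tensoring.\<close>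

lemma flat_Am: "flat_module B Am"
 unfolding flat_module_def
proof (intro allI impI; elim conjE)
 fix N' N :: "('b, nat => 'b) module" and f
 assume N': "module B N'" and N: "module B N" and fm: "f : linear_maps B N' N" and inj: "inj_on f (carrier N')"
 have f: "lin B N' N f" using fm by (simp add: maps_iff)
 interpret T': tensor_modules B N' Am by (intro tensor_modules.intro N' Am_m)
 interpret T: tensor_modules B N Am by (intro tensor_modules.intro N Am_m)
 let ?N = "restr B N" and ?N' = "restr B N'"
 have "lin K ?N' ?N f" using f by (auto simp: lin_def additive_def)
 from linear_retraction[OF fieldK restr_module[OF N'] restr_module[OF N] this] inj
 obtain r where r: "lin K ?N ?N' r" "!!x. x :. N' ==> r (f x) = x" by auto
 have rc: "!!n. n :. N ==> r n :. N'" and ra: "!!n n'. n :. N ==> n' :. N ==> r (n \<oplus>\<^sub>N n') = r n \<oplus>\<^sub>N' r n'"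
  and rs: "!!c n. c :. K ==> n :. N ==> r ((c \<odot>\<^sub>B \<one>\<^sub>B) \<odot>\<^sub>N n) = (c \<odot>\<^sub>B \<one>\<^sub>B) \<odot>\<^sub>N' r n"
  using lin_closed[OF r(1)] lin_add[OF r(1)] lin_smult[OF r(1)] by auto
 have Tg': "abelian_group T'.T" and Tg: "abelian_group T.T" by (rule mod_group[OF T'.tensor_module] mod_group[OF T.tensor_module])+
 \<comment> \<open>The left inverse on \<open>n \<otimes> (a \<otimes> b)\<close>: the scalar
   \<open>b\<close> is first moved to \<open>n\<close>, because \<open>r\<close> need not be
   \<open>B\<close>-linear and must be applied to \<open>b n\<close>.\<close>
 let ?g = "%n a b. T'.pure (r (b \<odot>\<^sub>N n)) (\<iota> a)"
 define \<gamma> where "\<gamma> n = tensor_lift K A B T'.T (?g n)" for n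
 have \<iota>s: "\<iota> (c \<odot>\<^sub>A a) = (c \<odot>\<^sub>B \<one>\<^sub>B) \<odot>\<^sub>Am \<iota> a" if "c :. K" "a :. A" for c a
  using lin_smult[OF \<iota>_lin that] by simp
 have \<iota>a: "\<iota> (a \<oplus>\<^sub>A a') = \<iota> a \<oplus>\<^sub>Am \<iota> a'" if "a :. A" "a' :. A" for a a'
  using lin_add[OF \<iota>_lin that] by simp
 have bal: "AB.balanced T'.T (?g n)" if n: "n :. N" for n
 proof (rule AB.balancedI)
  fix c a b assume c: "c :. K" and a: "a :. A" and b: "b :. B"
  have "(c \<odot>\<^sub>B b) \<odot>\<^sub>N n = (c \<odot>\<^sub>B \<one>\<^sub>B) \<odot>\<^sub>N (b \<odot>\<^sub>N n)"
   using c b n by (simp add: T.M.smult_assoc1[symmetric] B.smult_assoc2)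
  then have "r ((c \<odot>\<^sub>B b) \<odot>\<^sub>N n) = (c \<odot>\<^sub>B \<one>\<^sub>B) \<odot>\<^sub>N' r (b \<odot>\<^sub>N n)" using rs[OF c] b n by simp
  then show "T'.pure (r (b \<odot>\<^sub>N n)) (\<iota> (c \<odot>\<^sub>A a)) = T'.pure (r ((c \<odot>\<^sub>B b) \<odot>\<^sub>N n)) (\<iota> a)"
   using T'.pure_smult[of "c \<odot>\<^sub>B \<one>\<^sub>B" "r (b \<odot>\<^sub>N n)" "\<iota> a"] a b c n rc \<iota>_closed by (simp add: \<iota>s)
 qed (use n rc \<iota>_closed in \<open>simp_all add: \<iota>a ra T.M.smult_l_distr T'.pure_closed T'.pure_add_left T'.pure_add_right\<close>)
 have \<gamma>: "additive Am T'.T (\<gamma> n)" "!!a b. a :. A ==> b :. B ==> \<gamma> n (AB.pure a b) = ?g n a b" if "n :. N" for n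
  unfolding \<gamma>_def using AB.bc_lift(1,3)[OF Tg' bal[OF that]] by auto
 have bal2: "T.balanced T'.T \<gamma>"
 proof (rule T.balancedI)
  fix n n' X assume n: "n :. N" "n' :. N" and X: "X :. Am"
  show "\<gamma> (n \<oplus>\<^sub>N n') X = \<gamma> n X \<oplus>\<^sub>T'.T \<gamma> n' X"
   by (rule AB.bc_ext[OF Tg' \<gamma>(1) additive_plus[OF Tg' \<gamma>(1) \<gamma>(1)] _ X])
     (use n in \<open>simp_all add: \<gamma> T.M.smult_r_distr ra rc \<iota>_closed T'.pure_add_left\<close>)
 next
  fix b n X assume b: "b :. B" and n: "n :. N" and X: "X :. Am"
  show "\<gamma> (b \<odot>\<^sub>N n) X = \<gamma> n (b \<odot>\<^sub>Am X)"
   by (rule AB.bc_ext[OF Tg' \<gamma>(1) additive_comp[OF AB.bc_smult(1)[OF b] \<gamma>(1)[OF n]] _ X])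
     (use n b in \<open>simp_all add: \<gamma> AB.bc_smult(2) T.M.smult_assoc1[symmetric] B.m_comm\<close>)
 qed (use additive_closed[OF \<gamma>(1)] additive_add[OF \<gamma>(1)] in auto)
 from T.tensor_universal[OF Tg' bal2] obtain G where G: "additive T.T T'.T G"
  "!!n X. n :. N ==> X :. Am ==> G (T.pure n X) = \<gamma> n X" by auto
 let ?F = "tensor_lift B N' Am T.T (%n x. T.pure (f n) x)"
 note Fm = tensor_map[OF N' Am_m N Am_m f lin_id]
 note fc = lin_closed[OF f]
 have p: "additive Am T'.T (T'.pure n)" if "n :. N'" for n
  using that by (intro additiveI) (simp_all add: T'.pure_closed T'.pure_add_right)
 have "\<gamma> (f n) X = T'.pure n X" if n: "n :. N'" and X: "X :. Am" for n X
 proof (rule AB.bc_ext[OF Tg' \<gamma>(1)[OF fc[OF n]] p[OF n] _ X])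
  fix a b assume a: "a :. A" and b: "b :. B"
  have "\<gamma> (f n) (AB.pure a b) = T'.pure (b \<odot>\<^sub>N' n) (\<iota> a)"
   using a b n r(2)[of "b \<odot>\<^sub>N' n"] by (simp add: \<gamma> fc lin_smult[OF f, symmetric])
  also have "\<dots> = T'.pure n (b \<odot>\<^sub>Am \<iota> a)" by (rule T'.pure_smult[OF b n \<iota>_closed[OF a]])
  also have "b \<odot>\<^sub>Am \<iota> a = AB.pure a b" using AB.pure_one[OF a b] by (simp add: \<iota>_def)
  finally show "\<gamma> (f n) (AB.pure a b) = T'.pure n (AB.pure a b)" .
 qed
 then have "G (?F Z) = Z" if "Z :. T'.T" for Z
  by (intro T'.tensor_ext[OF Tg' additive_comp[OF Fm(1) G(1)] lin_additive[OF lin_id] _ that]) (simp add: Fm(2) G(2) fc)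
 then show "inj_on ?F (carrier T'.T)" by (rule inj_on_inverseI)
qed

lemma red_mult:
 assumes x: "x :. Am" and y: "y :. Am" shows "RA.red (x \<otimes>\<^sub>Am y) = RA.red x \<otimes>\<^sub>A RA.red y"
proof -
 note rc = RA.red_closed and ra = additive_add[OF RA.red_additive]
 have l1: "additive Am A (%x. RA.red x \<otimes>\<^sub>A a)" "additive Am A (%x. a \<otimes>\<^sub>A RA.red x)" if "a :. A" for a
  using that by (auto intro!: additiveI simp: rc ra mult_closed mult_add_left mult_add_right)
 show ?thesis
 proof (rule AB.bc_ext[OF A_group additive_comp[OF AB.bc_mult_left[OF y] RA.red_additive] l1(1)[OF rc[OF y]] _ x])
  fix a b assume a: "a :. A" and b: "b :. B"
  note p = AB.bc_pure_closed[OF a b]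
  show "RA.red (AB.pure a b \<otimes>\<^sub>Am y) = RA.red (AB.pure a b) \<otimes>\<^sub>A RA.red y"
  proof (rule AB.bc_ext[OF A_group additive_comp[OF AB.bc_mult_right[OF p] RA.red_additive] l1(2)[OF rc[OF p]] _ y])
   fix a' b' assume a': "a' :. A" and b': "b' :. B"
   show "RA.red (AB.pure a b \<otimes>\<^sub>Am AB.pure a' b') = RA.red (AB.pure a b) \<otimes>\<^sub>A RA.red (AB.pure a' b')"
    using a b a' b' by (simp add: AB.bc_mult_pure RA.red_pure res_mult res_closed mult_closed mult_smult_left mult_smult_right smult_assoc1[symmetric] R.m_comm)
  qed
 qed
qed

lemma proj_Df:
 assumes \<beta>: "\<beta> : MCa"
 shows proj_red: "proj (Df \<beta>) RA.red" and flat_Df: "flat_module B (Df \<beta>)"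
proof -
 note \<beta>D = MC_assD[OF \<beta>]
 interpret P: nonunital_algebra B "Df \<beta>" by (rule \<beta>D(4))
 have f: "fil B m (Df \<beta>) 1 = FA" unfolding fil_def by (simp add: Df_simps generate_def)
 show "proj (Df \<beta>) RA.red" unfolding proj_def f Df_simps(1)
 proof (intro conjI ballI impI \<beta>D(4))
  show "additive (Df \<beta>) A RA.red" using RA.red_additive by (simp add: additive_def Df_simps)
  show "RA.red ` carrier Am = carrier A"
  proof
   show "RA.red ` carrier Am \<subseteq> carrier A" using RA.red_closed by auto
   show "carrier A \<subseteq> RA.red ` carrier Am"
   proof
    fix a assume a: "a :. A"
    have "RA.red (\<iota> a) = a" using RA.red_pure[OF a, of "\<one>\<^sub>B"] a by (simp add: \<iota>_def res_one)
    then show "a : RA.red ` carrier Am" using \<iota>_closed[OF a] by (intro image_eqI[of _ _ "\<iota> a"]) auto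
   qed
  qed
  show "RA.red (b \<odot>\<^bsub>Df \<beta>\<^esub> x) = res b \<odot>\<^sub>A RA.red x" if "b :. B" "x :. Am" for b x
   using RA.red_smult[OF that] by (simp add: Df_simps(4))
  show "x : FA" if "x :. Am" "RA.red x = \<zero>\<^sub>A" for x using RA.red_zero_iff[OF that(1)] that(2) by simp
  fix x y assume x: "x :. Am" and y: "y :. Am"
  have "RA.red (x \<otimes>\<^bsub>Df \<beta>\<^esub> y) = RA.red (x \<otimes>\<^sub>Am y)"
   using RA.red_eq_iff[of "x \<otimes>\<^bsub>Df \<beta>\<^esub> y" "x \<otimes>\<^sub>Am y"] MC_ass_near(2)[OF \<beta> x y] P.mult_closed[of x y] Am.mult_closed[OF x y] x y
   by (simp add: Df_simps(1))
  also have "\<dots> = RA.red x \<otimes>\<^sub>A RA.red y" by (rule red_mult[OF x y])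
  finally show "RA.red (x \<otimes>\<^bsub>Df \<beta>\<^esub> y) = RA.red x \<otimes>\<^sub>A RA.red y" .
 qed
 have "lin B Am (Df \<beta>) (%x. x)" "lin B (Df \<beta>) Am (%x. x)" by (simp_all add: same_module_lin[OF Df_same] lin_id)
 from flat_iso[OF Am_m P.module_axioms this(2,1) refl flat_Am] show "flat_module B (Df \<beta>)" .
qed

end

text \<open>Flatness is tested on modules inside \<open>nat \<Rightarrow> 'b\<close>; an ideal is placed there as a set of constant functions.\<close>

definition const_module :: "('b, 'z) ring_scheme => 'b set => ('b, nat => 'b) module" where
 "const_module B J = \<lparr>carrier = (%b _. b) ` J, mult = undefined, one = undefined, zero = %_. \<zero>\<^sub>B,
   add = %f g _. f 0 \<oplus>\<^sub>B g 0, smult = %b f _. b \<otimes>\<^sub>B f 0\<rparr>"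

lemma const_simps:
 "carrier (const_module B J) = (%b _. b) ` J" "\<zero>\<^bsub>const_module B J\<^esub> = (%_. \<zero>\<^sub>B)"
 "f \<oplus>\<^bsub>const_module B J\<^esub> g = (%_. f 0 \<oplus>\<^sub>B g 0)" "b \<odot>\<^bsub>const_module B J\<^esub> f = (%_. b \<otimes>\<^sub>B f 0)"
 by (simp_all add: const_module_def)

lemma const_module:
 assumes "cring B" "ideal J B" shows "module B (const_module B J)"
proof -
 interpret cring B by fact
 interpret J: ideal J B by fact
 have neg: "\<exists>y\<in>J. (%_. y \<oplus>\<^sub>B x) = (%_::nat. \<zero>\<^sub>B)" if "x : J" for x
  using that J.Icarr by (intro bexI[of _ "\<ominus>\<^sub>B x"]) (simp_all add: l_neg J.a_inv_closed)
 show ?thesis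
 proof (rule moduleI)
  show "abelian_group (const_module B J)"
  proof (rule abelian_groupI)
   fix u assume "u :. (const_module B J)"
   then obtain x where x: "x : J" "u = (%_. x)" by (auto simp: const_simps)
   from neg[OF x(1)] obtain y where "y : J" "(%_. y \<oplus>\<^sub>B x) = (%_::nat. \<zero>\<^sub>B)" by (rule bexE)
   then show "\<exists>v\<in>carrier (const_module B J). v \<oplus>\<^bsub>const_module B J\<^esub> u = \<zero>\<^bsub>const_module B J\<^esub>"
    using x by (intro bexI[of _ "%_. y"]) (simp_all add: const_simps)
  qed (auto simp: const_simps J.Icarr a_ac)
 qed (auto simp: const_simps J.Icarr J.I_l_closed is_cring l_distr r_distr m_assoc)
qed

context flat_setting
begin

abbreviation "Nm j == const_module B (F.mp j)"

text \<open>Lift \<open>Y\<close> to an element \<open>Z\<close> of \<open>m^j \<otimes> X\<close>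
  lying over \<open>h Y = 0\<close>. By flatness \<open>m^j \<otimes> X\<close> embeds into
  \<open>B \<otimes> X\<close>, so \<open>Z = 0\<close>. But
  \<open>c \<otimes> x \<mapsto> c \<iota> (\<pi> x)\<close> is well defined on
  \<open>m^j \<otimes> X\<close> modulo \<open>m^(j+1) A_B\<close>, and it sends \<open>Z\<close> to
  the class of \<open>Y\<close>.\<close>

lemma flat_inj_step:
 fixes X :: "('b, 'x) module"
 assumes X: "module B X" and fl: "flat_module B X" and h: "lin B Am X h" and \<pi>: "additive X A \<pi>"
  and \<pi>s: "!!b x. b :. B ==> x :. X ==> \<pi> (b \<odot>\<^sub>X x) = res b \<odot>\<^sub>A \<pi> x"
  and \<pi>h: "!!Y. Y :. Am ==> \<pi> (h Y) = RA.red Y"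
  and Y: "Y : fil B m Am j" and hY: "h Y = \<zero>\<^sub>X"
 shows "Y : fil B m Am (Suc j)"
proof -
 have Nj: "module B (Nm i)" for i by (rule const_module[OF B.M_cring F.mp_ideal])
 interpret X: module B X by (rule X)
 interpret J: tensor_modules B "Nm j" X by (intro tensor_modules.intro Nj X)
 interpret I: tensor_modules B "Nm 0" X by (intro tensor_modules.intro Nj X)
 have Xg: "abelian_group X" and Tj: "abelian_group J.T" and Ti: "abelian_group I.T"
  by (rule mod_group[OF X] mod_group[OF J.tensor_module] mod_group[OF I.tensor_module])+
 have jB: "F.mp j \<subseteq> carrier B" by (rule F.mp_sub)
 have Jc: "\<exists>c0. c0 : F.mp j \<and> c0 :. B \<and> c = (%_. c0)" if "c :. (Nm j)" for c
  using that jB by (auto simp: const_simps)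
 note \<pi>c = additive_closed[OF \<pi>]
 define e where "e = restrict (%c. c) (carrier (Nm j))"
 have el: "lin B (Nm j) (Nm 0) e"
 proof (rule linI)
  show "e x :. (Nm 0)" if "x :. (Nm j)" for x using that jB by (auto simp: e_def const_simps)
 qed (simp_all add: e_def, simp_all add: const_simps)
 then have em: "e : linear_maps B (Nm j) (Nm 0)" by (simp add: maps_iff e_def)
 have "inj_on e (carrier (Nm j))" by (rule inj_onI) (simp add: e_def)
 then have inj: "inj_on (tensor_lift B (Nm j) X I.T (%n x. I.pure (e n) x)) (carrier J.T)"
  using fl Nj em unfolding flat_module_def by blast
 let ?F = "tensor_lift B (Nm j) X I.T (%n x. I.pure (e n) x)"
 note Fm = tensor_map[OF Nj X Nj X el lin_id]
 have bal1: "J.balanced X (%c x. c 0 \<odot>\<^sub>X x)"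
  by (rule J.balancedI) (auto simp: const_simps X.smult_l_distr X.smult_r_distr X.smult_assoc1[symmetric] B.m_comm subsetD[OF jB])
 from J.tensor_universal[OF Xg bal1] obtain f1 where f1: "additive J.T X f1"
  "!!c x. c :. (Nm j) ==> x :. X ==> f1 (J.pure c x) = c 0 \<odot>\<^sub>X x" by auto
 note fc = F.fil_closed[OF Am_m]
 note Ag = mod_group[OF Am_m]
 from quotient_exists[OF Ag fc(1-4), of "Suc j"] obtain P :: "('b, ('a, 'b) bc set) module" and q
  where P: "abelian_group P" "additive Am P q"
   and q0: "!!x. x :. Am ==> q x = \<zero>\<^sub>P \<longleftrightarrow> x : fil B m Am (Suc j)" by auto
 have qeq: "q y = q z" if "y :. Am" "z :. Am" "y \<ominus>\<^sub>Am z : fil B m Am (Suc j)" for y z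
  using additive_diff[OF Ag P(1,2) that(1,2)] q0[of "y \<ominus>\<^sub>Am z"] that abelian_group.diff_zero_iff[OF P(1)] additive_closed[OF P(2)]
  by simp
 have \<iota>a: "\<iota> (a \<oplus>\<^sub>A a') = \<iota> a \<oplus>\<^sub>Am \<iota> a'" if "a :. A" "a' :. A" for a a'
  using lin_add[OF \<iota>_lin that] by simp
 have bal2: "J.balanced P (%c x. q (c 0 \<odot>\<^sub>Am \<iota> (\<pi> x)))"
 proof (rule J.balancedI)
  fix b c x assume b: "b :. B" and "c :. (Nm j)" and x: "x :. X"
  then obtain c0 where c: "c0 : F.mp j" "c0 :. B" "c = (%_. c0)" using Jc by blast
  let ?r = "res b \<odot>\<^sub>B \<one>\<^sub>B" and ?y = "\<iota> (\<pi> x)"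
  note y = \<iota>_closed[OF \<pi>c[OF x]]
  have r: "?r :. B" "res b :. K" using res_closed[OF b] by auto
  have i: "\<iota> (\<pi> (b \<odot>\<^sub>X x)) = ?r \<odot>\<^sub>Am ?y" using lin_smult[OF \<iota>_lin r(2) \<pi>c[OF x]] \<pi>s[OF b x] by simp
  \<comment> \<open>\<open>b\<close> differs from its residue by an element of \<open>m\<close>, and
    multiplied by \<open>c0\<close> in \<open>m^j\<close> this lands in
    \<open>m^(j+1)\<close>.\<close>
  have "(b \<otimes>\<^sub>B c0) \<odot>\<^sub>Am ?y \<ominus>\<^sub>Am c0 \<odot>\<^sub>Am (?r \<odot>\<^sub>Am ?y) = ((b \<ominus>\<^sub>B ?r) \<otimes>\<^sub>B c0) \<odot>\<^sub>Am ?y"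
   using b c r y by (simp add: a_minus_def Am.smult_assoc1[symmetric] Am.smult_l_distr Am.smult_l_minus B.l_distr B.l_minus B.r_distr B.r_minus B.m_comm)
  then have "(b \<otimes>\<^sub>B c0) \<odot>\<^sub>Am ?y \<ominus>\<^sub>Am c0 \<odot>\<^sub>Am (?r \<odot>\<^sub>Am ?y) : fil B m Am (Suc j)"
   using F.fil_base[OF F.mp_Suc_step[OF res_in[OF b] c(1)] y] by simp
  from qeq[OF _ _ this] show "q ((b \<odot>\<^bsub>Nm j\<^esub> c) 0 \<odot>\<^sub>Am ?y) = q (c 0 \<odot>\<^sub>Am \<iota> (\<pi> (b \<odot>\<^sub>X x)))"
   using b c r y by (simp add: const_simps i)
 next
  fix c x assume "c :. (Nm j)" and x: "x :. X"
  then obtain c0 where c: "c0 :. B" "c = (%_. c0)" using Jc by blast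
  note y = \<iota>_closed[OF \<pi>c[OF x]]
  show "q (c 0 \<odot>\<^sub>Am \<iota> (\<pi> x)) :. P" using c y additive_closed[OF P(2)] by simp
  show "q (c 0 \<odot>\<^sub>Am \<iota> (\<pi> (x \<oplus>\<^sub>X x'))) = q (c 0 \<odot>\<^sub>Am \<iota> (\<pi> x)) \<oplus>\<^sub>P q (c 0 \<odot>\<^sub>Am \<iota> (\<pi> x'))" if x': "x' :. X" for x'
   using c y x x' by (simp add: additive_add[OF \<pi>] \<iota>a \<pi>c \<iota>_closed Am.smult_r_distr additive_add[OF P(2)])
  fix c' assume "c' :. (Nm j)"
  then obtain c0' where c': "c0' :. B" "c' = (%_. c0')" using Jc by blast
  show "q ((c \<oplus>\<^bsub>Nm j\<^esub> c') 0 \<odot>\<^sub>Am \<iota> (\<pi> x)) = q (c 0 \<odot>\<^sub>Am \<iota> (\<pi> x)) \<oplus>\<^sub>P q (c' 0 \<odot>\<^sub>Am \<iota> (\<pi> x))"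
   using c c' y by (simp add: const_simps Am.smult_l_distr additive_add[OF P(2)])
 qed
 from J.tensor_universal[OF P(1) bal2] obtain f2 where f2: "additive J.T P f2"
  "!!c x. c :. (Nm j) ==> x :. X ==> f2 (J.pure c x) = q (c 0 \<odot>\<^sub>Am \<iota> (\<pi> x))" by auto
 note hc = lin_closed[OF h]
 have lift: "\<exists>Z\<in>carrier J.T. f1 Z = h Y \<and> f2 Z = q Y" if "Y : fil B m Am j" for Y
  using Ag F.fil_gen_sub[OF Am_m] that[unfolded fil_def]
 proof (induction rule: span_induct)
  case zero
  show ?case by (rule bexI[of _ "\<zero>\<^sub>J.T"])
   (simp_all add: additive_zero[OF Tj Xg f1(1)] additive_zero[OF Tj P(1) f2(1)] additive_zero[OF Ag P] lin_zero[OF Am_m X h])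
 next
  case (base s)
  then obtain c y where s: "s = c \<odot>\<^sub>Am y" "c : F.mp j" "y :. Am" by auto
  then have c: "c :. B" "(%_. c) :. (Nm j)" using jB by (auto simp: const_simps)
  note ry = RA.red_closed[OF s(3)]
  have "y \<ominus>\<^sub>Am \<iota> (RA.red y) : fil B m Am 1" using RA.near_pure[OF s(3)] by (simp add: \<iota>_def)
  from F.smult_fil[OF Am_m s(2) this]
  have "c \<odot>\<^sub>Am y \<ominus>\<^sub>Am c \<odot>\<^sub>Am \<iota> (RA.red y) : fil B m Am (Suc j)"
   using c s(3) \<iota>_closed[OF ry] by (simp add: a_minus_def Am.smult_r_distr Am.smult_r_minus)
  from qeq[OF _ _ this] have "q (c \<odot>\<^sub>Am y) = q (c \<odot>\<^sub>Am \<iota> (RA.red y))" using c s(3) \<iota>_closed[OF ry] by simp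
  then show ?case using f1(2)[OF c(2) hc[OF s(3)]] f2(2)[OF c(2) hc[OF s(3)]] lin_smult[OF h c(1) s(3)] \<pi>h[OF s(3)] J.pure_closed[OF c(2) hc[OF s(3)]]
   by (intro bexI[of _ "J.pure (%_. c) (h y)"]) (simp_all add: s(1))
 next
  case (neg y)
  then obtain Z where Z: "Z :. J.T" "f1 Z = h y" "f2 Z = q y" by auto
  then show ?case using neg(1) by (intro bexI[of _ "\<ominus>\<^sub>J.T Z"])
   (simp_all add: additive_neg[OF Tj Xg f1(1)] additive_neg[OF Tj P(1) f2(1)] additive_neg[OF Ag P] lin_neg[OF Am_m X h])
 next
  case (add y z)
  then obtain Z Z' where Z: "Z :. J.T" "f1 Z = h y" "f2 Z = q y" "Z' :. J.T" "f1 Z' = h z" "f2 Z' = q z" by auto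
  then show ?case using add(1,2) by (intro bexI[of _ "Z \<oplus>\<^sub>J.T Z'"])
   (simp_all add: additive_add[OF f1(1)] additive_add[OF f2(1)] additive_add[OF P(2)] lin_add[OF h])
 qed
 have one: "(%_. \<one>\<^sub>B) :. (Nm 0)" by (simp add: const_simps)
 have u: "additive X I.T (I.pure (%_. \<one>\<^sub>B))" by (rule additiveI[OF I.pure_closed[OF one] I.pure_add_right[OF one]])
 \<comment> \<open>The map into \<open>B \<otimes> X\<close> is \<open>f1\<close> followed by
   \<open>x \<mapsto> 1 \<otimes> x\<close>, so \<open>f1 Z = 0\<close> forces
   \<open>?F Z = 0\<close>.\<close>
 have FI: "?F Z = I.pure (%_. \<one>\<^sub>B) (f1 Z)" if "Z :. J.T" for Z
 proof (rule J.tensor_ext[OF Ti Fm(1) additive_comp[OF f1(1) u] _ that])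
  fix c x assume cN: "c :. (Nm j)" and x: "x :. X"
  then obtain c0 where c: "c0 :. B" "c = (%_. c0)" using Jc by blast
  have ec: "e c = c" using cN by (simp add: e_def)
  have "I.pure (%_. \<one>\<^sub>B) (c 0 \<odot>\<^sub>X x) = I.pure c x" using I.pure_smult[OF c(1) one x] c by (simp add: const_simps)
  then show "?F (J.pure c x) = I.pure (%_. \<one>\<^sub>B) (f1 (J.pure c x))" unfolding Fm(2)[OF cN x] f1(2)[OF cN x] ec by (rule sym)
 qed
 from lift[OF Y] obtain Z where Z: "Z :. J.T" "f1 Z = h Y" "f2 Z = q Y" by auto
 have "?F Z = ?F \<zero>\<^sub>J.T"
  using FI[OF Z(1)] Z(2) hY additive_zero[OF Xg Ti u] additive_zero[OF Tj Ti Fm(1)] by simp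
 then have "Z = \<zero>\<^sub>J.T" by (rule inj_onD[OF inj _ Z(1) abelian_monoid.zero_closed[OF abelian_group.axioms(1)[OF Tj]]])
 then have "q Y = \<zero>\<^sub>P" using Z(3) additive_zero[OF Tj P(1) f2(1)] by simp
 then show ?thesis using q0 fc(1) Y by blast
qed

lemma red_\<iota>: "a :. A ==> RA.red (\<iota> a) = a"
 using RA.red_pure[of a "\<one>\<^sub>B"] by (simp add: \<iota>_def res_one)

text \<open>\<open>h\<close> is the \<open>B\<close>-linear extension of a \<open>K\<close>-linear
  section of \<open>\<pi>\<close>. Its kernel lies in every \<open>m^k A_B\<close> by
  \<open>flat_inj_step\<close>, and its image approximates each element modulo \<open>m^k X\<close>
  for every \<open>k\<close>; both arguments end at the exponent \<open>nil\<close>, where the power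
  of \<open>m\<close> is zero.\<close>

lemma flat_lift:
 assumes P: "proj X \<pi>" and fl: "flat_module B X"
 shows "\<exists>h. lin B Am X h \<and> bij_betw h (carrier Am) (carrier X) \<and> (\<forall>Y\<in>carrier Am. \<pi> (h Y) = RA.red Y)"
proof -
 note Pd = projD[OF P]
 interpret X: nonunital_algebra B X by (rule Pd(1))
 have X: "module B X" by (rule X.module_axioms)
 note Xg = mod_group[OF X]
 note \<pi>c = additive_closed[OF Pd(2)]
 have "lin K (restr B X) A \<pi>"
  by (rule linI) (simp_all add: \<pi>c additive_add[OF Pd(2)] Pd(3) res_scalar)
 from linear_section[OF fieldK restr_module[OF X] A_module this] Pd(5)
 obtain s where s: "lin K A (restr B X) s" "!!a. a :. A ==> \<pi> (s a) = a" by auto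
 define h where "h = tensor_lift K A B X (%a b. b \<odot>\<^sub>X s a)"
 note L = lift_scaled[OF X s(1), folded h_def]
 note hc = lin_closed[OF L(1)]
 have sc: "s a :. X" if "a :. A" for a using lin_closed[OF s(1) that] by simp
 have \<pi>h: "\<pi> (h Y) = RA.red Y" if Y: "Y :. Am" for Y
  by (rule AB.bc_ext[OF A_group additive_comp[OF lin_additive[OF L(1)] Pd(2)] RA.red_additive _ Y])
    (simp add: L(2) Pd(3) sc s(2) RA.red_pure)
 have ker: "Y = \<zero>\<^sub>Am" if Y: "Y :. Am" "h Y = \<zero>\<^sub>X" for Y
 proof -
  have "Y : fil B m Am k" for k
  proof (induction k)
   case 0
   then show ?case using Y by (simp add: F.fil_0[OF Am_m])
  next
   case (Suc k)
   show ?case by (rule flat_inj_step[OF X fl L(1) Pd(2,3) \<pi>h Suc Y(2)])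
  qed
  then show ?thesis by (rule F.fil_zero[OF Am_m nil])
 qed
 have inj: "inj_on h (carrier Am)"
 proof (rule inj_onI)
  fix Y Z assume YZ: "Y :. Am" "Z :. Am" and e: "h Y = h Z"
  have "h (Y \<ominus>\<^sub>Am Z) = \<zero>\<^sub>X" using e YZ hc X.M.diff_zero_iff by (simp add: lin_diff[OF Am_m X L(1)])
  then show "Y = Z" using ker[of "Y \<ominus>\<^sub>Am Z"] YZ Am.M.diff_zero_iff by simp
 qed
 \<comment> \<open>For \<open>c x\<close> with \<open>c\<close> in \<open>m^k\<close> it is enough
   to approximate \<open>x\<close> modulo \<open>m X\<close>, which
   \<open>h (\<iota> (\<pi> x))\<close> does.\<close>
 have step: "\<exists>Y\<in>carrier Am. e \<ominus>\<^sub>X h Y : fil B m X (Suc k)" if "e : fil B m X k" for e k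
  using Xg F.fil_gen_sub[OF X] that[unfolded fil_def[of _ _ _ k]]
 proof (induction rule: span_induct)
  case zero
  show ?case using F.fil_closed(2)[OF X] by (intro bexI[of _ "\<zero>\<^sub>Am"]) (simp_all add: lin_zero[OF Am_m X L(1)])
 next
  case (base s')
  then obtain c x where x: "s' = c \<odot>\<^sub>X x" "c : F.mp k" "x :. X" by auto
  have c: "c :. B" using x(2) F.mp_sub by auto
  let ?y = "\<iota> (\<pi> x)"
  note y = \<iota>_closed[OF \<pi>c[OF x(3)]]
  have "\<pi> (x \<ominus>\<^sub>X h ?y) = \<zero>\<^sub>A"
   using x(3) y hc \<pi>c by (simp add: additive_diff[OF Xg A_group Pd(2)] \<pi>h red_\<iota> abelian_group.diff_zero_iff[OF A_group])
  then have "x \<ominus>\<^sub>X h ?y : fil B m X 1" using Pd(6) x(3) hc[OF y] by simp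
  from F.smult_fil[OF X x(2) this] have "s' \<ominus>\<^sub>X h (c \<odot>\<^sub>Am ?y) : fil B m X (Suc k)"
   using x c y hc by (simp add: lin_smult[OF L(1)] a_minus_def X.smult_r_distr X.smult_r_minus)
  then show ?case using c y by (intro bexI[of _ "c \<odot>\<^sub>Am ?y"]) simp_all
 next
  case (neg x)
  then obtain Y where Y: "Y :. Am" "x \<ominus>\<^sub>X h Y : fil B m X (Suc k)" by auto
  have "\<ominus>\<^sub>X x \<ominus>\<^sub>X h (\<ominus>\<^sub>Am Y) = \<ominus>\<^sub>X (x \<ominus>\<^sub>X h Y)" using Y neg(1) hc by (simp add: lin_neg[OF Am_m X L(1)] X.M.ab_simps)
  then show ?case using F.fil_closed(4)[OF X Y(2)] Y(1) by (intro bexI[of _ "\<ominus>\<^sub>Am Y"]) simp_all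
 next
  case (add x x')
  then obtain Y Y' where Y: "Y :. Am" "x \<ominus>\<^sub>X h Y : fil B m X (Suc k)" "Y' :. Am" "x' \<ominus>\<^sub>X h Y' : fil B m X (Suc k)" by auto
  have "(x \<oplus>\<^sub>X x') \<ominus>\<^sub>X h (Y \<oplus>\<^sub>Am Y') = (x \<ominus>\<^sub>X h Y) \<oplus>\<^sub>X (x' \<ominus>\<^sub>X h Y')"
   using Y add(1,2) hc by (simp add: lin_add[OF L(1)] X.M.ab_simps)
  then show ?case using F.fil_closed(3)[OF X Y(2,4)] Y(1,3) by (intro bexI[of _ "Y \<oplus>\<^sub>Am Y'"]) simp_all
 qed
 have appr: "\<exists>Y\<in>carrier Am. x \<ominus>\<^sub>X h Y : fil B m X k" if x: "x :. X" for x k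
 proof (induction k)
  case 0
  then show ?case using x by (intro bexI[of _ "\<zero>\<^sub>Am"]) (simp_all add: F.fil_0[OF X] hc)
 next
  case (Suc k)
  then obtain Y where Y: "Y :. Am" "x \<ominus>\<^sub>X h Y : fil B m X k" by auto
  from step[OF Y(2)] obtain Y' where Y': "Y' :. Am" "x \<ominus>\<^sub>X h Y \<ominus>\<^sub>X h Y' : fil B m X (Suc k)" by auto
  have "x \<ominus>\<^sub>X h (Y \<oplus>\<^sub>Am Y') = x \<ominus>\<^sub>X h Y \<ominus>\<^sub>X h Y'" using x Y Y' hc by (simp add: lin_add[OF L(1)] X.M.ab_simps)
  then show ?case using Y Y' by (intro bexI[of _ "Y \<oplus>\<^sub>Am Y'"]) simp_all
 qed
 have "carrier X \<subseteq> h ` carrier Am"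
 proof
  fix x assume x: "x :. X"
  from appr[OF x, of nil] obtain Y where Y: "Y :. Am" "x \<ominus>\<^sub>X h Y : fil B m X nil" by auto
  have "x \<ominus>\<^sub>X h Y = \<zero>\<^sub>X" by (rule F.fil_zero[OF X nil Y(2)])
  then have "x = h Y" using X.M.diff_zero_iff x hc[OF Y(1)] by simp
  then show "x : h ` carrier Am" using Y(1) by blast
 qed
 then have "bij_betw h (carrier Am) (carrier X)" using inj hc by (auto simp: bij_betw_def)
 then show ?thesis using L(1) \<pi>h by blast
qed

abbreviation "flat_of \<beta> == (Df \<beta>, lift (Df \<beta>) RA.red)"

lemma flat_of_deformation: "\<beta> : MCa ==> flat_deformation K A B m (flat_of \<beta>)"
 by (intro flat_deformationI proj_red flat_Df)

text \<open>The product of \<open>Y\<close> pulled back along the bijection \<open>h\<close> is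
  congruent to the original one modulo \<open>m\<close>, since both reduce to the product of
  \<open>A\<close>.\<close>

lemma flat_representative:
 assumes Y: "flat_deformation K A B m (Y, \<phi>)"
 shows "\<exists>\<beta>\<in>MCa. fe (flat_of \<beta>) (Y, \<phi>)"
proof -
 have Ya: "nonunital_algebra B Y" and Yf: "flat_module B Y" and \<phi>: "\<phi> : algebra_isos K (base_change B Y kk) A"
  using Y by (simp_all add: flat_deformation_def)
 interpret Y: nonunital_algebra B Y by (rule Ya)
 let ?\<pi> = "%y. \<phi> (red1 Y y)"
 note P = proj_of_iso[OF Ya \<phi>]
 note Pd = projD[OF P]
 from flat_lift[OF P Yf] obtain h where h: "lin B Am Y h" "bij_betw h (carrier Am) (carrier Y)"
  "!!Y'. Y' :. Am ==> ?\<pi> (h Y') = RA.red Y'" by auto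
 note hc = lin_closed[OF h(1)]
 have im: "h ` carrier Am = carrier Y" using h(2) by (simp add: bij_betw_def)
 have eq: "x = y" if "h x = h y" "x :. Am" "y :. Am" for x y
  using inj_onD[OF bij_betw_imp_inj_on[OF h(2)] that] .
 define \<mu> where "\<mu> x y = inv_into (carrier Am) h (h x \<otimes>\<^sub>Y h y)" for x y
 have \<mu>: "\<mu> x y :. Am" "h (\<mu> x y) = h x \<otimes>\<^sub>Y h y" if "x :. Am" "y :. Am" for x y
  using inv_into_into[of "h x \<otimes>\<^sub>Y h y" h "carrier Am"] f_inv_into_f[of "h x \<otimes>\<^sub>Y h y" h "carrier Am"] Y.mult_closed[OF hc hc, OF that] im
  by (simp_all add: \<mu>_def)
 have "\<exists>\<beta>. \<beta> : MCa \<and> (\<forall>x\<in>carrier Am. \<forall>y\<in>carrier Am. x \<otimes>\<^bsub>Df \<beta>\<^esub> y = \<mu> x y)"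
 proof (rule product_cochain)
  show "lin B Am Am (%x. \<mu> x y)" if "y :. Am" for y
   by (rule linI; (rule eq)?) (use that in \<open>simp_all add: \<mu> lin_add[OF h(1)] lin_smult[OF h(1)] hc Y.mult_add_left Y.mult_smult_left\<close>)
  show "lin B Am Am (\<mu> x)" if "x :. Am" for x
   by (rule linI; (rule eq)?) (use that in \<open>simp_all add: \<mu> lin_add[OF h(1)] lin_smult[OF h(1)] hc Y.mult_add_right Y.mult_smult_right\<close>)
  show "\<mu> (\<mu> x y) z = \<mu> x (\<mu> y z)" if "x :. Am" "y :. Am" "z :. Am" for x y z
   by (rule eq) (use that in \<open>simp_all add: \<mu> hc Y.mult_assoc\<close>)
  show "\<mu> x y \<ominus>\<^sub>Am (x \<otimes>\<^sub>Am y) : FA" if "x :. Am" "y :. Am" for x y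
  proof -
   have "RA.red (\<mu> x y) = RA.red (x \<otimes>\<^sub>Am y)"
    using that h(3)[OF \<mu>(1)[OF that]] by (simp add: \<mu>(2) Pd(4) hc h(3) red_mult)
   then show ?thesis using RA.red_eq_iff[OF \<mu>(1)[OF that] Am.mult_closed[OF that]] by simp
  qed
 qed
 then obtain \<beta> where \<beta>: "\<beta> : MCa" "!!x y. x :. Am ==> y :. Am ==> x \<otimes>\<^bsub>Df \<beta>\<^esub> y = \<mu> x y" by auto
 interpret D: nonunital_algebra B "Df \<beta>" by (rule MC_assD(4)[OF \<beta>(1)])
 have "lin B (Df \<beta>) Y h" using h(1) by (simp add: same_module_lin[OF Df_same])
 then have iso: "restrict h (carrier (Df \<beta>)) : algebra_isos B (Df \<beta>) Y"
  by (rule algebra_isosI[OF D.module_axioms]) (use h(2) D.mult_closed \<mu>(2) \<beta>(2) in \<open>simp_all add: Df_simps(1)\<close>)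
 have "fe (flat_of \<beta>) (Y, \<phi>)"
  by (rule feI[OF flat_of_deformation[OF \<beta>(1)] Y iso]) (use h(3) lift_red1[OF proj_red[OF \<beta>(1)]] in \<open>simp add: Df_simps(1)\<close>)
 then show ?thesis using \<beta>(1) by blast
qed

text \<open>Both relations ask for an isomorphism of the deformed algebras compatible with
  \<open>red\<close>, so injectivity of \<open>F\<close> is nearly built into the
  definitions.\<close>

lemma equiv_ass_iff_flat:
 assumes \<beta>: "\<beta> : MCa" "\<beta>' : MCa"
 shows "(\<beta>, \<beta>') : eqa \<longleftrightarrow> fe (flat_of \<beta>) (flat_of \<beta>')"
proof
 note l = lift_red1[OF proj_red[OF \<beta>(1)]] lift_red1[OF proj_red[OF \<beta>(2)]]
 note c = Df_simps(1)
 {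
  assume "(\<beta>, \<beta>') : eqa"
  then obtain f where f: "f : algebra_isos B (Df \<beta>) (Df \<beta>')" "\<forall>x\<in>carrier Am. RA.red (f x) = RA.red x" unfolding equiv_ass_iff by auto
  show "fe (flat_of \<beta>) (flat_of \<beta>')"
   by (rule feI[OF flat_of_deformation[OF \<beta>(1)] flat_of_deformation[OF \<beta>(2)] f(1)])
     (use f(2) lin_closed[OF isosD(1)[OF f(1)]] in \<open>simp add: l c\<close>)
 }
 assume "fe (flat_of \<beta>) (flat_of \<beta>')"
 then obtain f where f: "f : algebra_isos B (Df \<beta>) (Df \<beta>')"
  "\<forall>x\<in>carrier (Df \<beta>). lift (Df \<beta>') RA.red (red1 (Df \<beta>') (f x)) = lift (Df \<beta>) RA.red (red1 (Df \<beta>) x)" by (rule feE)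
 have "RA.red (f x) = RA.red x" if "x :. Am" for x
  using bspec[OF f(2), of x] that lin_closed[OF isosD(1)[OF f(1)], of x] by (simp add: l c)
 then show "(\<beta>, \<beta>') : eqa" unfolding equiv_ass_iff using \<beta> f(1) by blast
qed

end

section \<open>Cohomology and the comparison of deformation functors\<close>

lemma (in extended_resolution) omega_proj_lin: "lin K (omega K A) A (omega_proj K A)"
 unfolding omega_proj_eq using lin_restrict[OF O.Xm O.p_lin] by (simp add: maps_iff)

lemma (in extended_resolution) gr_smult:
 assumes b: "b :. B" and y: "y : W0.gr k" shows "b \<odot>\<^sub>Om y : W0.gr k"
proof (rule W0.gr_map[OF lin_scaled[OF Om.module_axioms lin_id b] _ y])
 fix ws assume ws: "ws : NW Am" "word_degree ws = k"
 then obtain a w vs where wv: "ws = (a # w) # vs" by (cases ws; cases "hd ws") (auto simp: words_def)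
 have s: "a :. Am" "set w \<subseteq> carrier Am" "set vs \<subseteq> nonempty_words (carrier Am)"
  using ws(1) wv by (auto simp: words_def)
 have "lin B Am Om (%x. WB ((x # w) # vs))"
  using nmultilinD[OF WB_multilin, of "[]" vs "[]" w] s by simp
 from lin_smult[OF this b s(1)] have "b \<odot>\<^sub>Om WB ws = WB (((b \<odot>\<^sub>Am a) # w) # vs)" using wv by simp
 moreover have "((b \<odot>\<^sub>Am a) # w) # vs : NW Am" using s b by (auto simp: words_def)
 from W0.gr_W[OF this] have "WB (((b \<odot>\<^sub>Am a) # w) # vs) : W0.gr k" using ws(2) wv by (simp add: word_degree_def)
 ultimately show "b \<odot>\<^sub>Om WB ws : W0.gr k" by simp
qed

lemma (in deformation) omega_proj_red: "y :. Om ==> omega_proj K A (RO.red y) = RA.red (W0.p y)"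
proof (rule OB.bc_ext[OF mod_group[OF module_axioms] additive_comp[OF RO.red_additive lin_additive[OF omega_proj_lin]]
   additive_comp[OF lin_additive[OF W0.p_lin] RA.red_additive]])
 fix x b assume x: "x :. (omega K A)" and b: "b :. B"
 have "W0.p (OB.pure x b) = AB.pure (omega_proj K A x) b"
  using base_change_proj[OF OB.bc_pure_closed[OF x b]] OB.lin_map_extension(2)[OF module_axioms omega_proj_lin x b] by simp
 then show "omega_proj K A (RO.red (OB.pure x b)) = RA.red (W0.p (OB.pure x b))"
  using x b by (simp add: RO.red_pure RA.red_pure lin_smult[OF omega_proj_lin] lin_closed[OF omega_proj_lin] res_closed)
qed

context perturbation
begin

definition "bd = E ` W0.gr (- 1)"
abbreviation "coh == cohomology0 K A B \<delta>"
abbreviation "cls x == bd +>\<^sub>Om x"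

text \<open>All elements of degree 0 are cycles, so by the Leibniz rule the boundaries form a
  two-sided ideal there.\<close>

lemma bd_closed:
 "y : bd ==> y : CO" "zO : bd" "y : bd ==> z : bd ==> y \<boxplus> z : bd" "y : bd ==> \<^bold>- y : bd"
 "s :. B ==> y : bd ==> s \<odot>\<^sub>Om y : bd"
 "y : bd ==> z : W0.gr 0 ==> y \<boxtimes> z : bd" "y : bd ==> z : W0.gr 0 ==> z \<boxtimes> y : bd"
proof -
 note grc = gr_sub
 show "y : bd ==> y : CO" using grc E_closed by (auto simp: bd_def)
 show "zO : bd" unfolding bd_def by (rule image_eqI[of _ _ zO]) (simp_all only: E_zero W0.gr_closed(2))
 show "y \<boxplus> z : bd" if yz: "y : bd" "z : bd"
 proof -
  obtain v w where "v : W0.gr (- 1)" "w : W0.gr (- 1)" "y = E v" "z = E w" using yz by (auto simp: bd_def)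
  then show ?thesis unfolding bd_def by (intro image_eqI[of _ _ "v \<boxplus> w"]) (simp_all add: E_add grc W0.gr_closed(3))
 qed
 show "\<^bold>- y : bd" if yz: "y : bd"
 proof -
  obtain v where "v : W0.gr (- 1)" "y = E v" using yz by (auto simp: bd_def)
  then show ?thesis unfolding bd_def by (intro image_eqI[of _ _ "\<^bold>- v"]) (simp_all add: E_neg grc W0.gr_closed(4))
 qed
 show "s \<odot>\<^sub>Om y : bd" if yz: "s :. B" "y : bd"
 proof -
  obtain v where "v : W0.gr (- 1)" "y = E v" using yz by (auto simp: bd_def)
  then show ?thesis unfolding bd_def using yz(1)
   by (intro image_eqI[of _ _ "s \<odot>\<^sub>Om v"]) (simp_all add: lin_smult[OF E_lin] grc gr_smult)
 qed
 show "y \<boxtimes> z : bd" if yz: "y : bd" "z : W0.gr 0"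
 proof -
  obtain v where v: "v : W0.gr (- 1)" "y = E v" using yz by (auto simp: bd_def)
  have "E (v \<boxtimes> z) = y \<boxtimes> z"
   using E_leibniz[OF v(1) grc[OF yz(2)]] v grc[OF v(1)] grc[OF yz(2)]
   by (simp add: E_gr0[OF yz(2)] Om.mult_zero signed_def Om.mult_closed E_closed)
  moreover have "v \<boxtimes> z : W0.gr (- 1)" using W0.gr_mult[OF v(1) yz(2)] by simp
  ultimately show ?thesis unfolding bd_def by (intro image_eqI[of _ _ "v \<boxtimes> z"]) simp_all
 qed
 show "z \<boxtimes> y : bd" if yz: "y : bd" "z : W0.gr 0"
 proof -
  obtain v where v: "v : W0.gr (- 1)" "y = E v" using yz by (auto simp: bd_def)
  have "E (z \<boxtimes> v) = z \<boxtimes> y"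
   using E_leibniz[OF yz(2) grc[OF v(1)]] v grc[OF v(1)] grc[OF yz(2)]
   by (simp add: E_gr0[OF yz(2)] Om.mult_zero signed_def Om.mult_closed E_closed)
  moreover have "z \<boxtimes> v : W0.gr (- 1)" using W0.gr_mult[OF yz(2) v(1)] by simp
  ultimately show ?thesis unfolding bd_def by (intro image_eqI[of _ _ "z \<boxtimes> v"]) simp_all
 qed
qed

lemma bd_subgroup: "subgroup bd (add_monoid Om)"
 by (rule Om.M.add.subgroupI) (use bd_closed in \<open>auto simp: a_inv_def\<close>)

lemma cls_mem: "z : cls x \<longleftrightarrow> (\<exists>y\<in>bd. z = y \<boxplus> x)"
 by (auto simp: a_r_coset_def')

lemma cls_eq:
 assumes x: "x : CO" and y: "y : CO" shows "cls x = cls y \<longleftrightarrow> x \<boxminus> y : bd"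
proof
 have self: "x : cls x" using bd_closed(2) x by (auto simp: cls_mem intro!: bexI[of _ zO])
 assume "cls x = cls y"
 then obtain i where i: "i : bd" "x = i \<boxplus> y" using self cls_mem by auto
 have "x \<boxminus> y = i" unfolding i(2) using y bd_closed(1)[OF i(1)] by (simp add: Om.M.ab_simps)
 then show "x \<boxminus> y : bd" using i(1) by simp
next
 assume d: "x \<boxminus> y : bd"
 have "x = (x \<boxminus> y) \<boxplus> y" using x y by (simp add: Om.M.ab_simps)
 then have "x : cls y" using d cls_mem by blast
 from Om.M.a_repr_independence[OF this y bd_subgroup] show "cls x = cls y" by simp
qed

lemma cls_D: assumes "z : cls x" "x : W0.gr 0" shows "z : W0.gr 0" "z \<boxminus> x : bd"
proof -
 obtain i where i: "i : bd" "z = i \<boxplus> x" using assms(1) cls_mem by auto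
 obtain v where "v : W0.gr (- 1)" "i = E v" using i by (auto simp: bd_def)
 then have "i : W0.gr 0" using E_gr[of v "- 1"] by simp
 then show "z : W0.gr 0" using i(2) W0.gr_closed(3) assms(2) by simp
 have "z \<boxminus> x = i" unfolding i(2) using gr_sub[OF assms(2)] bd_closed(1)[OF i(1)] by (simp add: Om.M.ab_simps)
 then show "z \<boxminus> x : bd" using i(1) by simp
qed

lemma cls_nonempty: "x : CO ==> x : cls x"
 using bd_closed(2) by (auto simp: cls_mem intro!: bexI[of _ zO])

lemma coh_simps:
 shows "carrier coh = cls ` W0.gr 0" and "\<zero>\<^sub>coh = cls zO"
  and "x : CO ==> y : CO ==> cls x \<oplus>\<^sub>coh cls y = cls (x \<boxplus> y)"
  and "x : W0.gr 0 ==> y : W0.gr 0 ==> cls x \<otimes>\<^sub>coh cls y = cls (x \<boxtimes> y)"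
  and "s :. B ==> x : W0.gr 0 ==> s \<odot>\<^sub>coh cls x = cls (s \<odot>\<^sub>Om x)"
proof -
 interpret S: abelian_subgroup bd Om
  by (rule abelian_subgroupI3[OF additive_subgroup.intro[OF bd_subgroup] Om.M.abelian_group_axioms])
 have I: "pd \<delta> ` omegaB_degree K A B (- 1) = bd"
  unfolding bd_def omegaB_degree_eq by (rule image_cong[OF refl]) (use gr_sub in \<open>simp add: E_perturbed\<close>)
 have Z: "{x : omegaB_degree K A B 0. pd \<delta> x = zO} = W0.gr 0"
  unfolding omegaB_degree_eq using gr_sub E_gr0 by (auto simp: E_perturbed)
 note u = cohomology0_def Let_def I Z
 show "carrier coh = cls ` W0.gr 0" by (simp add: u)
 have "cls zO = bd" using Om.M.a_coset_join2[OF _ bd_subgroup bd_closed(2)] by simp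
 then show "\<zero>\<^sub>coh = cls zO" by (simp add: u)
 show "x : CO ==> y : CO ==> cls x \<oplus>\<^sub>coh cls y = cls (x \<boxplus> y)" by (simp add: u S.a_rcos_sum)
 show "cls x \<otimes>\<^sub>coh cls y = cls (x \<boxtimes> y)" if x: "x : W0.gr 0" and y: "y : W0.gr 0"
 proof -
  \<comment> \<open>All products of representatives have the same class, by the ideal property of
    boundaries, so the union in the definition collapses.\<close>
  have e: "cls (x' \<boxtimes> y') = cls (x \<boxtimes> y)" if x': "x' : cls x" and y': "y' : cls y" for x' y'
  proof -
   note dx = cls_D[OF x' x] and dy = cls_D[OF y' y]
   note c = gr_sub[OF dx(1)] gr_sub[OF dy(1)] gr_sub[OF x] gr_sub[OF y]
   have "x' \<boxtimes> y' \<boxminus> x \<boxtimes> y = (x' \<boxminus> x) \<boxtimes> y' \<boxplus> x \<boxtimes> (y' \<boxminus> y)"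
    using c by (simp add: a_minus_def Om.mult_add_left Om.mult_add_right Om.mult_neg Om.mult_closed Om.M.ab_simps)
   then have "x' \<boxtimes> y' \<boxminus> x \<boxtimes> y : bd" using bd_closed(3)[OF bd_closed(6)[OF dx(2) dy(1)] bd_closed(7)[OF dy(2) x]] by simp
   then show ?thesis using cls_eq[of "x' \<boxtimes> y'" "x \<boxtimes> y"] c by (simp add: Om.mult_closed)
  qed
  have "cls x \<otimes>\<^sub>coh cls y = (\<Union>x'\<in>cls x. \<Union>y'\<in>cls y. cls (x' \<boxtimes> y'))" by (simp add: u)
  also have "\<dots> = (\<Union>x'\<in>cls x. \<Union>y'\<in>cls y. cls (x \<boxtimes> y))" using e by (intro SUP_cong refl) simp
  also have "\<dots> = cls (x \<boxtimes> y)" using cls_nonempty[OF gr_sub[OF x]] cls_nonempty[OF gr_sub[OF y]] by blast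
  finally show ?thesis .
 qed
 show "s \<odot>\<^sub>coh cls x = cls (s \<odot>\<^sub>Om x)" if s: "s :. B" and x: "x : W0.gr 0"
 proof -
  have e: "cls (s \<odot>\<^sub>Om x') = cls (s \<odot>\<^sub>Om x)" if x': "x' : cls x" for x'
  proof -
   note dx = cls_D[OF x' x]
   note c = gr_sub[OF dx(1)] gr_sub[OF x]
   have "s \<odot>\<^sub>Om x' \<boxminus> s \<odot>\<^sub>Om x = s \<odot>\<^sub>Om (x' \<boxminus> x)"
    using c s by (simp add: a_minus_def Om.smult_r_distr Om.smult_r_minus)
   then show ?thesis using cls_eq[of "s \<odot>\<^sub>Om x'" "s \<odot>\<^sub>Om x"] c s bd_closed(5)[OF s dx(2)] by simp
  qed
  have "s \<odot>\<^sub>coh cls x = (\<Union>x'\<in>cls x. cls (s \<odot>\<^sub>Om x'))" by (simp add: u)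
  also have "\<dots> = (\<Union>x'\<in>cls x. cls (s \<odot>\<^sub>Om x))" using e by (intro SUP_cong refl) simp
  also have "\<dots> = cls (s \<odot>\<^sub>Om x)" using cls_nonempty[OF gr_sub[OF x]] by blast
  finally show ?thesis .
 qed
qed

text \<open>Representatives differ by some \<open>E v\<close>, and
  \<open>p (E v) = p (\<delta> v)\<close> lies in the \<open>m\<close>-part. So the arbitrary
  representative chosen in \<open>map_G\<close> does not influence the projection.\<close>

lemma red_p_cls: assumes x: "x : W0.gr 0" and z: "z : cls x" shows "RA.red (W0.p z) = RA.red (W0.p x)"
proof -
 note c = gr_sub[OF x] gr_sub[OF cls_D(1)[OF z x]]
 from cls_D(2)[OF z x] obtain v where v: "v : W0.gr (- 1)" "z \<boxminus> x = E v" by (auto simp: bd_def)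
 note vc = gr_sub[OF v(1)]
 have "W0.p z \<ominus>\<^sub>Am W0.p x = W0.p (E v)" using lin_diff[OF Om_m Am_m W0.p_lin c(2,1)] v(2) by simp
 also have "\<dots> = W0.p (\<delta> v)"
  using vc by (simp add: E_def lin_add[OF W0.p_lin] W0.D_closed \<delta>_closed W0.p_D W0.p_closed)
 finally have "W0.p z \<ominus>\<^sub>Am W0.p x : FA" using F.lin_fil[OF Om_m Am_m W0.p_lin \<delta>D(4)[OF vc]] by simp
 then show ?thesis using RA.red_eq_iff[OF W0.p_closed[OF c(2)] W0.p_closed[OF c(1)]] by simp
qed

end

context flat_setting
begin

definition "coh_proj X = omega_proj K A (RO.red (SOME x. x : X))"

text \<open>The isomorphism \<open>f\<close> carries the question to the cobar-bar construction of
  \<open>\<alpha> + \<beta>\<close>, whose own contraction shows that \<open>i\<close> identifies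
  the deformed algebra with zeroth cohomology. The class of \<open>f (i x)\<close> is then the
  required isomorphism.\<close>

lemma cohomology_equiv:
 assumes \<beta>: "\<beta> : MCa" and e: "(\<Delta> \<beta>, \<delta>) : eqr"
 shows "fe (flat_of \<beta>) (cohomology0 K A B \<delta>, lift (cohomology0 K A B \<delta>) coh_proj)"
proof -
 have \<delta>: "\<delta> : MCr" using e by (simp add: equiv_rel_def)
 interpret p: perturbation K A B m \<delta> by (unfold_locales; rule \<delta>)
 interpret W: word_algebra B "Df \<beta>" Om WB by (rule MC_ass_word_algebra[OF \<beta>])
 have c: "carrier (Df \<gamma>) = carrier Am" for \<gamma> by (simp add: Df_simps)
 have gr: "W.gr = W0.gr" by (rule same_gr[OF W.word_algebra_axioms c])
 obtain f where f: "f : algebra_isos B Om Om" and fgr: "!!k. f ` W0.gr k = W0.gr k"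
  and fD: "!!y. y :. Om ==> f (pd (\<Delta> \<beta>) y) = pd \<delta> (f y)"
  and near: "!!y. y :. Om ==> f y \<ominus>\<^sub>Om y : FO"
  using equiv_relD[OF e] by metis
 note fl = isosD(1)[OF f] and fm = isosD(2)[OF f]
 note fc = lin_closed[OF fl]
 have finj: "x = y" if "f x = f y" "x :. Om" "y :. Om" for x y
  using inj_onD[OF bij_betw_imp_inj_on[OF isosD(3)[OF f]] that] .
 have fE: "f (W.D y) = p.E (f y)" if "y :. Om" for y
  using fD[OF that] that fc[OF that] by (simp add: perturbed_\<Delta>[OF \<beta>] p.E_perturbed)
 have fg: "f y : W0.gr k" if "y : W0.gr k" for y k using fgr[of k] that by blast
 note ic = W0.i_closed
 have ig: "f (W0.i x) : W0.gr 0" if "x :. Am" for x by (rule fg[OF W0.gr_i[OF that]])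
 note igc = p.gr_sub[OF ig]
 let ?\<psi> = "%x. p.cls (f (W0.i x))"
 have fi: "lin B Am Om (%x. f (W0.i x))" by (rule lin_comp[OF W0.i_lin fl])
 have bij: "bij_betw ?\<psi> (carrier (Df \<beta>)) (carrier p.coh)"
  unfolding bij_betw_def c p.coh_simps(1)
 proof
  show "inj_on ?\<psi> (carrier Am)"
  proof (rule inj_onI)
   fix x y assume x: "x :. Am" and y: "y :. Am" and "?\<psi> x = ?\<psi> y"
   then have "f (W0.i x) \<ominus>\<^sub>Om f (W0.i y) : p.bd" using p.cls_eq[OF igc[OF x] igc[OF y]] by simp
   then obtain w where w: "w : W0.gr (- 1)" "f (W0.i x) \<ominus>\<^sub>Om f (W0.i y) = p.E w" by (auto simp: p.bd_def)
   have "w : f ` W0.gr (- 1)" using w(1) fgr by simp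
   then obtain w' where w': "w' : W0.gr (- 1)" "w = f w'" by auto
   note w'c = p.gr_sub[OF w'(1)]
   have xy: "x \<ominus>\<^sub>Am y :. Am" using x y by simp
   have "f (W0.i (x \<ominus>\<^sub>Am y)) = f (W.D w')"
    using w(2) lin_diff[OF Am_m Om_m fi x y] w'(2) fE[OF w'c] by simp
   then have "W0.i (x \<ominus>\<^sub>Am y) = W.D w'" by (rule finj[OF _ ic[OF xy] W.D_closed[OF w'c]])
   \<comment> \<open>The augmentation for the deformed product is left inverse to \<open>i\<close>
     and kills boundaries.\<close>
   then have "x \<ominus>\<^sub>Am y = \<zero>\<^sub>Am" using W.p_i[of "x \<ominus>\<^sub>Am y"] W.p_D[OF w'c] xy by (simp add: c Df_simps(2))
   then show "x = y" using Am.M.diff_zero_iff[OF x y] by simp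
  qed
  show "?\<psi> ` carrier Am = p.cls ` W0.gr 0"
  proof
   show "?\<psi> ` carrier Am \<subseteq> p.cls ` W0.gr 0" using ig by auto
   show "p.cls ` W0.gr 0 \<subseteq> ?\<psi> ` carrier Am"
   proof
    fix u assume "u : p.cls ` W0.gr 0"
    then obtain z where z: "z : W0.gr 0" "u = p.cls z" by auto
    have "z : f ` W0.gr 0" using z(1) fgr by simp
    then obtain z' where z': "z' : W0.gr 0" "z = f z'" by auto
    note z'c = p.gr_sub[OF z'(1)]
    have pz: "W.p z' :. Am" using W.p_closed[OF z'c] by (simp add: c)
    have "W.D z' = \<zero>\<^sub>Om" using W.D_gr[of z' 0] z'(1) p.gr_pos by (simp add: gr)
    \<comment> \<open>In degree 0 everything is a cycle, so the homotopy formula shows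
      \<open>z'\<close> and \<open>i (W.p z')\<close> to be cohomologous.\<close>
    then have "W.D (W.H z') = z' \<ominus>\<^sub>Om W0.i (W.p z')"
     using W.homotopy[OF z'c] W.D_closed[OF W.H_closed[OF z'c]] lin_zero[OF Om_m Om_m W.H_lin] by simp
    then have "f z' \<ominus>\<^sub>Om f (W0.i (W.p z')) = p.E (f (W.H z'))"
     using fE[OF W.H_closed[OF z'c]] lin_diff[OF Om_m Om_m fl z'c ic[OF pz]] by simp
    moreover have "f (W.H z') : W0.gr (- 1)" using fg W.gr_H[of z' 0] z'(1) by (simp add: gr)
    ultimately have "f z' \<ominus>\<^sub>Om f (W0.i (W.p z')) : p.bd" unfolding p.bd_def by simp
    then have "u = ?\<psi> (W.p z')" using p.cls_eq[OF fc[OF z'c] igc[OF pz]] z(2) z'(2) by simp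
    then show "u : ?\<psi> ` carrier Am" using pz by blast
   qed
  qed
 qed
 have mult: "?\<psi> (x \<otimes>\<^bsub>Df \<beta>\<^esub> y) = ?\<psi> x \<otimes>\<^sub>p.coh ?\<psi> y" if "x :. (Df \<beta>)" "y :. (Df \<beta>)" for x y
 proof -
  have x: "x :. Am" and y: "y :. Am" using that by (simp_all add: c)
  have xy: "x \<otimes>\<^bsub>Df \<beta>\<^esub> y :. Am" using W.M.mult_closed[of x y] that by (simp add: c)
  let ?v = "W0.v x (W0.i y)"
  have vc: "?v :. Om" by (rule W0.v_closed[OF x ic[OF y]])
  have vg: "?v : W0.gr (- 1)" using W0.gr_v[OF x W0.gr_i[OF y]] by simp
  note m = Om.mult_closed[OF ic[OF x] ic[OF y]]
  have "W0.i (x \<otimes>\<^bsub>Df \<beta>\<^esub> y) \<ominus>\<^sub>Om W0.i x \<otimes>\<^sub>Om W0.i y = W.D ?v"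
   unfolding D_v_i[OF W.word_algebra_axioms c x y] using ic[OF xy] m by (simp add: Om.M.ab_simps)
  then have "f (W0.i (x \<otimes>\<^bsub>Df \<beta>\<^esub> y)) \<ominus>\<^sub>Om f (W0.i x) \<otimes>\<^sub>Om f (W0.i y) = p.E (f ?v)"
   using fE[OF vc] lin_diff[OF Om_m Om_m fl ic[OF xy] m] fm[OF ic[OF x] ic[OF y]] by simp
  then have "f (W0.i (x \<otimes>\<^bsub>Df \<beta>\<^esub> y)) \<ominus>\<^sub>Om f (W0.i x) \<otimes>\<^sub>Om f (W0.i y) : p.bd" unfolding p.bd_def using fg[OF vg] by simp
  then show ?thesis using p.cls_eq[OF igc[OF xy] Om.mult_closed[OF igc[OF x] igc[OF y]]] p.coh_simps(4)[OF ig[OF x] ig[OF y]] by simp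
 qed
 have T: "nonunital_algebra B p.coh" "restrict ?\<psi> (carrier (Df \<beta>)) : algebra_isos B (Df \<beta>) p.coh"
  by (rule transport_algebra[OF MC_assD(4)[OF \<beta>] bij _ _ mult];
    simp add: Df_simps(1-4) lin_zero[OF Am_m Om_m fi] lin_add[OF fi] lin_smult[OF fi] p.coh_simps(2,3,5) ig igc)+
 show ?thesis
 proof (rule fe_transport[OF proj_red[OF \<beta>] flat_Df[OF \<beta>] T])
  fix x assume "x :. (Df \<beta>)"
  then have x: "x :. Am" by (simp add: c)
  let ?z = "f (W0.i x)"
  define z where "z = (SOME z. z : p.cls ?z)"
  have z: "z : p.cls ?z" unfolding z_def by (rule someI[of _ ?z]) (rule p.cls_nonempty[OF igc[OF x]])
  have zc: "z :. Om" by (rule p.gr_sub[OF p.cls_D(1)[OF z ig[OF x]]])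
  have "coh_proj (p.cls ?z) = RA.red (W0.p z)" unfolding coh_proj_def z_def[symmetric] by (rule omega_proj_red[OF zc])
  also have "\<dots> = RA.red (W0.p ?z)" by (rule p.red_p_cls[OF ig[OF x] z])
  also have "\<dots> = RA.red x"
  proof -
   have "W0.p ?z \<ominus>\<^sub>Am x = W0.p (?z \<ominus>\<^sub>Om W0.i x)"
    using lin_diff[OF Om_m Am_m W0.p_lin igc[OF x] ic[OF x]] W0.p_i[OF x] by simp
   then have "W0.p ?z \<ominus>\<^sub>Am x : FA" using F.lin_fil[OF Om_m Am_m W0.p_lin near[OF ic[OF x]]] by simp
   then show ?thesis using RA.red_eq_iff[OF W0.p_closed[OF igc[OF x]] x] by simp
  qed
  finally show "coh_proj (restrict ?\<psi> (carrier (Df \<beta>)) x) = RA.red x" using x by (simp add: c)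
 qed
qed

end

context deformation
begin

lemma equiv_rel_equiv: "equiv (MCr) (eqr)"
proof (rule equivI)
 show "eqr \<subseteq> MCr \<times> MCr" by (auto simp: equiv_rel_def)
 have pc: "pd \<delta> y :. Om" if "\<delta> : MCr" "y :. Om" for \<delta> y
  using that lin_closed[OF MC_relD(1)[OF that(1)]] W0.D_closed by (simp add: perturbed_eq)
 show "refl_on (MCr) (eqr)"
 proof (rule refl_onI)
  fix \<delta> assume \<delta>: "\<delta> : MCr"
  show "(\<delta>, \<delta>) : eqr"
   by (rule equiv_relI[OF \<delta> \<delta> lin_id]) (use FOc(2) in \<open>simp_all add: a_minus_def Om.M.r_neg\<close>)
 qed
 have mc: "\<delta> : MCr \<and> \<delta>' : MCr" if "(\<delta>, \<delta>') : eqr" for \<delta> \<delta>'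
  using that by (simp add: equiv_rel_def)
 show "sym (eqr)"
 proof (rule symI)
  fix \<delta> \<delta>' assume e: "(\<delta>, \<delta>') : eqr"
  obtain f where f: "f : algebra_isos B Om Om" and fgr: "!!k. f ` W0.gr k = W0.gr k"
   and fD: "!!y. y :. Om ==> f (pd \<delta> y) = pd \<delta>' (f y)"
   and near: "!!y. y :. Om ==> f y \<ominus>\<^sub>Om y : FO"
   using equiv_relD[OF e] by metis
  define g where "g = restrict (inv_into (carrier Om) f) (carrier Om)"
  note g = algebra_isos_inv[OF Om.nonunital_algebra_axioms Om.nonunital_algebra_axioms f, folded g_def]
  note gl = isosD(1)[OF g(1)]
  note gc = lin_closed[OF gl]
  show "(\<delta>', \<delta>) : eqr"
  proof (rule equiv_relI[OF conjunct2[OF mc[OF e]] conjunct1[OF mc[OF e]] gl isosD(2)[OF g(1)]])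
   fix y assume y: "y :. Om"
   have "g y \<ominus>\<^sub>Om y = \<ominus>\<^sub>Om (f (g y) \<ominus>\<^sub>Om g y)" unfolding g(3)[OF y] using y gc[OF y] by (simp add: Om.M.ab_simps)
   then show "g y \<ominus>\<^sub>Om y : FO" using FOc(4)[OF near[OF gc[OF y]]] by simp
   have "f (pd \<delta> (g y)) = pd \<delta>' y" using fD[OF gc[OF y]] unfolding g(3)[OF y] .
   then show "g (pd \<delta>' y) = pd \<delta> (g y)"
    using g(2)[OF pc[OF conjunct1[OF mc[OF e]] gc[OF y]]] by simp
  next
   fix y k assume y: "y : W0.gr k"
   then have "y : f ` W0.gr k" using fgr by simp
   then obtain z where "z : W0.gr k" "y = f z" by auto
   then show "g y : W0.gr k" using g(2)[of z] W0.gr_closed(1)[of k] by auto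
  qed
 qed
 show "trans (eqr)"
 proof (rule transI)
  fix \<delta> \<delta>' \<delta>'' assume e: "(\<delta>, \<delta>') : eqr" and e': "(\<delta>', \<delta>'') : eqr"
  obtain f where f: "f : algebra_isos B Om Om" and fgr: "!!k. f ` W0.gr k = W0.gr k"
   and fD: "!!y. y :. Om ==> f (pd \<delta> y) = pd \<delta>' (f y)"
   and near: "!!y. y :. Om ==> f y \<ominus>\<^sub>Om y : FO"
   using equiv_relD[OF e] by metis
  obtain g where g: "g : algebra_isos B Om Om" and ggr: "!!k. g ` W0.gr k = W0.gr k"
   and gD: "!!y. y :. Om ==> g (pd \<delta>' y) = pd \<delta>'' (g y)"
   and gnear: "!!y. y :. Om ==> g y \<ominus>\<^sub>Om y : FO"
   using equiv_relD[OF e'] by metis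
  note fl = isosD(1)[OF f] and gl = isosD(1)[OF g]
  note fc = lin_closed[OF fl] and gc = lin_closed[OF gl]
  show "(\<delta>, \<delta>'') : eqr"
  proof (rule equiv_relI[OF conjunct1[OF mc[OF e]] conjunct2[OF mc[OF e']] lin_comp[OF fl gl]])
   show "g (f (y \<otimes>\<^sub>Om z)) = g (f y) \<otimes>\<^sub>Om g (f z)" if "y :. Om" "z :. Om" for y z
    using that fc by (simp add: isosD(2)[OF f] isosD(2)[OF g])
   fix y assume y: "y :. Om"
   have "g (f y) \<ominus>\<^sub>Om y = (g (f y) \<ominus>\<^sub>Om f y) \<oplus>\<^sub>Om (f y \<ominus>\<^sub>Om y)" using y fc gc by (simp add: Om.M.ab_simps)
   then show "g (f y) \<ominus>\<^sub>Om y : FO" using FOc(3)[OF gnear[OF fc[OF y]] near[OF y]] by simp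
   show "g (f (pd \<delta> y)) = pd \<delta>'' (g (f y))" using fD[OF y] gD[OF fc[OF y]] by simp
  next
   fix y k assume "y : W0.gr k"
   then show "g (f y) : W0.gr k" using fgr[of k] ggr[of k] by blast
  qed
 qed
qed

end

text \<open>Made for \<open>E\<close>, which by \<open>map_E_eq\<close> is the preimage of classes
  under \<open>\<Delta>\<close>: the map \<open>f\<close> has to preserve and reflect the relations
  and to meet every class.\<close>

lemma bij_betw_class_preimage:
 assumes R: "equiv P R" and f: "!!y. y : Q ==> f y : P" and S: "S \<subseteq> Q \<times> Q"
  and iff: "!!y y'. y : Q ==> y' : Q ==> (f y, f y') : R \<longleftrightarrow> (y, y') : S"
  and surj: "!!x. x : P ==> \<exists>y\<in>Q. (f y, x) : R"
 shows "bij_betw (%c. {y : Q. f y : c}) (P // R) (Q // S)"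
proof -
 have pre: "{y : Q. f y : R `` {x}} = S `` {y0}" if "y0 : Q" "(f y0, x) : R" for x y0
 proof -
  have "R `` {x} = R `` {f y0}" using equiv_class_eq[OF R that(2)] by simp
  then show ?thesis using iff[OF that(1)] S by auto
 qed
 show ?thesis unfolding bij_betw_def
 proof
  show "inj_on (%c. {y : Q. f y : c}) (P // R)"
  proof (rule inj_onI)
   fix c c' assume c: "c : P // R" and c': "c' : P // R" and e: "{y : Q. f y : c} = {y : Q. f y : c'}"
   obtain x where x: "x : P" "c = R `` {x}" using c by (rule quotientE)
   from surj[OF x(1)] obtain y where y: "y : Q" "(f y, x) : R" by (rule bexE)
   have "(x, f y) : R" using R y(2) by (auto simp: equiv_def dest: symD)
   then have "y : {y : Q. f y : c}" using x y by simp
   then have "f y : c \<inter> c'" using e by auto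
   then show "c = c'" using quotient_disj[OF R c c'] by auto
  qed
  show "(%c. {y : Q. f y : c}) ` (P // R) = Q // S"
  proof
   show "(%c. {y : Q. f y : c}) ` (P // R) \<subseteq> Q // S"
   proof
    fix d assume "d : (%c. {y : Q. f y : c}) ` (P // R)"
    then obtain c where c: "c : P // R" "d = {y : Q. f y : c}" by auto
    obtain x where x: "x : P" "c = R `` {x}" using c(1) by (rule quotientE)
    from surj[OF x(1)] obtain y where y: "y : Q" "(f y, x) : R" by (rule bexE)
    show "d : Q // S" unfolding c(2) x(2) pre[OF y] by (rule quotientI[OF y(1)])
   qed
   show "Q // S \<subseteq> (%c. {y : Q. f y : c}) ` (P // R)"
   proof
    fix d assume "d : Q // S"
    then obtain y where y: "y : Q" "d = S `` {y}" by (rule quotientE)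
    have "(f y, f y) : R" using R f[OF y(1)] by (auto simp: equiv_def dest: refl_onD)
    from pre[OF y(1) this] show "d : (%c. {y : Q. f y : c}) ` (P // R)"
     using y(2) quotientI[OF f[OF y(1)], of R] by (intro image_eqI[of _ _ "R `` {f y}"]) simp_all
   qed
  qed
 qed
qed

lemma class_union:
 assumes R: "equiv P R" and c: "c : P // R" and p: "p : c" and k: "!!p p'. (p, p') : R ==> k p = k p'"
 shows "(\<Union>p\<in>c. k p) = k p"
proof -
 have "k p' = k p" if "p' : c" for p' using quotient_eqI[OF R c c that p] k quotient_eq_iff[OF R c c that p] by blast
 then have "(\<Union>p\<in>c. k p) = (\<Union>p'\<in>c. k p)" by (intro SUP_cong refl) simp
 then show ?thesis using p by blast
qed

text \<open>Made for \<open>F\<close>, a union over representatives of a value that is constant on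
  each class.\<close>

lemma bij_betw_class_union:
 assumes R: "equiv P R" and cl: "!!p. p : P ==> k p : C"
  and iff: "!!p p'. p : P ==> p' : P ==> k p = k p' \<longleftrightarrow> (p, p') : R"
  and surj: "!!d. d : C ==> \<exists>p\<in>P. k p = d"
 shows "bij_betw (%c. \<Union>p\<in>c. k p) (P // R) C"
proof -
 have RP: "p : P" "p' : P" if "(p, p') : R" for p p' using R that by (auto simp: equiv_def)
 note U = class_union[OF R, of _ _ k]
 have kR: "k p = k p'" if "(p, p') : R" for p p' using iff[OF RP[OF that]] that by simp
 have un: "(\<Union>p\<in>R `` {x}. k p) = k x" if "x : P" for x
  by (rule U[OF quotientI[OF that] equiv_class_self[OF R that] kR])
 show ?thesis unfolding bij_betw_def
 proof
  show "inj_on (%c. \<Union>p\<in>c. k p) (P // R)"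
  proof (rule inj_onI)
   fix c c' assume c: "c : P // R" and c': "c' : P // R" and e: "(\<Union>p\<in>c. k p) = (\<Union>p\<in>c'. k p)"
   obtain x where x: "x : P" "c = R `` {x}" using c by (rule quotientE)
   obtain x' where x': "x' : P" "c' = R `` {x'}" using c' by (rule quotientE)
   have "k x = k x'" using e unfolding x(2) x'(2) un[OF x(1)] un[OF x'(1)] .
   then show "c = c'" unfolding x(2) x'(2) by (intro equiv_class_eq[OF R]) (use iff[OF x(1) x'(1)] in simp)
  qed
  show "(%c. \<Union>p\<in>c. k p) ` (P // R) = C"
  proof
   show "(%c. \<Union>p\<in>c. k p) ` (P // R) \<subseteq> C"
   proof
    fix d assume "d : (%c. \<Union>p\<in>c. k p) ` (P // R)"
    then obtain c where c: "c : P // R" "d = (\<Union>p\<in>c. k p)" by auto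
    obtain x where x: "x : P" "c = R `` {x}" using c(1) by (rule quotientE)
    show "d : C" unfolding c(2) x(2) un[OF x(1)] by (rule cl[OF x(1)])
   qed
   show "C \<subseteq> (%c. \<Union>p\<in>c. k p) ` (P // R)"
   proof
    fix d assume "d : C"
    from surj[OF this] obtain x where x: "x : P" "k x = d" by (rule bexE)
    show "d : (%c. \<Union>p\<in>c. k p) ` (P // R)"
     by (rule image_eqI[OF _ quotientI[OF x(1)]]) (simp add: un[OF x(1)] x(2))
   qed
  qed
 qed
qed

context flat_setting
begin

text \<open>Inherited from the equivalence of flat deformations through
  \<open>equiv_ass_iff_flat\<close>.\<close>

lemma equiv_ass_equiv: "equiv (MCa) (eqa)"
proof (rule equivI)
 show sub: "eqa \<subseteq> MCa \<times> MCa" by (auto simp: equiv_ass_def)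
 show "refl_on (MCa) (eqa)"
  by (rule refl_onI) (simp add: equiv_ass_iff_flat fe_refl[OF flat_of_deformation])
 show "sym (eqa)"
 proof (rule symI)
  fix \<beta> \<beta>' assume e: "(\<beta>, \<beta>') : eqa"
  then have \<beta>: "\<beta> : MCa" "\<beta>' : MCa" using sub by auto
  show "(\<beta>', \<beta>) : eqa" using fe_sym e unfolding equiv_ass_iff_flat[OF \<beta>] equiv_ass_iff_flat[OF \<beta>(2,1)] .
 qed
 show "trans (eqa)"
 proof (rule transI)
  fix \<beta> \<beta>' \<beta>'' assume e: "(\<beta>, \<beta>') : eqa" "(\<beta>', \<beta>'') : eqa"
  then have \<beta>: "\<beta> : MCa" "\<beta>' : MCa" "\<beta>'' : MCa" using sub by auto
  show "(\<beta>, \<beta>'') : eqa"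
   using fe_trans e unfolding equiv_ass_iff_flat[OF \<beta>(1,2)] equiv_ass_iff_flat[OF \<beta>(2,3)] equiv_ass_iff_flat[OF \<beta>(1,3)] .
 qed
qed

text \<open>\<open>compose_p\<close> is a left inverse of \<open>\<Delta>\<close>, so applying it to
  the representatives of the form \<open>\<Delta> \<beta>\<close> returns the preimage of the
  class.\<close>

lemma map_E_eq: "map_E K A B m c = {\<beta> : MCa. \<Delta> \<beta> : c}"
proof
 show "map_E K A B m c \<subseteq> {\<beta> : MCa. \<Delta> \<beta> : c}" by (auto simp: map_E_def compose_p_\<Delta>)
 show "{\<beta> : MCa. \<Delta> \<beta> : c} \<subseteq> map_E K A B m c"
 proof
  fix \<beta> assume \<beta>: "\<beta> : {\<beta> : MCa. \<Delta> \<beta> : c}"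
  then show "\<beta> : map_E K A B m c" unfolding map_E_def by (intro image_eqI[of _ _ "\<Delta> \<beta>"]) (simp_all add: compose_p_\<Delta>)
 qed
qed

lemma bij_E: "bij_betw (map_E K A B m) (Def_rel K A B m) (Def_ass K A B m)"
 unfolding Def_rel_def Def_ass_def map_E_eq[abs_def]
 by (rule bij_betw_class_preimage[OF equiv_rel_equiv \<Delta>_MC_rel])
   (use ass_to_rel rel_to_ass rel_surj in \<open>auto simp: equiv_ass_def\<close>)

definition flat_set :: "'u itself => ('a, 'b) cochain => ('k, 'a, 'b, 'u) fdef set" where
 "flat_set U \<beta> = flat_class U K A B m (flat_of \<beta>)"

lemma flat_set_cong: "(\<beta>, \<beta>') : eqa ==> flat_set U \<beta> = flat_set U \<beta>'"
proof -
 assume e: "(\<beta>, \<beta>') : eqa"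
 then have \<beta>: "\<beta> : MCa" "\<beta>' : MCa" by (auto simp: equiv_ass_def)
 have e': "fe (flat_of \<beta>) (flat_of \<beta>')" using e unfolding equiv_ass_iff_flat[OF \<beta>] .
 show ?thesis unfolding flat_set_def flat_class_def using fe_trans[OF e'] fe_trans[OF fe_sym[OF e']] by blast
qed

lemma map_F_eq: "map_F U K A B m c = (\<Union>\<beta>\<in>c. flat_set U \<beta>)"
 by (simp add: map_F_def flat_set_def lift_def)

text \<open>Guarantees that \<open>flat_class\<close> is nonempty in the universe \<open>'u\<close>;
  empty classes could not be told apart, which would defeat injectivity of \<open>F\<close>.\<close>

lemma flat_copy:
 fixes j :: "('a, 'b) bc => 'u"
 assumes j: "inj_on j (carrier Am)" and \<beta>: "\<beta> : MCa"
 shows "\<exists>Y :: ('k, 'a, 'b, 'u) fdef. fe (flat_of \<beta>) Y"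
proof -
 have j': "inj_on j (carrier (Df \<beta>))" using j by (simp add: Df_simps)
 note C = copy_algebra[OF MC_assD(4)[OF \<beta>] j']
 have "fe (flat_of \<beta>)
   (copy_algebra j (Df \<beta>), lift (copy_algebra j (Df \<beta>)) (%u. RA.red (inv_into (carrier (Df \<beta>)) j u)))"
  by (rule fe_transport[OF proj_red[OF \<beta>] flat_Df[OF \<beta>] C]) (use j' in simp)
 then show ?thesis by blast
qed

lemma fe_deformation: "fe X Y ==> flat_deformation K A B m Y"
 by (auto simp: flat_equivalent_def split: prod.splits)

lemma bij_F:
 fixes j :: "('a, 'b) bc => 'u"
 assumes j: "inj_on j (carrier Am)"
 shows "bij_betw (map_F TYPE('u) K A B m) (Def_ass K A B m) (Def_flat TYPE('u) K A B m)"
 unfolding Def_ass_def map_F_eq[abs_def]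
proof (rule bij_betw_class_union[OF equiv_ass_equiv])
 let ?S = "{(X, Y). fe X Y} :: (('k, 'a, 'b, 'u) fdef \<times> ('k, 'a, 'b, 'u) fdef) set"
 have cl: "flat_set TYPE('u) \<beta> = ?S `` {Y}" if "fe (flat_of \<beta>) Y" for \<beta> and Y :: "('k, 'a, 'b, 'u) fdef"
  unfolding flat_set_def flat_class_def using fe_trans[OF that] fe_trans[OF fe_sym[OF that]] by blast
 show "flat_set TYPE('u) \<beta> : Def_flat TYPE('u) K A B m" if "\<beta> : MCa" for \<beta>
 proof -
  from flat_copy[OF j that] obtain Y :: "('k, 'a, 'b, 'u) fdef" where Y: "fe (flat_of \<beta>) Y" by (rule exE)
  show ?thesis unfolding Def_flat_def cl[OF Y] by (rule quotientI) (use fe_deformation[OF Y] in simp)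
 qed
 show "flat_set TYPE('u) \<beta> = flat_set TYPE('u) \<beta>' \<longleftrightarrow> (\<beta>, \<beta>') : eqa"
  if \<beta>: "\<beta> : MCa" "\<beta>' : MCa" for \<beta> \<beta>'
 proof
  assume e: "flat_set TYPE('u) \<beta> = flat_set TYPE('u) \<beta>'"
  from flat_copy[OF j \<beta>(1)] obtain Y :: "('k, 'a, 'b, 'u) fdef" where Y: "fe (flat_of \<beta>) Y" by (rule exE)
  then have "Y : flat_set TYPE('u) \<beta>'" unfolding e[symmetric] by (simp add: flat_set_def flat_class_def)
  then have "fe (flat_of \<beta>') Y" by (simp add: flat_set_def flat_class_def)
  from fe_trans[OF Y fe_sym[OF this]] show "(\<beta>, \<beta>') : eqa" unfolding equiv_ass_iff_flat[OF \<beta>] .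
 qed (rule flat_set_cong)
 fix d assume "d : Def_flat TYPE('u) K A B m"
 then obtain Y :: "('k, 'a, 'b, 'u) fdef" where Y: "flat_deformation K A B m Y" "d = ?S `` {Y}"
  unfolding Def_flat_def by (auto elim: quotientE)
 obtain Y1 Y2 where Y12: "Y = (Y1, Y2)" by (cases Y)
 from flat_representative[OF Y(1)[unfolded Y12]] obtain \<beta> where \<beta>: "\<beta> : MCa" "fe (flat_of \<beta>) Y"
  unfolding Y12 by (rule bexE)
 show "\<exists>\<beta>\<in>MCa. flat_set TYPE('u) \<beta> = d" unfolding Y(2) using cl[OF \<beta>(2)] \<beta>(1) by (intro bexI[of _ \<beta>])
qed

text \<open>All members of the class are equivalent to one \<open>\<Delta> \<beta>\<close>, so by
  \<open>cohomology_equiv\<close> each of their cohomologies has the flat class of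
  \<open>\<beta>\<close>; and \<open>\<beta>\<close> represents the image under
  \<open>E\<close>.\<close>

lemma triangle:
 assumes c: "c : Def_rel K A B m" shows "map_F U K A B m (map_E K A B m c) = map_G U K A B m c"
proof -
 note c' = c[unfolded Def_rel_def]
 obtain \<delta> where \<delta>: "\<delta> : MCr" "c = eqr `` {\<delta>}" using c' by (rule quotientE)
 from rel_surj[OF \<delta>(1)] obtain \<beta> where \<beta>: "\<beta> : MCa" "(\<Delta> \<beta>, \<delta>) : eqr" by (rule bexE)
 have R: "(\<Delta> \<beta>, \<delta>') : eqr" if "\<delta>' : c" for \<delta>'
  using equiv_rel_equiv \<beta>(2) that \<delta>(2) by (auto simp: equiv_def dest: transD)
 have "(\<delta>, \<Delta> \<beta>) : eqr" using equiv_rel_equiv \<beta>(2) by (auto simp: equiv_def dest: symD)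
 then have "\<beta> : map_E K A B m c" using \<beta>(1) \<delta>(2) by (simp add: map_E_eq)
 moreover have "map_E K A B m c : MCa // eqa"
  using bij_E c unfolding Def_ass_def by (auto simp: bij_betw_def)
 ultimately have "map_F U K A B m (map_E K A B m c) = flat_set U \<beta>"
  unfolding map_F_eq by (intro class_union[OF equiv_ass_equiv] flat_set_cong)
 moreover have "flat_class U K A B m (cohomology0 K A B \<delta>', lift (cohomology0 K A B \<delta>') coh_proj) = flat_set U \<beta>"
  if "\<delta>' : c" for \<delta>'
 proof -
  note e = cohomology_equiv[OF \<beta>(1) R[OF that]]
  show ?thesis unfolding flat_set_def flat_class_def using fe_trans[OF e] fe_trans[OF fe_sym[OF e]] by blast
 qed
 then have "map_G U K A B m c = (\<Union>\<delta>'\<in>c. flat_set U \<beta>)"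
  unfolding map_G_def lift_def coh_proj_def[abs_def] by (intro SUP_cong refl) simp
 moreover have "c \<noteq> {}" using equiv_class_self[OF equiv_rel_equiv \<delta>(1)] \<delta>(2) by auto
 ultimately show ?thesis by simp
qed

end

text \<open>The assumption \<open>universe\<close> makes \<open>'u\<close> large enough for all flat
  deformations: by \<open>flat_representative\<close> each one is equivalent to a product on
  \<open>A_B\<close>, and this has a copy in \<open>'u\<close>.\<close>

theorem theorem5p3:
  fixes K :: "'k ring" and A :: "('k, 'a) module" and B :: "('k, 'b) module" and m :: "'b set"
  assumes "field K" and "\<forall>n::nat. n > 0 \<longrightarrow> [n] \<cdot>\<^bsub>K\<^esub> \<one>\<^bsub>K\<^esub> \<noteq> \<zero>\<^bsub>K\<^esub>"
    and "nonunital_algebra K A"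
    and "local_artinian_algebra K B m"
    and universe: "\<exists>\<iota> :: ('a, 'b) bc \<Rightarrow> 'u. inj_on \<iota> (carrier (algB K A B))"
  shows "(\<forall>c \<in> Def_rel K A B m. map_F TYPE('u) K A B m (map_E K A B m c) = map_G TYPE('u) K A B m c) \<and>
    bij_betw (map_E K A B m) (Def_rel K A B m) (Def_ass K A B m) \<and>
    bij_betw (map_F TYPE('u) K A B m) (Def_ass K A B m) (Def_flat TYPE('u) K A B m) \<and>
    bij_betw (map_G TYPE('u) K A B m) (Def_rel K A B m) (Def_flat TYPE('u) K A B m)"
proof -
 have alg: "algebra K B" using assms(4) by (simp add: local_artinian_algebra_def)
 interpret flat_setting K A B m
  by (intro flat_setting.intro flat_setting_axioms.intro deformation.intro extended_resolution.intro resolution.intro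
    local_artinian.intro assms alg)
 obtain j :: "('a, 'b) bc => 'u" where j: "inj_on j (carrier Am)" using universe by (rule exE)
 \<comment> \<open>By the triangle, \<open>G\<close> agrees on \<open>Def_rel\<close> with this
   composite of bijections.\<close>
 have "bij_betw (map_F TYPE('u) K A B m \<circ> map_E K A B m) (Def_rel K A B m) (Def_flat TYPE('u) K A B m)"
  by (rule bij_betw_trans[OF bij_E bij_F[OF j]])
 then have "bij_betw (map_G TYPE('u) K A B m) (Def_rel K A B m) (Def_flat TYPE('u) K A B m)"
  by (subst (asm) bij_betw_cong[where g = "map_G TYPE('u) K A B m"]) (simp_all add: triangle)
 then show ?thesis using triangle bij_E bij_F[OF j] by blast
qed

end
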